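(* Let $(\mathsf V,\otimes,I,\sigma)$ be a symmetric monoidal category. Then the following data constitute a $\mathsf{Lax}^+_0\mathsf{Oplax}^0_+$-duoidal category $\mathsf D$. - The objects of $\mathsf D$ are quintuples $(a,\alpha,\beta,\kappa,\nu)$ of an object $a$ of $\mathsf V$ and four pairwise commuting endomorphisms $\alpha,\beta,\kappa,\nu$ of $a$. The morphisms in $\mathsf D$ are the morphisms in $\mathsf V$ which commute with all of the four endomorphisms of the source and target objects. - Both families of product functors $\bullet_n=\circ_n:\mathsf D^n\to\mathsf D$ are: for $n=0$ the object $(I,1,1,1,1)$, for $n=1$ the identity functor, and for $n>1$ the $n$-fold monoidal product, sending $\{(a_r,\alpha_r,\beta_r,\kappa_r,\nu_r)\}_{r=1}^n$ to $(\otimes_ra_r,\otimes_r\alpha_r,\otimes_r\beta_r,\otimes_r\kappa_r,\otimes_r\nu_r)$ and morphisms $\vartheta_1,\dots,\vartheta_n$ to $\vartheta_1\otimes\cdots\otimes\vartheta_n$. - The $\mathsf{Lax}^+\mathsf{Oplax}^0$-monoidal structure $(\bullet,\Phi,\phi,\iota)$ has $\iota=1$ and, for $n,k_1,\dots,k_n\in\mathbb N$ and objects $(a_{rs},\alpha_{rs},\beta_{rs},\kappa_{rs},\nu_{rs})$ ($1\le r\le n$, $1\le s\le k_r$), the following endomorphisms of $\otimes_{r=1}^n\otimes_{s=1}^{k_r}a_{rs}$: $$\Phi_{k_1,\dots,k_n}=\otimes_{r}\otimes_{s}\alpha_{rs}^{\sum_{p=r+1}^n(\overline k_p-1)}\beta_{rs}^{\sum_{p=1}^{r-1}(\overline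 k_p-1)},\qquad \phi_{k_1,\dots,k_n}=\otimes_{r}\otimes_{s}\alpha_{rs}^{\sum_{p=r+1}^nZ(k_p)}\beta_{rs}^{\sum_{p=1}^{r-1}Z(k_p)}.$$ - The $\mathsf{Lax}_0\mathsf{Oplax}_+$-monoidal structure $(\circ,\Psi,\psi,\upsilon)$ has $\upsilon=1$ and $$\Psi_{k_1,\dots,k_n}=\otimes_{r}\otimes_{s}\kappa_{rs}^{\sum_{p=r+1}^n(\overline k_p-1)}\nu_{rs}^{\sum_{p=1}^{r-1}(\overline k_p-1)},\qquad \psi_{k_1,\dots,k_n}=\otimes_{r}\otimes_{s}\kappa_{rs}^{\sum_{p=r+1}^nZ(k_p)}\nu_{rs}^{\sum_{p=1}^{r-1}Z(k_p)}.$$ - For $n,p\in\mathbb N$, $\xi^p_n:\otimes_{r=1}^n(\otimes_{s=1}^pa_{rs})\to\otimes_{s=1}^p(\otimes_{r=1}^na_{rs})$ is given by the unique component of the symmetry $\sigma$ (the canonical isomorphism permuting the factors accordingly).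
   Context: Mac Lane coherence isomorphisms of $\mathsf V$ are suppressed. Conventions: $gf$ means first $f$, then $g$ (also for vertical composition of natural transformations); $\cdot$ is composition of functors and Godement product of natural transformations; $1$ denotes any identity; $\mathsf A^n$ is the $n$-fold Cartesian power, $\mathsf A^0=\mathbb 1$ the terminal category, $G^n=G\times\cdots\times G$. For $m\in\mathbb N$: $Z(m)=1$ if $m=0$, $Z(m)=0$ if $m>0$, $\overline m=m+Z(m)$. For $k_1,\dots,k_n\in\mathbb N$: $K=\sum_ik_i$, $Z=\sum_iZ(k_i)$. A $\mathsf{Lax}^+\mathsf{Oplax}^0$-monoidal category $(\mathsf L,\bullet,\Phi,\phi,\iota)$ consists of a category $\mathsf L$; functors $\bullet_n:\mathsf L^n\to\mathsf L$ for $n\ge0$; and, with $[k]:\mathsf L^k\to\mathsf L^{\overline k}$ denoting the identity if $k>0$ and $\bullet_0:\mathbb 1\to\mathsf L$ if $k=0$, natural transformations, for all $n,k_1,\dots,k_n\ge0$, $\Phi_{k_1,\dots,k_n}:\bullet_n\cdot(\bullet_{k_1}\times\cdots\times\bullet_{k_n})\to\bullet_{K+Z}\cdot([k_1]\times\cdots\times[k_n])$, $\phi_{k_1,\dots,k_n}:\bullet_K\to\bullet_{K+Z}\cdot([k_1]\times\cdots\times[k_n])$, and $\iota:1\to\bullet_1$, such that: (a) $\Phi_{k_1,\dots,k_n}=1$ if $K=0$; $\phi_{k_1,\dots,k_n}=1$ if $Z=0$; $\phi_0=\iota\cdot1$ (sequence of length one with $k_1=0$). (b) $\Phi_n(\iota\cdot1)=1=\Phi_{1,\dots,1}(1\cdot(\iota\times\cdots\times\iota))$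 on $\bullet_n$ for $n\ge1$. (c) For all non-negative $n$, $m_i$ ($1\le i\le n$), $k_{ij}$ ($1\le j\le m_i$), put $\vec m=(m_1,\dots,m_n)$, $\vec k_i=(k_{i1},\dots,k_{im_i})$, $\vec k=(k_{11},\dots,k_{nm_n})$, $K_i=\sum_jk_{ij}$, $Z_i=\sum_jZ(k_{ij})$, $K=\sum_iK_i$, and for $1\le i\le n$, $1\le j\le\overline m_i$: $\widetilde k_{ij}=k_{ij}$ if $m_i>0$, $\widetilde k_{ij}=0$ if $m_i=0$; $\widehat k_{ij}=k_{ij}$ if $K_i>0$; $\widehat k_{ij}=1$ if $K_i=0,m_i>0,j=1$; $\widehat k_{ij}=0$ if $K_i=0,m_i>0,j>1$; $\widehat k_{ij}=1$ if $m_i=0$. Let $\widetilde k,\widehat k$ be these sequences in lexicographic order and $\widetilde Z=\sum_{i,j}Z(\widetilde k_{ij})$. Then, with common codomain $\bullet_{K+\widetilde Z}\cdot\prod_{i,j}[\widetilde k_{ij}]=\bullet_{K+\widetilde Z}\cdot\prod_i[K_i+Z_i]\cdot\prod_{i,j}[k_{ij}]=\bullet_{K+\widetilde Z}\cdot\prod_{i,j}[\widehat k_{ij}]\cdot\prod_i[K_i]$: $\Phi_{\widetilde k}(\Phi_{\vec m}\cdot1)=(\Phi_{K_1+Z_1,\dots,K_n+Z_n}\cdot1)(1\cdot(\Phi_{\vec k_1}\times\cdots\times\Phi_{\vec k_n}))$; $\Phi_{\widetilde k}(\phi_{\vec m}\cdot1)=(\phi_{K_1+Z_1,\dots,K_n+Z_n}\cdot1)\Phi_{\vec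 k}$; $(\Phi_{K_1+Z_1,\dots,K_n+Z_n}\cdot1)(1\cdot(\phi_{\vec k_1}\times\cdots\times\phi_{\vec k_n}))=(\phi_{\widehat k}\cdot1)\Phi_{K_1,\dots,K_n}$; $(\phi_{K_1+Z_1,\dots,K_n+Z_n}\cdot1)\phi_{\vec k}=(\phi_{\widehat k}\cdot1)\phi_{K_1,\dots,K_n}$. A $\mathsf{Lax}_0\mathsf{Oplax}_+$-monoidal category $(\mathsf R,\circ,\Psi,\psi,\upsilon)$ is one for which $(\mathsf R^{op},\circ^{op},\Psi^{op},\psi^{op},\upsilon^{op})$ is $\mathsf{Lax}^+\mathsf{Oplax}^0$-monoidal; so $\Psi_{k_1,\dots,k_n}:\circ_{K+Z}\cdot([k_1]\times\cdots\times[k_n])\to\circ_n\cdot(\circ_{k_1}\times\cdots\times\circ_{k_n})$, $\psi_{k_1,\dots,k_n}:\circ_{K+Z}\cdot([k_1]\times\cdots\times[k_n])\to\circ_K$ (with $[0]=\circ_0$), $\upsilon:\circ_1\to1$. A $\mathsf{Lax}^+\mathsf{Oplax}^0$-monoidal functor $(G,\Gamma):\mathsf L\to\mathsf L'$ is a functor $G$ with natural transformations $\Gamma_n:G\cdot\bullet_n\to\bullet'_n\cdot G^n$ ($n\ge0$) such that, with $\langle k\rangle:G^{\overline k}\cdot[k]\to[k]'\cdot G^k$ the identity if $k>0$ and $\Gamma_0$ if $k=0$: $\Gamma_1(1\cdot\iota)=\iota'\cdot1$; $(1\cdot(\langle k_1\rangle\times\cdots\times\langle k_n\rangle))(\Gamma_{K+Z}\cdot1)(1\cdot\Phi_{k_1,\dots,k_n})=(\Phi'_{k_1,\dots,k_n}\cdot1)(1\cdot(\Gamma_{k_1}\times\cdots\times\Gamma_{k_n}))(\Gamma_n\cdot1)$;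 $(1\cdot(\langle k_1\rangle\times\cdots\times\langle k_n\rangle))(\Gamma_{K+Z}\cdot1)(1\cdot\phi_{k_1,\dots,k_n})=(\phi'_{k_1,\dots,k_n}\cdot1)\Gamma_K$. A $\mathsf{Lax}^+\mathsf{Oplax}^0$-monoidal natural transformation is $\omega:G\to G'$ with $\Gamma'_n(\omega\cdot1)=(1\cdot(\omega\times\cdots\times\omega))\Gamma_n$ for all $n\ge0$. The composite of $(G,\Gamma)$ followed by $(H,\Xi)$ has structure $(\Xi_n\cdot1)(1\cdot\Gamma_n)$; Cartesian products of such categories and functors have componentwise structure; identity functors have identity structure. A $\mathsf{Lax}^+_0\mathsf{Oplax}^0_+$-duoidal category is a category $\mathsf D$ with a $\mathsf{Lax}^+\mathsf{Oplax}^0$-monoidal structure $(\bullet,\Phi,\phi,\iota)$, a $\mathsf{Lax}_0\mathsf{Oplax}_+$-monoidal structure $(\circ,\Psi,\psi,\upsilon)$, and for all $n,p\ge0$ morphisms natural in the objects $a_{rs}$ ($1\le r\le n$, $1\le s\le p$), $\xi^p_n:\circ_{r=1}^n(\bullet_{s=1}^pa_{rs})\to\bullet_{s=1}^p(\circ_{r=1}^na_{rs})$, such that (a) for each $n\ge0$, $(\circ_n,\{\xi^p_n\}_{p\ge0}):\mathsf D^n\to\mathsf D$ is a $\mathsf{Lax}^+\mathsf{Oplax}^0$-monoidal functor; (b) all $\Psi_{k_1,\dots,k_p}$, $\psi_{k_1,\dots,k_p}$ and $\upsilon$ are $\mathsf{Lax}^+\mathsf{Oplax}^0$-monoidal natural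 transformations. *)

theory Defs
  imports Main
begin

section \<open>Categories, functors, natural transformations\<close>

record ('o, 'a) category =
  Ob :: "'o set"
  Ar :: "'a set"
  Dom :: "'a \<Rightarrow> 'o"
  Cod :: "'a \<Rightarrow> 'o"
  Id :: "'o \<Rightarrow> 'a"
  Comp :: "'a \<Rightarrow> 'a \<Rightarrow> 'a" (infixr "\<odot>\<index>" 70)

text \<open>Composites are written in the order of function application: in \<open>g \<odot>\<^bsub>C\<^esub> f\<close> the arrow \<open>f\<close>
  comes first.\<close>

definition hom :: "('o, 'a, 'x) category_scheme \<Rightarrow> 'o \<Rightarrow> 'o \<Rightarrow> 'a set" where
  "hom C a b = {f \<in> Ar C. Dom C f = a \<and> Cod C f = b}"

locale category =
  fixes C :: "('o, 'a, 'x) category_scheme" (structure)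
  assumes dom_ob: "f \<in> Ar C \<Longrightarrow> Dom C f \<in> Ob C"
    and cod_ob: "f \<in> Ar C \<Longrightarrow> Cod C f \<in> Ob C"
    and id_hom: "a \<in> Ob C \<Longrightarrow> Id C a \<in> hom C a a"
    and comp_hom: "\<lbrakk>f \<in> hom C a b; g \<in> hom C b c\<rbrakk> \<Longrightarrow> g \<odot> f \<in> hom C a c"
    and comp_id: "f \<in> hom C a b \<Longrightarrow> f \<odot> Id C a = f"
    and id_comp: "f \<in> hom C a b \<Longrightarrow> Id C b \<odot> f = f"
    and comp_assoc: "\<lbrakk>f \<in> hom C a b; g \<in> hom C b c; h \<in> hom C c d\<rbrakk>
      \<Longrightarrow> (h \<odot> g) \<odot> f = h \<odot> (g \<odot> f)"

definition op_cat :: "('o, 'a) category \<Rightarrow> ('o, 'a) category" where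
  "op_cat C = \<lparr>Ob = Ob C, Ar = Ar C, Dom = Cod C, Cod = Dom C, Id = Id C,
     Comp = (\<lambda>g f. f \<odot>\<^bsub>C\<^esub> g)\<rparr>"

text \<open>Cartesian products of finite families of categories; objects and arrows are lists.
  \<open>prod_cat []\<close> is the terminal category. Since the construction can be iterated, objects of
  \<open>\<Prod>\<^sub>r C\<^bsup>k r\<^esup>\<close> are lists of lists.\<close>

definition prod_cat :: "('o, 'a) category list \<Rightarrow> ('o list, 'a list) category" where
  "prod_cat Cs = \<lparr>Ob = {xs. list_all2 (\<lambda>C x. x \<in> Ob C) Cs xs},
     Ar = {fs. list_all2 (\<lambda>C f. f \<in> Ar C) Cs fs},
     Dom = map2 Dom Cs, Cod = map2 Cod Cs, Id = map2 Id Cs,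
     Comp = (\<lambda>gs fs. map2 (\<lambda>C (g, f). g \<odot>\<^bsub>C\<^esub> f) Cs (zip gs fs))\<rparr>"

definition power_cat :: "('o, 'a) category \<Rightarrow> nat \<Rightarrow> ('o list, 'a list) category" where
  "power_cat C n = prod_cat (replicate n C)"

definition powers_cat :: "('o, 'a) category \<Rightarrow> nat list \<Rightarrow> ('o list list, 'a list list) category" where
  "powers_cat C ks = prod_cat (map (power_cat C) ks)"

record ('o, 'a, 'p, 'b) func =
  fob :: "'o \<Rightarrow> 'p"
  far :: "'a \<Rightarrow> 'b"

locale cat_functor = C: category C + D: category D
  for C :: "('o, 'a, 'x) category_scheme" and D :: "('p, 'b, 'y) category_scheme" +
  fixes F :: "('o, 'a, 'p, 'b, 'z) func_scheme"
  assumes fob_ob: "a \<in> Ob C \<Longrightarrow> fob F a \<in> Ob D"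
    and far_hom: "f \<in> hom C a b \<Longrightarrow> far F f \<in> hom D (fob F a) (fob F b)"
    and far_id: "a \<in> Ob C \<Longrightarrow> far F (Id C a) = Id D (fob F a)"
    and far_comp: "\<lbrakk>f \<in> hom C a b; g \<in> hom C b c\<rbrakk> \<Longrightarrow> far F (g \<odot>\<^bsub>C\<^esub> f) = far F g \<odot>\<^bsub>D\<^esub> far F f"

locale nat_trans = F: cat_functor C D F + G: cat_functor C D G
  for C :: "('o, 'a, 'x) category_scheme" and D :: "('p, 'b, 'y) category_scheme"
    and F :: "('o, 'a, 'p, 'b, 'z) func_scheme" and G :: "('o, 'a, 'p, 'b, 'w) func_scheme" +
  fixes \<tau> :: "'o \<Rightarrow> 'b"
  assumes comp_hom: "a \<in> Ob C \<Longrightarrow> \<tau> a \<in> hom D (fob F a) (fob G a)"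
    and natural: "f \<in> hom C a b \<Longrightarrow> \<tau> b \<odot>\<^bsub>D\<^esub> far F f = far G f \<odot>\<^bsub>D\<^esub> \<tau> a"

definition id_func :: "('o, 'a, 'o, 'a) func" where
  "id_func = \<lparr>fob = (\<lambda>x. x), far = (\<lambda>f. f)\<rparr>"

definition comp_func ::
  "('p, 'b, 'q, 'c, 'y) func_scheme \<Rightarrow> ('o, 'a, 'p, 'b, 'x) func_scheme \<Rightarrow> ('o, 'a, 'q, 'c) func" where
  "comp_func G F = \<lparr>fob = (\<lambda>x. fob G (fob F x)), far = (\<lambda>f. far G (far F f))\<rparr>"

definition prod_func ::
  "('o, 'a, 'p, 'b, 'x) func_scheme list \<Rightarrow> ('o list, 'a list, 'p list, 'b list) func" where
  "prod_func Fs = \<lparr>fob = map2 fob Fs, far = map2 far Fs\<rparr>"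

text \<open>The canonical isomorphisms \<open>C \<cong> C\<^sup>1\<close> and \<open>\<Prod>\<^sub>r C\<^bsup>l r\<^esup> \<cong> C\<^bsup>\<Sum>\<^sub>r l r\<^esup>\<close>.\<close>

definition single_func :: "('o, 'a, 'o list, 'a list) func" where
  "single_func = \<lparr>fob = (\<lambda>x. [x]), far = (\<lambda>f. [f])\<rparr>"

definition concat_func :: "('o list list, 'a list list, 'o list, 'a list) func" where
  "concat_func = \<lparr>fob = concat, far = concat\<rparr>"


section \<open>Lax-plus oplax-zero monoidal categories\<close>

definition Z :: "nat \<Rightarrow> nat" where
  "Z m = (if m = 0 then 1 else 0)"

definition bar :: "nat \<Rightarrow> nat" where
  "bar m = m + Z m"

definition KZ :: "nat list \<Rightarrow> nat" where
  "KZ ks = sum_list ks + sum_list (map Z ks)"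

text \<open>The transformations \<open>\<Phi>\<close> and \<open>\<phi>\<close> are indexed by the sequence \<open>k\<^sub>1, \<dots>, k\<^sub>n\<close>, and their components by
  families \<open>(a\<^sub>r\<^sub>s)\<close> with \<open>1 \<le> r \<le> n\<close>, \<open>1 \<le> s \<le> k\<^sub>r\<close>, that is, by objects of \<open>powers_cat C [k\<^sub>1, \<dots>, k\<^sub>n]\<close>.\<close>

record ('o, 'a) mon_struct =
  prd :: "nat \<Rightarrow> ('o list, 'a list, 'o, 'a) func"
  Phi :: "nat list \<Rightarrow> 'o list list \<Rightarrow> 'a"
  phi :: "nat list \<Rightarrow> 'o list list \<Rightarrow> 'a"
  iota :: "'o \<Rightarrow> 'a"

text \<open>\<open>pad_func m k\<close> is the functor \<open>[k]\<close>. The functors \<open>pads_func\<close>, \<open>nested_func\<close>, \<open>padded_func\<close>, \<open>flat_func\<close>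
  at \<open>k\<^sub>1, \<dots>, k\<^sub>n\<close> are \<open>[k\<^sub>1] \<times> \<dots> \<times> [k\<^sub>n]\<close>, \<open>\<bullet>\<^sub>n \<cdot> (\<bullet> \<times> \<dots> \<times> \<bullet>)\<close>,
  \<open>\<bullet> \<cdot> ([k\<^sub>1] \<times> \<dots> \<times> [k\<^sub>n])\<close> and \<open>\<bullet>\<^sub>K\<close>, all with domain \<open>powers_cat C [k\<^sub>1, \<dots>, k\<^sub>n]\<close>.\<close>

definition pad_func :: "(nat \<Rightarrow> ('o list, 'a list, 'o, 'a) func) \<Rightarrow> nat \<Rightarrow> ('o list, 'a list, 'o list, 'a list) func" where
  "pad_func m k = (if k = 0 then comp_func single_func (m 0) else id_func)"

definition pads_func :: "(nat \<Rightarrow> ('o list, 'a list, 'o, 'a) func) \<Rightarrow> nat list \<Rightarrow> ('o list list, 'a list list, 'o list, 'a list) func" where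
  "pads_func m ks = comp_func concat_func (prod_func (map (pad_func m) ks))"

definition nested_func :: "(nat \<Rightarrow> ('o list, 'a list, 'o, 'a) func) \<Rightarrow> nat list \<Rightarrow> ('o list list, 'a list list, 'o, 'a) func" where
  "nested_func m ks = comp_func (m (length ks)) (prod_func (map m ks))"

definition padded_func :: "(nat \<Rightarrow> ('o list, 'a list, 'o, 'a) func) \<Rightarrow> nat list \<Rightarrow> ('o list list, 'a list list, 'o, 'a) func" where
  "padded_func m ks = comp_func (m (KZ ks)) (pads_func m ks)"

definition flat_func :: "(nat \<Rightarrow> ('o list, 'a list, 'o, 'a) func) \<Rightarrow> nat list \<Rightarrow> ('o list list, 'a list list, 'o, 'a) func" where
  "flat_func m ks = comp_func (m (sum_list ks)) concat_func"

text \<open>For \<open>kss = [k\<^sub>1, \<dots>, k\<^sub>n]\<close> with \<open>k\<^sub>i = [k\<^sub>i\<^sub>1, \<dots>, k\<^sub>i\<^sub>m]\<close>, \<open>m = m\<^sub>i\<close>: the sequences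
  written with a tilde and with a hat in the associativity axioms, and the families indexed by them
  which are obtained from a family indexed by \<open>kss\<close>.\<close>

definition tilde_seq :: "nat list list \<Rightarrow> nat list" where
  "tilde_seq kss = concat (map (\<lambda>ks. if ks = [] then [0] else ks) kss)"

definition hat_seq :: "nat list list \<Rightarrow> nat list" where
  "hat_seq kss = concat (map (\<lambda>ks. if ks = [] then [1]
     else if sum_list ks = 0 then 1 # replicate (length ks - 1) 0 else ks) kss)"

definition tilde_fam :: "'o list list list \<Rightarrow> 'o list list" where
  "tilde_fam xsss = concat (map (\<lambda>xss. if xss = [] then [[]] else xss) xsss)"

text \<open>In \<open>hat_fam e xsss\<close>, the argument \<open>e\<close> is the object \<open>\<bullet>\<^sub>0\<close>.\<close>

definition hat_fam :: "'o \<Rightarrow> 'o list list list \<Rightarrow> 'o list list" where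
  "hat_fam e xsss = concat (map (\<lambda>xss. if xss = [] then [[e]]
     else if concat xss = [] then [e] # replicate (length xss - 1) [] else xss) xsss)"

locale lax_oplax_monoidal = category C
  for C :: "('o, 'a) category" (structure) +
  fixes S :: "('o, 'a) mon_struct"
  assumes prd_functor: "cat_functor (power_cat C n) C (prd S n)"
    and Phi_nat: "nat_trans (powers_cat C ks) C (nested_func (prd S) ks) (padded_func (prd S) ks) (Phi S ks)"
    and phi_nat: "nat_trans (powers_cat C ks) C (flat_func (prd S) ks) (padded_func (prd S) ks) (phi S ks)"
    and iota_nat: "nat_trans C C id_func (comp_func (prd S 1) single_func) (iota S)"
    and Phi_zero: "\<lbrakk>sum_list ks = 0; xss \<in> Ob (powers_cat C ks)\<rbrakk>
      \<Longrightarrow> Phi S ks xss = Id C (fob (nested_func (prd S) ks) xss)"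
    and phi_pos: "\<lbrakk>sum_list (map Z ks) = 0; xss \<in> Ob (powers_cat C ks)\<rbrakk>
      \<Longrightarrow> phi S ks xss = Id C (fob (flat_func (prd S) ks) xss)"
    and phi_iota: "phi S [0] [[]] = iota S (fob (prd S 0) [])"
    and unit_left: "\<lbrakk>n \<ge> 1; xs \<in> Ob (power_cat C n)\<rbrakk>
      \<Longrightarrow> Phi S [n] [xs] \<odot> iota S (fob (prd S n) xs) = Id C (fob (prd S n) xs)"
    and unit_right: "\<lbrakk>n \<ge> 1; xs \<in> Ob (power_cat C n)\<rbrakk>
      \<Longrightarrow> Phi S (replicate n 1) (map (\<lambda>x. [x]) xs) \<odot> far (prd S n) (map (iota S) xs)
          = Id C (fob (prd S n) xs)"
    and assoc_Phi_Phi: "xsss \<in> Ob (prod_cat (map (powers_cat C) kss)) \<Longrightarrow>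
      Phi S (tilde_seq kss) (tilde_fam xsss)
        \<odot> Phi S (map length kss) (map2 (\<lambda>ks. fob (prod_func (map (prd S) ks))) kss xsss)
      = Phi S (map KZ kss) (map2 (\<lambda>ks. fob (pads_func (prd S) ks)) kss xsss)
        \<odot> far (prd S (length kss)) (map2 (Phi S) kss xsss)"
    and assoc_Phi_phi: "xsss \<in> Ob (prod_cat (map (powers_cat C) kss)) \<Longrightarrow>
      Phi S (tilde_seq kss) (tilde_fam xsss)
        \<odot> phi S (map length kss) (map2 (\<lambda>ks. fob (prod_func (map (prd S) ks))) kss xsss)
      = phi S (map KZ kss) (map2 (\<lambda>ks. fob (pads_func (prd S) ks)) kss xsss)
        \<odot> Phi S (concat kss) (concat xsss)"
    and assoc_phi_Phi: "xsss \<in> Ob (prod_cat (map (powers_cat C) kss)) \<Longrightarrow>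
      Phi S (map KZ kss) (map2 (\<lambda>ks. fob (pads_func (prd S) ks)) kss xsss)
        \<odot> far (prd S (length kss)) (map2 (phi S) kss xsss)
      = phi S (hat_seq kss) (hat_fam (fob (prd S 0) []) xsss)
        \<odot> Phi S (map sum_list kss) (map concat xsss)"
    and assoc_phi_phi: "xsss \<in> Ob (prod_cat (map (powers_cat C) kss)) \<Longrightarrow>
      phi S (map KZ kss) (map2 (\<lambda>ks. fob (pads_func (prd S) ks)) kss xsss)
        \<odot> phi S (concat kss) (concat xsss)
      = phi S (hat_seq kss) (hat_fam (fob (prd S 0) []) xsss)
        \<odot> phi S (map sum_list kss) (map concat xsss)"

text \<open>The opposites of functors and of natural transformations have the same maps of objects and
  arrows, resp. the same components; hence the opposite of a structure is given by the same data.\<close>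

definition lax0_oplaxplus_monoidal :: "('o, 'a) category \<Rightarrow> ('o, 'a) mon_struct \<Rightarrow> bool" where
  "lax0_oplaxplus_monoidal C S \<longleftrightarrow> lax_oplax_monoidal (op_cat C) S"

definition prod_struct :: "('o, 'a) mon_struct list \<Rightarrow> ('o list, 'a list) mon_struct" where
  "prod_struct Ss = \<lparr>
     prd = (\<lambda>n. \<lparr>
       fob = (\<lambda>xss. map (\<lambda>i. fob (prd (Ss ! i) n) (map (\<lambda>xs. xs ! i) xss)) [0..<length Ss]),
       far = (\<lambda>fss. map (\<lambda>i. far (prd (Ss ! i) n) (map (\<lambda>fs. fs ! i) fss)) [0..<length Ss])\<rparr>),
     Phi = (\<lambda>ks xsss. map (\<lambda>i. Phi (Ss ! i) ks (map (map (\<lambda>xs. xs ! i)) xsss)) [0..<length Ss]),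
     phi = (\<lambda>ks xsss. map (\<lambda>i. phi (Ss ! i) ks (map (map (\<lambda>xs. xs ! i)) xsss)) [0..<length Ss]),
     iota = map2 iota Ss\<rparr>"

definition power_struct :: "('o, 'a) mon_struct \<Rightarrow> nat \<Rightarrow> ('o list, 'a list) mon_struct" where
  "power_struct S n = prod_struct (replicate n S)"

definition powers_struct :: "('o, 'a) mon_struct \<Rightarrow> nat list \<Rightarrow> ('o list list, 'a list list) mon_struct" where
  "powers_struct S ks = prod_struct (map (power_struct S) ks)"


section \<open>Monoidal functors and monoidal natural transformations\<close>

text \<open>A functor \<open>G\<close> with the components \<open>str G n xs\<close> of \<open>\<Gamma>\<^sub>n : G \<cdot> \<bullet>\<^sub>n \<rightarrow> \<bullet>'\<^sub>n \<cdot> G\<^sup>n\<close>.\<close>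

record ('o, 'a, 'p, 'b) mfunc = "('o, 'a, 'p, 'b) func" +
  str :: "nat \<Rightarrow> 'o list \<Rightarrow> 'b"

text \<open>The components of \<open>\<langle>k\<rangle> : G\<^bsup>bar k\<^esup> \<cdot> [k] \<rightarrow> [k]' \<cdot> G\<^sup>k\<close>, where \<open>D\<close> is the target of \<open>G\<close>.\<close>

definition ang :: "('p, 'b) category \<Rightarrow> ('o, 'a, 'p, 'b) mfunc \<Rightarrow> nat \<Rightarrow> 'o list \<Rightarrow> 'b list" where
  "ang D G k xs = (if k = 0 then [str G 0 xs] else map (\<lambda>x. Id D (fob G x)) xs)"

text \<open>This and the next predicate are meant for \<open>(C, S)\<close> and \<open>(D, T)\<close> satisfying \<open>lax_oplax_monoidal\<close>.\<close>

locale lax_oplax_functor = cat_functor C D G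
  for C :: "('o, 'a) category" and S :: "('o, 'a) mon_struct"
    and D :: "('p, 'b) category" (structure) and T :: "('p, 'b) mon_struct"
    and G :: "('o, 'a, 'p, 'b) mfunc" +
  assumes str_nat: "nat_trans (power_cat C n) D (comp_func G (prd S n))
        (comp_func (prd T n) (prod_func (replicate n G))) (str G n)"
    and str_iota: "x \<in> Ob C \<Longrightarrow> str G 1 [x] \<odot> far G (iota S x) = iota T (fob G x)"
    and str_Phi: "xss \<in> Ob (powers_cat C ks) \<Longrightarrow>
      far (prd T (KZ ks)) (concat (map2 (ang D G) ks xss))
        \<odot> str G (KZ ks) (fob (pads_func (prd S) ks) xss)
        \<odot> far G (Phi S ks xss)
      = Phi T ks (map (map (fob G)) xss)
        \<odot> far (prd T (length ks)) (map2 (str G) ks xss)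
        \<odot> str G (length ks) (fob (prod_func (map (prd S) ks)) xss)"
    and str_phi: "xss \<in> Ob (powers_cat C ks) \<Longrightarrow>
      far (prd T (KZ ks)) (concat (map2 (ang D G) ks xss))
        \<odot> str G (KZ ks) (fob (pads_func (prd S) ks) xss)
        \<odot> far G (phi S ks xss)
      = phi T ks (map (map (fob G)) xss) \<odot> str G (sum_list ks) (concat xss)"

locale lax_oplax_nat_trans = nat_trans C D G H \<omega>
  for C :: "('o, 'a) category" and S :: "('o, 'a) mon_struct"
    and D :: "('p, 'b) category" (structure) and T :: "('p, 'b) mon_struct"
    and G H :: "('o, 'a, 'p, 'b) mfunc" and \<omega> :: "'o \<Rightarrow> 'b" +
  assumes str_trans: "xs \<in> Ob (power_cat C n) \<Longrightarrow>
      str H n xs \<odot> \<omega> (fob (prd S n) xs) = far (prd T n) (map \<omega> xs) \<odot> str G n xs"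

text \<open>The functor \<open>F\<close> from \<open>(C, S)\<close> to \<open>D\<close>, strictly compatible with the structures, with identity
  structure.\<close>

definition strict_mfunc ::
  "('o, 'a) mon_struct \<Rightarrow> ('p, 'b) category \<Rightarrow> ('o, 'a, 'p, 'b) func \<Rightarrow> ('o, 'a, 'p, 'b) mfunc" where
  "strict_mfunc S D F = \<lparr>fob = fob F, far = far F, str = (\<lambda>n xs. Id D (fob F (fob (prd S n) xs)))\<rparr>"

text \<open>The composite of \<open>G\<close> followed by \<open>H\<close>, with values in \<open>D\<close>.\<close>

definition comp_mfunc ::
  "('q, 'c) category \<Rightarrow> ('p, 'b, 'q, 'c) mfunc \<Rightarrow> ('o, 'a, 'p, 'b) mfunc \<Rightarrow> ('o, 'a, 'q, 'c) mfunc" where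
  "comp_mfunc D H G = \<lparr>fob = (\<lambda>x. fob H (fob G x)), far = (\<lambda>f. far H (far G f)),
     str = (\<lambda>n xs. str H n (map (fob G) xs) \<odot>\<^bsub>D\<^esub> far H (str G n xs))\<rparr>"

definition prod_mfunc ::
  "('o, 'a, 'p, 'b) mfunc list \<Rightarrow> ('o list, 'a list, 'p list, 'b list) mfunc" where
  "prod_mfunc Fs = \<lparr>fob = map2 fob Fs, far = map2 far Fs,
     str = (\<lambda>n xss. map (\<lambda>i. str (Fs ! i) n (map (\<lambda>xs. xs ! i) xss)) [0..<length Fs])\<rparr>"


section \<open>Duoidal categories\<close>

text \<open>A family \<open>(a\<^sub>r\<^sub>s)\<close>, \<open>1 \<le> r \<le> n\<close>, \<open>1 \<le> s \<le> p\<close>, is the list of its \<open>n\<close> rows, each of length \<open>p\<close>;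
  \<open>\<xi> p n\<close> takes this list as its argument. The list of columns is \<open>columns p\<close> of the list of rows
  (the number of columns is not determined if \<open>n = 0\<close>).\<close>

definition columns :: "nat \<Rightarrow> 'o list list \<Rightarrow> 'o list list" where
  "columns p xss = map (\<lambda>s. map (\<lambda>xs. xs ! s) xss) [0..<p]"

text \<open>\<open>(\<circ>\<^sub>n, {\<xi>\<^sup>p\<^sub>n}\<^sub>p)\<close>. A \<open>p\<close>-tuple of objects of \<open>D\<^sup>n\<close> is a list of columns of length \<open>n\<close>, whence the
  transposition.\<close>

definition circ_mfunc ::
  "('o, 'a) mon_struct \<Rightarrow> (nat \<Rightarrow> nat \<Rightarrow> 'o list list \<Rightarrow> 'a) \<Rightarrow> nat \<Rightarrow> ('o list, 'a list, 'o, 'a) mfunc" where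
  "circ_mfunc R \<xi> n = \<lparr>fob = fob (prd R n), far = far (prd R n),
     str = (\<lambda>p yss. \<xi> p n (columns n yss))\<rparr>"

text \<open>The functors \<open>[k]\<close>, \<open>\<circ> \<cdot> ([k\<^sub>1] \<times> \<dots> \<times> [k\<^sub>n])\<close>, \<open>\<circ>\<^sub>n \<cdot> (\<circ> \<times> \<dots> \<times> \<circ>)\<close> and \<open>\<circ>\<^sub>K\<close>
  as monoidal functors with respect to \<open>\<bullet>\<close>, whose structure is \<open>B\<close>.\<close>

definition pad_mfunc ::
  "('o, 'a) category \<Rightarrow> ('o, 'a) mon_struct \<Rightarrow> ('o, 'a) mon_struct \<Rightarrow> (nat \<Rightarrow> nat \<Rightarrow> 'o list list \<Rightarrow> 'a)
    \<Rightarrow> nat \<Rightarrow> ('o list, 'a list, 'o list, 'a list) mfunc" where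
  "pad_mfunc D B R \<xi> k =
     (if k = 0 then comp_mfunc (power_cat D 1) (strict_mfunc B (power_cat D 1) single_func) (circ_mfunc R \<xi> 0)
      else strict_mfunc (power_struct B k) (power_cat D k) id_func)"

definition padded_mfunc ::
  "('o, 'a) category \<Rightarrow> ('o, 'a) mon_struct \<Rightarrow> ('o, 'a) mon_struct \<Rightarrow> (nat \<Rightarrow> nat \<Rightarrow> 'o list list \<Rightarrow> 'a)
    \<Rightarrow> nat list \<Rightarrow> ('o list list, 'a list list, 'o, 'a) mfunc" where
  "padded_mfunc D B R \<xi> ks =
     comp_mfunc D (circ_mfunc R \<xi> (KZ ks))
       (comp_mfunc (power_cat D (KZ ks))
         (strict_mfunc (powers_struct B (map bar ks)) (power_cat D (KZ ks)) concat_func)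
         (prod_mfunc (map (pad_mfunc D B R \<xi>) ks)))"

definition nested_mfunc ::
  "('o, 'a) category \<Rightarrow> ('o, 'a) mon_struct \<Rightarrow> (nat \<Rightarrow> nat \<Rightarrow> 'o list list \<Rightarrow> 'a)
    \<Rightarrow> nat list \<Rightarrow> ('o list list, 'a list list, 'o, 'a) mfunc" where
  "nested_mfunc D R \<xi> ks =
     comp_mfunc D (circ_mfunc R \<xi> (length ks)) (prod_mfunc (map (circ_mfunc R \<xi>) ks))"

definition flat_mfunc ::
  "('o, 'a) category \<Rightarrow> ('o, 'a) mon_struct \<Rightarrow> ('o, 'a) mon_struct \<Rightarrow> (nat \<Rightarrow> nat \<Rightarrow> 'o list list \<Rightarrow> 'a)
    \<Rightarrow> nat list \<Rightarrow> ('o list list, 'a list list, 'o, 'a) mfunc" where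
  "flat_mfunc D B R \<xi> ks =
     comp_mfunc D (circ_mfunc R \<xi> (sum_list ks))
       (strict_mfunc (powers_struct B ks) (power_cat D (sum_list ks)) concat_func)"

locale lax_oplax_duoidal =
  fixes D :: "('o, 'a) category" and B R :: "('o, 'a) mon_struct"
    and \<xi> :: "nat \<Rightarrow> nat \<Rightarrow> 'o list list \<Rightarrow> 'a"
  assumes bullet: "lax_oplax_monoidal D B"
    and circ: "lax0_oplaxplus_monoidal D R"
    and xi_nat: "nat_trans (powers_cat D (replicate n p)) D
        (comp_func (prd R n) (prod_func (replicate n (prd B p))))
        (comp_func (prd B p) (comp_func (prod_func (replicate p (prd R n)))
          \<lparr>fob = columns p, far = columns p\<rparr>))
        (\<xi> p n)"
    and circ_functor: "lax_oplax_functor (power_cat D n) (power_struct B n) D B (circ_mfunc R \<xi> n)"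
    and Psi_trans: "lax_oplax_nat_trans (powers_cat D ks) (powers_struct B ks) D B
        (padded_mfunc D B R \<xi> ks) (nested_mfunc D R \<xi> ks) (Phi R ks)"
    and psi_trans: "lax_oplax_nat_trans (powers_cat D ks) (powers_struct B ks) D B
        (padded_mfunc D B R \<xi> ks) (flat_mfunc D B R \<xi> ks) (phi R ks)"
    and upsilon_trans: "lax_oplax_nat_trans D B D B
        (comp_mfunc D (circ_mfunc R \<xi> 1) (strict_mfunc B (power_cat D 1) single_func))
        (strict_mfunc B D id_func) (iota R)"


section \<open>Symmetric monoidal categories and their coherence isomorphisms\<close>

record ('o, 'a) sym_mon_cat = "('o, 'a) category" +
  tob :: "'o \<Rightarrow> 'o \<Rightarrow> 'o" (infixr "\<otimes>\<index>" 75)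
  tar :: "'a \<Rightarrow> 'a \<Rightarrow> 'a" (infixr "\<boxtimes>\<index>" 75)
  unit :: "'o" ("\<I>\<index>")
  assoc :: "'o \<Rightarrow> 'o \<Rightarrow> 'o \<Rightarrow> 'a"
  lunit :: "'o \<Rightarrow> 'a"
  runit :: "'o \<Rightarrow> 'a"
  sigma :: "'o \<Rightarrow> 'o \<Rightarrow> 'a"

definition inverse_arrows :: "('o, 'a, 'x) category_scheme \<Rightarrow> 'o \<Rightarrow> 'o \<Rightarrow> 'a \<Rightarrow> 'a \<Rightarrow> bool" where
  "inverse_arrows C a b f g \<longleftrightarrow> f \<in> hom C a b \<and> g \<in> hom C b a \<and>
     g \<odot>\<^bsub>C\<^esub> f = Id C a \<and> f \<odot>\<^bsub>C\<^esub> g = Id C b"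

definition iso_arrow :: "('o, 'a, 'x) category_scheme \<Rightarrow> 'o \<Rightarrow> 'o \<Rightarrow> 'a \<Rightarrow> bool" where
  "iso_arrow C a b f \<longleftrightarrow> (\<exists>g. inverse_arrows C a b f g)"

locale symmetric_monoidal_category = category V
  for V :: "('o, 'a) sym_mon_cat" (structure) +
  assumes tob_ob: "\<lbrakk>a \<in> Ob V; b \<in> Ob V\<rbrakk> \<Longrightarrow> a \<otimes> b \<in> Ob V"
    and tar_hom: "\<lbrakk>f \<in> hom V a a'; g \<in> hom V b b'\<rbrakk> \<Longrightarrow> f \<boxtimes> g \<in> hom V (a \<otimes> b) (a' \<otimes> b')"
    and tar_id: "\<lbrakk>a \<in> Ob V; b \<in> Ob V\<rbrakk> \<Longrightarrow> Id V a \<boxtimes> Id V b = Id V (a \<otimes> b)"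
    and tar_comp: "\<lbrakk>f \<in> hom V a a'; f' \<in> hom V a' a''; g \<in> hom V b b'; g' \<in> hom V b' b''\<rbrakk>
      \<Longrightarrow> (f' \<odot> f) \<boxtimes> (g' \<odot> g) = (f' \<boxtimes> g') \<odot> (f \<boxtimes> g)"
    and unit_ob: "\<I> \<in> Ob V"
    and assoc_iso: "\<lbrakk>a \<in> Ob V; b \<in> Ob V; c \<in> Ob V\<rbrakk>
      \<Longrightarrow> iso_arrow V ((a \<otimes> b) \<otimes> c) (a \<otimes> b \<otimes> c) (assoc V a b c)"
    and assoc_nat: "\<lbrakk>f \<in> hom V a a'; g \<in> hom V b b'; h \<in> hom V c c'\<rbrakk>
      \<Longrightarrow> assoc V a' b' c' \<odot> ((f \<boxtimes> g) \<boxtimes> h) = (f \<boxtimes> g \<boxtimes> h) \<odot> assoc V a b c"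
    and lunit_iso: "a \<in> Ob V \<Longrightarrow> iso_arrow V (\<I> \<otimes> a) a (lunit V a)"
    and lunit_nat: "f \<in> hom V a a' \<Longrightarrow> lunit V a' \<odot> (Id V \<I> \<boxtimes> f) = f \<odot> lunit V a"
    and runit_iso: "a \<in> Ob V \<Longrightarrow> iso_arrow V (a \<otimes> \<I>) a (runit V a)"
    and runit_nat: "f \<in> hom V a a' \<Longrightarrow> runit V a' \<odot> (f \<boxtimes> Id V \<I>) = f \<odot> runit V a"
    and pentagon: "\<lbrakk>a \<in> Ob V; b \<in> Ob V; c \<in> Ob V; d \<in> Ob V\<rbrakk> \<Longrightarrow>
      (Id V a \<boxtimes> assoc V b c d) \<odot> assoc V a (b \<otimes> c) d \<odot> (assoc V a b c \<boxtimes> Id V d)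
      = assoc V a b (c \<otimes> d) \<odot> assoc V (a \<otimes> b) c d"
    and triangle: "\<lbrakk>a \<in> Ob V; b \<in> Ob V\<rbrakk> \<Longrightarrow>
      (Id V a \<boxtimes> lunit V b) \<odot> assoc V a \<I> b = runit V a \<boxtimes> Id V b"
    and sym_hom: "\<lbrakk>a \<in> Ob V; b \<in> Ob V\<rbrakk> \<Longrightarrow> sigma V a b \<in> hom V (a \<otimes> b) (b \<otimes> a)"
    and sym_nat: "\<lbrakk>f \<in> hom V a a'; g \<in> hom V b b'\<rbrakk>
      \<Longrightarrow> sigma V a' b' \<odot> (f \<boxtimes> g) = (g \<boxtimes> f) \<odot> sigma V a b"
    and sym_sym: "\<lbrakk>a \<in> Ob V; b \<in> Ob V\<rbrakk> \<Longrightarrow> sigma V b a \<odot> sigma V a b = Id V (a \<otimes> b)"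
    and hexagon: "\<lbrakk>a \<in> Ob V; b \<in> Ob V; c \<in> Ob V\<rbrakk> \<Longrightarrow>
      assoc V b c a \<odot> sigma V a (b \<otimes> c) \<odot> assoc V a b c
      = (Id V b \<boxtimes> sigma V a c) \<odot> assoc V b a c \<odot> (sigma V a b \<boxtimes> Id V c)"

text \<open>Iterated products are bracketed to the right; the product of one factor is the factor itself.\<close>

fun nfold :: "'b \<Rightarrow> ('b \<Rightarrow> 'b \<Rightarrow> 'b) \<Rightarrow> 'b list \<Rightarrow> 'b" where
  "nfold e f [] = e"
| "nfold e f [x] = x"
| "nfold e f (x # y # xs) = f x (nfold e f (y # xs))"

definition tobs :: "('o, 'a) sym_mon_cat \<Rightarrow> 'o list \<Rightarrow> 'o" where
  "tobs V = nfold (unit V) (tob V)"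

definition tars :: "('o, 'a) sym_mon_cat \<Rightarrow> 'a list \<Rightarrow> 'a" where
  "tars V = nfold (Id V (unit V)) (tar V)"

datatype 'v tterm = Unit | Var 'v | Ten "'v tterm" "'v tterm"

abbreviation Tens :: "'v tterm list \<Rightarrow> 'v tterm" where
  "Tens \<equiv> nfold Unit Ten"

fun tval :: "('o, 'a) sym_mon_cat \<Rightarrow> ('v \<Rightarrow> 'o) \<Rightarrow> 'v tterm \<Rightarrow> 'o" where
  "tval V A Unit = unit V"
| "tval V A (Var v) = A v"
| "tval V A (Ten s t) = tob V (tval V A s) (tval V A t)"

text \<open>The components of the structure isomorphisms of \<open>V\<close>, in the sense of Mac Lane's coherence theorem:
  \<open>canonical V A s t f\<close> holds if the arrow \<open>f\<close>, from the value of \<open>s\<close> to the value of \<open>t\<close>, is built from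
  identities, associativity and unit constraints and symmetries by inverses, composition and tensor
  products. The variables keep track of the factors. By the coherence theorem, there is at most one
  such \<open>f\<close> if the variables in \<open>s\<close> are distinct, and \<open>coherence V A s t\<close> is this arrow. (If moreover the
  variables occur in the same order in \<open>s\<close> and \<open>t\<close>, it can be obtained without using symmetries.)\<close>

inductive canonical :: "('o, 'a) sym_mon_cat \<Rightarrow> ('v \<Rightarrow> 'o) \<Rightarrow> 'v tterm \<Rightarrow> 'v tterm \<Rightarrow> 'a \<Rightarrow> bool"
  for V A where
  c_id: "canonical V A t t (Id V (tval V A t))"
| c_assoc: "canonical V A (Ten (Ten s t) u) (Ten s (Ten t u))
    (assoc V (tval V A s) (tval V A t) (tval V A u))"
| c_lunit: "canonical V A (Ten Unit t) t (lunit V (tval V A t))"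
| c_runit: "canonical V A (Ten t Unit) t (runit V (tval V A t))"
| c_sym: "canonical V A (Ten s t) (Ten t s) (sigma V (tval V A s) (tval V A t))"
| c_inv: "\<lbrakk>canonical V A s t f; inverse_arrows V (tval V A s) (tval V A t) f g\<rbrakk> \<Longrightarrow> canonical V A t s g"
| c_comp: "\<lbrakk>canonical V A s t f; canonical V A t u g\<rbrakk> \<Longrightarrow> canonical V A s u (g \<odot>\<^bsub>V\<^esub> f)"
| c_tensor: "\<lbrakk>canonical V A s t f; canonical V A s' t' f'\<rbrakk>
    \<Longrightarrow> canonical V A (Ten s s') (Ten t t') (f \<boxtimes>\<^bsub>V\<^esub> f')"

definition coherence :: "('o, 'a) sym_mon_cat \<Rightarrow> ('v \<Rightarrow> 'o) \<Rightarrow> 'v tterm \<Rightarrow> 'v tterm \<Rightarrow> 'a" where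
  "coherence V A s t = (THE f. canonical V A s t f)"


section \<open>The category of objects with four commuting endomorphisms\<close>

datatype ('o, 'a) dobj = DObj (car: 'o) (al: 'a) (be: 'a) (ka: 'a) (nu: 'a)

text \<open>Arrows record their source and target, since the same arrow of \<open>V\<close> may underlie arrows between
  different objects.\<close>

datatype ('o, 'a) darr = DArr (src: "('o, 'a) dobj") (mor: 'a) (tgt: "('o, 'a) dobj")

definition D_cat :: "('o, 'a) sym_mon_cat \<Rightarrow> (('o, 'a) dobj, ('o, 'a) darr) category" where
  "D_cat V = (let
       obs = {x. car x \<in> Ob V \<and> {al x, be x, ka x, nu x} \<subseteq> hom V (car x) (car x) \<and>
         (\<forall>f \<in> {al x, be x, ka x, nu x}. \<forall>g \<in> {al x, be x, ka x, nu x}. f \<odot>\<^bsub>V\<^esub> g = g \<odot>\<^bsub>V\<^esub> f)} in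
     \<lparr>Ob = obs,
      Ar = {f. src f \<in> obs \<and> tgt f \<in> obs \<and> mor f \<in> hom V (car (src f)) (car (tgt f)) \<and>
        mor f \<odot>\<^bsub>V\<^esub> al (src f) = al (tgt f) \<odot>\<^bsub>V\<^esub> mor f \<and>
        mor f \<odot>\<^bsub>V\<^esub> be (src f) = be (tgt f) \<odot>\<^bsub>V\<^esub> mor f \<and>
        mor f \<odot>\<^bsub>V\<^esub> ka (src f) = ka (tgt f) \<odot>\<^bsub>V\<^esub> mor f \<and>
        mor f \<odot>\<^bsub>V\<^esub> nu (src f) = nu (tgt f) \<odot>\<^bsub>V\<^esub> mor f},
      Dom = src, Cod = tgt,
      Id = (\<lambda>x. DArr x (Id V (car x)) x),
      Comp = (\<lambda>g f. DArr (src f) (mor g \<odot>\<^bsub>V\<^esub> mor f) (tgt g))\<rparr>)"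

definition D_tobs :: "('o, 'a) sym_mon_cat \<Rightarrow> ('o, 'a) dobj list \<Rightarrow> ('o, 'a) dobj" where
  "D_tobs V xs = DObj (tobs V (map car xs)) (tars V (map al xs)) (tars V (map be xs))
     (tars V (map ka xs)) (tars V (map nu xs))"

definition D_tars :: "('o, 'a) sym_mon_cat \<Rightarrow> ('o, 'a) darr list \<Rightarrow> ('o, 'a) darr" where
  "D_tars V fs = DArr (D_tobs V (map src fs)) (tars V (map mor fs)) (D_tobs V (map tgt fs))"

definition D_prd :: "('o, 'a) sym_mon_cat
    \<Rightarrow> nat \<Rightarrow> (('o, 'a) dobj list, ('o, 'a) darr list, ('o, 'a) dobj, ('o, 'a) darr) func" where
  "D_prd V n = \<lparr>fob = D_tobs V, far = D_tars V\<rparr>"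

definition apow :: "('o, 'a) sym_mon_cat \<Rightarrow> 'a \<Rightarrow> nat \<Rightarrow> 'a" where
  "apow V f n = ((\<lambda>g. f \<odot>\<^bsub>V\<^esub> g) ^^ n) (Id V (Dom V f))"

text \<open>For \<open>c = (\<lambda>k. bar k - 1)\<close> and \<open>c = Z\<close>, and \<open>\<epsilon>, \<eta>\<close> two of the four endomorphisms, the endomorphisms
  \<open>\<epsilon>\<^sub>r\<^sub>s\<^bsup>\<Sum>\<^sub>p\<^sub>>\<^sub>r c k\<^sub>p\<^esup> \<eta>\<^sub>r\<^sub>s\<^bsup>\<Sum>\<^sub>p\<^sub><\<^sub>r c k\<^sub>p\<^esup>\<close> of the \<open>a\<^sub>r\<^sub>s\<close>.\<close>

definition end_fam :: "('o, 'a) sym_mon_cat \<Rightarrow> (('o, 'a) dobj \<Rightarrow> 'a) \<Rightarrow> (('o, 'a) dobj \<Rightarrow> 'a)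
    \<Rightarrow> (nat \<Rightarrow> nat) \<Rightarrow> nat list \<Rightarrow> ('o, 'a) dobj list list \<Rightarrow> 'a list list" where
  "end_fam V \<epsilon> \<eta> c ks xss =
     map (\<lambda>r. map (\<lambda>s.
         apow V (\<epsilon> (xss ! r ! s)) (\<Sum>p = Suc r..<length ks. c (ks ! p))
         \<odot>\<^bsub>V\<^esub> apow V (\<eta> (xss ! r ! s)) (\<Sum>p = 0..<r. c (ks ! p)))
       [0..<ks ! r]) [0..<length ks]"

definition vars :: "nat list \<Rightarrow> (nat \<times> nat) tterm list list" where
  "vars ks = map (\<lambda>r. map (\<lambda>s. Var (r, s)) [0..<ks ! r]) [0..<length ks]"

definition car_fam :: "('o, 'a) dobj list list \<Rightarrow> nat \<times> nat \<Rightarrow> 'o" where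
  "car_fam xss = (\<lambda>(r, s). car (xss ! r ! s))"

definition nested_term :: "nat list \<Rightarrow> (nat \<times> nat) tterm" where
  "nested_term ks = Tens (map Tens (vars ks))"

definition flat_term :: "nat list \<Rightarrow> (nat \<times> nat) tterm" where
  "flat_term ks = Tens (concat (vars ks))"

definition padded_term :: "nat list \<Rightarrow> (nat \<times> nat) tterm" where
  "padded_term ks = Tens (concat (map (\<lambda>ts. if ts = [] then [Unit] else ts) (vars ks)))"

text \<open>The coherence isomorphisms in \<open>V\<close> from \<open>\<otimes>\<^sub>r\<otimes>\<^sub>s a\<^sub>r\<^sub>s\<close>, resp. \<open>\<otimes>\<^sub>(\<^sub>r\<^sub>,\<^sub>s\<^sub>) a\<^sub>r\<^sub>s\<close>, to the iterated product in which
  an empty row contributes a factor \<open>\<I>\<close>, and their inverses, are composed with the stated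
  endomorphisms.\<close>

definition D_bullet :: "('o, 'a) sym_mon_cat \<Rightarrow> (('o, 'a) dobj, ('o, 'a) darr) mon_struct" where
  "D_bullet V = \<lparr>prd = D_prd V,
     Phi = (\<lambda>ks xss. DArr (fob (nested_func (D_prd V) ks) xss)
       (coherence V (car_fam xss) (nested_term ks) (padded_term ks)
         \<odot>\<^bsub>V\<^esub> tars V (map (tars V) (end_fam V al be (\<lambda>k. bar k - 1) ks xss)))
       (fob (padded_func (D_prd V) ks) xss)),
     phi = (\<lambda>ks xss. DArr (fob (flat_func (D_prd V) ks) xss)
       (coherence V (car_fam xss) (flat_term ks) (padded_term ks)
         \<odot>\<^bsub>V\<^esub> tars V (concat (end_fam V al be Z ks xss)))
       (fob (padded_func (D_prd V) ks) xss)),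
     iota = Id (D_cat V)\<rparr>"

definition D_circ :: "('o, 'a) sym_mon_cat \<Rightarrow> (('o, 'a) dobj, ('o, 'a) darr) mon_struct" where
  "D_circ V = \<lparr>prd = D_prd V,
     Phi = (\<lambda>ks xss. DArr (fob (padded_func (D_prd V) ks) xss)
       (tars V (map (tars V) (end_fam V ka nu (\<lambda>k. bar k - 1) ks xss))
         \<odot>\<^bsub>V\<^esub> coherence V (car_fam xss) (padded_term ks) (nested_term ks))
       (fob (nested_func (D_prd V) ks) xss)),
     phi = (\<lambda>ks xss. DArr (fob (padded_func (D_prd V) ks) xss)
       (tars V (concat (end_fam V ka nu Z ks xss))
         \<odot>\<^bsub>V\<^esub> coherence V (car_fam xss) (padded_term ks) (flat_term ks))
       (fob (flat_func (D_prd V) ks) xss)),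
     iota = Id (D_cat V)\<rparr>"

definition D_xi :: "('o, 'a) sym_mon_cat \<Rightarrow> nat \<Rightarrow> nat \<Rightarrow> ('o, 'a) dobj list list \<Rightarrow> ('o, 'a) darr" where
  "D_xi V p n xss = DArr (D_tobs V (map (D_tobs V) xss))
     (coherence V (car_fam xss)
       (Tens (map (\<lambda>r. Tens (map (\<lambda>s. Var (r, s)) [0..<p])) [0..<n]))
       (Tens (map (\<lambda>s. Tens (map (\<lambda>r. Var (r, s)) [0..<n])) [0..<p])))
     (D_tobs V (map (D_tobs V) (columns p xss)))"

end

theory Submission
  imports Defs "HOL-Library.Multiset"
begin

text \<open>
  Every arrow of \<open>D\<close> that occurs in the axioms is built, by composition and tensor products, from
  components of the structure isomorphisms of \<open>V\<close> and from monomials in the four endomorphisms. Such an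
  arrow is determined by its source and target, written as formal tensor products of distinct variables,
  and by one exponent of each endomorphism for each variable. The reason is that, first, canonical
  arrows are natural, so that all endomorphisms can be moved to the source
  (\<open>canonical_natural\<close>, \<open>gen_comp\<close>); second, there is only one canonical arrow between two given
  formal products (\<open>canonical_unique\<close>, Mac Lane's theorem); third, the endomorphisms commute
  (\<open>endo_comp\<close>). Hence \<open>gen_unique\<close>: two arrows with the same source, target and
  exponents are equal, and each axiom is reduced to a comparison of formal products and of exponents.

  The predicate \<open>gen h s t f\<close> says that \<open>f\<close> is obtained in this way from arrows \<open>h v\<close>, one for each variable
  \<open>v\<close>; \<open>mgen\<close> is the special case where \<open>h v\<close> is a monomial. Since arbitrary arrows \<open>h v\<close> are allowed,
  functoriality and naturality are proved by the same uniqueness argument (\<open>shape_functor\<close>,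
  \<open>shape_nat_trans\<close>).

  In the associativity axioms, a variable in the group \<open>i\<close> receives from each later group \<open>p\<close> a contribution
  to the exponent of the first endomorphism, and from each earlier group one to the exponent of the second
  endomorphism. With \<open>m\<close>, \<open>K\<close>, \<open>Z\<close> and \<open>\<Sum> (bar k - 1)\<close> those of the group \<open>p\<close>, and with \<open>m\<close> positive, the
  first axiom holds because \<open>(bar m - 1) + \<Sum> (bar k - 1) = K + Z - 1\<close>; the other three axioms and the
  degenerate cases are similar (\<open>weight_Phi_Phi\<close> and the lemmas following it). The structures
  \<open>\<bullet>\<close> and \<open>\<circ>\<close> differ only in the choice of the two endomorphisms and in the direction of the arrows, so that
  both are covered by \<open>mon_str_lax_oplax_monoidal\<close>.

  In the axioms on \<open>\<xi>\<close>, both sides carry the same exponents, since these depend only on the row of a variable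
  (\<open>slice_exponents\<close>), and \<open>\<xi>\<close> contributes none.

  The uniqueness of canonical arrows is proved by comparison with normal forms: \<open>nf t c\<close> maps
  \<open>t \<otimes> c\<close> to the product of the variables of \<open>t\<close>, bracketed to the right and ending with \<open>c\<close>. On the normal
  forms there are permutations \<open>P\<close> of factors, composed of exchanges \<open>sw\<close> of neighbouring factors. These
  satisfy the braid relation, whence \<open>P\<close> is functorial (\<open>P_comp\<close>), and \<open>nf\<close> turns every canonical arrow into
  a permutation (\<open>nf_canonical\<close>).
\<close>

section \<open>Calculus in a symmetric monoidal category\<close>

context category begin

lemma homD: "f \<in> hom C a b \<Longrightarrow> f \<in> Ar C \<and> Dom C f = a \<and> Cod C f = b"
  by (simp add: hom_def)

lemma id_typ [simp]: "a \<in> Ob C \<Longrightarrow> Id C a \<in> Ar C" "a \<in> Ob C \<Longrightarrow> Dom C (Id C a) = a"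
  "a \<in> Ob C \<Longrightarrow> Cod C (Id C a) = a"
  using id_hom[of a] by (auto simp: hom_def)

lemma ob_typ [simp]: "f \<in> Ar C \<Longrightarrow> Dom C f \<in> Ob C" "f \<in> Ar C \<Longrightarrow> Cod C f \<in> Ob C"
  by (simp_all add: dom_ob cod_ob)

lemma comp_typ [simp]:
  assumes "f \<in> Ar C" "g \<in> Ar C" "Cod C f = Dom C g"
  shows "g \<odot> f \<in> Ar C" "Dom C (g \<odot> f) = Dom C f" "Cod C (g \<odot> f) = Cod C g"
  using comp_hom[of f "Dom C f" "Cod C f" g "Cod C g"] assms by (auto simp: hom_def)

lemma comp_id' [simp]: "f \<in> Ar C \<Longrightarrow> Dom C f = a \<Longrightarrow> f \<odot> Id C a = f"
  using comp_id[of f] by (auto simp: hom_def)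

lemma id_comp' [simp]: "f \<in> Ar C \<Longrightarrow> Cod C f = a \<Longrightarrow> Id C a \<odot> f = f"
  using id_comp[of f] by (auto simp: hom_def)

text \<open>The axioms are restated with conditions on domains and codomains, which the simplifier can check.\<close>
lemma comp_assoc' [simp]:
  "\<lbrakk>f \<in> Ar C; g \<in> Ar C; h \<in> Ar C; Cod C f = Dom C g; Cod C g = Dom C h\<rbrakk> \<Longrightarrow> (h \<odot> g) \<odot> f = h \<odot> g \<odot> f"
  using comp_assoc[of f "Dom C f" "Cod C f" g "Cod C g" h "Cod C h"] by (simp add: hom_def)

text \<open>Consequence of an equation between composites, for use under further composition.\<close>
lemma comp_reassoc:
  assumes "g \<odot> f = k \<odot> h" "f \<in> Ar C" "g \<in> Ar C" "h \<in> Ar C" "k \<in> Ar C" "Cod C f = Dom C g"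
    "Cod C h = Dom C k" "l \<in> Ar C" "Cod C l = Dom C f" "Dom C f = Dom C h"
  shows "g \<odot> f \<odot> l = k \<odot> h \<odot> l"
  using assms by (metis comp_assoc')

lemma inverse_unique:
  assumes "inverse_arrows C a b f g" "inverse_arrows C a b f g'"
  shows "g = g'"
  using assms comp_assoc'[of g f g'] comp_id' id_comp'
  unfolding inverse_arrows_def by (auto simp: hom_def)

end

context symmetric_monoidal_category begin

text \<open>A chosen inverse of an isomorphism \<open>f : a \<rightarrow> b\<close>, and the resulting inverses of the constraints.\<close>
definition ainv :: "'a \<Rightarrow> 'o \<Rightarrow> 'o \<Rightarrow> 'a" where
  "ainv f a b = (SOME g. inverse_arrows V a b f g)"

lemma ainv: "iso_arrow V a b f \<Longrightarrow> inverse_arrows V a b f (ainv f a b)"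
  unfolding ainv_def iso_arrow_def by (rule someI_ex)

definition asi :: "'o \<Rightarrow> 'o \<Rightarrow> 'o \<Rightarrow> 'a" where
  "asi a b c = ainv (assoc V a b c) ((a \<otimes> b) \<otimes> c) (a \<otimes> b \<otimes> c)"

definition lui :: "'o \<Rightarrow> 'a" where
  "lui a = ainv (lunit V a) (\<I> \<otimes> a) a"

lemma inverse_asi: "\<lbrakk>a \<in> Ob V; b \<in> Ob V; c \<in> Ob V\<rbrakk>
  \<Longrightarrow> inverse_arrows V ((a \<otimes> b) \<otimes> c) (a \<otimes> b \<otimes> c) (assoc V a b c) (asi a b c)"
  unfolding asi_def by (rule ainv[OF assoc_iso])

lemma inverse_lui: "a \<in> Ob V \<Longrightarrow> inverse_arrows V (\<I> \<otimes> a) a (lunit V a) (lui a)"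
  unfolding lui_def by (rule ainv[OF lunit_iso])

declare tob_ob [simp] unit_ob [simp]

lemma tar_typ [simp]:
  assumes "f \<in> Ar V" "g \<in> Ar V"
  shows "f \<boxtimes> g \<in> Ar V" "Dom V (f \<boxtimes> g) = Dom V f \<otimes> Dom V g" "Cod V (f \<boxtimes> g) = Cod V f \<otimes> Cod V g"
  using tar_hom[of f "Dom V f" "Cod V f" g "Dom V g" "Cod V g"] assms by (auto simp: hom_def)

lemma assoc_typ [simp]:
  assumes "a \<in> Ob V" "b \<in> Ob V" "c \<in> Ob V"
  shows "assoc V a b c \<in> Ar V" "Dom V (assoc V a b c) = (a \<otimes> b) \<otimes> c"
    "Cod V (assoc V a b c) = a \<otimes> b \<otimes> c" "asi a b c \<in> Ar V" "Cod V (asi a b c) = (a \<otimes> b) \<otimes> c"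
    "Dom V (asi a b c) = a \<otimes> b \<otimes> c" "asi a b c \<odot> assoc V a b c = Id V ((a \<otimes> b) \<otimes> c)"
    "assoc V a b c \<odot> asi a b c = Id V (a \<otimes> b \<otimes> c)"
  using inverse_asi[OF assms] by (auto simp: inverse_arrows_def hom_def)

lemma lunit_typ [simp]:
  assumes "a \<in> Ob V"
  shows "lunit V a \<in> Ar V" "Dom V (lunit V a) = \<I> \<otimes> a" "Cod V (lunit V a) = a"
    "lui a \<in> Ar V" "Cod V (lui a) = \<I> \<otimes> a" "Dom V (lui a) = a"
    "lui a \<odot> lunit V a = Id V (\<I> \<otimes> a)" "lunit V a \<odot> lui a = Id V a"
  using inverse_lui[OF assms] by (auto simp: inverse_arrows_def hom_def)

lemma runit_typ [simp]:
  assumes "a \<in> Ob V"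
  shows "runit V a \<in> Ar V" "Dom V (runit V a) = a \<otimes> \<I>" "Cod V (runit V a) = a"
  using runit_iso[OF assms] by (auto simp: iso_arrow_def inverse_arrows_def hom_def)

lemma sym_typ [simp]:
  assumes "a \<in> Ob V" "b \<in> Ob V"
  shows "sigma V a b \<in> Ar V" "Dom V (sigma V a b) = a \<otimes> b" "Cod V (sigma V a b) = b \<otimes> a"
    "sigma V b a \<odot> sigma V a b = Id V (a \<otimes> b)"
  using sym_hom[OF assms] sym_sym[OF assms] by (auto simp: hom_def)

lemma tar_id' [simp]: "\<lbrakk>a \<in> Ob V; b \<in> Ob V\<rbrakk> \<Longrightarrow> Id V a \<boxtimes> Id V b = Id V (a \<otimes> b)"
  by (rule tar_id)

lemma interchange:
  assumes "f \<in> Ar V" "f' \<in> Ar V" "g \<in> Ar V" "g' \<in> Ar V" "Cod V f = Dom V f'" "Cod V g = Dom V g'"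
  shows "(f' \<boxtimes> g') \<odot> (f \<boxtimes> g) = (f' \<odot> f) \<boxtimes> (g' \<odot> g)"
  using tar_comp[of f "Dom V f" "Cod V f" f' "Cod V f'" g "Dom V g" "Cod V g" g' "Cod V g'"] assms
  by (simp add: hom_def)

lemma interchange':
  assumes "f \<in> Ar V" "f' \<in> Ar V" "g \<in> Ar V" "g' \<in> Ar V" "Cod V f = Dom V f'" "Cod V g = Dom V g'"
    "k \<in> Ar V" "Cod V k = Dom V f \<otimes> Dom V g"
  shows "(f' \<boxtimes> g') \<odot> (f \<boxtimes> g) \<odot> k = ((f' \<odot> f) \<boxtimes> (g' \<odot> g)) \<odot> k"
  using assms by (subst interchange[symmetric]) simp_all

lemma iso_cancel:
  assumes "h \<in> Ar V" "h' \<in> Ar V" "Dom V h' = Cod V h" "h \<odot> h' = Id V (Cod V h)" "Cod V h' = Dom V h"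
    "f \<in> Ar V" "g \<in> Ar V" "Dom V f = Cod V h" "Dom V g = Cod V h" "f \<odot> h = g \<odot> h"
  shows "f = g"
  using assms by (metis comp_assoc' comp_id')

lemma assoc_inv' [simp]:
  assumes "a \<in> Ob V" "b \<in> Ob V" "c \<in> Ob V" "k \<in> Ar V"
  shows "Cod V k = (a \<otimes> b) \<otimes> c \<Longrightarrow> asi a b c \<odot> assoc V a b c \<odot> k = k"
    "Cod V k = a \<otimes> b \<otimes> c \<Longrightarrow> assoc V a b c \<odot> asi a b c \<odot> k = k"
  using assms by (simp_all flip: comp_assoc')

lemma lunit_inv' [simp]:
  assumes "a \<in> Ob V" "k \<in> Ar V"
  shows "Cod V k = \<I> \<otimes> a \<Longrightarrow> lui a \<odot> lunit V a \<odot> k = k"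
    "Cod V k = a \<Longrightarrow> lunit V a \<odot> lui a \<odot> k = k"
  using assms by (simp_all flip: comp_assoc')

lemma sym_inv' [simp]:
  assumes "a \<in> Ob V" "b \<in> Ob V" "k \<in> Ar V" "Cod V k = a \<otimes> b"
  shows "sigma V b a \<odot> sigma V a b \<odot> k = k"
  using assms by (simp flip: comp_assoc')

lemma assoc_nat': 
  assumes "f \<in> Ar V" "g \<in> Ar V" "h \<in> Ar V" "a = Cod V f" "b = Cod V g" "c = Cod V h"
  shows "assoc V a b c \<odot> ((f \<boxtimes> g) \<boxtimes> h) = (f \<boxtimes> g \<boxtimes> h) \<odot> assoc V (Dom V f) (Dom V g) (Dom V h)"
  using assoc_nat[of f _ _ g _ _ h] assms by (simp add: hom_def)

lemma assoc_nat'':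
  assumes "f \<in> Ar V" "g \<in> Ar V" "h \<in> Ar V" "a = Cod V f" "b = Cod V g" "c = Cod V h"
    "k \<in> Ar V" "Cod V k = (Dom V f \<otimes> Dom V g) \<otimes> Dom V h"
  shows "assoc V a b c \<odot> ((f \<boxtimes> g) \<boxtimes> h) \<odot> k
    = (f \<boxtimes> g \<boxtimes> h) \<odot> assoc V (Dom V f) (Dom V g) (Dom V h) \<odot> k"
  using assms by (intro comp_reassoc assoc_nat') simp_all

lemma asi_nat': 
  assumes "f \<in> Ar V" "g \<in> Ar V" "h \<in> Ar V" "a = Cod V f" "b = Cod V g" "c = Cod V h"
  shows "asi a b c \<odot> (f \<boxtimes> g \<boxtimes> h) = ((f \<boxtimes> g) \<boxtimes> h) \<odot> asi (Dom V f) (Dom V g) (Dom V h)"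
proof -
  have "asi a b c \<odot> (f \<boxtimes> g \<boxtimes> h)
      = asi a b c \<odot> ((f \<boxtimes> g \<boxtimes> h) \<odot> assoc V (Dom V f) (Dom V g) (Dom V h)) \<odot> asi (Dom V f) (Dom V g) (Dom V h)"
    using assms by simp
  also have "\<dots> = asi a b c \<odot> (assoc V a b c \<odot> ((f \<boxtimes> g) \<boxtimes> h)) \<odot> asi (Dom V f) (Dom V g) (Dom V h)"
    using assms by (subst assoc_nat') simp_all
  also have "\<dots> = ((f \<boxtimes> g) \<boxtimes> h) \<odot> asi (Dom V f) (Dom V g) (Dom V h)"
    using assms by simp
  finally show ?thesis .
qed

lemma lunit_nat': "f \<in> Ar V \<Longrightarrow> a = Cod V f \<Longrightarrow> lunit V a \<odot> (Id V \<I> \<boxtimes> f) = f \<odot> lunit V (Dom V f)"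
  using lunit_nat[of f] by (simp add: hom_def)

lemma sym_nat': "\<lbrakk>f \<in> Ar V; g \<in> Ar V; a = Cod V f; b = Cod V g\<rbrakk>
  \<Longrightarrow> sigma V a b \<odot> (f \<boxtimes> g) = (g \<boxtimes> f) \<odot> sigma V (Dom V f) (Dom V g)"
  using sym_nat[of f _ _ g] by (simp add: hom_def)

lemma unit_faithful:
  assumes "f \<in> Ar V" "g \<in> Ar V" "Dom V f = Dom V g" "Cod V f = Cod V g" "Id V \<I> \<boxtimes> f = Id V \<I> \<boxtimes> g"
  shows "f = g"
proof (rule iso_cancel[where h = "lunit V (Dom V f)" and h' = "lui (Dom V f)"])
  show "f \<odot> lunit V (Dom V f) = g \<odot> lunit V (Dom V f)"
    using lunit_nat'[of f "Cod V f"] lunit_nat'[of g "Cod V f"] assms by simp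
qed (use assms in simp_all)

text \<open>Kelly's theorem that the triangle and pentagon axioms imply compatibility of the associativity
  with the left unit constraint.\<close>
lemma lunit_tensor:
  assumes [simp]: "a \<in> Ob V" "b \<in> Ob V"
  shows "lunit V (a \<otimes> b) \<odot> assoc V \<I> a b = lunit V a \<boxtimes> Id V b"
proof (rule unit_faithful)
  let ?h = "assoc V \<I> (\<I> \<otimes> a) b \<odot> (assoc V \<I> \<I> a \<boxtimes> Id V b)"
  let ?h' = "(asi \<I> \<I> a \<boxtimes> Id V b) \<odot> asi \<I> (\<I> \<otimes> a) b"
  show "Id V \<I> \<boxtimes> (lunit V (a \<otimes> b) \<odot> assoc V \<I> a b) = Id V \<I> \<boxtimes> (lunit V a \<boxtimes> Id V b)"
  proof (rule iso_cancel[where h = ?h and h' = ?h'])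
    have "(Id V \<I> \<boxtimes> (lunit V (a \<otimes> b) \<odot> assoc V \<I> a b)) \<odot> ?h
      = (Id V \<I> \<boxtimes> lunit V (a \<otimes> b)) \<odot> (Id V \<I> \<boxtimes> assoc V \<I> a b) \<odot> ?h"
      by (simp add: interchange')
    also have "\<dots> = (Id V \<I> \<boxtimes> lunit V (a \<otimes> b)) \<odot> assoc V \<I> \<I> (a \<otimes> b) \<odot> assoc V (\<I> \<otimes> \<I>) a b"
      by (simp add: pentagon)
    also have "\<dots> = ((Id V \<I> \<boxtimes> lunit V (a \<otimes> b)) \<odot> assoc V \<I> \<I> (a \<otimes> b)) \<odot> assoc V (\<I> \<otimes> \<I>) a b"
      by simp
    also have "\<dots> = (runit V \<I> \<boxtimes> Id V (a \<otimes> b)) \<odot> assoc V (\<I> \<otimes> \<I>) a b"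
      by (subst triangle) simp_all
    also have "\<dots> = assoc V \<I> a b \<odot> ((runit V \<I> \<boxtimes> Id V a) \<boxtimes> Id V b)"
      by (simp add: assoc_nat')
    also have "\<dots> = assoc V \<I> a b \<odot> (((Id V \<I> \<boxtimes> lunit V a) \<odot> assoc V \<I> \<I> a) \<boxtimes> Id V b)"
      by (simp add: triangle)
    also have "\<dots> = assoc V \<I> a b \<odot> ((Id V \<I> \<boxtimes> lunit V a) \<boxtimes> Id V b) \<odot> (assoc V \<I> \<I> a \<boxtimes> Id V b)"
      by (simp add: interchange)
    also have "\<dots> = (Id V \<I> \<boxtimes> (lunit V a \<boxtimes> Id V b)) \<odot> ?h"
      by (simp add: assoc_nat'')
    finally show "(Id V \<I> \<boxtimes> (lunit V (a \<otimes> b) \<odot> assoc V \<I> a b)) \<odot> ?h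
      = (Id V \<I> \<boxtimes> (lunit V a \<boxtimes> Id V b)) \<odot> ?h" .
  qed (simp_all add: interchange interchange')
qed simp_all

text \<open>The exchange of the first two factors of \<open>a \<otimes> (b \<otimes> c)\<close>.\<close>
definition sw :: "'o \<Rightarrow> 'o \<Rightarrow> 'o \<Rightarrow> 'a" where
  "sw a b c = assoc V b a c \<odot> (sigma V a b \<boxtimes> Id V c) \<odot> asi a b c"

lemma sw_typ [simp]:
  assumes "a \<in> Ob V" "b \<in> Ob V" "c \<in> Ob V"
  shows "sw a b c \<in> Ar V" "Dom V (sw a b c) = a \<otimes> b \<otimes> c" "Cod V (sw a b c) = b \<otimes> a \<otimes> c"
    "sw b a c \<odot> sw a b c = Id V (a \<otimes> b \<otimes> c)"
  using assms by (simp_all add: sw_def interchange')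

lemma sw_inv' [simp]:
  assumes "a \<in> Ob V" "b \<in> Ob V" "c \<in> Ob V" "k \<in> Ar V" "Cod V k = a \<otimes> b \<otimes> c"
  shows "sw b a c \<odot> sw a b c \<odot> k = k"
  using assms by (simp flip: comp_assoc')

lemma sw_nat:
  assumes [simp]: "f \<in> Ar V" "g \<in> Ar V" "h \<in> Ar V" "a = Cod V f" "b = Cod V g" "c = Cod V h"
  shows "sw a b c \<odot> (f \<boxtimes> g \<boxtimes> h) = (g \<boxtimes> f \<boxtimes> h) \<odot> sw (Dom V f) (Dom V g) (Dom V h)"
  unfolding sw_def
  by (simp add: asi_nat' interchange' sym_nat' flip: assoc_nat'')

lemma sw_nat':
  assumes "f \<in> Ar V" "g \<in> Ar V" "h \<in> Ar V" "a = Cod V f" "b = Cod V g" "c = Cod V h"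
    "k \<in> Ar V" "Cod V k = Dom V f \<otimes> Dom V g \<otimes> Dom V h"
  shows "sw a b c \<odot> (f \<boxtimes> g \<boxtimes> h) \<odot> k = (g \<boxtimes> f \<boxtimes> h) \<odot> sw (Dom V f) (Dom V g) (Dom V h) \<odot> k"
  using assms by (intro comp_reassoc sw_nat) simp_all


text \<open>The second hexagon is the inverse of the first one.\<close>
lemma hexagon_inv:
  assumes [simp]: "a \<in> Ob V" "b \<in> Ob V" "c \<in> Ob V"
  shows "sigma V (a \<otimes> b) c = assoc V c a b \<odot> (sigma V a c \<boxtimes> Id V b) \<odot> asi a c b
    \<odot> (Id V a \<boxtimes> sigma V b c) \<odot> assoc V a b c"
proof -
  let ?s = "sigma V c (a \<otimes> b)"
  let ?r = "assoc V c a b \<odot> (sigma V a c \<boxtimes> Id V b) \<odot> asi a c b \<odot> (Id V a \<boxtimes> sigma V b c) \<odot> assoc V a b c"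
  have "?r \<odot> ?s = assoc V c a b \<odot> (sigma V a c \<boxtimes> Id V b) \<odot> asi a c b \<odot> (Id V a \<boxtimes> sigma V b c)
      \<odot> (assoc V a b c \<odot> ?s \<odot> assoc V c a b) \<odot> asi c a b"
    by simp
  also have "\<dots> = Id V (c \<otimes> a \<otimes> b)"
    by (simp add: hexagon interchange interchange')
  finally have "?r \<odot> ?s = Id V (c \<otimes> a \<otimes> b)" .
  hence "(?r \<odot> ?s) \<odot> sigma V (a \<otimes> b) c = sigma V (a \<otimes> b) c"
    by simp
  thus ?thesis by simp
qed

text \<open>The two hexagons in terms of \<open>sw\<close>: the exchange with a product is a composite of two exchanges.\<close>
lemma sw_tensor_left:
  assumes [simp]: "a \<in> Ob V" "b \<in> Ob V" "c \<in> Ob V" "d \<in> Ob V"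
  shows "(Id V c \<boxtimes> assoc V a b d) \<odot> sw (a \<otimes> b) c d
    = sw a c (b \<otimes> d) \<odot> (Id V a \<boxtimes> sw b c d) \<odot> assoc V a b (c \<otimes> d)"
proof (rule iso_cancel[where h = "assoc V (a \<otimes> b) c d" and h' = "asi (a \<otimes> b) c d"])
  have pent: "(Id V a \<boxtimes> assoc V c b d) \<odot> assoc V a (c \<otimes> b) d
      = assoc V a c (b \<otimes> d) \<odot> assoc V (a \<otimes> c) b d \<odot> (asi a c b \<boxtimes> Id V d)"
    (is "?l = ?r")
  proof -
    have "?l = ((Id V a \<boxtimes> assoc V c b d) \<odot> assoc V a (c \<otimes> b) d \<odot> (assoc V a c b \<boxtimes> Id V d)) \<odot> (asi a c b \<boxtimes> Id V d)"
      by (simp add: interchange)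
    also have "\<dots> = ?r"
      by (subst pentagon) simp_all
    finally show ?thesis .
  qed
  have "(sw a c (b \<otimes> d) \<odot> (Id V a \<boxtimes> sw b c d) \<odot> assoc V a b (c \<otimes> d)) \<odot> assoc V (a \<otimes> b) c d
    = sw a c (b \<otimes> d) \<odot> (Id V a \<boxtimes> sw b c d)
      \<odot> ((Id V a \<boxtimes> assoc V b c d) \<odot> assoc V a (b \<otimes> c) d \<odot> (assoc V a b c \<boxtimes> Id V d))"
    by (simp add: pentagon)
  also have "\<dots> = sw a c (b \<otimes> d) \<odot> (Id V a \<boxtimes> (assoc V c b d \<odot> (sigma V b c \<boxtimes> Id V d)))
      \<odot> assoc V a (b \<otimes> c) d \<odot> (assoc V a b c \<boxtimes> Id V d)"
    by (simp add: interchange' sw_def)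
  also have "\<dots> = sw a c (b \<otimes> d) \<odot> ((Id V a \<boxtimes> assoc V c b d)
      \<odot> assoc V a (c \<otimes> b) d) \<odot> ((Id V a \<boxtimes> sigma V b c) \<boxtimes> Id V d) \<odot> (assoc V a b c \<boxtimes> Id V d)"
    by (simp add: assoc_nat'' interchange')
  also have "\<dots> = sw a c (b \<otimes> d) \<odot> (assoc V a c (b \<otimes> d) \<odot> assoc V (a \<otimes> c) b d)
     \<odot> ((asi a c b \<odot> (Id V a \<boxtimes> sigma V b c) \<odot> assoc V a b c) \<boxtimes> Id V d)"
    by (subst pent) (simp add: interchange interchange')
  also have "\<dots> = assoc V c a (b \<otimes> d) \<odot> (sigma V a c \<boxtimes> Id V b \<boxtimes> Id V d) \<odot> assoc V (a \<otimes> c) b d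
     \<odot> ((asi a c b \<odot> (Id V a \<boxtimes> sigma V b c) \<odot> assoc V a b c) \<boxtimes> Id V d)"
    by (simp add: sw_def)
  also have "\<dots> = (assoc V c a (b \<otimes> d) \<odot> assoc V (c \<otimes> a) b d) \<odot> ((sigma V a c \<boxtimes> Id V b) \<boxtimes> Id V d)
     \<odot> ((asi a c b \<odot> (Id V a \<boxtimes> sigma V b c) \<odot> assoc V a b c) \<boxtimes> Id V d)"
    by (simp add: assoc_nat'' del: tar_id')
  also have "\<dots> = ((Id V c \<boxtimes> assoc V a b d) \<odot> assoc V c (a \<otimes> b) d \<odot> (assoc V c a b \<boxtimes> Id V d))
     \<odot> ((sigma V a c \<boxtimes> Id V b) \<boxtimes> Id V d)
     \<odot> ((asi a c b \<odot> (Id V a \<boxtimes> sigma V b c) \<odot> assoc V a b c) \<boxtimes> Id V d)"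
    by (simp add: pentagon)
  also have "\<dots> = (Id V c \<boxtimes> assoc V a b d) \<odot> assoc V c (a \<otimes> b) d
    \<odot> ((assoc V c a b \<odot> (sigma V a c \<boxtimes> Id V b) \<odot> asi a c b \<odot> (Id V a \<boxtimes> sigma V b c) \<odot> assoc V a b c) \<boxtimes> Id V d)"
    by (simp add: interchange interchange')
  also have "\<dots> = (Id V c \<boxtimes> assoc V a b d) \<odot> assoc V c (a \<otimes> b) d \<odot> (sigma V (a \<otimes> b) c \<boxtimes> Id V d)"
    by (subst hexagon_inv) simp_all
  also have "\<dots> = ((Id V c \<boxtimes> assoc V a b d) \<odot> sw (a \<otimes> b) c d) \<odot> assoc V (a \<otimes> b) c d"
    by (simp add: sw_def)
  finally show "((Id V c \<boxtimes> assoc V a b d) \<odot> sw (a \<otimes> b) c d) \<odot> assoc V (a \<otimes> b) c d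
    = (sw a c (b \<otimes> d) \<odot> (Id V a \<boxtimes> sw b c d) \<odot> assoc V a b (c \<otimes> d)) \<odot> assoc V (a \<otimes> b) c d"
    by simp
qed simp_all

lemma sw_tensor_right:
  assumes [simp]: "a \<in> Ob V" "b \<in> Ob V" "x \<in> Ob V" "d \<in> Ob V"
  shows "assoc V a b (x \<otimes> d) \<odot> sw x (a \<otimes> b) d
    = (Id V a \<boxtimes> sw x b d) \<odot> sw x a (b \<otimes> d) \<odot> (Id V x \<boxtimes> assoc V a b d)"
proof -
  have "(Id V a \<boxtimes> sw x b d) \<odot> sw x a (b \<otimes> d) \<odot> (Id V x \<boxtimes> assoc V a b d)
    = (Id V a \<boxtimes> sw x b d) \<odot> sw x a (b \<otimes> d) \<odot> ((Id V x \<boxtimes> assoc V a b d) \<odot> sw (a \<otimes> b) x d) \<odot> sw x (a \<otimes> b) d"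
    by simp
  also have "\<dots> = assoc V a b (x \<otimes> d) \<odot> sw x (a \<otimes> b) d"
    by (subst sw_tensor_left) (simp_all add: interchange')
  finally show ?thesis ..
qed

text \<open>The braid relation, from naturality of the exchange of \<open>c\<close> with \<open>a \<otimes> b\<close> in the latter.\<close>
lemma sw_braid:
  assumes [simp]: "a \<in> Ob V" "b \<in> Ob V" "c \<in> Ob V" "d \<in> Ob V"
  shows "(Id V c \<boxtimes> sw a b d) \<odot> sw a c (b \<otimes> d) \<odot> (Id V a \<boxtimes> sw b c d)
    = sw b c (a \<otimes> d) \<odot> (Id V b \<boxtimes> sw a c d) \<odot> sw a b (c \<otimes> d)"
proof (rule iso_cancel[where h = "assoc V a b (c \<otimes> d)" and h' = "asi a b (c \<otimes> d)"])
  have "(sw b c (a \<otimes> d) \<odot> (Id V b \<boxtimes> sw a c d) \<odot> sw a b (c \<otimes> d)) \<odot> assoc V a b (c \<otimes> d)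
    = (sw b c (a \<otimes> d) \<odot> (Id V b \<boxtimes> sw a c d) \<odot> assoc V b a (c \<otimes> d)) \<odot> (sigma V a b \<boxtimes> Id V c \<boxtimes> Id V d)"
    by (simp add: sw_def)
  also have "\<dots> = (Id V c \<boxtimes> assoc V b a d) \<odot> sw (b \<otimes> a) c d \<odot> (sigma V a b \<boxtimes> Id V c \<boxtimes> Id V d)"
    by (simp add: sw_tensor_left[symmetric])
  also have "\<dots> = (Id V c \<boxtimes> assoc V b a d) \<odot> (Id V c \<boxtimes> sigma V a b \<boxtimes> Id V d) \<odot> sw (a \<otimes> b) c d"
    by (simp add: sw_nat del: tar_id')
  also have "\<dots> = (Id V c \<boxtimes> sw a b d) \<odot> ((Id V c \<boxtimes> assoc V a b d) \<odot> sw (a \<otimes> b) c d)"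
    by (simp add: interchange' sw_def)
  also have "\<dots> = ((Id V c \<boxtimes> sw a b d) \<odot> sw a c (b \<otimes> d) \<odot> (Id V a \<boxtimes> sw b c d)) \<odot> assoc V a b (c \<otimes> d)"
    by (subst sw_tensor_left) simp_all
  finally show "((Id V c \<boxtimes> sw a b d) \<odot> sw a c (b \<otimes> d) \<odot> (Id V a \<boxtimes> sw b c d)) \<odot> assoc V a b (c \<otimes> d)
    = (sw b c (a \<otimes> d) \<odot> (Id V b \<boxtimes> sw a c d) \<odot> sw a b (c \<otimes> d)) \<odot> assoc V a b (c \<otimes> d)" ..
qed simp_all

text \<open>The exchange with the unit is trivial. For the exchange with a third factor of the form \<open>\<I> \<otimes> d\<close>, this
  follows from \<open>sw_tensor_left\<close> with both of the first factors equal to \<open>\<I>\<close>; the general case then follows by naturality,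
  since \<open>\<I> \<otimes> d\<close> is isomorphic to \<open>d\<close>.\<close>
lemma lunit_sw:
  assumes [simp]: "c \<in> Ob V" "d \<in> Ob V"
  shows "(Id V c \<boxtimes> lunit V d) \<odot> sw \<I> c d = lunit V (c \<otimes> d)"
proof -
  have star: "(Id V c \<boxtimes> lunit V (\<I> \<otimes> d)) \<odot> sw \<I> c (\<I> \<otimes> d) = lunit V (c \<otimes> \<I> \<otimes> d)"
  proof (rule iso_cancel[where h = "Id V \<I> \<boxtimes> sw \<I> c d" and h' = "Id V \<I> \<boxtimes> sw c \<I> d"])
    show "((Id V c \<boxtimes> lunit V (\<I> \<otimes> d)) \<odot> sw \<I> c (\<I> \<otimes> d)) \<odot> (Id V \<I> \<boxtimes> sw \<I> c d)
      = lunit V (c \<otimes> \<I> \<otimes> d) \<odot> (Id V \<I> \<boxtimes> sw \<I> c d)"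
    proof (rule iso_cancel[where h = "assoc V \<I> \<I> (c \<otimes> d)" and h' = "asi \<I> \<I> (c \<otimes> d)"])
      have "(((Id V c \<boxtimes> lunit V (\<I> \<otimes> d)) \<odot> sw \<I> c (\<I> \<otimes> d)) \<odot> (Id V \<I> \<boxtimes> sw \<I> c d)) \<odot> assoc V \<I> \<I> (c \<otimes> d)
        = (Id V c \<boxtimes> lunit V (\<I> \<otimes> d)) \<odot> (Id V c \<boxtimes> assoc V \<I> \<I> d) \<odot> sw (\<I> \<otimes> \<I>) c d"
        by (simp add: sw_tensor_left)
      also have "\<dots> = (Id V c \<boxtimes> (lunit V (\<I> \<otimes> d) \<odot> assoc V \<I> \<I> d)) \<odot> sw (\<I> \<otimes> \<I>) c d"
        by (simp add: interchange')
      also have "\<dots> = (Id V c \<boxtimes> lunit V \<I> \<boxtimes> Id V d) \<odot> sw (\<I> \<otimes> \<I>) c d"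
        by (subst lunit_tensor) simp_all
      also have "\<dots> = sw \<I> c d \<odot> (lunit V \<I> \<boxtimes> Id V c \<boxtimes> Id V d)"
        by (simp add: sw_nat del: tar_id')
      also have "\<dots> = sw \<I> c d \<odot> (lunit V (\<I> \<otimes> c \<otimes> d) \<odot> assoc V \<I> \<I> (c \<otimes> d))"
        by (subst lunit_tensor) simp_all
      also have "\<dots> = (sw \<I> c d \<odot> lunit V (\<I> \<otimes> c \<otimes> d)) \<odot> assoc V \<I> \<I> (c \<otimes> d)"
        by simp
      also have "\<dots> = (lunit V (c \<otimes> \<I> \<otimes> d) \<odot> (Id V \<I> \<boxtimes> sw \<I> c d)) \<odot> assoc V \<I> \<I> (c \<otimes> d)"
        by (subst lunit_nat') simp_all
      finally show "(((Id V c \<boxtimes> lunit V (\<I> \<otimes> d)) \<odot> sw \<I> c (\<I> \<otimes> d)) \<odot> (Id V \<I> \<boxtimes> sw \<I> c d)) \<odot> assoc V \<I> \<I> (c \<otimes> d)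
        = (lunit V (c \<otimes> \<I> \<otimes> d) \<odot> (Id V \<I> \<boxtimes> sw \<I> c d)) \<odot> assoc V \<I> \<I> (c \<otimes> d)" .
    qed simp_all
  qed (simp_all add: interchange)
  have "(Id V c \<boxtimes> lunit V d) \<odot> sw \<I> c d
    = (Id V c \<boxtimes> lunit V d) \<odot> sw \<I> c d \<odot> (Id V \<I> \<boxtimes> Id V c \<boxtimes> lunit V d) \<odot> (Id V \<I> \<boxtimes> Id V c \<boxtimes> lui d)"
    by (simp add: interchange)
  also have "\<dots> = (Id V c \<boxtimes> lunit V d) \<odot> (Id V c \<boxtimes> Id V \<I> \<boxtimes> lunit V d) \<odot> sw \<I> c (\<I> \<otimes> d) \<odot> (Id V \<I> \<boxtimes> Id V c \<boxtimes> lui d)"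
    by (simp add: sw_nat')
  also have "\<dots> = (Id V c \<boxtimes> (lunit V d \<odot> lunit V (\<I> \<otimes> d))) \<odot> sw \<I> c (\<I> \<otimes> d) \<odot> (Id V \<I> \<boxtimes> Id V c \<boxtimes> lui d)"
    by (simp add: interchange' lunit_nat')
  also have "\<dots> = (Id V c \<boxtimes> lunit V d) \<odot> ((Id V c \<boxtimes> lunit V (\<I> \<otimes> d)) \<odot> sw \<I> c (\<I> \<otimes> d)) \<odot> (Id V \<I> \<boxtimes> Id V c \<boxtimes> lui d)"
    by (simp add: interchange')
  also have "\<dots> = (Id V c \<boxtimes> lunit V d) \<odot> lunit V (c \<otimes> \<I> \<otimes> d) \<odot> (Id V \<I> \<boxtimes> Id V c \<boxtimes> lui d)"
    by (subst star) simp
  also have "\<dots> = lunit V (c \<otimes> d)"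
    by (simp add: lunit_nat' interchange')
  finally show ?thesis .
qed

end

section \<open>Uniqueness of canonical arrows\<close>

text \<open>The list of the variables of a term, from left to right.\<close>
primrec vl :: "'v tterm \<Rightarrow> 'v list" where
  "vl Unit = []"
| "vl (Var v) = [v]"
| "vl (Ten s t) = vl s @ vl t"

text \<open>An assignment of objects of \<open>V\<close> to variables.\<close>
locale object_family = symmetric_monoidal_category V
  for V :: "('o, 'a) sym_mon_cat" (structure) +
  fixes A :: "'v \<Rightarrow> 'o"
  assumes A_ob [simp]: "A v \<in> Ob V"
begin

lemma tval_ob [simp]: "tval V A t \<in> Ob V"
  by (induction t) simp_all

text \<open>The product \<open>A x\<^sub>1 \<otimes> (\<dots> \<otimes> (A x\<^sub>n \<otimes> c))\<close> for a list \<open>x\<^sub>1, \<dots>, x\<^sub>n\<close>, as a functor of \<open>c\<close>. The free last factor \<open>c\<close>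
  makes concatenation of lists into composition of functors.\<close>
primrec T :: "'v list \<Rightarrow> 'o \<Rightarrow> 'o" where
  "T [] c = c"
| "T (x # xs) c = A x \<otimes> T xs c"

primrec Tm :: "'v list \<Rightarrow> 'a \<Rightarrow> 'a" where
  "Tm [] k = k"
| "Tm (x # xs) k = Id V (A x) \<boxtimes> Tm xs k"

lemma T_ob [simp]: "c \<in> Ob V \<Longrightarrow> T xs c \<in> Ob V"
  by (induction xs) simp_all

lemma Tm_typ [simp]:
  assumes "k \<in> Ar V"
  shows "Tm xs k \<in> Ar V" "Dom V (Tm xs k) = T xs (Dom V k)" "Cod V (Tm xs k) = T xs (Cod V k)"
  using assms by (induction xs) simp_all

lemma T_append [simp]: "T (xs @ ys) c = T xs (T ys c)"
  by (induction xs) simp_all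

lemma Tm_append [simp]: "Tm (xs @ ys) k = Tm xs (Tm ys k)"
  by (induction xs) simp_all

lemma Tm_id [simp]: "c \<in> Ob V \<Longrightarrow> Tm xs (Id V c) = Id V (T xs c)"
  by (induction xs) simp_all

lemma Tm_comp: "\<lbrakk>f \<in> Ar V; g \<in> Ar V; Cod V f = Dom V g\<rbrakk> \<Longrightarrow> Tm xs g \<odot> Tm xs f = Tm xs (g \<odot> f)"
  by (induction xs) (simp_all add: interchange)

text \<open>The normalization of \<open>t \<otimes> c\<close>: brackets are moved to the right and units are removed.\<close>
primrec nf :: "'v tterm \<Rightarrow> 'o \<Rightarrow> 'a" where
  "nf Unit c = lunit V c"
| "nf (Var v) c = Id V (A v \<otimes> c)"
| "nf (Ten s t) c = nf s (T (vl t) c) \<odot> (Id V (tval V A s) \<boxtimes> nf t c) \<odot> assoc V (tval V A s) (tval V A t) c"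

lemma nf_typ [simp]:
  assumes "c \<in> Ob V"
  shows "nf t c \<in> Ar V \<and> Dom V (nf t c) = tval V A t \<otimes> c \<and> Cod V (nf t c) = T (vl t) c"
  using assms by (induction t arbitrary: c) simp_all

lemma nf_nat:
  assumes "k \<in> Ar V" "d' = Cod V k"
  shows "nf t d' \<odot> (Id V (tval V A t) \<boxtimes> k) = Tm (vl t) k \<odot> nf t (Dom V k)"
  using assms
proof (induction t arbitrary: k d')
  case (Ten s t)
  have "nf (Ten s t) d' \<odot> (Id V (tval V A (Ten s t)) \<boxtimes> k)
    = nf s (T (vl t) d') \<odot> (Id V (tval V A s) \<boxtimes> nf t d') \<odot> assoc V (tval V A s) (tval V A t) d'
       \<odot> ((Id V (tval V A s) \<boxtimes> Id V (tval V A t)) \<boxtimes> k)"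
    using Ten.prems by simp
  also have "\<dots> = nf s (T (vl t) d') \<odot> (Id V (tval V A s) \<boxtimes> (Tm (vl t) k \<odot> nf t (Dom V k)))
      \<odot> assoc V (tval V A s) (tval V A t) (Dom V k)"
    using Ten.prems by (simp add: assoc_nat' Ten.IH interchange' del: tar_id')
  also have "\<dots> = (nf s (T (vl t) d') \<odot> (Id V (tval V A s) \<boxtimes> Tm (vl t) k)) \<odot> (Id V (tval V A s) \<boxtimes> nf t (Dom V k))
      \<odot> assoc V (tval V A s) (tval V A t) (Dom V k)"
    using Ten.prems by (simp add: interchange')
  also have "\<dots> = Tm (vl (Ten s t)) k \<odot> nf (Ten s t) (Dom V k)"
    using Ten.prems by (subst Ten.IH(1)) simp_all
  finally show ?case .
qed (simp_all add: lunit_nat' interchange)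

text \<open>The move of the factor \<open>b\<close> to the front, past the factors indexed by a list.\<close>
primrec B :: "'v list \<Rightarrow> 'o \<Rightarrow> 'o \<Rightarrow> 'a" where
  "B [] b d = Id V (b \<otimes> d)"
| "B (x # xs) b d = sw (A x) b (T xs d) \<odot> (Id V (A x) \<boxtimes> B xs b d)"

lemma B_typ [simp]:
  assumes "b \<in> Ob V" "d \<in> Ob V"
  shows "B xs b d \<in> Ar V \<and> Dom V (B xs b d) = T xs (b \<otimes> d) \<and> Cod V (B xs b d) = b \<otimes> T xs d"
  using assms by (induction xs) simp_all

lemma B_nat:
  assumes "b \<in> Ob V" "k \<in> Ar V" "d' = Cod V k"
  shows "B xs b d' \<odot> Tm xs (Id V b \<boxtimes> k) = (Id V b \<boxtimes> Tm xs k) \<odot> B xs b (Dom V k)"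
proof (induction xs)
  case (Cons x xs)
  have "B (x # xs) b d' \<odot> Tm (x # xs) (Id V b \<boxtimes> k)
    = sw (A x) b (T xs d') \<odot> (Id V (A x) \<boxtimes> ((Id V b \<boxtimes> Tm xs k) \<odot> B xs b (Dom V k)))"
    using assms Cons.IH by (simp add: interchange)
  also have "\<dots> = (sw (A x) b (T xs d') \<odot> (Id V (A x) \<boxtimes> Id V b \<boxtimes> Tm xs k)) \<odot> (Id V (A x) \<boxtimes> B xs b (Dom V k))"
    using assms by (simp add: interchange)
  also have "\<dots> = (Id V b \<boxtimes> Tm (x # xs) k) \<odot> B (x # xs) b (Dom V k)"
    using assms by (subst sw_nat) simp_all
  finally show ?case .
qed (use assms in simp)

lemma B_append: "b \<in> Ob V \<Longrightarrow> d \<in> Ob V \<Longrightarrow> B (xs @ ys) b d = B xs b (T ys d) \<odot> Tm xs (B ys b d)"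
  by (induction xs) (simp_all add: interchange)

text \<open>To move a product is to move its factors in turn, and to move the unit is to remove it.\<close>
lemma B_tensor:
  assumes [simp]: "a \<in> Ob V" "b \<in> Ob V" "d \<in> Ob V"
  shows "assoc V a b (T xs d) \<odot> B xs (a \<otimes> b) d
    = (Id V a \<boxtimes> B xs b d) \<odot> B xs a (b \<otimes> d) \<odot> Tm xs (assoc V a b d)"
proof (induction xs)
  case (Cons x xs)
  have "assoc V a b (T (x # xs) d) \<odot> B (x # xs) (a \<otimes> b) d
    = (assoc V a b (A x \<otimes> T xs d) \<odot> sw (A x) (a \<otimes> b) (T xs d)) \<odot> (Id V (A x) \<boxtimes> B xs (a \<otimes> b) d)"
    by simp
  also have "\<dots> = (Id V a \<boxtimes> sw (A x) b (T xs d)) \<odot> sw (A x) a (b \<otimes> T xs d)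
      \<odot> (Id V (A x) \<boxtimes> (assoc V a b (T xs d) \<odot> B xs (a \<otimes> b) d))"
    by (subst sw_tensor_right) (simp_all add: interchange)
  also have "\<dots> = (Id V a \<boxtimes> sw (A x) b (T xs d)) \<odot> sw (A x) a (b \<otimes> T xs d)
      \<odot> (Id V (A x) \<boxtimes> ((Id V a \<boxtimes> B xs b d) \<odot> B xs a (b \<otimes> d) \<odot> Tm xs (assoc V a b d)))"
    by (simp only: Cons.IH)
  also have "\<dots> = (Id V a \<boxtimes> sw (A x) b (T xs d)) \<odot> (sw (A x) a (b \<otimes> T xs d)
      \<odot> (Id V (A x) \<boxtimes> Id V a \<boxtimes> B xs b d)) \<odot> (Id V (A x) \<boxtimes> (B xs a (b \<otimes> d) \<odot> Tm xs (assoc V a b d)))"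
    by (simp add: interchange)
  also have "\<dots> = (Id V a \<boxtimes> B (x # xs) b d) \<odot> B (x # xs) a (b \<otimes> d) \<odot> Tm (x # xs) (assoc V a b d)"
    by (subst sw_nat) (simp_all add: interchange interchange')
  finally show ?case .
qed simp

lemma B_unit: "d \<in> Ob V \<Longrightarrow> lunit V (T xs d) \<odot> B xs \<I> d = Tm xs (lunit V d)"
proof (induction xs)
  case (Cons x xs)
  have eq: "lunit V (A x \<otimes> T xs d) \<odot> sw (A x) \<I> (T xs d) = Id V (A x) \<boxtimes> lunit V (T xs d)"
    using lunit_sw[of "A x" "T xs d"] Cons.prems by (simp flip: lunit_sw)
  have "lunit V (T (x # xs) d) \<odot> B (x # xs) \<I> d
    = (lunit V (A x \<otimes> T xs d) \<odot> sw (A x) \<I> (T xs d)) \<odot> (Id V (A x) \<boxtimes> B xs \<I> d)"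
    using Cons.prems by simp
  also have "\<dots> = Tm (x # xs) (lunit V d)"
    using Cons.prems by (subst eq) (simp add: interchange Cons.IH)
  finally show ?case .
qed simp

text \<open>Compatibility of the move with normalization of the factor that it passes.\<close>
lemma nf_sw:
  assumes "b \<in> Ob V" "d \<in> Ob V"
  shows "(Id V b \<boxtimes> nf s d) \<odot> sw (tval V A s) b d = B (vl s) b d \<odot> nf s (b \<otimes> d)"
  using assms
proof (induction s arbitrary: d)
  case Unit
  thus ?case by (simp add: lunit_sw)
next
  case (Ten s t)
  note [simp] = Ten.prems
  let ?s = "tval V A s" and ?t = "tval V A t"
  have "(Id V b \<boxtimes> nf (Ten s t) d) \<odot> sw (tval V A (Ten s t)) b d
    = (Id V b \<boxtimes> nf s (T (vl t) d)) \<odot> (Id V b \<boxtimes> Id V ?s \<boxtimes> nf t d)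
        \<odot> ((Id V b \<boxtimes> assoc V ?s ?t d) \<odot> sw (?s \<otimes> ?t) b d)"
    by (simp add: interchange')
  also have "\<dots> = (Id V b \<boxtimes> nf s (T (vl t) d)) \<odot> ((Id V b \<boxtimes> Id V ?s \<boxtimes> nf t d)
        \<odot> sw ?s b (?t \<otimes> d)) \<odot> (Id V ?s \<boxtimes> sw ?t b d) \<odot> assoc V ?s ?t (b \<otimes> d)"
    by (subst sw_tensor_left) simp_all
  also have "\<dots> = (Id V b \<boxtimes> nf s (T (vl t) d)) \<odot> (sw ?s b (T (vl t) d) \<odot> (Id V ?s \<boxtimes> Id V b \<boxtimes> nf t d))
        \<odot> (Id V ?s \<boxtimes> sw ?t b d) \<odot> assoc V ?s ?t (b \<otimes> d)"
    by (simp add: sw_nat)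
  also have "\<dots> = ((Id V b \<boxtimes> nf s (T (vl t) d)) \<odot> sw ?s b (T (vl t) d))
        \<odot> (Id V ?s \<boxtimes> ((Id V b \<boxtimes> nf t d) \<odot> sw ?t b d)) \<odot> assoc V ?s ?t (b \<otimes> d)"
    by (simp add: interchange')
  also have "\<dots> = (B (vl s) b (T (vl t) d) \<odot> nf s (b \<otimes> T (vl t) d))
        \<odot> (Id V ?s \<boxtimes> (B (vl t) b d \<odot> nf t (b \<otimes> d))) \<odot> assoc V ?s ?t (b \<otimes> d)"
    by (subst Ten.IH, simp, simp, subst Ten.IH) simp_all
  also have "\<dots> = B (vl s) b (T (vl t) d) \<odot> (nf s (b \<otimes> T (vl t) d)
        \<odot> (Id V ?s \<boxtimes> B (vl t) b d)) \<odot> (Id V ?s \<boxtimes> nf t (b \<otimes> d)) \<odot> assoc V ?s ?t (b \<otimes> d)"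
    by (simp add: interchange')
  also have "\<dots> = B (vl (Ten s t)) b d \<odot> nf (Ten s t) (b \<otimes> d)"
    by (subst nf_nat) (simp_all add: B_append)
  finally show ?case .
qed simp

text \<open>The move of the factor \<open>x\<close> of a list to the front, and the permutation of factors from \<open>xs\<close>
  to \<open>ys\<close>, which for each element of \<open>ys\<close> in turn moves that factor to its place.\<close>
primrec E :: "'v \<Rightarrow> 'v list \<Rightarrow> 'o \<Rightarrow> 'a" where
  "E x [] c = Id V c"
| "E x (y # ys) c = (if x = y then Id V (A x \<otimes> T ys c)
    else sw (A y) (A x) (T (remove1 x ys) c) \<odot> (Id V (A y) \<boxtimes> E x ys c))"

primrec P :: "'v list \<Rightarrow> 'v list \<Rightarrow> 'o \<Rightarrow> 'a" where
  "P xs [] c = Id V c"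
| "P xs (y # ys) c = (Id V (A y) \<boxtimes> P (remove1 y xs) ys c) \<odot> E y xs c"

lemma E_typ [simp]:
  assumes "c \<in> Ob V" "x \<in> set ys"
  shows "E x ys c \<in> Ar V \<and> Dom V (E x ys c) = T ys c \<and> Cod V (E x ys c) = A x \<otimes> T (remove1 x ys) c"
  using assms by (induction ys) auto

lemma mset_Cons_D: "mset xs = mset (y # ys) \<Longrightarrow> y \<in> set xs \<and> mset (remove1 y xs) = mset ys"
  by (metis add_mset_remove_trivial list.set_intros(1) mset.simps(2) mset_remove1 mset_eq_setD)

lemma P_typ [simp]:
  assumes "c \<in> Ob V" "mset xs = mset ys"
  shows "P xs ys c \<in> Ar V \<and> Dom V (P xs ys c) = T xs c \<and> Cod V (P xs ys c) = T ys c"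
  using assms
proof (induction ys arbitrary: xs)
  case (Cons y ys)
  thus ?case using mset_Cons_D[OF Cons.prems(2)] by simp
qed simp

lemma P_refl [simp]: "c \<in> Ob V \<Longrightarrow> P xs xs c = Id V (T xs c)"
  by (induction xs) simp_all

text \<open>The order in which two factors are moved to the front does not matter, up to an exchange.\<close>
lemma E_exchange:
  assumes "c \<in> Ob V" "x \<in> set ys" "z \<in> set ys" "x \<noteq> z"
  shows "sw (A z) (A x) (T (remove1 x (remove1 z ys)) c) \<odot> (Id V (A z) \<boxtimes> E x (remove1 z ys) c) \<odot> E z ys c
    = (Id V (A x) \<boxtimes> E z (remove1 x ys) c) \<odot> E x ys c"
  using assms
proof (induction ys)
  case (Cons y ys)
  note [simp] = Cons.prems(1)
  consider (z) "y = z" | (x) "y = x" | (n) "y \<noteq> z" "y \<noteq> x" by blast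
  thus ?case
  proof cases
    case z
    thus ?thesis using Cons.prems by simp
  next
    case x
    thus ?thesis using Cons.prems by simp
  next
    case n
    hence [simp]: "x \<in> set ys" "z \<in> set ys" "y \<noteq> z" "y \<noteq> x" "z \<noteq> y" "x \<noteq> y" "x \<noteq> z" "z \<noteq> x"
      using Cons.prems by auto
    let ?t = "T (remove1 x (remove1 z ys)) c"
    have comm: "remove1 z (remove1 x ys) = remove1 x (remove1 z ys)"
      by (simp add: remove1_commute)
    have "sw (A z) (A x) (T (remove1 x (remove1 z (y # ys))) c) \<odot> (Id V (A z) \<boxtimes> E x (remove1 z (y # ys)) c) \<odot> E z (y # ys) c
      = sw (A z) (A x) (A y \<otimes> ?t) \<odot> (Id V (A z) \<boxtimes> sw (A y) (A x) ?t) \<odot>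
        (Id V (A z) \<boxtimes> Id V (A y) \<boxtimes> E x (remove1 z ys) c) \<odot> sw (A y) (A z) (T (remove1 z ys) c) \<odot> (Id V (A y) \<boxtimes> E z ys c)"
      by (simp add: interchange')
    also have "\<dots> = sw (A z) (A x) (A y \<otimes> ?t) \<odot> (Id V (A z) \<boxtimes> sw (A y) (A x) ?t) \<odot>
         (sw (A y) (A z) (A x \<otimes> ?t) \<odot> (Id V (A y) \<boxtimes> Id V (A z) \<boxtimes> E x (remove1 z ys) c)) \<odot> (Id V (A y) \<boxtimes> E z ys c)"
      by (subst sw_nat) simp_all
    also have "\<dots> = (sw (A z) (A x) (A y \<otimes> ?t) \<odot> (Id V (A z) \<boxtimes> sw (A y) (A x) ?t) \<odot>
         sw (A y) (A z) (A x \<otimes> ?t)) \<odot> (Id V (A y) \<boxtimes> ((Id V (A z) \<boxtimes> E x (remove1 z ys) c) \<odot> E z ys c))"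
      by (simp add: interchange)
    also have "\<dots> = ((Id V (A x) \<boxtimes> sw (A y) (A z) ?t) \<odot> sw (A y) (A x) (A z \<otimes> ?t) \<odot> (Id V (A y) \<boxtimes> sw (A z) (A x) ?t))
         \<odot> (Id V (A y) \<boxtimes> ((Id V (A z) \<boxtimes> E x (remove1 z ys) c) \<odot> E z ys c))"
      by (subst sw_braid) simp_all
    also have "\<dots> = (Id V (A x) \<boxtimes> sw (A y) (A z) ?t) \<odot> sw (A y) (A x) (A z \<otimes> ?t)
         \<odot> (Id V (A y) \<boxtimes> (sw (A z) (A x) ?t \<odot> (Id V (A z) \<boxtimes> E x (remove1 z ys) c) \<odot> E z ys c))"
      by (simp add: interchange)
    also have "\<dots> = (Id V (A x) \<boxtimes> sw (A y) (A z) ?t) \<odot> sw (A y) (A x) (A z \<otimes> ?t)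
         \<odot> (Id V (A y) \<boxtimes> ((Id V (A x) \<boxtimes> E z (remove1 x ys) c) \<odot> E x ys c))"
      by (subst Cons.IH) simp_all
    also have "\<dots> = (Id V (A x) \<boxtimes> sw (A y) (A z) ?t) \<odot> (sw (A y) (A x) (A z \<otimes> ?t)
         \<odot> (Id V (A y) \<boxtimes> Id V (A x) \<boxtimes> E z (remove1 x ys) c)) \<odot> (Id V (A y) \<boxtimes> E x ys c)"
      by (simp add: interchange comm)
    also have "\<dots> = (Id V (A x) \<boxtimes> E z (remove1 x (y # ys)) c) \<odot> E x (y # ys) c"
      by (subst sw_nat) (simp_all add: comm interchange')
    finally show ?thesis .
  qed
qed simp

text \<open>A permutation followed by a move to the front: the crucial step for functoriality of \<open>P\<close>.\<close>
lemma E_P: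
  assumes "c \<in> Ob V" "distinct ys" "mset ys = mset zs" "x \<in> set zs"
  shows "E x zs c \<odot> P ys zs c = (Id V (A x) \<boxtimes> P (remove1 x ys) (remove1 x zs) c) \<odot> E x ys c"
  using assms
proof (induction zs arbitrary: ys)
  case (Cons z zs)
  note [simp] = Cons.prems(1)
  have z: "z \<in> set ys" "mset (remove1 z ys) = mset zs"
    using mset_Cons_D[OF Cons.prems(3)] by simp_all
  have x: "x \<in> set ys" using Cons.prems by (metis mset_eq_setD)
  show ?case
  proof (cases "x = z")
    case True
    thus ?thesis using z by simp
  next
    case False
    hence xz: "x \<in> set zs" "x \<in> set (remove1 z ys)" "z \<in> set (remove1 x ys)" "z \<noteq> x"
      using Cons.prems(4) x z by auto
    have m: "mset (remove1 x (remove1 z ys)) = mset (remove1 x zs)"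
      using z by (metis mset_remove1)
    have comm: "remove1 z (remove1 x ys) = remove1 x (remove1 z ys)"
      by (simp add: remove1_commute)
    note [simp] = x z xz m False comm Cons.prems(3)
    have "E x (z # zs) c \<odot> P ys (z # zs) c
      = sw (A z) (A x) (T (remove1 x zs) c) \<odot> (Id V (A z) \<boxtimes> (E x zs c \<odot> P (remove1 z ys) zs c)) \<odot> E z ys c"
      by (simp add: interchange')
    also have "\<dots> = sw (A z) (A x) (T (remove1 x zs) c)
       \<odot> (Id V (A z) \<boxtimes> ((Id V (A x) \<boxtimes> P (remove1 x (remove1 z ys)) (remove1 x zs) c) \<odot> E x (remove1 z ys) c)) \<odot> E z ys c"
      using Cons.prems by (subst Cons.IH) simp_all
    also have "\<dots> = (sw (A z) (A x) (T (remove1 x zs) c)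
       \<odot> (Id V (A z) \<boxtimes> Id V (A x) \<boxtimes> P (remove1 x (remove1 z ys)) (remove1 x zs) c))
       \<odot> (Id V (A z) \<boxtimes> E x (remove1 z ys) c) \<odot> E z ys c"
      by (simp add: interchange')
    also have "\<dots> = (Id V (A x) \<boxtimes> Id V (A z) \<boxtimes> P (remove1 x (remove1 z ys)) (remove1 x zs) c)
       \<odot> (sw (A z) (A x) (T (remove1 x (remove1 z ys)) c) \<odot> (Id V (A z) \<boxtimes> E x (remove1 z ys) c) \<odot> E z ys c)"
      by (subst sw_nat) simp_all
    also have "\<dots> = (Id V (A x) \<boxtimes> P (remove1 x ys) (remove1 x (z # zs)) c) \<odot> E x ys c"
      by (subst E_exchange) (simp_all add: interchange')
    finally show ?thesis .
  qed
qed simp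

lemma P_comp:
  assumes "c \<in> Ob V" "distinct ys" "mset ys = mset zs" "mset zs = mset ws"
  shows "P zs ws c \<odot> P ys zs c = P ys ws c"
  using assms
proof (induction ws arbitrary: ys zs)
  case (Cons w ws)
  note [simp] = Cons.prems(1)
  have w: "w \<in> set zs" "mset (remove1 w zs) = mset ws"
    using mset_Cons_D[OF Cons.prems(4)] by simp_all
  have w': "w \<in> set ys" "mset (remove1 w ys) = mset ws" "mset (remove1 w ys) = mset (remove1 w zs)"
    using mset_Cons_D[of ys w ws] Cons.prems by auto
  note [simp] = w w'(1,2) Cons.prems(3,4)
  have "P zs (w # ws) c \<odot> P ys zs c = (Id V (A w) \<boxtimes> P (remove1 w zs) ws c) \<odot> (E w zs c \<odot> P ys zs c)"
    by simp
  also have "\<dots> = (Id V (A w) \<boxtimes> P (remove1 w zs) ws c) \<odot> (Id V (A w) \<boxtimes> P (remove1 w ys) (remove1 w zs) c) \<odot> E w ys c"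
    using Cons.prems by (subst E_P) simp_all
  also have "\<dots> = (Id V (A w) \<boxtimes> (P (remove1 w zs) ws c \<odot> P (remove1 w ys) (remove1 w zs) c)) \<odot> E w ys c"
    by (simp add: interchange')
  also have "\<dots> = P ys (w # ws) c"
    using Cons.prems by (subst Cons.IH) simp_all
  finally show ?case .
qed simp

lemma P_comp':
  assumes "c \<in> Ob V" "distinct ys" "mset ys = mset zs" "mset zs = mset ws" "k \<in> Ar V" "Cod V k = T ys c"
  shows "P zs ws c \<odot> P ys zs c \<odot> k = P ys ws c \<odot> k"
  using assms by (subst P_comp[where zs = zs, symmetric]) simp_all

lemma E_append: "x \<in> set xs \<Longrightarrow> E x (xs @ zs) c = E x xs (T zs c)"
  by (induction xs) (auto simp: remove1_append)

lemma P_append_right: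
  assumes "mset xs = mset ys" "c \<in> Ob V"
  shows "P (xs @ zs) (ys @ zs) c = P xs ys (T zs c)"
  using assms
proof (induction ys arbitrary: xs)
  case (Cons y ys)
  thus ?case using mset_Cons_D[OF Cons.prems(1)] by (simp add: E_append remove1_append)
qed simp

lemma P_append_left:
  assumes "mset xs = mset ys" "c \<in> Ob V"
  shows "P (zs @ xs) (zs @ ys) c = Tm zs (P xs ys c)"
  using assms by (induction zs) simp_all

lemma P_append:
  assumes "mset xs = mset ys" "mset zs = mset ws" "distinct (xs @ zs)" "c \<in> Ob V"
  shows "P xs ys (T ws c) \<odot> Tm xs (P zs ws c) = P (xs @ zs) (ys @ ws) c"
proof -
  have "P (xs @ ws) (ys @ ws) c \<odot> P (xs @ zs) (xs @ ws) c = P (xs @ zs) (ys @ ws) c"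
    using assms by (intro P_comp) simp_all
  thus ?thesis using assms by (simp add: P_append_left P_append_right)
qed

lemma B_eq_P: "v \<notin> set xs \<Longrightarrow> c \<in> Ob V \<Longrightarrow> B xs (A v) c = P (xs @ [v]) (v # xs) c"
proof -
  assume a: "v \<notin> set xs" "c \<in> Ob V"
  have "E v (xs @ [v]) c = B xs (A v) c"
    using a by (induction xs) (auto simp: remove1_append remove1_idem)
  thus ?thesis using a by (simp add: remove1_append remove1_idem)
qed

text \<open>Compatibility of the move with normalization of the factor that is moved.\<close>
lemma nf_B:
  assumes "d \<in> Ob V" "distinct (xs @ vl t)"
  shows "nf t (T xs d) \<odot> B xs (tval V A t) d = P (xs @ vl t) (vl t @ xs) d \<odot> Tm xs (nf t d)"
  using assms
proof (induction t arbitrary: xs d)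
  case Unit
  thus ?case by (simp add: B_unit)
next
  case (Var v)
  thus ?case by (simp add: B_eq_P)
next
  case (Ten t u)
  note [simp] = Ten.prems(1)
  let ?t = "tval V A t" and ?u = "tval V A u"
  have d: "distinct (xs @ vl t)" "distinct (xs @ vl u)" using Ten.prems by auto
  have "nf (Ten t u) (T xs d) \<odot> B xs (tval V A (Ten t u)) d
    = nf t (T (vl u) (T xs d)) \<odot> (Id V ?t \<boxtimes> nf u (T xs d)) \<odot> (assoc V ?t ?u (T xs d) \<odot> B xs (?t \<otimes> ?u) d)"
    by simp
  also have "\<dots> = nf t (T (vl u) (T xs d)) \<odot> (Id V ?t \<boxtimes> (nf u (T xs d) \<odot> B xs ?u d))
      \<odot> B xs ?t (?u \<otimes> d) \<odot> Tm xs (assoc V ?t ?u d)"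
    by (subst B_tensor) (simp_all add: interchange')
  also have "\<dots> = nf t (T (vl u) (T xs d)) \<odot> (Id V ?t \<boxtimes> (P (xs @ vl u) (vl u @ xs) d \<odot> Tm xs (nf u d)))
      \<odot> B xs ?t (?u \<otimes> d) \<odot> Tm xs (assoc V ?t ?u d)"
    using d by (subst Ten.IH) simp_all
  also have "\<dots> = (nf t (T (vl u) (T xs d)) \<odot> (Id V ?t \<boxtimes> P (xs @ vl u) (vl u @ xs) d)) \<odot> ((Id V ?t \<boxtimes> Tm xs (nf u d))
      \<odot> B xs ?t (?u \<otimes> d)) \<odot> Tm xs (assoc V ?t ?u d)"
    by (simp add: interchange')
  also have "\<dots> = (Tm (vl t) (P (xs @ vl u) (vl u @ xs) d) \<odot> nf t (T xs (T (vl u) d)))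
      \<odot> (B xs ?t (T (vl u) d) \<odot> Tm xs (Id V ?t \<boxtimes> nf u d)) \<odot> Tm xs (assoc V ?t ?u d)"
    by (subst nf_nat, simp, simp, subst B_nat) simp_all
  also have "\<dots> = Tm (vl t) (P (xs @ vl u) (vl u @ xs) d) \<odot> (nf t (T xs (T (vl u) d))
      \<odot> B xs ?t (T (vl u) d)) \<odot> Tm xs ((Id V ?t \<boxtimes> nf u d) \<odot> assoc V ?t ?u d)"
    by (simp add: Tm_comp)
  also have "\<dots> = Tm (vl t) (P (xs @ vl u) (vl u @ xs) d) \<odot> P (xs @ vl t) (vl t @ xs) (T (vl u) d)
      \<odot> Tm xs (nf (Ten t u) d)"
    using d by (subst Ten.IH) (simp_all add: Tm_comp)
  also have "\<dots> = P (vl t @ xs @ vl u) (vl t @ vl u @ xs) d \<odot> P ((xs @ vl t) @ vl u) ((vl t @ xs) @ vl u) d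
      \<odot> Tm xs (nf (Ten t u) d)"
    by (subst P_append_left, simp, simp, subst P_append_right) simp_all
  also have "\<dots> = P (xs @ vl (Ten t u)) (vl (Ten t u) @ xs) d \<odot> Tm xs (nf (Ten t u) d)"
    using Ten.prems by (simp add: P_comp')
  finally show ?case .
qed


lemma iso_arrow_typ: "iso_arrow V a b f \<Longrightarrow> f \<in> Ar V \<and> Dom V f = a \<and> Cod V f = b"
  by (auto simp: iso_arrow_def inverse_arrows_def hom_def)

lemma iso_arrow_Id: "a \<in> Ob V \<Longrightarrow> iso_arrow V a a (Id V a)"
  by (auto simp: iso_arrow_def inverse_arrows_def hom_def intro!: exI[of _ "Id V a"])

lemma iso_arrow_comp: 
  assumes "iso_arrow V a b f" "iso_arrow V b c g"
  shows "iso_arrow V a c (g \<odot> f)"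
proof -
  obtain f' g' where fg: "inverse_arrows V a b f f'" "inverse_arrows V b c g g'"
    using assms by (auto simp: iso_arrow_def)
  have l: "g' \<odot> g \<odot> k = k" if "k \<in> Ar V" "Cod V k = b" for k
    using fg that by (simp add: inverse_arrows_def hom_def flip: comp_assoc')
  have r: "f \<odot> f' \<odot> k = k" if "k \<in> Ar V" "Cod V k = b" for k
    using fg that by (simp add: inverse_arrows_def hom_def flip: comp_assoc')
  have "inverse_arrows V a c (g \<odot> f) (f' \<odot> g')"
    using fg l[of f] r[of g'] by (auto simp: inverse_arrows_def hom_def)
  thus ?thesis by (auto simp: iso_arrow_def)
qed

lemma iso_arrow_tar:
  assumes "iso_arrow V a b f" "iso_arrow V a' b' f'"
  shows "iso_arrow V (a \<otimes> a') (b \<otimes> b') (f \<boxtimes> f')"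
proof -
  obtain g g' where "inverse_arrows V a b f g" "inverse_arrows V a' b' f' g'"
    using assms by (auto simp: iso_arrow_def)
  hence "inverse_arrows V (a \<otimes> a') (b \<otimes> b') (f \<boxtimes> f') (g \<boxtimes> g')"
    by (auto simp: inverse_arrows_def hom_def interchange)
  thus ?thesis by (auto simp: iso_arrow_def)
qed

end

context object_family begin

lemma canonical_iso: "canonical V A s t f \<Longrightarrow> iso_arrow V (tval V A s) (tval V A t) f"
proof (induction rule: canonical.induct)
  case (c_inv s t f g)
  thus ?case by (auto simp: iso_arrow_def inverse_arrows_def)
next
  case (c_sym s t)
  show ?case
    by (auto simp: iso_arrow_def inverse_arrows_def hom_def intro!: exI[of _ "sigma V (tval V A t) (tval V A s)"])
qed (auto intro: iso_arrow_Id iso_arrow_comp iso_arrow_tar assoc_iso lunit_iso runit_iso)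

lemma canonical_typ: "canonical V A s t f \<Longrightarrow> f \<in> Ar V \<and> Dom V f = tval V A s \<and> Cod V f = tval V A t"
  using canonical_iso iso_arrow_typ by blast

lemma canonical_mset: "canonical V A s t f \<Longrightarrow> mset (vl s) = mset (vl t)"
  by (induction rule: canonical.induct) simp_all

lemma nf_inverse: "c \<in> Ob V \<Longrightarrow>
  \<exists>g. g \<in> Ar V \<and> Dom V g = T (vl t) c \<and> Cod V g = tval V A t \<otimes> c \<and> g \<odot> nf t c = Id V (tval V A t \<otimes> c)"
proof (induction t arbitrary: c)
  case Unit
  thus ?case by (auto intro!: exI[of _ "lui c"])
next
  case (Var v)
  thus ?case by (auto intro!: exI[of _ "Id V (A v \<otimes> c)"])
next
  case (Ten s t)
  obtain g where [simp]: "g \<in> Ar V" "Dom V g = T (vl t) c" "Cod V g = tval V A t \<otimes> c"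
      "g \<odot> nf t c = Id V (tval V A t \<otimes> c)"
    using Ten by blast
  have "T (vl t) c \<in> Ob V" using Ten.prems by simp
  then obtain h where [simp]: "h \<in> Ar V" "Dom V h = T (vl s) (T (vl t) c)" "Cod V h = tval V A s \<otimes> T (vl t) c"
      "h \<odot> nf s (T (vl t) c) = Id V (tval V A s \<otimes> T (vl t) c)"
    using Ten.IH(1) by blast
  have [simp]: "h \<odot> nf s (T (vl t) c) \<odot> k = k" if "k \<in> Ar V" "Cod V k = tval V A s \<otimes> T (vl t) c" for k
    using Ten.prems that by (simp flip: comp_assoc')
  show ?case
    using Ten.prems
    by (intro exI[of _ "asi (tval V A s) (tval V A t) c \<odot> (Id V (tval V A s) \<boxtimes> g) \<odot> h"])
      (simp add: interchange')
qed

text \<open>After normalization, a canonical arrow is the permutation determined by the variables.\<close>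
theorem nf_canonical:
  assumes "canonical V A s t f" "distinct (vl s)" "c \<in> Ob V"
  shows "nf t c \<odot> (f \<boxtimes> Id V c) = P (vl s) (vl t) c \<odot> nf s c"
  using assms
proof (induction arbitrary: c rule: canonical.induct)
  case (c_id t)
  thus ?case by simp
next
  case (c_assoc s t u)
  note [simp] = c_assoc(2)
  let ?s = "tval V A s" and ?t = "tval V A t" and ?u = "tval V A u"
  have "nf (Ten s (Ten t u)) c \<odot> (assoc V ?s ?t ?u \<boxtimes> Id V c)
    = nf s (T (vl t) (T (vl u) c)) \<odot> (Id V ?s \<boxtimes> (nf t (T (vl u) c) \<odot> (Id V ?t \<boxtimes> nf u c)))
      \<odot> ((Id V ?s \<boxtimes> assoc V ?t ?u c) \<odot> assoc V ?s (?t \<otimes> ?u) c \<odot> (assoc V ?s ?t ?u \<boxtimes> Id V c))"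
    by (simp add: interchange')
  also have "\<dots> = nf s (T (vl t) (T (vl u) c)) \<odot> (Id V ?s \<boxtimes> nf t (T (vl u) c))
      \<odot> ((Id V ?s \<boxtimes> Id V ?t \<boxtimes> nf u c) \<odot> assoc V ?s ?t (?u \<otimes> c)) \<odot> assoc V (?s \<otimes> ?t) ?u c"
    by (simp add: interchange' pentagon)
  also have "\<dots> = nf s (T (vl t) (T (vl u) c)) \<odot> (Id V ?s \<boxtimes> nf t (T (vl u) c))
      \<odot> (assoc V ?s ?t (T (vl u) c) \<odot> ((Id V ?s \<boxtimes> Id V ?t) \<boxtimes> nf u c)) \<odot> assoc V (?s \<otimes> ?t) ?u c"
    by (subst assoc_nat') simp_all
  also have "\<dots> = P (vl (Ten (Ten s t) u)) (vl (Ten s (Ten t u))) c \<odot> nf (Ten (Ten s t) u) c"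
    by simp
  finally show ?case .
next
  case (c_lunit t)
  note [simp] = c_lunit(2)
  have "nf t c \<odot> (lunit V (tval V A t) \<boxtimes> Id V c)
    = nf t c \<odot> (lunit V (tval V A t \<otimes> c) \<odot> assoc V \<I> (tval V A t) c)"
    by (subst lunit_tensor) simp_all
  also have "\<dots> = (lunit V (T (vl t) c) \<odot> (Id V \<I> \<boxtimes> nf t c)) \<odot> assoc V \<I> (tval V A t) c"
    by (simp add: lunit_nat')
  finally show ?case by simp
next
  case (c_runit t)
  thus ?case by (simp flip: triangle)
next
  case (c_sym s t)
  note [simp] = c_sym(2)
  have d: "distinct (vl s @ vl t)" using c_sym by simp
  let ?s = "tval V A s" and ?t = "tval V A t"
  have "nf (Ten t s) c \<odot> (sigma V ?s ?t \<boxtimes> Id V c)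
    = nf t (T (vl s) c) \<odot> ((Id V ?t \<boxtimes> nf s c) \<odot> sw ?s ?t c) \<odot> assoc V ?s ?t c"
    by (simp add: sw_def)
  also have "\<dots> = (nf t (T (vl s) c) \<odot> B (vl s) ?t c) \<odot> nf s (?t \<otimes> c) \<odot> assoc V ?s ?t c"
    by (subst nf_sw) simp_all
  also have "\<dots> = P (vl s @ vl t) (vl t @ vl s) c \<odot> (Tm (vl s) (nf t c) \<odot> nf s (?t \<otimes> c)) \<odot> assoc V ?s ?t c"
    using d by (subst nf_B) simp_all
  also have "\<dots> = P (vl s @ vl t) (vl t @ vl s) c \<odot> (nf s (T (vl t) c) \<odot> (Id V ?s \<boxtimes> nf t c)) \<odot> assoc V ?s ?t c"
    by (subst nf_nat) simp_all
  also have "\<dots> = P (vl (Ten s t)) (vl (Ten t s)) c \<odot> nf (Ten s t) c"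
    by simp
  finally show ?case .
next
  case (c_inv s t f g)
  note [simp] = c_inv.prems(2)
  have m: "mset (vl s) = mset (vl t)" using c_inv.hyps canonical_mset by blast
  have d: "distinct (vl s)" using c_inv.prems(1) m by (metis mset_eq_imp_distinct_iff)
  have [simp]: "f \<in> Ar V" "g \<in> Ar V" "Dom V f = tval V A s" "Cod V f = tval V A t"
      "Dom V g = tval V A t" "Cod V g = tval V A s" "f \<odot> g = Id V (tval V A t)"
    using c_inv.hyps by (auto simp: inverse_arrows_def hom_def)
  have "nf s c \<odot> (g \<boxtimes> Id V c) = P (vl t) (vl s) c \<odot> P (vl s) (vl t) c \<odot> nf s c \<odot> (g \<boxtimes> Id V c)"
    using m d by (simp add: P_comp')
  also have "\<dots> = P (vl t) (vl s) c \<odot> (P (vl s) (vl t) c \<odot> nf s c) \<odot> (g \<boxtimes> Id V c)"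
    using m by simp
  also have "\<dots> = P (vl t) (vl s) c \<odot> (nf t c \<odot> (f \<boxtimes> Id V c)) \<odot> (g \<boxtimes> Id V c)"
    using d by (simp only: c_inv.IH c_inv.prems(2))
  also have "\<dots> = P (vl t) (vl s) c \<odot> nf t c"
    using m by (simp add: interchange)
  finally show ?case .
next
  case (c_comp s t f u g)
  note [simp] = c_comp.prems(2)
  have m: "mset (vl s) = mset (vl t)" "mset (vl t) = mset (vl u)"
    using c_comp.hyps canonical_mset by blast+
  have d: "distinct (vl t)" using c_comp.prems(1) m(1) by (metis mset_eq_imp_distinct_iff)
  have [simp]: "f \<in> Ar V" "g \<in> Ar V" "Dom V f = tval V A s" "Cod V f = tval V A t"
      "Dom V g = tval V A t" "Cod V g = tval V A u"
    using c_comp.hyps canonical_typ by blast+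
  have "nf u c \<odot> ((g \<odot> f) \<boxtimes> Id V c) = (nf u c \<odot> (g \<boxtimes> Id V c)) \<odot> (f \<boxtimes> Id V c)"
    by (simp add: interchange)
  also have "\<dots> = P (vl t) (vl u) c \<odot> (nf t c \<odot> (f \<boxtimes> Id V c))"
    using d m by (subst c_comp.IH) simp_all
  also have "\<dots> = P (vl s) (vl u) c \<odot> nf s c"
    using c_comp.prems(1) m by (subst c_comp.IH) (simp_all add: P_comp')
  finally show ?case .
next
  case (c_tensor s t f s' t' f')
  note [simp] = c_tensor.prems(2)
  have m: "mset (vl s) = mset (vl t)" "mset (vl s') = mset (vl t')"
    using c_tensor.hyps canonical_mset by blast+
  have d: "distinct (vl s)" "distinct (vl s')" using c_tensor.prems(1) by auto
  have [simp]: "f \<in> Ar V" "f' \<in> Ar V" "Dom V f = tval V A s" "Cod V f = tval V A t"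
      "Dom V f' = tval V A s'" "Cod V f' = tval V A t'"
    using c_tensor.hyps canonical_typ by blast+
  let ?s = "tval V A s" and ?t = "tval V A t" and ?s' = "tval V A s'" and ?t' = "tval V A t'"
  have "nf (Ten t t') c \<odot> ((f \<boxtimes> f') \<boxtimes> Id V c)
    = nf t (T (vl t') c) \<odot> (f \<boxtimes> (nf t' c \<odot> (f' \<boxtimes> Id V c))) \<odot> assoc V ?s ?s' c"
    by (simp add: assoc_nat' interchange')
  also have "\<dots> = nf t (T (vl t') c) \<odot> (f \<boxtimes> (P (vl s') (vl t') c \<odot> nf s' c)) \<odot> assoc V ?s ?s' c"
    using d by (subst c_tensor.IH) simp_all
  also have "\<dots> = (nf t (T (vl t') c) \<odot> (f \<boxtimes> Id V (T (vl t') c))) \<odot> (Id V ?s \<boxtimes> P (vl s') (vl t') c)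
      \<odot> (Id V ?s \<boxtimes> nf s' c) \<odot> assoc V ?s ?s' c"
    using m by (simp add: interchange')
  also have "\<dots> = P (vl s) (vl t) (T (vl t') c) \<odot> (nf s (T (vl t') c) \<odot> (Id V ?s \<boxtimes> P (vl s') (vl t') c))
      \<odot> (Id V ?s \<boxtimes> nf s' c) \<odot> assoc V ?s ?s' c"
    using d m by (subst c_tensor.IH) simp_all
  also have "\<dots> = (P (vl s) (vl t) (T (vl t') c) \<odot> Tm (vl s) (P (vl s') (vl t') c)) \<odot> nf (Ten s s') c"
    using m by (subst nf_nat) simp_all
  also have "\<dots> = P (vl (Ten s s')) (vl (Ten t t')) c \<odot> nf (Ten s s') c"
    using m c_tensor.prems(1) by (subst P_append) simp_all
  finally show ?case .
qed

text \<open>Mac Lane's coherence theorem: uniqueness of canonical arrows.\<close>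
theorem canonical_unique:
  assumes "canonical V A s t f" "canonical V A s t g" "distinct (vl s)"
  shows "f = g"
proof -
  have [simp]: "f \<in> Ar V" "g \<in> Ar V" "Dom V f = tval V A s" "Cod V f = tval V A t"
      "Dom V g = tval V A s" "Cod V g = tval V A t"
    using assms canonical_typ by blast+
  obtain n where [simp]: "n \<in> Ar V" "Dom V n = T (vl t) \<I>" "Cod V n = tval V A t \<otimes> \<I>"
      "n \<odot> nf t \<I> = Id V (tval V A t \<otimes> \<I>)"
    using nf_inverse[of \<I> t] by auto
  \<comment> \<open>Normalization is split monic, and \<open>- \<otimes> \<I>\<close> is faithful.\<close>
  have "n \<odot> nf t \<I> \<odot> (f \<boxtimes> Id V \<I>) = n \<odot> nf t \<I> \<odot> (g \<boxtimes> Id V \<I>)"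
    using nf_canonical[OF assms(1,3)] nf_canonical[OF assms(2,3)] by simp
  hence "f \<boxtimes> Id V \<I> = g \<boxtimes> Id V \<I>"
    by (simp flip: comp_assoc')
  hence eq: "f \<odot> runit V (tval V A s) = g \<odot> runit V (tval V A s)"
    using runit_nat[of f "tval V A s" "tval V A t"] runit_nat[of g "tval V A s" "tval V A t"]
    by (simp add: hom_def)
  obtain r where "inverse_arrows V (tval V A s \<otimes> \<I>) (tval V A s) (runit V (tval V A s)) r"
    using runit_iso[of "tval V A s"] by (auto simp: iso_arrow_def)
  hence [simp]: "r \<in> Ar V" "Dom V r = tval V A s" "Cod V r = tval V A s \<otimes> \<I>"
      "runit V (tval V A s) \<odot> r = Id V (tval V A s)"
    by (auto simp: inverse_arrows_def hom_def)
  show ?thesis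
    by (rule iso_cancel[OF _ _ _ _ _ _ _ _ _ eq, of r]) simp_all
qed

section \<open>Existence of canonical arrows\<close>

text \<open>There is a canonical arrow between the terms.\<close>
definition linked :: "'v tterm \<Rightarrow> 'v tterm \<Rightarrow> bool" where
  "linked s t \<longleftrightarrow> (\<exists>f. canonical V A s t f)"

lemma linked_intros:
  shows "linked t t" "linked (Ten (Ten s t) u) (Ten s (Ten t u))" "linked (Ten Unit t) t"
    "linked (Ten t Unit) t" "linked (Ten s t) (Ten t s)"
  unfolding linked_def
  by (rule exI, rule canonical.c_id canonical.c_assoc canonical.c_lunit canonical.c_runit canonical.c_sym)+

lemma linked_sym:
  assumes "linked s t"
  shows "linked t s"
proof -
  obtain f where f: "canonical V A s t f" using assms by (auto simp: linked_def)
  then obtain g where "inverse_arrows V (tval V A s) (tval V A t) f g"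
    using canonical_iso[OF f] unfolding iso_arrow_def by blast
  from canonical.c_inv[OF f this] show ?thesis by (auto simp: linked_def)
qed

lemma linked_trans [trans]: "linked s t \<Longrightarrow> linked t u \<Longrightarrow> linked s u"
  unfolding linked_def by (elim exE) (rule exI, erule (1) canonical.c_comp)

lemma linked_Ten: "linked s t \<Longrightarrow> linked s' t' \<Longrightarrow> linked (Ten s s') (Ten t t')"
  unfolding linked_def by (elim exE) (rule exI, erule (1) canonical.c_tensor)

text \<open>The right-bracketed product of variables.\<close>
abbreviation rt :: "'v list \<Rightarrow> 'v tterm" where
  "rt xs \<equiv> foldr (\<lambda>v. Ten (Var v)) xs Unit"

lemma linked_rt: "linked (Ten t (rt xs)) (rt (vl t @ xs))"
proof (induction t arbitrary: xs)
  case (Ten s t)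
  have "linked (Ten (Ten s t) (rt xs)) (Ten s (Ten t (rt xs)))"
    by (rule linked_intros)
  also have "linked \<dots> (Ten s (rt (vl t @ xs)))"
    by (intro linked_Ten linked_intros Ten.IH)
  also have "linked \<dots> (rt (vl s @ vl t @ xs))"
    by (rule Ten.IH)
  finally show ?case by simp
qed (simp_all add: linked_intros)

lemma linked_rt_move: "linked (Ten (Var x) (rt (xs @ ys))) (rt (xs @ x # ys))"
proof (induction xs)
  case (Cons a xs)
  have "linked (Ten (Var x) (Ten (Var a) (rt (xs @ ys)))) (Ten (Ten (Var x) (Var a)) (rt (xs @ ys)))"
    by (intro linked_sym[OF linked_intros(2)])
  also have "linked \<dots> (Ten (Ten (Var a) (Var x)) (rt (xs @ ys)))"
    by (intro linked_Ten linked_intros)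
  also have "linked \<dots> (Ten (Var a) (Ten (Var x) (rt (xs @ ys))))"
    by (intro linked_intros)
  also have "linked \<dots> (Ten (Var a) (rt (xs @ x # ys)))"
    by (intro linked_Ten linked_intros Cons.IH)
  finally show ?case by simp
qed (simp add: linked_intros)

lemma linked_rt_perm: "mset xs = mset ys \<Longrightarrow> linked (rt xs) (rt ys)"
proof (induction xs arbitrary: ys)
  case (Cons x xs)
  have "x \<in> set ys" using Cons.prems by (metis list.set_intros(1) mset_eq_setD)
  then obtain ys1 ys2 where ys: "ys = ys1 @ x # ys2" by (meson split_list)
  have "linked (rt (x # xs)) (Ten (Var x) (rt (ys1 @ ys2)))"
    using linked_Ten[OF linked_intros(1)[of "Var x"] Cons.IH[of "ys1 @ ys2"]] Cons.prems ys by simp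
  also have "linked \<dots> (rt ys)"
    unfolding ys by (rule linked_rt_move)
  finally show ?case .
qed (simp add: linked_intros)

lemma canonical_exists:
  assumes "mset (vl s) = mset (vl t)"
  shows "\<exists>f. canonical V A s t f"
proof -
  have *: "linked u (rt (vl u))" for u
    using linked_trans[OF linked_sym[OF linked_intros(4)] linked_rt[of u "[]", simplified]] by simp
  show ?thesis
    using linked_trans[OF linked_trans[OF *[of s] linked_rt_perm[OF assms]] linked_sym[OF *[of t]]]
    by (simp add: linked_def)
qed

end

section \<open>Substitution and naturality for canonical arrows\<close>

lemma canonical_vars: "canonical V A s t f \<Longrightarrow> mset (vl s) = mset (vl t)"
  by (induction rule: canonical.induct) simp_all

lemma tval_cong: "(\<And>v. v \<in> set (vl t) \<Longrightarrow> A v = A' v) \<Longrightarrow> tval V A t = tval V A' t"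
  by (induction t) simp_all

text \<open>Only the objects assigned to the variables that occur matter.\<close>
lemma canonical_cong:
  assumes "canonical V A s t f" "\<And>v. v \<in> set (vl s) \<Longrightarrow> A v = A' v"
  shows "canonical V A' s t f"
  using assms
proof (induction rule: canonical.induct)
  case (c_id t)
  thus ?case using canonical.c_id tval_cong by metis
next
  case (c_assoc s t u)
  thus ?case using canonical.c_assoc[of V A' s t u] tval_cong[of _ A A' V] by simp
next
  case (c_lunit t)
  thus ?case using canonical.c_lunit[of V A' t] tval_cong[of _ A A' V] by simp
next
  case (c_runit t)
  thus ?case using canonical.c_runit[of V A' t] tval_cong[of _ A A' V] by simp
next
  case (c_sym s t)
  thus ?case using canonical.c_sym[of V A' s t] tval_cong[of _ A A' V] by simp
next
  case (c_inv s t f g)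
  have *: "set (vl s) = set (vl t)"
    using mset_eq_setD[OF canonical_vars[OF c_inv.hyps(1)]] by simp
  have "tval V A s = tval V A' s" "tval V A t = tval V A' t"
    by (rule tval_cong, use c_inv.prems * in simp)+
  hence "inverse_arrows V (tval V A' s) (tval V A' t) f g" using c_inv.hyps(2) by simp
  moreover have "canonical V A' s t f" by (rule c_inv.IH) (use c_inv.prems * in simp)
  ultimately show ?case by (rule canonical.c_inv[rotated])
next
  case (c_comp s t f u g)
  have *: "set (vl s) = set (vl t)"
    using mset_eq_setD[OF canonical_vars[OF c_comp.hyps(1)]] by simp
  have "canonical V A' s t f" "canonical V A' t u g"
    by (rule c_comp.IH, use c_comp.prems * in simp)+
  thus ?case by (rule canonical.c_comp)
next
  case (c_tensor s t f s' t' f')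
  have "canonical V A' s t f" "canonical V A' s' t' f'"
    by (rule c_tensor.IH, use c_tensor.prems in simp)+
  thus ?case by (rule canonical.c_tensor)
qed

text \<open>Substitution of terms for variables.\<close>
primrec tsub :: "('v \<Rightarrow> 'w tterm) \<Rightarrow> 'v tterm \<Rightarrow> 'w tterm" where
  "tsub \<theta> Unit = Unit"
| "tsub \<theta> (Var v) = \<theta> v"
| "tsub \<theta> (Ten s t) = Ten (tsub \<theta> s) (tsub \<theta> t)"

lemma tval_tsub: "tval V A (tsub \<theta> t) = tval V (\<lambda>v. tval V A (\<theta> v)) t"
  by (induction t) simp_all

lemma canonical_tsub:
  assumes "canonical V (\<lambda>v. tval V A (\<theta> v)) s t f"
  shows "canonical V A (tsub \<theta> s) (tsub \<theta> t) f"
  using assms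
proof (induction rule: canonical.induct)
  case (c_inv s t f g)
  from canonical.c_inv[OF c_inv.IH] c_inv.hyps(2) show ?case by (simp add: tval_tsub)
next
  case (c_comp s t f u g)
  from canonical.c_comp[OF c_comp.IH] show ?case .
qed (use canonical.intros[of V A] in \<open>simp_all flip: tval_tsub\<close>)

lemma tsub_Tens: "tsub \<theta> (Tens ts) = Tens (map (tsub \<theta>) ts)"
  by (induction ts rule: induct_list012) simp_all

lemma vl_Tens: "vl (Tens ts) = concat (map vl ts)"
  by (induction ts rule: induct_list012) simp_all

text \<open>The arrow obtained from a term by replacing each variable by an arrow.\<close>
primrec tmap :: "('o, 'a) sym_mon_cat \<Rightarrow> ('v \<Rightarrow> 'a) \<Rightarrow> 'v tterm \<Rightarrow> 'a" where
  "tmap V h Unit = Id V (unit V)"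
| "tmap V h (Var v) = h v"
| "tmap V h (Ten s t) = tar V (tmap V h s) (tmap V h t)"

lemma tmap_cong: "(\<And>v. v \<in> set (vl t) \<Longrightarrow> h v = h' v) \<Longrightarrow> tmap V h t = tmap V h' t"
  by (induction t) simp_all

lemma tval_Tens: "tval V A (Tens ts) = tobs V (map (tval V A) ts)"
  by (induction ts rule: induct_list012) (simp_all add: tobs_def)

lemma tmap_Tens: "tmap V h (Tens ts) = tars V (map (tmap V h) ts)"
  by (induction ts rule: induct_list012) (simp_all add: tars_def)

context symmetric_monoidal_category begin

text \<open>By existence and uniqueness, the definite description in \<open>coherence\<close> denotes a canonical arrow. The objects
  assigned to other variables are irrelevant, and are replaced by the unit for the proof.\<close>
lemma coherence_canonical:
  assumes "\<And>v. v \<in> set (vl s) \<Longrightarrow> A v \<in> Ob V" "mset (vl s) = mset (vl t)" "distinct (vl s)"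
  shows "canonical V A s t (coherence V A s t)"
proof -
  define A' where "A' v = (if v \<in> set (vl s) then A v else \<I>)" for v
  interpret object_family V A'
    by unfold_locales (use assms in \<open>auto simp: A'_def\<close>)
  obtain f where f: "canonical V A' s t f"
    using canonical_exists assms by blast
  have "canonical V A s t f"
    by (rule canonical_cong[OF f]) (simp add: A'_def)
  moreover have "g = f" if "canonical V A s t g" for g
    by (rule canonical_unique[OF canonical_cong[OF that] f assms(3)]) (simp add: A'_def)
  ultimately show ?thesis
    unfolding coherence_def by (rule theI)
qed

lemma hom_ob: "f \<in> hom V a b \<Longrightarrow> a \<in> Ob V \<and> b \<in> Ob V"
  by (auto simp: hom_def)

lemma tmap_typ:
  assumes "\<And>v. h v \<in> hom V (A v) (B v)"
  shows "tmap V h t \<in> Ar V \<and> Dom V (tmap V h t) = tval V A t \<and> Cod V (tmap V h t) = tval V B t"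
proof (induction t)
  case (Var v)
  thus ?case using assms[of v] by (simp add: hom_def)
qed simp_all

lemma tmap_comp:
  assumes "\<And>v. h v \<in> hom V (A v) (B v)" "\<And>v. k v \<in> hom V (B v) (C v)"
  shows "tmap V (\<lambda>v. k v \<odot> h v) t = tmap V k t \<odot> tmap V h t"
proof (induction t)
  case (Ten s t)
  show ?case
    using Ten tmap_typ[where h = h and A = A and B = B, OF assms(1)] tmap_typ[where h = k and A = B and B = C, OF assms(2)]
    by (simp add: interchange)
qed simp_all

text \<open>Canonical arrows are natural. Since the variables of \<open>s\<close> need not be distinct, \<open>f'\<close> is not determined by
  \<open>f\<close>; the last conjunct says that \<open>f\<close> itself can be taken if \<open>A = B\<close>.\<close>
lemma canonical_natural:
  assumes "canonical V A s t f" "\<And>v. h v \<in> hom V (A v) (B v)"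
  shows "\<exists>f'. canonical V B s t f' \<and> f' \<odot> tmap V h s = tmap V h t \<odot> f \<and> (A = B \<longrightarrow> f' = f)"
proof -
  interpret A: object_family V A
    by unfold_locales (use hom_ob[OF assms(2)] in simp)
  interpret B: object_family V B
    by unfold_locales (use hom_ob[OF assms(2)] in simp)
  have [simp]: "tmap V h u \<in> Ar V" "Dom V (tmap V h u) = tval V A u" "Cod V (tmap V h u) = tval V B u" for u
    using tmap_typ[where h = h and A = A and B = B, OF assms(2)] by auto
  show ?thesis
    using assms(1)
  proof (induction rule: canonical.induct)
    case (c_id t)
    show ?case by (rule exI, rule conjI[OF canonical.c_id]) simp
  next
    case (c_assoc s t u)
    show ?case by (rule exI, rule conjI[OF canonical.c_assoc]) (simp add: assoc_nat')
  next
    case (c_lunit t)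
    show ?case by (rule exI, rule conjI[OF canonical.c_lunit]) (simp add: lunit_nat')
  next
    case (c_runit t)
    have "runit V (tval V B t) \<odot> (tmap V h t \<boxtimes> Id V \<I>) = tmap V h t \<odot> runit V (tval V A t)"
      by (rule runit_nat) (simp add: hom_def)
    thus ?case by - (rule exI, rule conjI[OF canonical.c_runit], simp)
  next
    case (c_sym s t)
    show ?case by (rule exI, rule conjI[OF canonical.c_sym]) (simp add: sym_nat')
  next
    case (c_inv s t f g)
    then obtain f' where f': "canonical V B s t f'" "f' \<odot> tmap V h s = tmap V h t \<odot> f" "A = B \<longrightarrow> f' = f"
      by blast
    then obtain g' where g': "inverse_arrows V (tval V B s) (tval V B t) f' g'"
      using B.canonical_iso[OF f'(1)] unfolding iso_arrow_def by blast
    have [simp]: "f \<in> Ar V" "g \<in> Ar V" "Dom V f = tval V A s" "Cod V f = tval V A t"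
      "Dom V g = tval V A t" "Cod V g = tval V A s" "f \<odot> g = Id V (tval V A t)"
      using c_inv.hyps by (auto simp: inverse_arrows_def hom_def)
    have [simp]: "f' \<in> Ar V" "g' \<in> Ar V" "Dom V f' = tval V B s" "Cod V f' = tval V B t"
      "Dom V g' = tval V B t" "Cod V g' = tval V B s" "g' \<odot> f' = Id V (tval V B s)"
      using g' by (auto simp: inverse_arrows_def hom_def)
    have "g' \<odot> tmap V h t = g' \<odot> (tmap V h t \<odot> f) \<odot> g"
      by simp
    also have "\<dots> = g' \<odot> (f' \<odot> tmap V h s) \<odot> g"
      by (simp only: f')
    also have "\<dots> = (g' \<odot> f') \<odot> tmap V h s \<odot> g"
      by (simp del: \<open>g' \<odot> f' = Id V (tval V B s)\<close>)
    also have "\<dots> = tmap V h s \<odot> g" by simp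
    finally have "g' \<odot> tmap V h t = tmap V h s \<odot> g" .
    moreover have "A = B \<longrightarrow> g' = g" using c_inv.hyps f' g' inverse_unique by blast
    ultimately show ?case using canonical.c_inv[OF f'(1) g'] by blast
  next
    case (c_comp s t f u g)
    then obtain f' g' where f': "canonical V B s t f'" "f' \<odot> tmap V h s = tmap V h t \<odot> f" "A = B \<longrightarrow> f' = f"
      and g': "canonical V B t u g'" "g' \<odot> tmap V h t = tmap V h u \<odot> g" "A = B \<longrightarrow> g' = g"
      by blast
    note [simp] = A.canonical_typ[OF c_comp.hyps(1)] A.canonical_typ[OF c_comp.hyps(2)]
      B.canonical_typ[OF f'(1)] B.canonical_typ[OF g'(1)]
    have "(g' \<odot> f') \<odot> tmap V h s = g' \<odot> (f' \<odot> tmap V h s)" by simp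
    also have "\<dots> = (g' \<odot> tmap V h t) \<odot> f" by (simp add: f')
    also have "\<dots> = tmap V h u \<odot> (g \<odot> f)" by (simp add: g')
    finally show ?case using canonical.c_comp[OF f'(1) g'(1)] f'(3) g'(3) by blast
  next
    case (c_tensor s t f s' t' f')
    then obtain g g' where g: "canonical V B s t g" "g \<odot> tmap V h s = tmap V h t \<odot> f" "A = B \<longrightarrow> g = f"
      and g': "canonical V B s' t' g'" "g' \<odot> tmap V h s' = tmap V h t' \<odot> f'" "A = B \<longrightarrow> g' = f'"
      by blast
    note [simp] = A.canonical_typ[OF c_tensor.hyps(1)] A.canonical_typ[OF c_tensor.hyps(2)]
      B.canonical_typ[OF g(1)] B.canonical_typ[OF g'(1)]
    show ?case
      using canonical.c_tensor[OF g(1) g'(1)] g g' by (intro exI[of _ "g \<boxtimes> g'"]) (simp add: interchange)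
  qed
qed

end

section \<open>The category of objects with four commuting endomorphisms\<close>

text \<open>The selectors of the four endomorphisms.\<close>
definition sels :: "(('o, 'a) dobj \<Rightarrow> 'a) set" where
  "sels = {al, be, ka, nu}"

context symmetric_monoidal_category begin

abbreviation D :: "(('o, 'a) dobj, ('o, 'a) darr) category" where
  "D \<equiv> D_cat V"

lemma D_ob: "x \<in> Ob D \<longleftrightarrow> car x \<in> Ob V \<and> (\<forall>\<epsilon>\<in>sels. \<epsilon> x \<in> hom V (car x) (car x))
    \<and> (\<forall>\<epsilon>\<in>sels. \<forall>\<eta>\<in>sels. \<epsilon> x \<odot> \<eta> x = \<eta> x \<odot> \<epsilon> x)"
  by (simp add: D_cat_def Let_def sels_def)

lemma D_ar: "f \<in> Ar D \<longleftrightarrow> src f \<in> Ob D \<and> tgt f \<in> Ob D \<and> mor f \<in> hom V (car (src f)) (car (tgt f))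
    \<and> (\<forall>\<epsilon>\<in>sels. mor f \<odot> \<epsilon> (src f) = \<epsilon> (tgt f) \<odot> mor f)"
  by (simp add: D_cat_def Let_def sels_def)

lemma D_simps [simp]: "Dom D = src" "Cod D = tgt" "Id D x = DArr x (Id V (car x)) x"
    "g \<odot>\<^bsub>D\<^esub> f = DArr (src f) (mor g \<odot> mor f) (tgt g)"
  by (simp_all add: D_cat_def Let_def)

lemma D_obD:
  assumes "x \<in> Ob D"
  shows "car x \<in> Ob V" "\<epsilon> \<in> sels \<Longrightarrow> \<epsilon> x \<in> Ar V" "\<epsilon> \<in> sels \<Longrightarrow> Dom V (\<epsilon> x) = car x"
    "\<epsilon> \<in> sels \<Longrightarrow> Cod V (\<epsilon> x) = car x" "\<epsilon> \<in> sels \<Longrightarrow> \<eta> \<in> sels \<Longrightarrow> \<epsilon> x \<odot> \<eta> x = \<eta> x \<odot> \<epsilon> x"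
  using assms by (auto simp: D_ob hom_def)

lemma D_arD:
  assumes "f \<in> Ar D"
  shows "src f \<in> Ob D" "tgt f \<in> Ob D" "mor f \<in> Ar V" "Dom V (mor f) = car (src f)"
    "Cod V (mor f) = car (tgt f)" "\<epsilon> \<in> sels \<Longrightarrow> mor f \<odot> \<epsilon> (src f) = \<epsilon> (tgt f) \<odot> mor f"
  using assms by (auto simp: D_ar hom_def)

lemma D_comp_ar:
  assumes "f \<in> Ar D" "g \<in> Ar D" "tgt f = src g"
  shows "g \<odot>\<^bsub>D\<^esub> f \<in> Ar D"
proof -
  note [simp] = D_arD(1-5)[OF assms(1)] D_arD(1-5)[OF assms(2)] D_obD(1-4)[OF D_arD(1)[OF assms(1)]]
    D_obD(1-4)[OF D_arD(2)[OF assms(2)]] D_obD(1-4)[OF D_arD(1)[OF assms(2)]] assms(3)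
  have "(mor g \<odot> mor f) \<odot> \<epsilon> (src f) = \<epsilon> (tgt g) \<odot> mor g \<odot> mor f" if [simp]: "\<epsilon> \<in> sels" for \<epsilon>
  proof -
    have f: "mor f \<odot> \<epsilon> (src f) = \<epsilon> (src g) \<odot> mor f" and g: "mor g \<odot> \<epsilon> (src g) = \<epsilon> (tgt g) \<odot> mor g"
      using D_arD(6)[OF assms(1) that] D_arD(6)[OF assms(2) that] by simp_all
    have "(mor g \<odot> mor f) \<odot> \<epsilon> (src f) = mor g \<odot> (\<epsilon> (src g) \<odot> mor f)" by (simp add: f)
    also have "\<dots> = (mor g \<odot> \<epsilon> (src g)) \<odot> mor f" by simp
    also have "\<dots> = \<epsilon> (tgt g) \<odot> mor g \<odot> mor f" unfolding g by simp
    finally show ?thesis .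
  qed
  thus ?thesis by (auto simp: D_ar[of "DArr _ _ _"] hom_def)
qed

lemma D_category: "category D"
proof
  fix f g h a b c d
  show "f \<in> Ar D \<Longrightarrow> Dom D f \<in> Ob D" "f \<in> Ar D \<Longrightarrow> Cod D f \<in> Ob D"
    by (simp_all add: D_arD)
  show "a \<in> Ob D \<Longrightarrow> Id D a \<in> hom D a a"
    by (auto simp: hom_def D_ar D_obD)
  show "\<lbrakk>f \<in> hom D a b; g \<in> hom D b c\<rbrakk> \<Longrightarrow> g \<odot>\<^bsub>D\<^esub> f \<in> hom D a c"
    using D_comp_ar[of f g] by (auto simp: hom_def)
  show "f \<in> hom D a b \<Longrightarrow> f \<odot>\<^bsub>D\<^esub> Id D a = f" "f \<in> hom D a b \<Longrightarrow> Id D b \<odot>\<^bsub>D\<^esub> f = f"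
    by (auto simp: hom_def D_arD intro: darr.expand)
  show "\<lbrakk>f \<in> hom D a b; g \<in> hom D b c; h \<in> hom D c d\<rbrakk> \<Longrightarrow> (h \<odot>\<^bsub>D\<^esub> g) \<odot>\<^bsub>D\<^esub> f = h \<odot>\<^bsub>D\<^esub> g \<odot>\<^bsub>D\<^esub> f"
    by (auto simp: hom_def D_arD)
qed

lemma apow_typ:
  assumes "f \<in> hom V a a"
  shows "apow V f n \<in> hom V a a"
  using assms by (induction n) (auto simp: apow_def hom_def)

lemma apow_0 [simp]: "apow V f 0 = Id V (Dom V f)"
  by (simp add: apow_def)

lemma apow_Suc [simp]: "apow V f (Suc n) = f \<odot> apow V f n"
  by (simp add: apow_def)

lemma apow_commute:
  assumes "f \<in> hom V a a" "g \<in> hom V a a" "f \<odot> g = g \<odot> f"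
  shows "apow V f n \<odot> g = g \<odot> apow V f n"
proof (induction n)
  case (Suc n)
  note [simp] = homD[OF assms(1)] homD[OF assms(2)] homD[OF apow_typ[OF assms(1)]]
  have "apow V f (Suc n) \<odot> g = f \<odot> (apow V f n \<odot> g)" by simp
  also have "\<dots> = (f \<odot> g) \<odot> apow V f n" by (simp add: Suc)
  also have "\<dots> = g \<odot> apow V f (Suc n)" unfolding assms(3) by simp
  finally show ?case .
qed (use assms in \<open>auto simp: hom_def\<close>)

lemma apow_add:
  assumes "f \<in> hom V a a"
  shows "apow V f (m + n) = apow V f m \<odot> apow V f n"
proof -
  note [simp] = homD[OF assms] homD[OF apow_typ[OF assms]]
  show ?thesis by (induction m) simp_all
qed

lemma apow_tmap:
  assumes "\<And>v. e v \<in> hom V (A v) (A v)"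
  shows "tmap V (\<lambda>v. apow V (e v) n) t = apow V (tmap V e t) n"
proof (induction n)
  case 0
  note [simp] = tmap_typ[OF assms]
  interpret object_family V A
    by unfold_locales (use hom_ob[OF assms] in simp)
  show ?case by (induction t) (use homD[OF assms] in simp_all)
next
  case (Suc n)
  have "tmap V (\<lambda>v. e v \<odot> apow V (e v) n) t = tmap V e t \<odot> tmap V (\<lambda>v. apow V (e v) n) t"
    using assms by (intro tmap_comp[where A = A and B = A and C = A] apow_typ)
  thus ?case using Suc by simp
qed


section \<open>Arrows given by terms\<close>

text \<open>The object of \<open>D\<close> that a term denotes if the object \<open>X v\<close> is assigned to the variable \<open>v\<close>.\<close>
definition Dval :: "('v \<Rightarrow> ('o, 'a) dobj) \<Rightarrow> 'v tterm \<Rightarrow> ('o, 'a) dobj" where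
  "Dval X t = DObj (tval V (\<lambda>v. car (X v)) t) (tmap V (\<lambda>v. al (X v)) t) (tmap V (\<lambda>v. be (X v)) t)
     (tmap V (\<lambda>v. ka (X v)) t) (tmap V (\<lambda>v. nu (X v)) t)"

lemma car_Dval [simp]: "car (Dval X t) = tval V (\<lambda>v. car (X v)) t"
  by (simp add: Dval_def)

lemma sel_Dval: "\<epsilon> \<in> sels \<Longrightarrow> \<epsilon> (Dval X t) = tmap V (\<lambda>v. \<epsilon> (X v)) t"
  by (auto simp: Dval_def sels_def)

lemma Dval_Var [simp]: "Dval X (Var v) = X v"
  by (simp add: Dval_def)

lemma Dval_Tens: "Dval X (Tens ts) = D_tobs V (map (Dval X) ts)"
  by (simp add: Dval_def D_tobs_def tval_Tens tmap_Tens o_def)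

lemma Dval_cong: "(\<And>v. v \<in> set (vl t) \<Longrightarrow> X v = Y v) \<Longrightarrow> Dval X t = Dval Y t"
  by (simp add: Dval_def cong: tval_cong tmap_cong)

lemma Dval_ob:
  assumes "\<And>v. X v \<in> Ob D"
  shows "Dval X t \<in> Ob D"
proof -
  interpret object_family V "\<lambda>v. car (X v)"
    by unfold_locales (use D_obD[OF assms] in simp)
  have h: "\<epsilon> (X v) \<in> hom V (car (X v)) (car (X v))" if "\<epsilon> \<in> sels" for \<epsilon> v
    using D_obD[OF assms] that by (simp add: hom_def)
  have "tmap V (\<lambda>v. \<epsilon> (X v)) t \<odot> tmap V (\<lambda>v. \<eta> (X v)) t = tmap V (\<lambda>v. \<eta> (X v)) t \<odot> tmap V (\<lambda>v. \<epsilon> (X v)) t"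
    if "\<epsilon> \<in> sels" "\<eta> \<in> sels" for \<epsilon> \<eta>
    using tmap_comp[where h = "\<lambda>v. \<epsilon> (X v)" and k = "\<lambda>v. \<eta> (X v)" and t = t, OF h[OF that(1)] h[OF that(2)]]
      tmap_comp[where h = "\<lambda>v. \<eta> (X v)" and k = "\<lambda>v. \<epsilon> (X v)" and t = t, OF h[OF that(2)] h[OF that(1)]]
      D_obD(5)[OF assms that] by simp
  moreover have "tmap V (\<lambda>v. \<epsilon> (X v)) t \<in> hom V (tval V (\<lambda>v. car (X v)) t) (tval V (\<lambda>v. car (X v)) t)"
    if "\<epsilon> \<in> sels" for \<epsilon>
    using tmap_typ[where h = "\<lambda>v. \<epsilon> (X v)" and t = t, OF h[OF that]] by (simp add: hom_def)
  ultimately show ?thesis by (auto simp: D_ob sel_Dval)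
qed

text \<open>Arrows of \<open>D\<close> that are obtained from a family of arrows \<open>h v\<close>, one for each variable, by
  tensor products and canonical arrows.\<close>
definition gen :: "('v \<Rightarrow> ('o, 'a) darr) \<Rightarrow> 'v tterm \<Rightarrow> 'v tterm \<Rightarrow> ('o, 'a) darr \<Rightarrow> bool" where
  "gen h s t f \<longleftrightarrow> src f = Dval (\<lambda>v. src (h v)) s \<and> tgt f = Dval (\<lambda>v. tgt (h v)) t \<and>
     (\<exists>g. canonical V (\<lambda>v. car (tgt (h v))) s t g \<and> mor f = g \<odot> tmap V (\<lambda>v. mor (h v)) s)"

lemma gen_vars: "gen h s t f \<Longrightarrow> mset (vl s) = mset (vl t)"
  using canonical_vars by (auto simp: gen_def)

lemma gen_src: "gen h s t f \<Longrightarrow> src f = Dval (\<lambda>v. src (h v)) s"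
  and gen_tgt: "gen h s t f \<Longrightarrow> tgt f = Dval (\<lambda>v. tgt (h v)) t"
  by (simp_all add: gen_def)

lemma mor_hom: "f \<in> Ar D \<Longrightarrow> mor f \<in> hom V (car (src f)) (car (tgt f))"
  by (simp add: D_ar)

lemma sel_hom: "x \<in> Ob D \<Longrightarrow> \<epsilon> \<in> sels \<Longrightarrow> \<epsilon> x \<in> hom V (car x) (car x)"
  by (simp add: D_ob)

lemma object_familyI: "(\<And>v. X v \<in> Ob D) \<Longrightarrow> object_family V (\<lambda>v. car (X v))"
  by unfold_locales (simp add: D_obD)

lemma gen_ar:
  assumes h: "\<And>v. h v \<in> Ar D" and "gen h s t f"
  shows "f \<in> Ar D"
proof -
  let ?X = "\<lambda>v. src (h v)" and ?Y = "\<lambda>v. tgt (h v)" and ?A = "\<lambda>v. car (src (h v))" and ?B = "\<lambda>v. car (tgt (h v))"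
  have X: "?X v \<in> Ob D" and Y: "?Y v \<in> Ob D" for v
    using D_arD[OF h] by auto
  interpret A: object_family V ?A using X by (rule object_familyI)
  interpret B: object_family V ?B using Y by (rule object_familyI)
  obtain g where g: "canonical V ?B s t g" and f: "mor f = g \<odot> tmap V (\<lambda>v. mor (h v)) s"
    "src f = Dval ?X s" "tgt f = Dval ?Y t"
    using assms(2) by (auto simp: gen_def)
  have m: "mor (h v) \<in> hom V (?A v) (?B v)" for v
    using h by (simp add: D_ar)
  note [simp] = B.canonical_typ[OF g] tmap_typ[where h = "\<lambda>v. mor (h v)" and A = ?A and B = ?B, OF m]
  have "mor f \<odot> tmap V (\<lambda>v. \<epsilon> (?X v)) s = tmap V (\<lambda>v. \<epsilon> (?Y v)) t \<odot> mor f" if "\<epsilon> \<in> sels" for \<epsilon>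
  proof -
    have eX: "\<epsilon> (?X v) \<in> hom V (?A v) (?A v)" and eY: "\<epsilon> (?Y v) \<in> hom V (?B v) (?B v)" for v
      using X Y that by (simp_all add: sel_hom)
    note [simp] = tmap_typ[where h = "\<lambda>v. \<epsilon> (?X v)" and A = ?A and B = ?A, OF eX]
      tmap_typ[where h = "\<lambda>v. \<epsilon> (?Y v)" and A = ?B and B = ?B, OF eY]
    have 1: "tmap V (\<lambda>v. mor (h v)) s \<odot> tmap V (\<lambda>v. \<epsilon> (?X v)) s = tmap V (\<lambda>v. \<epsilon> (?Y v)) s \<odot> tmap V (\<lambda>v. mor (h v)) s"
      using tmap_comp[where h = "\<lambda>v. \<epsilon> (?X v)" and k = "\<lambda>v. mor (h v)", OF eX m, of s]
        tmap_comp[where k = "\<lambda>v. \<epsilon> (?Y v)" and h = "\<lambda>v. mor (h v)", OF m eY, of s] D_arD(6)[OF h that] by simp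
    have 2: "g \<odot> tmap V (\<lambda>v. \<epsilon> (?Y v)) s = tmap V (\<lambda>v. \<epsilon> (?Y v)) t \<odot> g"
      using canonical_natural[where h = "\<lambda>v. \<epsilon> (?Y v)", OF g eY] by auto
    have "mor f \<odot> tmap V (\<lambda>v. \<epsilon> (?X v)) s = g \<odot> (tmap V (\<lambda>v. \<epsilon> (?Y v)) s \<odot> tmap V (\<lambda>v. mor (h v)) s)"
      by (simp add: f(1) 1)
    also have "\<dots> = (g \<odot> tmap V (\<lambda>v. \<epsilon> (?Y v)) s) \<odot> tmap V (\<lambda>v. mor (h v)) s"
      by simp
    also have "\<dots> = tmap V (\<lambda>v. \<epsilon> (?Y v)) t \<odot> mor f"
      by (simp add: 2 f(1))
    finally show ?thesis .
  qed
  thus ?thesis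
    using Dval_ob[where X = ?X, OF X] Dval_ob[where X = ?Y, OF Y]
    by (simp add: D_ar[of f] f(2,3) sel_Dval) (simp add: f(1) hom_def)
qed

text \<open>By coherence, an arrow given by a family \<open>h\<close> is determined by its source and target.\<close>
lemma gen_unique:
  assumes "\<And>v. h v \<in> Ar D" "gen h s t f" "gen h s t f'" "distinct (vl s)"
  shows "f = f'"
proof -
  interpret B: object_family V "\<lambda>v. car (tgt (h v))"
    using D_arD(2)[OF assms(1)] by (rule object_familyI)
  obtain g g' where "canonical V (\<lambda>v. car (tgt (h v))) s t g" "mor f = g \<odot> tmap V (\<lambda>v. mor (h v)) s"
      "canonical V (\<lambda>v. car (tgt (h v))) s t g'" "mor f' = g' \<odot> tmap V (\<lambda>v. mor (h v)) s"
    using assms(2,3) by (auto simp: gen_def)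
  moreover from this have "g = g'" using B.canonical_unique assms(4) by blast
  ultimately show ?thesis
    using assms(2,3) by (intro darr.expand) (simp add: gen_def)
qed

lemma gen_cong:
  assumes "gen h s t f" "\<And>v. v \<in> set (vl s) \<Longrightarrow> h v = h' v"
  shows "gen h' s t f"
proof -
  obtain g where g: "canonical V (\<lambda>v. car (tgt (h v))) s t g" and f: "mor f = g \<odot> tmap V (\<lambda>v. mor (h v)) s"
    "src f = Dval (\<lambda>v. src (h v)) s" "tgt f = Dval (\<lambda>v. tgt (h v)) t"
    using assms(1) by (auto simp: gen_def)
  have v: "set (vl t) = set (vl s)" using mset_eq_setD[OF gen_vars[OF assms(1)]] by simp
  have "tmap V (\<lambda>v. mor (h v)) s = tmap V (\<lambda>v. mor (h' v)) s"
    by (rule tmap_cong) (simp add: assms(2))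
  moreover have "Dval (\<lambda>v. src (h v)) s = Dval (\<lambda>v. src (h' v)) s" "Dval (\<lambda>v. tgt (h v)) t = Dval (\<lambda>v. tgt (h' v)) t"
    by (rule Dval_cong, simp add: assms(2) v)+
  moreover have "canonical V (\<lambda>v. car (tgt (h' v))) s t g"
    by (rule canonical_cong[OF g]) (simp add: assms(2))
  ultimately show ?thesis using f unfolding gen_def by auto
qed

text \<open>Naturality moves the arrows \<open>k v\<close> past the canonical arrow in \<open>f\<close>.\<close>
lemma gen_comp:
  assumes h: "\<And>v. h v \<in> Ar D" and k: "\<And>v. k v \<in> Ar D" and hk: "\<And>v. tgt (h v) = src (k v)"
    and f: "gen h s t f" and f': "gen k t u f'"
  shows "gen (\<lambda>v. k v \<odot>\<^bsub>D\<^esub> h v) s u (f' \<odot>\<^bsub>D\<^esub> f)"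
proof -
  let ?A = "\<lambda>v. car (src (h v))" and ?B = "\<lambda>v. car (src (k v))" and ?C = "\<lambda>v. car (tgt (k v))"
  interpret B: object_family V ?B using D_arD(1)[OF k] by (rule object_familyI)
  interpret C: object_family V ?C using D_arD(2)[OF k] by (rule object_familyI)
  obtain g where g: "canonical V ?B s t g" and mf: "mor f = g \<odot> tmap V (\<lambda>v. mor (h v)) s"
    using f hk by (auto simp: gen_def)
  obtain g' where g': "canonical V ?C t u g'" and mf': "mor f' = g' \<odot> tmap V (\<lambda>v. mor (k v)) t"
    using f' by (auto simp: gen_def)
  have mh: "mor (h v) \<in> hom V (?A v) (?B v)" and mk: "mor (k v) \<in> hom V (?B v) (?C v)" for v
    using mor_hom[OF h, of v] mor_hom[OF k, of v] hk[of v] by simp_all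
  obtain g'' where g'': "canonical V ?C s t g''" "g'' \<odot> tmap V (\<lambda>v. mor (k v)) s = tmap V (\<lambda>v. mor (k v)) t \<odot> g"
    using canonical_natural[where h = "\<lambda>v. mor (k v)", OF g mk] by blast
  note [simp] = B.canonical_typ[OF g] C.canonical_typ[OF g'] C.canonical_typ[OF g''(1)]
    tmap_typ[where h = "\<lambda>v. mor (h v)" and A = ?A and B = ?B, OF mh]
    tmap_typ[where h = "\<lambda>v. mor (k v)" and A = ?B and B = ?C, OF mk]
  have "mor f' \<odot> mor f = g' \<odot> (tmap V (\<lambda>v. mor (k v)) t \<odot> g) \<odot> tmap V (\<lambda>v. mor (h v)) s"
    by (simp add: mf mf')
  also have "\<dots> = (g' \<odot> g'') \<odot> (tmap V (\<lambda>v. mor (k v)) s \<odot> tmap V (\<lambda>v. mor (h v)) s)"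
    by (simp flip: g''(2))
  also have "tmap V (\<lambda>v. mor (k v)) s \<odot> tmap V (\<lambda>v. mor (h v)) s = tmap V (\<lambda>v. mor (k v) \<odot> mor (h v)) s"
    by (rule tmap_comp[symmetric, where A = ?A and B = ?B and C = ?C, OF mh mk])
  finally have "mor (f' \<odot>\<^bsub>D\<^esub> f) = (g' \<odot> g'') \<odot> tmap V (\<lambda>v. mor (k v) \<odot> mor (h v)) s" by simp
  moreover have "canonical V ?C s u (g' \<odot> g'')" by (rule canonical.c_comp[OF g''(1) g'])
  ultimately show ?thesis
    using f f' unfolding gen_def by auto
qed

lemma gen_Var: "h v \<in> Ar D \<Longrightarrow> gen h (Var v) (Var v) (h v)"
  using canonical.c_id[of V "\<lambda>v. car (tgt (h v))" "Var v"]
  by (auto simp: gen_def D_arD D_obD intro!: exI)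

lemma gen_canonical:
  assumes "\<And>v. X v \<in> Ob D" "canonical V (\<lambda>v. car (X v)) s t g"
  shows "gen (\<lambda>v. Id D (X v)) s t (DArr (Dval X s) g (Dval X t))"
proof -
  interpret object_family V "\<lambda>v. car (X v)" using assms(1) by (rule object_familyI)
  have [simp]: "tmap V (\<lambda>v. Id V (car (X v))) s = Id V (tval V (\<lambda>v. car (X v)) s)"
    by (induction s) (simp_all)
  show ?thesis using assms(2) canonical_typ[OF assms(2)] by (auto simp: gen_def)
qed

lemma gen_id:
  assumes "\<And>v. X v \<in> Ob D"
  shows "gen (\<lambda>v. Id D (X v)) t t (Id D (Dval X t))"
  using gen_canonical[where s = t and t = t, OF assms canonical.c_id] by simp

text \<open>For endomorphisms \<open>e v\<close>, the canonical arrow may also be applied first.\<close>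
lemma gen_endo:
  assumes e: "\<And>v. DArr (X v) (e v) (X v) \<in> Ar D" and g: "canonical V (\<lambda>v. car (X v)) s t g"
  shows "gen (\<lambda>v. DArr (X v) (e v) (X v)) s t (DArr (Dval X s) (g \<odot> tmap V e s) (Dval X t))"
    and "gen (\<lambda>v. DArr (X v) (e v) (X v)) s t (DArr (Dval X s) (tmap V e t \<odot> g) (Dval X t))"
proof -
  show 1: "gen (\<lambda>v. DArr (X v) (e v) (X v)) s t (DArr (Dval X s) (g \<odot> tmap V e s) (Dval X t))"
    using g by (auto simp: gen_def)
  have "e v \<in> hom V (car (X v)) (car (X v))" for v
    using mor_hom[OF e[of v]] by simp
  hence "g \<odot> tmap V e s = tmap V e t \<odot> g"
    using canonical_natural[where h = e and B = "\<lambda>v. car (X v)", OF g] by auto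
  thus "gen (\<lambda>v. DArr (X v) (e v) (X v)) s t (DArr (Dval X s) (tmap V e t \<odot> g) (Dval X t))"
    using 1 by simp
qed

lemma gen_Tens:
  assumes h: "\<And>v. h v \<in> Ar D" and "\<And>i. i \<in> set is \<Longrightarrow> gen h (S i) (T i) (F i)"
  shows "gen h (Tens (map S is)) (Tens (map T is)) (D_tars V (map F is))"
proof -
  let ?A = "\<lambda>v. car (src (h v))" and ?B = "\<lambda>v. car (tgt (h v))" and ?m = "tmap V (\<lambda>v. mor (h v))"
  interpret B: object_family V ?B using D_arD(2)[OF h] by (rule object_familyI)
  note [simp] = tmap_typ[where h = "\<lambda>v. mor (h v)" and A = ?A and B = ?B, OF mor_hom[OF h]]
  have "\<exists>g. canonical V ?B (Tens (map S is)) (Tens (map T is)) g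
      \<and> tars V (map (\<lambda>i. mor (F i)) is) = g \<odot> ?m (Tens (map S is))"
    using assms(2)
  proof (induction "is" rule: induct_list012)
    case 1
    show ?case using canonical.c_id[of V ?B Unit] by (intro exI[of _ "Id V \<I>"]) (simp add: tars_def)
  next
    case (2 x)
    thus ?case by (auto simp: gen_def tars_def)
  next
    case (3 x y zs)
    then obtain g where g: "canonical V ?B (Tens (map S (y # zs))) (Tens (map T (y # zs))) g"
      "tars V (map (\<lambda>i. mor (F i)) (y # zs)) = g \<odot> ?m (Tens (map S (y # zs)))"
      by auto
    obtain k where k: "canonical V ?B (S x) (T x) k" "mor (F x) = k \<odot> ?m (S x)"
      using 3(3)[of x] by (auto simp: gen_def)
    note [simp] = B.canonical_typ[OF g(1)] B.canonical_typ[OF k(1)]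
    have "tars V (map (\<lambda>i. mor (F i)) (x # y # zs)) = mor (F x) \<boxtimes> tars V (map (\<lambda>i. mor (F i)) (y # zs))"
      by (simp add: tars_def)
    also have "\<dots> = (k \<boxtimes> g) \<odot> (?m (S x) \<boxtimes> ?m (Tens (map S (y # zs))))"
      unfolding g(2) k(2) by (rule interchange[symmetric]) (simp_all del: nfold.simps list.map)
    also have "?m (S x) \<boxtimes> ?m (Tens (map S (y # zs))) = ?m (Tens (map S (x # y # zs)))"
      by simp
    finally show ?case
      using canonical.c_tensor[OF k(1) g(1)] by auto
  qed
  moreover have "map src (map F is) = map (Dval (\<lambda>v. src (h v))) (map S is)"
    "map tgt (map F is) = map (Dval (\<lambda>v. tgt (h v))) (map T is)"
    using assms(2) by (simp_all add: gen_def)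
  ultimately show ?thesis
    by (simp only: gen_def D_tars_def darr.sel Dval_Tens) (simp add: o_def)
qed

section \<open>Monomials in the endomorphisms\<close>

text \<open>The endomorphism \<open>\<epsilon>\<^sup>i \<eta>\<^sup>j\<close> of \<open>X v\<close>, where the exponents depend on \<open>v\<close>.\<close>
definition endo :: "(('o, 'a) dobj \<Rightarrow> 'a) \<Rightarrow> (('o, 'a) dobj \<Rightarrow> 'a) \<Rightarrow> ('v \<Rightarrow> ('o, 'a) dobj)
    \<Rightarrow> ('v \<Rightarrow> nat) \<Rightarrow> ('v \<Rightarrow> nat) \<Rightarrow> 'v \<Rightarrow> ('o, 'a) darr" where
  "endo \<epsilon> \<eta> X i j v = DArr (X v) (apow V (\<epsilon> (X v)) (i v) \<odot> apow V (\<eta> (X v)) (j v)) (X v)"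

lemma endo_simps [simp]: "src (endo \<epsilon> \<eta> X i j v) = X v" "tgt (endo \<epsilon> \<eta> X i j v) = X v"
  by (simp_all add: endo_def)

lemma apow_sel_commute:
  assumes "x \<in> Ob D" "\<epsilon> \<in> sels" "\<eta> \<in> sels"
  shows "apow V (\<epsilon> x) i \<odot> \<eta> x = \<eta> x \<odot> apow V (\<epsilon> x) i"
    "apow V (\<epsilon> x) i \<odot> apow V (\<eta> x) j = apow V (\<eta> x) j \<odot> apow V (\<epsilon> x) i"
proof -
  have h: "\<epsilon> x \<in> hom V (car x) (car x)" "\<eta> x \<in> hom V (car x) (car x)"
    using assms sel_hom by blast+
  show *: "apow V (\<epsilon> x) i \<odot> \<eta> x = \<eta> x \<odot> apow V (\<epsilon> x) i"
    using assms by (intro apow_commute[OF h] D_obD)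
  show "apow V (\<epsilon> x) i \<odot> apow V (\<eta> x) j = apow V (\<eta> x) j \<odot> apow V (\<epsilon> x) i"
    by (rule apow_commute[OF h(2) apow_typ[OF h(1)] *[symmetric], symmetric])
qed

lemma endo_ar:
  assumes x: "X v \<in> Ob D" and s: "\<epsilon> \<in> sels" "\<eta> \<in> sels"
  shows "endo \<epsilon> \<eta> X i j v \<in> Ar D"
proof -
  let ?p = "apow V (\<epsilon> (X v)) (i v)" and ?q = "apow V (\<eta> (X v)) (j v)"
  have h: "?p \<in> hom V (car (X v)) (car (X v))" "?q \<in> hom V (car (X v)) (car (X v))"
    using assms by (intro apow_typ sel_hom; simp)+
  have "(?p \<odot> ?q) \<odot> \<theta> (X v) = \<theta> (X v) \<odot> (?p \<odot> ?q)" if "\<theta> \<in> sels" for \<theta>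
  proof -
    note [simp] = homD[OF h(1)] homD[OF h(2)] homD[OF sel_hom[OF x that]]
    have "(?p \<odot> ?q) \<odot> \<theta> (X v) = (?p \<odot> \<theta> (X v)) \<odot> ?q"
      using apow_sel_commute(1)[OF x s(2) that] by simp
    thus ?thesis using apow_sel_commute(1)[OF x s(1) that] by simp
  qed
  thus ?thesis
    using x comp_hom[OF h(2) h(1)] by (auto simp: endo_def D_ar)
qed

lemma endo_comp:
  assumes x: "X v \<in> Ob D" and s: "\<epsilon> \<in> sels" "\<eta> \<in> sels"
  shows "endo \<epsilon> \<eta> X i' j' v \<odot>\<^bsub>D\<^esub> endo \<epsilon> \<eta> X i j v = endo \<epsilon> \<eta> X (\<lambda>v. i v + i' v) (\<lambda>v. j v + j' v) v"
proof -
  let ?p = "apow V (\<epsilon> (X v))" and ?q = "apow V (\<eta> (X v))"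
  have h: "?p n \<in> hom V (car (X v)) (car (X v))" "?q n \<in> hom V (car (X v)) (car (X v))" for n
    using assms by (intro apow_typ sel_hom; simp)+
  note [simp] = homD[OF h(1)] homD[OF h(2)]
  have "(?p (i' v) \<odot> ?q (j' v)) \<odot> ?p (i v) \<odot> ?q (j v) = ?p (i' v) \<odot> (?q (j' v) \<odot> ?p (i v)) \<odot> ?q (j v)"
    by simp
  also have "\<dots> = (?p (i' v) \<odot> ?p (i v)) \<odot> ?q (j' v) \<odot> ?q (j v)"
    unfolding apow_sel_commute(2)[OF x s(2) s(1)] by simp
  also have "\<dots> = ?p (i' v + i v) \<odot> ?q (j' v + j v)"
    using assms by (simp add: apow_add[OF sel_hom])
  finally show ?thesis by (simp add: endo_def add.commute)
qed

lemma endo_0: "X v \<in> Ob D \<Longrightarrow> \<epsilon> \<in> sels \<Longrightarrow> \<eta> \<in> sels \<Longrightarrow> endo \<epsilon> \<eta> X (\<lambda>_. 0) (\<lambda>_. 0) v = Id D (X v)"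
  by (simp add: endo_def D_obD)

end

section \<open>Powers of a category\<close>

lemma map2_replicate: "length xs = n \<Longrightarrow> map2 f (replicate n c) xs = map (f c) xs"
  by (induction xs arbitrary: n) auto

lemma map2_map_length: "map2 f (map (g \<circ> length) xss) xss = map (\<lambda>xs. f (g (length xs)) xs) xss"
  by (induction xss) auto

lemma map2_map1: "map2 f (map g xs) ys = map2 (\<lambda>x. f (g x)) xs ys"
  by (simp add: zip_map1 o_def case_prod_beta)

lemma power_cat_simps:
  "xs \<in> Ob (power_cat C n) \<longleftrightarrow> length xs = n \<and> set xs \<subseteq> Ob C"
  "fs \<in> Ar (power_cat C n) \<longleftrightarrow> length fs = n \<and> set fs \<subseteq> Ar C"
  "length fs = n \<Longrightarrow> Dom (power_cat C n) fs = map (Dom C) fs"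
  "length fs = n \<Longrightarrow> Cod (power_cat C n) fs = map (Cod C) fs"
  "length xs = n \<Longrightarrow> Id (power_cat C n) xs = map (Id C) xs"
  "length fs = n \<Longrightarrow> length gs = n \<Longrightarrow> gs \<odot>\<^bsub>power_cat C n\<^esub> fs = map2 (Comp C) gs fs"
proof -
  show "xs \<in> Ob (power_cat C n) \<longleftrightarrow> length xs = n \<and> set xs \<subseteq> Ob C"
    by (auto simp: power_cat_def prod_cat_def list_all2_conv_all_nth set_conv_nth)
  show "fs \<in> Ar (power_cat C n) \<longleftrightarrow> length fs = n \<and> set fs \<subseteq> Ar C"
    by (auto simp: power_cat_def prod_cat_def list_all2_conv_all_nth set_conv_nth)
  show "length fs = n \<Longrightarrow> length gs = n \<Longrightarrow> gs \<odot>\<^bsub>power_cat C n\<^esub> fs = map2 (Comp C) gs fs"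
    by (auto simp: power_cat_def prod_cat_def intro!: nth_equalityI)
qed (simp_all add: power_cat_def prod_cat_def map2_replicate)


lemma powers_cat_simps:
  "xss \<in> Ob (powers_cat C ks) \<longleftrightarrow> map length xss = ks \<and> (\<forall>xs\<in>set xss. set xs \<subseteq> Ob C)"
  "fss \<in> Ar (powers_cat C ks) \<longleftrightarrow> map length fss = ks \<and> (\<forall>fs\<in>set fss. set fs \<subseteq> Ar C)"
  "map length fss = ks \<Longrightarrow> Dom (powers_cat C ks) fss = map (map (Dom C)) fss"
  "map length fss = ks \<Longrightarrow> Cod (powers_cat C ks) fss = map (map (Cod C)) fss"
  "map length xss = ks \<Longrightarrow> Id (powers_cat C ks) xss = map (map (Id C)) xss"
  "map length fss = ks \<Longrightarrow> map length gss = ks \<Longrightarrow> gss \<odot>\<^bsub>powers_cat C ks\<^esub> fss = map2 (map2 (Comp C)) gss fss"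
proof -
  show "xss \<in> Ob (powers_cat C ks) \<longleftrightarrow> map length xss = ks \<and> (\<forall>xs\<in>set xss. set xs \<subseteq> Ob C)"
    unfolding powers_cat_def prod_cat_def
    by (simp add: list_all2_map1 power_cat_simps list_all2_conv_all_nth)
       (metis length_map nth_equalityI nth_map in_set_conv_nth)
  show "fss \<in> Ar (powers_cat C ks) \<longleftrightarrow> map length fss = ks \<and> (\<forall>fs\<in>set fss. set fs \<subseteq> Ar C)"
    unfolding powers_cat_def prod_cat_def
    by (simp add: list_all2_map1 power_cat_simps list_all2_conv_all_nth)
       (metis length_map nth_equalityI nth_map in_set_conv_nth)
  show "map length fss = ks \<Longrightarrow> Dom (powers_cat C ks) fss = map (map (Dom C)) fss"
    "map length fss = ks \<Longrightarrow> Cod (powers_cat C ks) fss = map (map (Cod C)) fss"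
    by (auto simp: powers_cat_def prod_cat_def map2_map_length power_cat_simps)
  show "map length xss = ks \<Longrightarrow> Id (powers_cat C ks) xss = map (map (Id C)) xss"
    by (auto simp: powers_cat_def prod_cat_def map2_map_length power_cat_simps)
  show "map length fss = ks \<Longrightarrow> map length gss = ks \<Longrightarrow> gss \<odot>\<^bsub>powers_cat C ks\<^esub> fss = map2 (map2 (Comp C)) gss fss"
  proof (rule nth_equalityI)
    assume l: "map length fss = ks" "map length gss = ks"
    hence l': "length fss = length ks" "length gss = length ks" by (metis length_map)+
    thus "length (gss \<odot>\<^bsub>powers_cat C ks\<^esub> fss) = length (map2 (map2 (Comp C)) gss fss)"
      by (simp add: powers_cat_def prod_cat_def)
    fix i assume i: "i < length (gss \<odot>\<^bsub>powers_cat C ks\<^esub> fss)"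
    hence "i < length ks" using l' by (simp add: powers_cat_def prod_cat_def)
    moreover from this have "length (fss ! i) = ks ! i" "length (gss ! i) = ks ! i"
      using l by (metis length_map nth_map)+
    ultimately show "(gss \<odot>\<^bsub>powers_cat C ks\<^esub> fss) ! i = map2 (map2 (Comp C)) gss fss ! i"
      using l' by (simp add: powers_cat_def prod_cat_def power_cat_simps)
  qed
qed

lemma prod_powers_ob:
  "xsss \<in> Ob (prod_cat (map (powers_cat C) kss)) \<longleftrightarrow>
    map (map length) xsss = kss \<and> (\<forall>xss\<in>set xsss. \<forall>xs\<in>set xss. set xs \<subseteq> Ob C)"
  unfolding prod_cat_def
  by (simp add: list_all2_map1 powers_cat_simps list_all2_conv_all_nth)
     (metis length_map nth_equalityI nth_map in_set_conv_nth)

lemma prod_category: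
  assumes "\<And>C. C \<in> set Cs \<Longrightarrow> category C"
  shows "category (prod_cat Cs)"
proof -
  have c: "category (Cs ! i)" if "i < length Cs" for i using assms that by simp
  note d = list_all2_conv_all_nth hom_def
  have h: "f \<in> hom (prod_cat Cs) a b \<longleftrightarrow> length f = length Cs \<and> length a = length Cs \<and> length b = length Cs \<and>
      (\<forall>i<length Cs. f ! i \<in> hom (Cs ! i) (a ! i) (b ! i))" for f a b
    by (auto simp: prod_cat_def list_all2_conv_all_nth hom_def list_eq_iff_nth_eq)
  have o: "a \<in> Ob (prod_cat Cs) \<longleftrightarrow> length a = length Cs \<and> (\<forall>i<length Cs. a ! i \<in> Ob (Cs ! i))" for a
    by (auto simp: prod_cat_def list_all2_conv_all_nth)
  have m: "length g = length Cs \<Longrightarrow> length f = length Cs \<Longrightarrow> length (g \<odot>\<^bsub>prod_cat Cs\<^esub> f) = length Cs"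
    "\<lbrakk>length g = length Cs; length f = length Cs; i < length Cs\<rbrakk> \<Longrightarrow> (g \<odot>\<^bsub>prod_cat Cs\<^esub> f) ! i = (g ! i) \<odot>\<^bsub>Cs ! i\<^esub> (f ! i)" for f g i
    by (simp_all add: prod_cat_def)
  have d: "length a = length Cs \<Longrightarrow> length (Id (prod_cat Cs) a) = length Cs"
    "\<lbrakk>length a = length Cs; i < length Cs\<rbrakk> \<Longrightarrow> Id (prod_cat Cs) a ! i = Id (Cs ! i) (a ! i)" for a i
    by (simp_all add: prod_cat_def)
  show ?thesis
  proof
    fix f g k a b c' d'
    show "f \<in> Ar (prod_cat Cs) \<Longrightarrow> Dom (prod_cat Cs) f \<in> Ob (prod_cat Cs)"
      "f \<in> Ar (prod_cat Cs) \<Longrightarrow> Cod (prod_cat Cs) f \<in> Ob (prod_cat Cs)"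
      using c by (auto simp: prod_cat_def list_all2_conv_all_nth category.dom_ob category.cod_ob)
    show "a \<in> Ob (prod_cat Cs) \<Longrightarrow> Id (prod_cat Cs) a \<in> hom (prod_cat Cs) a a"
      using c by (simp add: h o d category.id_hom)
    show "\<lbrakk>f \<in> hom (prod_cat Cs) a b; g \<in> hom (prod_cat Cs) b c'\<rbrakk> \<Longrightarrow> g \<odot>\<^bsub>prod_cat Cs\<^esub> f \<in> hom (prod_cat Cs) a c'"
      using c by (auto simp: h m category.comp_hom)
    show "f \<in> hom (prod_cat Cs) a b \<Longrightarrow> f \<odot>\<^bsub>prod_cat Cs\<^esub> Id (prod_cat Cs) a = f"
      using c by (auto simp: h m d category.comp_id intro!: nth_equalityI)
    show "f \<in> hom (prod_cat Cs) a b \<Longrightarrow> Id (prod_cat Cs) b \<odot>\<^bsub>prod_cat Cs\<^esub> f = f"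
      using c by (auto simp: h m d category.id_comp intro!: nth_equalityI)
    show "\<lbrakk>f \<in> hom (prod_cat Cs) a b; g \<in> hom (prod_cat Cs) b c'; k \<in> hom (prod_cat Cs) c' d'\<rbrakk>
      \<Longrightarrow> (k \<odot>\<^bsub>prod_cat Cs\<^esub> g) \<odot>\<^bsub>prod_cat Cs\<^esub> f = k \<odot>\<^bsub>prod_cat Cs\<^esub> g \<odot>\<^bsub>prod_cat Cs\<^esub> f"
    proof (rule nth_equalityI, goal_cases)
      case (2 i)
      hence i: "i < length Cs" by (simp add: h m)
      thus ?case
        using category.comp_assoc[OF c[OF i], of "f ! i" "a ! i" "b ! i" "g ! i" "c' ! i" "k ! i" "d' ! i"] 2
        by (simp add: h m)
    qed (simp add: h m)
  qed
qed

lemma power_category: "category C \<Longrightarrow> category (power_cat C n)"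
  unfolding power_cat_def by (rule prod_category) auto

lemma powers_category: "category C \<Longrightarrow> category (powers_cat C ks)"
  unfolding powers_cat_def by (rule prod_category) (auto intro: power_category)

subsection \<open>Opposites\<close>

lemma op_cat_simps [simp]: "Ob (op_cat C) = Ob C" "Ar (op_cat C) = Ar C" "Dom (op_cat C) = Cod C"
    "Cod (op_cat C) = Dom C" "Id (op_cat C) = Id C" "g \<odot>\<^bsub>op_cat C\<^esub> f = f \<odot>\<^bsub>C\<^esub> g"
    "hom (op_cat C) a b = hom C b a"
  by (auto simp: op_cat_def hom_def)

lemma op_category: "category C \<Longrightarrow> category (op_cat C)"
proof -
  assume "category C"
  then interpret category C .
  show ?thesis
    by unfold_locales (auto intro: dom_ob cod_ob id_hom comp_hom comp_id id_comp comp_assoc[symmetric])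
qed

lemma op_functor: "cat_functor C D F \<Longrightarrow> cat_functor (op_cat C) (op_cat D) F"
proof -
  assume "cat_functor C D F"
  then interpret cat_functor C D F .
  show ?thesis
    by (intro cat_functor.intro op_category C.category_axioms D.category_axioms cat_functor_axioms.intro)
      (auto intro: fob_ob far_hom far_id far_comp)
qed

lemma op_nat_trans: "nat_trans C D F G \<tau> \<Longrightarrow> nat_trans (op_cat C) (op_cat D) G F \<tau>"
proof -
  assume "nat_trans C D F G \<tau>"
  then interpret nat_trans C D F G \<tau> .
  show ?thesis
    by (intro nat_trans.intro op_functor F.cat_functor_axioms G.cat_functor_axioms nat_trans_axioms.intro)
      (auto intro: comp_hom natural[symmetric])
qed

text \<open>The opposite of a product is the product of the opposites, as an equality of categories.\<close>
lemma op_prod_cat: "prod_cat (map op_cat Cs) = op_cat (prod_cat Cs)"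
proof -
  have "map2 (\<lambda>C (g, f). g \<odot>\<^bsub>C\<^esub> f) (map op_cat Cs) (zip gs fs) = map2 (\<lambda>C (g, f). g \<odot>\<^bsub>C\<^esub> f) Cs (zip fs gs)" for gs fs
  proof (induction Cs arbitrary: gs fs)
    case (Cons C Cs)
    show ?case by (cases gs; cases fs) (use Cons in auto)
  qed simp
  thus ?thesis
    by (auto simp: prod_cat_def op_cat_def[of "\<lparr>Ob = _, Ar = _, Dom = _, Cod = _, Id = _, Comp = _\<rparr>"]
      list_all2_map1 fun_eq_iff map2_map1[where g = op_cat])
qed

lemma op_power_cat: "power_cat (op_cat C) n = op_cat (power_cat C n)"
  unfolding power_cat_def by (simp flip: op_prod_cat)

lemma op_powers_cat: "powers_cat (op_cat C) ks = op_cat (powers_cat C ks)"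
proof -
  have "map (power_cat (op_cat C)) ks = map op_cat (map (power_cat C) ks)"
    by (simp add: op_power_cat)
  thus ?thesis by (simp only: powers_cat_def op_prod_cat)
qed

section \<open>Labelling\<close>

text \<open>Lists and nested lists are images of lists of distinct labels. The labelling \<open>h\<close> is total: it takes the value
  \<open>d\<close> at the other labels.\<close>
lemma label:
  assumes "distinct vs" "length xs = length vs" "set xs \<subseteq> A" "d \<in> A"
  obtains h where "xs = map h vs" "\<And>v. h v \<in> A" "\<And>v. v \<notin> set vs \<Longrightarrow> h v = d"
proof
  let ?h = "\<lambda>v. case map_of (zip vs xs) v of None \<Rightarrow> d | Some x \<Rightarrow> x"
  show "xs = map ?h vs"
    using assms by (intro nth_equalityI) (simp_all add: map_of_zip_nth)
  show "?h v \<in> A" for v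
    using assms(3,4) by (auto split: option.splits dest!: map_of_SomeD set_zip_rightD)
  show "?h v = d" if "v \<notin> set vs" for v
    using that assms(2) by (auto split: option.splits dest: map_of_SomeD set_zip_leftD)
qed

lemma concat_inject:
  "map length xss = map length yss \<Longrightarrow> concat xss = concat yss \<longleftrightarrow> xss = yss"
proof (induction xss arbitrary: yss)
  case (Cons xs xss)
  then obtain ys yss' where "yss = ys # yss'" "length xs = length ys" "map length xss = map length yss'"
    by (cases yss) auto
  thus ?case using Cons.IH by auto
qed simp

lemma label2:
  assumes "distinct (concat vss)" "map length xss = map length vss" "\<And>xs. xs \<in> set xss \<Longrightarrow> set xs \<subseteq> A" "d \<in> A"
  obtains h where "xss = map (map h) vss" "\<And>v. h v \<in> A" "\<And>v. v \<notin> set (concat vss) \<Longrightarrow> h v = d"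
proof -
  have "length (concat xss) = length (concat vss)"
    by (simp add: length_concat assms(2))
  moreover have "set (concat xss) \<subseteq> A" using assms(3) by auto
  ultimately obtain h where h: "concat xss = map h (concat vss)" "\<And>v. h v \<in> A" "\<And>v. v \<notin> set (concat vss) \<Longrightarrow> h v = d"
    using label[OF assms(1) _ _ assms(4)] by metis
  have "xss = map (map h) vss"
    using h(1) assms(2) by (subst concat_inject[symmetric]) (simp_all add: map_concat o_def)
  thus ?thesis using h that by blast
qed

lemma unconcat: "map length xss = concat kss \<Longrightarrow> \<exists>xsss. map (map length) xsss = kss \<and> concat xsss = xss"
proof (induction kss arbitrary: xss)
  case (Cons ks kss)
  then obtain xss1 xss2 where "xss = xss1 @ xss2" "map length xss1 = ks" "map length xss2 = concat kss"
    by (auto simp: map_eq_append_conv)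
  moreover obtain xsss where "map (map length) xsss = kss" "concat xsss = xss2"
    using Cons.IH calculation(3) by blast
  ultimately show ?case by (intro exI[of _ "xss1 # xsss"]) simp
qed simp

text \<open>The family of its own indices, as a family of distinct labels with row lengths \<open>ks\<close>.\<close>
definition idx :: "nat list \<Rightarrow> (nat \<times> nat) list list" where
  "idx ks = map (\<lambda>r. map (Pair r) [0..<ks ! r]) [0..<length ks]"

lemma idx_length [simp]: "map length (idx ks) = ks"
  by (intro nth_equalityI) (simp_all add: idx_def)

lemma idx_distinct [simp]: "distinct (concat (idx ks))"
proof -
  have "distinct (concat (map (\<lambda>r. map (Pair r) [0..<f r]) rs))" if "distinct rs" for rs and f :: "nat \<Rightarrow> nat"
    using that by (induction rs) (auto simp: distinct_map inj_on_def)
  thus ?thesis by (simp add: idx_def)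
qed

lemma label3:
  assumes "\<forall>xss\<in>set xsss. \<forall>xs\<in>set xss. set xs \<subseteq> A" "d \<in> A"
  shows "\<exists>h (vsss :: (nat \<times> nat) list list list). xsss = map (map (map h)) vsss \<and> (\<forall>v. h v \<in> A)
    \<and> distinct (concat (concat vsss))"
proof -
  let ?kss = "map (map length) xsss"
  obtain vsss where v: "map (map length) vsss = ?kss" "concat vsss = idx (concat ?kss)"
    using unconcat[of "idx (concat ?kss)" ?kss] by auto
  have l: "map length (concat xsss) = map length (concat vsss)"
    by (simp add: v) (simp add: map_concat)
  have d: "distinct (concat (concat vsss))" by (simp add: v)
  have s: "set xs \<subseteq> A" if "xs \<in> set (concat xsss)" for xs using assms(1) that by fastforce
  show ?thesis
  proof (rule label2[OF d l s assms(2)])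
    fix h assume h: "concat xsss = map (map h) (concat vsss)" "\<And>v. h v \<in> A"
    have "xsss = map (map (map h)) vsss"
    proof (subst concat_inject[symmetric])
      show "map length xsss = map length (map (map (map h)) vsss)"
        using arg_cong[OF v(1), of "map length"] by (simp add: o_def)
      show "concat xsss = concat (map (map (map h)) vsss)" using h by (simp add: map_concat)
    qed
    thus ?thesis using h(2) d by blast
  qed simp
qed

lemma map2_maps: "map2 f (map g xs) (map h xs) = map (\<lambda>x. f (g x) (h x)) xs"
  by (induction xs) auto

context symmetric_monoidal_category begin

section \<open>Functors and transformations given by terms\<close>

text \<open>A category \<open>P\<close> whose objects and arrows are given by families of objects and arrows of \<open>D\<close>.\<close>
definition shape :: "('p, 'b) category \<Rightarrow> (('v \<Rightarrow> ('o, 'a) dobj) \<Rightarrow> 'p) \<Rightarrow> (('v \<Rightarrow> ('o, 'a) darr) \<Rightarrow> 'b) \<Rightarrow> bool" where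
  "shape P ob ar \<longleftrightarrow> category P
    \<and> (\<forall>x\<in>Ob P. \<exists>X. (\<forall>v. X v \<in> Ob D) \<and> x = ob X)
    \<and> (\<forall>f\<in>Ar P. \<exists>h. (\<forall>v. h v \<in> Ar D) \<and> f = ar h)
    \<and> (\<forall>f\<in>Ar P. \<forall>g\<in>Ar P. Cod P f = Dom P g \<longrightarrow>
        (\<exists>h k. (\<forall>v. h v \<in> Ar D) \<and> (\<forall>v. k v \<in> Ar D) \<and> (\<forall>v. tgt (h v) = src (k v)) \<and> f = ar h \<and> g = ar k
           \<and> g \<odot>\<^bsub>P\<^esub> f = ar (\<lambda>v. k v \<odot>\<^bsub>D\<^esub> h v)))
    \<and> (\<forall>h. (\<forall>v. h v \<in> Ar D) \<longrightarrow> Dom P (ar h) = ob (\<lambda>v. src (h v)) \<and> Cod P (ar h) = ob (\<lambda>v. tgt (h v)))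
    \<and> (\<forall>X. (\<forall>v. X v \<in> Ob D) \<longrightarrow> Id P (ob X) = ar (\<lambda>v. Id D (X v)))"

lemma shape_ob: "shape P ob ar \<Longrightarrow> x \<in> Ob P \<Longrightarrow> \<exists>X. (\<forall>v. X v \<in> Ob D) \<and> x = ob X"
  and shape_ar: "shape P ob ar \<Longrightarrow> f \<in> Ar P \<Longrightarrow> \<exists>h. (\<forall>v. h v \<in> Ar D) \<and> f = ar h"
  by (simp_all add: shape_def)

text \<open>The functor laws are equations between arrows given by the same term and the same family of arrows.\<close>
lemma shape_functor:
  assumes P: "shape P ob ar" and t: "distinct (vl t)"
    and ob: "\<And>X. (\<And>v. X v \<in> Ob D) \<Longrightarrow> fob F (ob X) = Dval X t"
    and ar: "\<And>h. (\<And>v. h v \<in> Ar D) \<Longrightarrow> gen h t t (far F (ar h))"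
  shows "cat_functor P D F"
proof (intro cat_functor.intro cat_functor_axioms.intro D_category)
  show "category P" using P by (simp add: shape_def)
  fix a assume "a \<in> Ob P"
  then obtain X where X: "\<And>v. X v \<in> Ob D" "a = ob X" using shape_ob[OF P] by blast
  thus "fob F a \<in> Ob D" by (simp add: ob Dval_ob)
  have 1: "Id D (X v) \<in> Ar D" for v using X(1) category.id_hom[OF D_category] by (auto simp: hom_def)
  have "far F (ar (\<lambda>v. Id D (X v))) = Id D (Dval X t)"
    by (rule gen_unique[OF 1 ar[OF 1] gen_id[OF X(1)] t])
  thus "far F (Id P a) = Id D (fob F a)"
    using P X ob[OF X(1)] by (simp add: shape_def)
next
  fix f a b assume f: "f \<in> hom P a b"
  then obtain h where h: "\<And>v. h v \<in> Ar D" "f = ar h" using shape_ar[OF P, of f] by (auto simp: hom_def)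
  have o: "(src (h v)) \<in> Ob D" "(tgt (h v)) \<in> Ob D" for v using D_arD[OF h(1)] by auto
  have "a = ob (\<lambda>v. src (h v))" "b = ob (\<lambda>v. tgt (h v))"
    using f h P by (auto simp: shape_def hom_def)
  thus "far F f \<in> hom D (fob F a) (fob F b)"
    using gen_ar[OF h(1) ar[OF h(1)]] gen_src[OF ar[OF h(1)]] gen_tgt[OF ar[OF h(1)]] ob[of "\<lambda>v. src (h v)", OF o(1)]
      ob[of "\<lambda>v. tgt (h v)", OF o(2)] h(2) by (simp add: hom_def)
next
  fix f a b g c assume "f \<in> hom P a b" "g \<in> hom P b c"
  hence "f \<in> Ar P" "g \<in> Ar P" "Cod P f = Dom P g" by (auto simp: hom_def)
  then obtain h k where h: "\<And>v. h v \<in> Ar D" "\<And>v. k v \<in> Ar D" "\<And>v. tgt (h v) = src (k v)" "f = ar h" "g = ar k"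
      "g \<odot>\<^bsub>P\<^esub> f = ar (\<lambda>v. k v \<odot>\<^bsub>D\<^esub> h v)"
    using P unfolding shape_def by blast
  have c: "k v \<odot>\<^bsub>D\<^esub> h v \<in> Ar D" for v by (rule D_comp_ar[OF h(1,2,3)])
  have "far F (ar (\<lambda>v. k v \<odot>\<^bsub>D\<^esub> h v)) = far F (ar k) \<odot>\<^bsub>D\<^esub> far F (ar h)"
    by (rule gen_unique[OF c ar[OF c] gen_comp[OF h(1,2,3) ar[OF h(1)] ar[OF h(2)]] t])
  thus "far F (g \<odot>\<^bsub>P\<^esub> f) = far F g \<odot>\<^bsub>D\<^esub> far F f" unfolding h(6) by (simp only: h(4,5))
qed

text \<open>Likewise, both sides of a naturality square are given by the family \<open>e v \<cdot> h v = h v \<cdot> e v\<close>.\<close>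
lemma shape_nat_trans:
  assumes P: "shape P ob ar" and s: "distinct (vl s)" and t: "distinct (vl t)"
    and Fob: "\<And>X. (\<And>v. X v \<in> Ob D) \<Longrightarrow> fob F (ob X) = Dval X s"
    and Far: "\<And>h. (\<And>v. h v \<in> Ar D) \<Longrightarrow> gen h s s (far F (ar h))"
    and Gob: "\<And>X. (\<And>v. X v \<in> Ob D) \<Longrightarrow> fob G (ob X) = Dval X t"
    and Gar: "\<And>h. (\<And>v. h v \<in> Ar D) \<Longrightarrow> gen h t t (far G (ar h))"
    and e: "\<And>X v. X v \<in> Ob D \<Longrightarrow> e X v \<in> Ar D \<and> src (e X v) = X v \<and> tgt (e X v) = X v"
    and en: "\<And>h v. h v \<in> Ar D \<Longrightarrow> e (\<lambda>v. tgt (h v)) v \<odot>\<^bsub>D\<^esub> h v = h v \<odot>\<^bsub>D\<^esub> e (\<lambda>v. src (h v)) v"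
    and \<tau>: "\<And>X. (\<And>v. X v \<in> Ob D) \<Longrightarrow> gen (e X) s t (\<tau> (ob X))"
  shows "nat_trans P D F G \<tau>"
proof (intro nat_trans.intro nat_trans_axioms.intro)
  show "cat_functor P D F" by (rule shape_functor[OF P s Fob Far])
  show "cat_functor P D G" by (rule shape_functor[OF P t Gob Gar])
  fix a assume "a \<in> Ob P"
  then obtain X where X: "\<And>v. X v \<in> Ob D" "a = ob X" using shape_ob[OF P] by blast
  have "\<tau> (ob X) \<in> Ar D" by (rule gen_ar[OF _ \<tau>[OF X(1)]]) (use e X in simp)
  thus "\<tau> a \<in> hom D (fob F a) (fob G a)"
    using gen_src[OF \<tau>[OF X(1)]] gen_tgt[OF \<tau>[OF X(1)]] Fob[OF X(1)] Gob[OF X(1)] e[of X, OF X(1)] X(2)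
    by (simp add: hom_def)
next
  fix f a b assume f: "f \<in> hom P a b"
  then obtain h where h: "\<And>v. h v \<in> Ar D" "f = ar h" using shape_ar[OF P, of f] by (auto simp: hom_def)
  let ?X = "\<lambda>v. src (h v)" and ?Y = "\<lambda>v. tgt (h v)"
  have o: "?X v \<in> Ob D" "?Y v \<in> Ob D" for v using D_arD[OF h(1)] by auto
  have ab: "a = ob ?X" "b = ob ?Y"
    using f h P by (auto simp: shape_def hom_def)
  have eX: "e ?X v \<in> Ar D" "src (e ?X v) = src (h v)" "tgt (e ?X v) = src (h v)" for v using e[of ?X, OF o(1)] by auto
  have eY: "e ?Y v \<in> Ar D" "src (e ?Y v) = tgt (h v)" "tgt (e ?Y v) = tgt (h v)" for v using e[of ?Y, OF o(2)] by auto
  have 1: "gen (\<lambda>v. e ?Y v \<odot>\<^bsub>D\<^esub> h v) s t (\<tau> (ob ?Y) \<odot>\<^bsub>D\<^esub> far F (ar h))"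
    by (rule gen_comp[OF h(1) eY(1) _ Far[OF h(1)] \<tau>[OF o(2)]]) (simp add: eY)
  have 2: "gen (\<lambda>v. h v \<odot>\<^bsub>D\<^esub> e ?X v) s t (far G (ar h) \<odot>\<^bsub>D\<^esub> \<tau> (ob ?X))"
    by (rule gen_comp[OF eX(1) h(1) _ \<tau>[OF o(1)] Gar[OF h(1)]]) (simp add: eX)
  have 3: "gen (\<lambda>v. e ?Y v \<odot>\<^bsub>D\<^esub> h v) s t (far G (ar h) \<odot>\<^bsub>D\<^esub> \<tau> (ob ?X))"
    by (rule gen_cong[OF 2]) (rule en[OF h(1), symmetric])
  show "\<tau> b \<odot>\<^bsub>D\<^esub> far F f = far G f \<odot>\<^bsub>D\<^esub> \<tau> a"
    unfolding h(2) ab by (rule gen_unique[OF D_comp_ar[OF h(1) eY(1)] 1 3 s]) (simp add: eY)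
qed

text \<open>The object \<open>(\<I>, 1, 1, 1, 1)\<close>, which serves as a default value in labellings.\<close>
definition du :: "('o, 'a) dobj" where "du = D_tobs V []"

lemma du_ob [simp]: "du \<in> Ob D"
  using Dval_ob[of "\<lambda>_. _" "Tens []"] by (auto simp: du_def D_tobs_def tobs_def tars_def D_ob sels_def hom_def)

lemma D_id_ar [simp]: "x \<in> Ob D \<Longrightarrow> DArr x (Id V (car x)) x \<in> Ar D"
  using category.id_hom[OF D_category, of x] by (simp add: hom_def)

lemma shape_D: "shape D (\<lambda>X. X v) (\<lambda>h. h v)"
  unfolding shape_def
proof (intro conjI ballI allI impI)
  show "category D" by (rule D_category)
  fix f assume f: "f \<in> Ar D"
  thus "\<exists>h. (\<forall>v. h v \<in> Ar D) \<and> f = h v" by (intro exI[of _ "\<lambda>_. f"]) simp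
  fix g assume "g \<in> Ar D" "Cod D f = Dom D g"
  thus "\<exists>h k. (\<forall>v. h v \<in> Ar D) \<and> (\<forall>v. k v \<in> Ar D) \<and> (\<forall>v. tgt (h v) = src (k v)) \<and> f = h v \<and> g = k v
           \<and> g \<odot>\<^bsub>D\<^esub> f = k v \<odot>\<^bsub>D\<^esub> h v"
    using f by (intro exI[of _ "\<lambda>_. f"] exI[of _ "\<lambda>_. g"]) simp
next
  fix x assume "x \<in> Ob D"
  thus "\<exists>X. (\<forall>v. X v \<in> Ob D) \<and> x = X v" by (intro exI[of _ "\<lambda>_. x"]) simp
qed simp_all

lemma shape_power:
  assumes vs: "distinct vs"
  shows "shape (power_cat D (length vs)) (\<lambda>X. map X vs) (\<lambda>h. map h vs)"
  unfolding shape_def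
proof (intro conjI ballI allI impI)
  let ?P = "power_cat D (length vs)" and ?u = "DArr du (Id V (car du)) du"
  show "category ?P" by (intro power_category D_category)
  fix f assume f: "f \<in> Ar ?P"
  obtain h where h: "f = map h vs" "\<And>v. h v \<in> Ar D" "\<And>v. v \<notin> set vs \<Longrightarrow> h v = ?u"
    by (rule label[OF vs, of f "Ar D" ?u]) (use f in \<open>auto simp: power_cat_simps\<close>)
  thus "\<exists>h. (\<forall>v. h v \<in> Ar D) \<and> f = map h vs" by blast
  fix g assume g: "g \<in> Ar ?P" "Cod ?P f = Dom ?P g"
  obtain k where k: "g = map k vs" "\<And>v. k v \<in> Ar D" "\<And>v. v \<notin> set vs \<Longrightarrow> k v = ?u"
    by (rule label[OF vs, of g "Ar D" ?u]) (use g in \<open>auto simp: power_cat_simps\<close>)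
  have "tgt (h v) = src (k v)" for v
  proof (cases "v \<in> set vs")
    case True
    thus ?thesis using g(2) h(1) k(1) by (simp add: power_cat_simps)
  qed (simp add: h k)
  moreover have "g \<odot>\<^bsub>?P\<^esub> f = map (\<lambda>v. k v \<odot>\<^bsub>D\<^esub> h v) vs"
    by (simp add: h(1) k(1) power_cat_simps map2_maps)
  ultimately show "\<exists>h k. (\<forall>v. h v \<in> Ar D) \<and> (\<forall>v. k v \<in> Ar D) \<and> (\<forall>v. tgt (h v) = src (k v)) \<and> f = map h vs \<and> g = map k vs
           \<and> g \<odot>\<^bsub>?P\<^esub> f = map (\<lambda>v. k v \<odot>\<^bsub>D\<^esub> h v) vs"
    using h(1,2) k(1,2) by (intro exI[of _ h] exI[of _ k]) simp
next
  fix x assume x: "x \<in> Ob (power_cat D (length vs))"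
  obtain X where X: "x = map X vs" "\<And>v. X v \<in> Ob D" "\<And>v. v \<notin> set vs \<Longrightarrow> X v = du"
    by (rule label[OF vs, of x "Ob D" du]) (use x in \<open>auto simp: power_cat_simps\<close>)
  thus "\<exists>X. (\<forall>v. X v \<in> Ob D) \<and> x = map X vs" by blast
qed (simp_all add: power_cat_simps)

lemma shape_powers:
  assumes vs: "distinct (concat vss)" and ks: "map length vss = ks"
  shows "shape (powers_cat D ks) (\<lambda>X. map (map X) vss) (\<lambda>h. map (map h) vss)"
  unfolding shape_def
proof (intro conjI ballI allI impI)
  let ?P = "powers_cat D ks" and ?u = "DArr du (Id V (car du)) du"
  have [simp]: "map (\<lambda>x. length (map f x)) vss = ks" for f :: "'b \<Rightarrow> 'd" using ks by simp
  have l[simp]: "map (length \<circ> map f) vss = ks" for f :: "'b \<Rightarrow> 'd" using ks by (simp add: o_def)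
  have l'[simp]: "map (length \<circ> map f) vss = ks" for f :: "'b \<Rightarrow> ('o, 'a) dobj" using ks by (simp add: o_def)
  have l''[simp]: "map (length \<circ> map f) vss = ks" for f :: "'b \<Rightarrow> ('o, 'a) darr" using ks by (simp add: o_def)
  show "category ?P" by (intro powers_category D_category)
  fix f assume f: "f \<in> Ar ?P"
  obtain h where h: "f = map (map h) vss" "\<And>v. h v \<in> Ar D" "\<And>v. v \<notin> set (concat vss) \<Longrightarrow> h v = ?u"
    by (rule label2[OF vs, of f "Ar D" ?u]) (use f ks in \<open>auto simp: powers_cat_simps\<close>)
  thus "\<exists>h. (\<forall>v. h v \<in> Ar D) \<and> f = map (map h) vss" by blast
  fix g assume g: "g \<in> Ar ?P" "Cod ?P f = Dom ?P g"
  obtain k where k: "g = map (map k) vss" "\<And>v. k v \<in> Ar D" "\<And>v. v \<notin> set (concat vss) \<Longrightarrow> k v = ?u"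
    by (rule label2[OF vs, of g "Ar D" ?u]) (use g ks in \<open>auto simp: powers_cat_simps\<close>)
  have "tgt (h v) = src (k v)" for v
  proof (cases "v \<in> set (concat vss)")
    case True
    thus ?thesis using g(2) h(1) k(1) by (auto simp add: powers_cat_simps)
  qed (simp add: h k)
  moreover have "g \<odot>\<^bsub>?P\<^esub> f = map (map (\<lambda>v. k v \<odot>\<^bsub>D\<^esub> h v)) vss"
    by (simp add: h(1) k(1) powers_cat_simps map2_maps)
  ultimately show "\<exists>h k. (\<forall>v. h v \<in> Ar D) \<and> (\<forall>v. k v \<in> Ar D) \<and> (\<forall>v. tgt (h v) = src (k v)) \<and> f = map (map h) vss \<and> g = map (map k) vss
           \<and> g \<odot>\<^bsub>?P\<^esub> f = map (map (\<lambda>v. k v \<odot>\<^bsub>D\<^esub> h v)) vss"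
    using h(1,2) k(1,2) by (intro exI[of _ h] exI[of _ k]) simp
next
  fix x assume x: "x \<in> Ob (powers_cat D ks)"
  obtain X where X: "x = map (map X) vss" "\<And>v. X v \<in> Ob D" "\<And>v. v \<notin> set (concat vss) \<Longrightarrow> X v = du"
    by (rule label2[OF vs, of x "Ob D" du]) (use x ks in \<open>auto simp: powers_cat_simps\<close>)
  thus "\<exists>X. (\<forall>v. X v \<in> Ob D) \<and> x = map (map X) vss" by blast
qed (use ks in \<open>auto simp: powers_cat_simps o_def\<close>)

end

section \<open>Families of terms\<close>

text \<open>The concatenation of the rows of a family, where an empty row contributes a unit.\<close>
definition padc :: "'v tterm list list \<Rightarrow> 'v tterm list" where
  "padc tss = concat (map (\<lambda>ts. if ts = [] then [Unit] else ts) tss)"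

text \<open>The variables of a family of terms, row by row.\<close>
definition fvl :: "'v tterm list list \<Rightarrow> 'v list" where
  "fvl tss = concat (map vl (concat tss))"

lemma vl_nested: "vl (Tens (map Tens tss)) = fvl tss"
  by (simp add: vl_Tens fvl_def o_def) (induction tss; simp add: vl_Tens)

lemma vl_padded: "vl (Tens (padc tss)) = fvl tss"
  by (simp add: vl_Tens fvl_def padc_def) (induction tss; simp)

lemma vl_flat: "vl (Tens (concat tss)) = fvl tss"
  by (simp add: vl_Tens fvl_def)

text \<open>For a variable in row \<open>r\<close>, the sums \<open>\<Sum>\<^sub>p\<^sub>>\<^sub>r c k\<^sub>p\<close> and \<open>\<Sum>\<^sub>p\<^sub><\<^sub>r c k\<^sub>p\<close>, where \<open>k\<^sub>p\<close> is the length of row \<open>p\<close>.\<close>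
abbreviation wt :: "(nat \<Rightarrow> nat) \<Rightarrow> 'v tterm list list \<Rightarrow> nat" where
  "wt c tss \<equiv> sum_list (map (\<lambda>ts. c (length ts)) tss)"

primrec after :: "(nat \<Rightarrow> nat) \<Rightarrow> 'v tterm list list \<Rightarrow> 'v \<Rightarrow> nat" where
  "after c [] v = 0"
| "after c (ts # tss) v = (if v \<in> set (concat (map vl ts)) then wt c tss else after c tss v)"

primrec before :: "(nat \<Rightarrow> nat) \<Rightarrow> 'v tterm list list \<Rightarrow> 'v \<Rightarrow> nat" where
  "before c [] v = 0"
| "before c (ts # tss) v = (if v \<in> set (concat (map vl ts)) then 0 else c (length ts) + before c tss v)"

lemma fvl_Cons: "fvl (ts # tss) = concat (map vl ts) @ fvl tss"
  by (simp add: fvl_def)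

lemma row_fvl: "r < length tss \<Longrightarrow> t \<in> set (tss ! r) \<Longrightarrow> v \<in> set (vl t) \<Longrightarrow> v \<in> set (fvl tss)"
  by (auto simp: fvl_def dest: nth_mem)

lemma after_nth:
  assumes "distinct (fvl tss)" "r < length tss" "t \<in> set (tss ! r)" "v \<in> set (vl t)"
  shows "after c tss v = (\<Sum>p = Suc r..<length tss. c (map length tss ! p))"
  using assms
proof (induction tss arbitrary: r)
  case (Cons ts tss)
  show ?case
  proof (cases r)
    case 0
    hence "after c (ts # tss) v = wt c tss" using Cons.prems by auto
    also have "\<dots> = (\<Sum>p = 0..<length tss. c (map length tss ! p))"
      by (simp add: sum_list_sum_nth)
    also have "\<dots> = (\<Sum>p = Suc 0..<Suc (length tss). c (map length (ts # tss) ! p))"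
      by (simp only: sum.shift_bounds_Suc_ivl) simp
    finally show ?thesis using 0 by simp
  next
    case (Suc r')
    hence r': "r' < length tss" "t \<in> set (tss ! r')" using Cons.prems by auto
    hence "v \<notin> set (concat (map vl ts))"
      using Cons.prems row_fvl[OF r' Cons.prems(4)] by (auto simp: fvl_Cons)
    hence "after c (ts # tss) v = (\<Sum>p = Suc r'..<length tss. c (map length tss ! p))"
      using Cons r' by (simp add: fvl_Cons)
    also have "\<dots> = (\<Sum>p = Suc (Suc r')..<Suc (length tss). c (map length (ts # tss) ! p))"
      by (simp only: sum.shift_bounds_Suc_ivl) simp
    finally show ?thesis using Suc by simp
  qed
qed simp

lemma before_nth:
  assumes "distinct (fvl tss)" "r < length tss" "t \<in> set (tss ! r)" "v \<in> set (vl t)"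
  shows "before c tss v = (\<Sum>p = 0..<r. c (map length tss ! p))"
  using assms
proof (induction tss arbitrary: r)
  case (Cons ts tss)
  show ?case
  proof (cases r)
    case 0
    thus ?thesis using Cons.prems by auto
  next
    case (Suc r')
    hence r': "r' < length tss" "t \<in> set (tss ! r')" using Cons.prems by auto
    hence "v \<notin> set (concat (map vl ts))"
      using Cons.prems row_fvl[OF r' Cons.prems(4)] by (auto simp: fvl_Cons)
    hence "before c (ts # tss) v = c (length ts) + (\<Sum>p = 0..<r'. c (map length tss ! p))"
      using Cons r' by (simp add: fvl_Cons)
    also have "\<dots> = (\<Sum>p = 0..<Suc r'. c (map length (ts # tss) ! p))"
      by (simp only: sum.atLeast0_lessThan_Suc_shift) simp
    finally show ?thesis using Suc by simp
  qed
qed simp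

text \<open>The substitution of a family of terms for the index variables used in the definition of the structures.\<close>
definition fam_sub :: "'v tterm list list \<Rightarrow> nat \<times> nat \<Rightarrow> 'v tterm" where
  "fam_sub tss = (\<lambda>(r, s). tss ! r ! s)"

lemma vars_sub: "map (map (tsub (fam_sub tss))) (vars (map length tss)) = tss"
  by (intro nth_equalityI) (simp_all add: vars_def fam_sub_def)

lemma sub_terms:
  "tsub (fam_sub tss) (nested_term (map length tss)) = Tens (map Tens tss)"
  "tsub (fam_sub tss) (flat_term (map length tss)) = Tens (concat tss)"
  "tsub (fam_sub tss) (padded_term (map length tss)) = Tens (padc tss)"
proof -
  let ?vs = "vars (map length tss)"
  have *: "tss = map (map (tsub (fam_sub tss))) ?vs" by (simp only: vars_sub)
  show "tsub (fam_sub tss) (nested_term (map length tss)) = Tens (map Tens tss)"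
    by (subst (3) *) (simp add: nested_term_def tsub_Tens o_def)
  show "tsub (fam_sub tss) (flat_term (map length tss)) = Tens (concat tss)"
    by (subst (3) *) (simp add: flat_term_def tsub_Tens map_concat)
  show "tsub (fam_sub tss) (padded_term (map length tss)) = Tens (padc tss)"
    by (subst (3) *) (simp add: padded_term_def padc_def tsub_Tens map_concat o_def if_distrib cong: if_cong)
qed

lemma vl_terms:
  "vl (nested_term ks) = concat (idx ks)" "vl (flat_term ks) = concat (idx ks)" "vl (padded_term ks) = concat (idx ks)"
proof -
  have v: "vars ks = map (map Var) (idx ks)" by (simp add: vars_def idx_def)
  have *: "fvl (vars ks) = concat (idx ks)"
    unfolding v by (simp add: fvl_def flip: map_concat) (simp add: o_def)
  show "vl (nested_term ks) = concat (idx ks)" "vl (flat_term ks) = concat (idx ks)"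
    by (simp_all only: nested_term_def flat_term_def vl_nested vl_flat *)
  show "vl (padded_term ks) = concat (idx ks)"
    by (simp only: padded_term_def * vl_padded[unfolded padc_def])
qed

lemma idx_set: "(r, i) \<in> set (concat (idx (map length tss))) \<Longrightarrow> r < length tss \<and> i < length (tss ! r)"
  by (auto simp: idx_def)

text \<open>The common form of the two structures: \<open>\<epsilon>\<close> and \<open>\<eta>\<close> are the endomorphisms used, and the arrows are
  directed as in \<open>\<bullet>\<close> if \<open>b\<close> is true, and as in \<open>\<circ>\<close> otherwise.\<close>
definition mon_str :: "('o, 'a) sym_mon_cat \<Rightarrow> bool \<Rightarrow> (('o, 'a) dobj \<Rightarrow> 'a) \<Rightarrow> (('o, 'a) dobj \<Rightarrow> 'a)
    \<Rightarrow> (('o, 'a) dobj, ('o, 'a) darr) mon_struct" where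
  "mon_str V b \<epsilon> \<eta> = \<lparr>prd = D_prd V,
     Phi = (\<lambda>ks xss. let n = fob (nested_func (D_prd V) ks) xss; p = fob (padded_func (D_prd V) ks) xss;
         e = tars V (map (tars V) (end_fam V \<epsilon> \<eta> (\<lambda>k. bar k - 1) ks xss)) in
       if b then DArr n (coherence V (car_fam xss) (nested_term ks) (padded_term ks) \<odot>\<^bsub>V\<^esub> e) p
       else DArr p (e \<odot>\<^bsub>V\<^esub> coherence V (car_fam xss) (padded_term ks) (nested_term ks)) n),
     phi = (\<lambda>ks xss. let n = fob (flat_func (D_prd V) ks) xss; p = fob (padded_func (D_prd V) ks) xss;
         e = tars V (concat (end_fam V \<epsilon> \<eta> Z ks xss)) in
       if b then DArr n (coherence V (car_fam xss) (flat_term ks) (padded_term ks) \<odot>\<^bsub>V\<^esub> e) p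
       else DArr p (e \<odot>\<^bsub>V\<^esub> coherence V (car_fam xss) (padded_term ks) (flat_term ks)) n),
     iota = Id (D_cat V)\<rparr>"

lemma D_bullet_mon_str: "D_bullet V = mon_str V True al be"
  by (simp add: D_bullet_def mon_str_def)

lemma D_circ_mon_str: "D_circ V = mon_str V False ka nu"
  by (simp add: D_circ_def mon_str_def)

context symmetric_monoidal_category begin

lemma D_prd_simps [simp]: "fob (D_prd V n) = D_tobs V" "far (D_prd V n) = D_tars V"
  by (simp_all add: D_prd_def)

lemma mon_str_simps [simp]: "prd (mon_str V b \<epsilon> \<eta>) = D_prd V" "iota (mon_str V b \<epsilon> \<eta>) = Id D"
  by (simp_all add: mon_str_def)

lemma prods_map: "map2 fob (map (D_prd V) (map length xss)) xss = map (D_tobs V) xss"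
  by (induction xss) simp_all

lemma prods_map_far: "map2 far (map (D_prd V) (map length fss)) fss = map (D_tars V) fss"
  by (induction fss) simp_all

lemma fob_prods: "fob (prod_func (map (D_prd V) (map length tss))) (map (map (Dval X)) tss) = map (Dval X) (map Tens tss)"
  using prods_map[of "map (map (Dval X)) tss"] by (simp add: prod_func_def o_def Dval_Tens)

lemma fob_pads: "fob (pads_func (D_prd V) (map length tss)) (map (map (Dval X)) tss) = map (Dval X) (padc tss)"
proof -
  have "concat (map2 fob (map (pad_func (D_prd V)) (map length tss)) (map (map (Dval X)) tss)) = map (Dval X) (padc tss)"
    by (induction tss) (simp_all add: padc_def pad_func_def comp_func_def single_func_def id_func_def
      Dval_Tens[of X "[]", simplified])
  thus ?thesis by (simp add: pads_func_def comp_func_def concat_func_def prod_func_def)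
qed

lemma fob_nested: "fob (nested_func (D_prd V) (map length tss)) (map (map (Dval X)) tss) = Dval X (Tens (map Tens tss))"
  using fob_prods[of tss X] by (simp add: nested_func_def comp_func_def Dval_Tens o_def)

lemma fob_padded: "fob (padded_func (D_prd V) (map length tss)) (map (map (Dval X)) tss) = Dval X (Tens (padc tss))"
  using fob_pads[of tss X] by (simp add: padded_func_def comp_func_def Dval_Tens)

lemma fob_flat: "fob (flat_func (D_prd V) (map length tss)) (map (map (Dval X)) tss) = Dval X (Tens (concat tss))"
  by (simp add: flat_func_def comp_func_def concat_func_def Dval_Tens map_concat)

text \<open>The coherence arrows in the structures, which are defined with index variables, are canonical for any family of
  terms that denote the given objects.\<close>
lemma coherence_fam:
  assumes X: "\<And>v. X v \<in> Ob D" and s: "\<And>r i. (r, i) \<in> set (vl s) \<Longrightarrow> r < length tss \<and> i < length (tss ! r)"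
    and "mset (vl s) = mset (vl t)" "distinct (vl s)"
  shows "canonical V (\<lambda>v. car (X v)) (tsub (fam_sub tss) s) (tsub (fam_sub tss) t)
    (coherence V (car_fam (map (map (Dval X)) tss)) s t)"
proof (rule canonical_tsub)
  interpret object_family V "\<lambda>v. car (X v)" using X by (rule object_familyI)
  have eq: "car_fam (map (map (Dval X)) tss) v = tval V (\<lambda>v. car (X v)) (fam_sub tss v)" if "v \<in> set (vl s)" for v
  proof -
    obtain r i where v: "v = (r, i)" by (cases v)
    show ?thesis using s[of r i] that by (simp add: v car_fam_def fam_sub_def)
  qed
  have "canonical V (car_fam (map (map (Dval X)) tss)) s t (coherence V (car_fam (map (map (Dval X)) tss)) s t)"
    by (rule coherence_canonical) (use assms eq in auto)
  from canonical_cong[OF this eq] show "canonical V (\<lambda>v. tval V (\<lambda>v. car (X v)) (fam_sub tss v)) s t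
    (coherence V (car_fam (map (map (Dval X)) tss)) s t)" .
qed

text \<open>The families of endomorphisms in the structures, as monomials attached to variables.\<close>
lemma end_fam_tmap:
  assumes X: "\<And>v. X v \<in> Ob D" and s: "\<epsilon> \<in> sels" "\<eta> \<in> sels" and d: "distinct (fvl tss)"
  shows "end_fam V \<epsilon> \<eta> c (map length tss) (map (map (Dval X)) tss)
    = map (map (tmap V (\<lambda>v. mor (endo \<epsilon> \<eta> X (after c tss) (before c tss) v)))) tss" (is "?l = ?r")
proof (rule nth_equalityI)
  show "length ?l = length ?r" by (simp add: end_fam_def)
  fix r assume "r < length ?l"
  hence r: "r < length tss" by (simp add: end_fam_def)
  show "?l ! r = ?r ! r"
  proof (rule nth_equalityI)
    show "length (?l ! r) = length (?r ! r)" using r by (simp add: end_fam_def)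
    fix i assume "i < length (?l ! r)"
    hence i: "i < length (tss ! r)" using r by (simp add: end_fam_def)
    let ?t = "tss ! r ! i"
    let ?m = "\<Sum>p = Suc r..<length tss. c (map length tss ! p)" and ?n = "\<Sum>p = 0..<r. c (map length tss ! p)"
    have h: "\<epsilon> (X v) \<in> hom V (car (X v)) (car (X v))" "\<eta> (X v) \<in> hom V (car (X v)) (car (X v))" for v
      using X s by (simp_all add: sel_hom)
    have "tmap V (\<lambda>v. mor (endo \<epsilon> \<eta> X (after c tss) (before c tss) v)) ?t
      = tmap V (\<lambda>v. apow V (\<epsilon> (X v)) ?m \<odot> apow V (\<eta> (X v)) ?n) ?t"
      by (rule tmap_cong) (simp add: endo_def after_nth[OF d r nth_mem[OF i]] before_nth[OF d r nth_mem[OF i]])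
    also have "\<dots> = tmap V (\<lambda>v. apow V (\<epsilon> (X v)) ?m) ?t \<odot> tmap V (\<lambda>v. apow V (\<eta> (X v)) ?n) ?t"
      by (rule tmap_comp[where A = "\<lambda>v. car (X v)" and B = "\<lambda>v. car (X v)" and C = "\<lambda>v. car (X v)"])
        (intro apow_typ h)+
    also have "\<dots> = apow V (\<epsilon> (Dval X ?t)) ?m \<odot> apow V (\<eta> (Dval X ?t)) ?n"
      using s by (simp add: sel_Dval apow_tmap[where A = "\<lambda>v. car (X v)" and e = "\<lambda>v. \<epsilon> (X v)", OF h(1)]
        apow_tmap[where A = "\<lambda>v. car (X v)" and e = "\<lambda>v. \<eta> (X v)", OF h(2)])
    finally show "?l ! r ! i = ?r ! r ! i"
      using r i by (simp add: end_fam_def)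
  qed
qed

text \<open>The following relation covers both directions: it is used for the structure \<open>\<bullet>\<close> on \<open>D\<close>, and
  for the structure \<open>\<circ>\<close> on the opposite category.\<close>
definition dgen :: "bool \<Rightarrow> ('v \<Rightarrow> ('o, 'a) darr) \<Rightarrow> 'v tterm \<Rightarrow> 'v tterm \<Rightarrow> ('o, 'a) darr \<Rightarrow> bool" where
  "dgen b h s t f \<longleftrightarrow> (if b then gen h s t f else gen h t s f)"

text \<open>The arrows \<open>\<Phi>\<close> and \<open>\<phi>\<close>, at families of objects that are denoted by terms.\<close>
lemma dgen_Phi:
  assumes X: "\<And>v. X v \<in> Ob D" and s: "\<epsilon> \<in> sels" "\<eta> \<in> sels" and d: "distinct (fvl tss)"
  shows "dgen b (endo \<epsilon> \<eta> X (after (\<lambda>k. bar k - 1) tss) (before (\<lambda>k. bar k - 1) tss))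
    (Tens (map Tens tss)) (Tens (padc tss)) (Phi (mon_str V b \<epsilon> \<eta>) (map length tss) (map (map (Dval X)) tss))"
proof -
  let ?E = "endo \<epsilon> \<eta> X (after (\<lambda>k. bar k - 1) tss) (before (\<lambda>k. bar k - 1) tss)"
  have e: "DArr (X v) (mor (?E v)) (X v) \<in> Ar D" for v
    using endo_ar[of X v, OF X s] by (simp add: endo_def)
  have eq: "(\<lambda>v. DArr (X v) (mor (?E v)) (X v)) = ?E" by (simp add: endo_def fun_eq_iff)
  have m: "tars V (map (tars V) (end_fam V \<epsilon> \<eta> (\<lambda>k. bar k - 1) (map length tss) (map (map (Dval X)) tss)))
     = tmap V (\<lambda>v. mor (?E v)) (Tens (map Tens tss))"
    by (subst end_fam_tmap[OF X s d]) (simp add: tmap_Tens o_def)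
  let ?c = "\<lambda>s t. coherence V (car_fam (map (map (Dval X)) tss)) s t"
  let ?n = "nested_term (map length tss)" and ?p = "padded_term (map length tss)"
  have 1: "canonical V (\<lambda>v. car (X v)) (Tens (map Tens tss)) (Tens (padc tss)) (?c ?n ?p)"
    by (rule coherence_fam[where X = X and tss = tss and s = ?n and t = ?p, OF X, unfolded sub_terms vl_terms])
      (simp_all only: idx_set idx_distinct simp_thms)
  have 2: "canonical V (\<lambda>v. car (X v)) (Tens (padc tss)) (Tens (map Tens tss)) (?c ?p ?n)"
    by (rule coherence_fam[where X = X and tss = tss and s = ?p and t = ?n, OF X, unfolded sub_terms vl_terms])
      (simp_all only: idx_set idx_distinct simp_thms)
  show ?thesis
    using gen_endo(1)[of X "\<lambda>v. mor (?E v)", OF e 1] gen_endo(2)[of X "\<lambda>v. mor (?E v)", OF e 2]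
    by (simp only: eq dgen_def) (simp add: mon_str_def Let_def fob_nested fob_padded m del: One_nat_def)
qed

lemma dgen_phi:
  assumes X: "\<And>v. X v \<in> Ob D" and s: "\<epsilon> \<in> sels" "\<eta> \<in> sels" and d: "distinct (fvl tss)"
  shows "dgen b (endo \<epsilon> \<eta> X (after Z tss) (before Z tss))
    (Tens (concat tss)) (Tens (padc tss)) (phi (mon_str V b \<epsilon> \<eta>) (map length tss) (map (map (Dval X)) tss))"
proof -
  let ?E = "endo \<epsilon> \<eta> X (after Z tss) (before Z tss)"
  have e: "DArr (X v) (mor (?E v)) (X v) \<in> Ar D" for v
    using endo_ar[of X v, OF X s] by (simp add: endo_def)
  have eq: "(\<lambda>v. DArr (X v) (mor (?E v)) (X v)) = ?E" by (simp add: endo_def fun_eq_iff)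
  have m: "tars V (concat (end_fam V \<epsilon> \<eta> Z (map length tss) (map (map (Dval X)) tss)))
     = tmap V (\<lambda>v. mor (?E v)) (Tens (concat tss))"
    by (subst end_fam_tmap[OF X s d]) (simp add: tmap_Tens map_concat)
  let ?c = "\<lambda>s t. coherence V (car_fam (map (map (Dval X)) tss)) s t"
  let ?n = "flat_term (map length tss)" and ?p = "padded_term (map length tss)"
  have 1: "canonical V (\<lambda>v. car (X v)) (Tens (concat tss)) (Tens (padc tss)) (?c ?n ?p)"
    by (rule coherence_fam[where X = X and tss = tss and s = ?n and t = ?p, OF X, unfolded sub_terms vl_terms])
      (simp_all only: idx_set idx_distinct simp_thms)
  have 2: "canonical V (\<lambda>v. car (X v)) (Tens (padc tss)) (Tens (concat tss)) (?c ?p ?n)"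
    by (rule coherence_fam[where X = X and tss = tss and s = ?p and t = ?n, OF X, unfolded sub_terms vl_terms])
      (simp_all only: idx_set idx_distinct simp_thms)
  show ?thesis
    using gen_endo(1)[of X "\<lambda>v. mor (?E v)", OF e 1] gen_endo(2)[of X "\<lambda>v. mor (?E v)", OF e 2]
    by (simp only: eq dgen_def) (simp add: mon_str_def Let_def fob_flat fob_padded m)
qed

lemma columns_map: "(\<And>xs. xs \<in> set xss \<Longrightarrow> length xs = p) \<Longrightarrow> columns p (map (map f) xss) = map (map f) (columns p xss)"
  by (simp add: columns_def)

text \<open>The arrows \<open>\<xi>\<close>, without endomorphisms.\<close>
lemma gen_xi:
  assumes X: "\<And>v. X v \<in> Ob D" and l: "length tss = n" "\<And>ts. ts \<in> set tss \<Longrightarrow> length ts = p"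
  shows "gen (\<lambda>v. Id D (X v)) (Tens (map Tens tss)) (Tens (map Tens (columns p tss)))
    (D_xi V p n (map (map (Dval X)) tss))"
proof -
  let ?s = "Tens (map (\<lambda>r. Tens (map (\<lambda>s. Var (r, s)) [0..<p])) [0..<n])"
  let ?t = "Tens (map (\<lambda>s. Tens (map (\<lambda>r. Var (r, s)) [0..<n])) [0..<p])"
  have vs: "vl ?s = concat (map (\<lambda>r. map (Pair r) [0..<p]) [0..<n])"
    and vt: "vl ?t = concat (map (\<lambda>s. map (\<lambda>r. (r, s)) [0..<n]) [0..<p])"
    by (simp_all add: vl_Tens o_def)
  have ds: "distinct (concat (map (\<lambda>r. map (Pair r) [0..<p]) rs))" if "distinct rs" for rs :: "nat list"
    using that by (induction rs) (auto simp: distinct_map inj_on_def)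
  have dt: "distinct (concat (map (\<lambda>s. map (\<lambda>r. (r, s)) [0..<n]) rs))" if "distinct rs" for rs :: "nat list"
    using that by (induction rs) (auto simp: distinct_map inj_on_def)
  have m: "mset (vl ?s) = mset (vl ?t)"
    by (subst set_eq_iff_mset_eq_distinct[symmetric]) (auto simp: vs vt intro: ds dt)
  have st: "tsub (fam_sub tss) ?s = Tens (map Tens tss)"
  proof -
    have "map (\<lambda>s. tss ! r ! s) [0..<p] = tss ! r" if "r < n" for r
      using that l by (auto intro!: nth_equalityI)
    hence "map (\<lambda>r. Tens (map (\<lambda>s. tss ! r ! s) [0..<p])) [0..<n] = map Tens tss"
      using l(1) by (intro nth_equalityI) simp_all
    thus ?thesis by (simp add: tsub_Tens o_def fam_sub_def)
  qed
  have "map (\<lambda>r. tss ! r ! s) [0..<n] = map (\<lambda>ts. ts ! s) tss" for s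
    using l(1) by (intro nth_equalityI) simp_all
  hence tt: "tsub (fam_sub tss) ?t = Tens (map Tens (columns p tss))"
    by (simp add: tsub_Tens o_def fam_sub_def columns_def)
  have "canonical V (\<lambda>v. car (X v)) (tsub (fam_sub tss) ?s) (tsub (fam_sub tss) ?t)
      (coherence V (car_fam (map (map (Dval X)) tss)) ?s ?t)"
    by (rule coherence_fam[OF X _ m]) (use l in \<open>auto simp: vs ds\<close>)
  from gen_canonical[OF X this[unfolded st tt]]
  show ?thesis using l(2)
    by (simp add: D_xi_def columns_map Dval_Tens o_def)
qed

end

section \<open>Exponents for grouped families\<close>

text \<open>Sums over the groups after, resp. before, the group that contains a variable, with an
  additional contribution of this group.\<close>
primrec gaft :: "('v tterm list list \<Rightarrow> nat) \<Rightarrow> ('v tterm list list \<Rightarrow> 'v \<Rightarrow> nat) \<Rightarrow> 'v tterm list list list \<Rightarrow> 'v \<Rightarrow> nat" where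
  "gaft w i [] v = 0"
| "gaft w i (tss # tsss) v = (if v \<in> set (fvl tss) then i tss v + sum_list (map w tsss) else gaft w i tsss v)"

primrec gbef :: "('v tterm list list \<Rightarrow> nat) \<Rightarrow> ('v tterm list list \<Rightarrow> 'v \<Rightarrow> nat) \<Rightarrow> 'v tterm list list list \<Rightarrow> 'v \<Rightarrow> nat" where
  "gbef w i [] v = 0"
| "gbef w i (tss # tsss) v = (if v \<in> set (fvl tss) then i tss v else w tss + gbef w i tsss v)"

lemma gaft_add: "gaft w i tsss v + gaft w' i' tsss v = gaft (\<lambda>tss. w tss + w' tss) (\<lambda>tss v. i tss v + i' tss v) tsss v"
  by (induction tsss) (simp_all add: sum_list_addf)

lemma gbef_add: "gbef w i tsss v + gbef w' i' tsss v = gbef (\<lambda>tss. w tss + w' tss) (\<lambda>tss v. i tss v + i' tss v) tsss v"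
  by (induction tsss) simp_all

lemma gaft_cong:
  assumes "\<And>tss. w tss = w' tss" "\<And>tss. v \<in> set (fvl tss) \<Longrightarrow> i tss v = i' tss v"
  shows "gaft w i tsss v = gaft w' i' tsss v"
proof -
  have "w = w'" using assms(1) by (rule ext)
  thus ?thesis using assms(2) by (induction tsss) simp_all
qed

lemma gbef_cong:
  assumes "\<And>tss. w tss = w' tss" "\<And>tss. v \<in> set (fvl tss) \<Longrightarrow> i tss v = i' tss v"
  shows "gbef w i tsss v = gbef w' i' tsss v"
  using assms by (induction tsss) simp_all

lemma fvl_append: "fvl (tss @ uss) = fvl tss @ fvl uss"
  by (simp add: fvl_def)

lemma gaft_gbef_group:
  assumes "distinct (fvl (concat tsss))" "tss \<in> set tsss" "v \<in> set (fvl tss)"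
  shows "gaft (\<lambda>_. 0) i tsss v = i tss v" "gbef (\<lambda>_. 0) i tsss v = i tss v"
proof -
  have m: "v \<in> set (fvl (concat tsss'))" if "tss \<in> set tsss'" "v \<in> set (fvl tss)" for tss and tsss' :: "'a tterm list list list"
    using that by (auto simp: fvl_def)
  show "gaft (\<lambda>_. 0) i tsss v = i tss v" "gbef (\<lambda>_. 0) i tsss v = i tss v"
    using assms m by (induction tsss) (auto simp: fvl_append)
qed

lemma after_append: "after c (tss @ uss) v = (if v \<in> set (fvl tss) then after c tss v + wt c uss else after c uss v)"
  by (induction tss) (auto simp: fvl_Cons fvl_def)

lemma before_append: "before c (tss @ uss) v = (if v \<in> set (fvl tss) then before c tss v else wt c tss + before c uss v)"
  by (induction tss) (auto simp: fvl_Cons fvl_def)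

lemma after_rows:
  assumes "\<And>tss. concat (map vl (f tss)) = fvl tss"
  shows "after c (map f tsss) v = gaft (\<lambda>tss. c (length (f tss))) (\<lambda>_ _. 0) tsss v"
    and "before c (map f tsss) v = gbef (\<lambda>tss. c (length (f tss))) (\<lambda>_ _. 0) tsss v"
proof -
  have s: "set (concat (map vl (f tss))) = set (fvl tss)" for tss by (simp only: assms)
  show "after c (map f tsss) v = gaft (\<lambda>tss. c (length (f tss))) (\<lambda>_ _. 0) tsss v"
    by (induction tsss) (simp_all only: after.simps list.map s gaft.simps, simp add: o_def)
  show "before c (map f tsss) v = gbef (\<lambda>tss. c (length (f tss))) (\<lambda>_ _. 0) tsss v"
    by (induction tsss) (simp_all only: before.simps list.map s gbef.simps)
qed

lemma wt_concat: "wt c (concat (map g tsss)) = sum_list (map (\<lambda>tss. wt c (g tss)) tsss)"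
  by (induction tsss) simp_all

lemma after_chunks:
  assumes "\<And>tss. fvl (g tss) = fvl tss"
  shows "after c (concat (map g tsss)) v = gaft (\<lambda>tss. wt c (g tss)) (\<lambda>tss. after c (g tss)) tsss v"
    and "before c (concat (map g tsss)) v = gbef (\<lambda>tss. wt c (g tss)) (\<lambda>tss. before c (g tss)) tsss v"
  by (induction tsss) (simp_all add: after_append before_append assms wt_concat)

text \<open>The contributions of one group to the families indexed by the sequences written with a tilde and with a hat.\<close>
definition tild :: "'v tterm list list \<Rightarrow> 'v tterm list list" where
  "tild tss = (if tss = [] then [[]] else tss)"

definition hatt :: "'v tterm list list \<Rightarrow> 'v tterm list list" where
  "hatt tss = (if tss = [] then [[Unit]] else if concat tss = [] then [Unit] # replicate (length tss - 1) [] else tss)"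

lemma fvl_tild [simp]: "fvl (tild tss) = fvl tss"
  by (simp add: tild_def fvl_def)

lemma concat_hatt: "concat (hatt tss) = (if concat tss = [] then [Unit] else concat tss)"
  by (auto simp: hatt_def)

lemma fvl_hatt [simp]: "fvl (hatt tss) = fvl tss"
  by (cases "concat tss = []") (simp_all add: fvl_def concat_hatt del: concat_eq_Nil_conv)

lemma vl_map_Tens: "concat (map vl (map Tens tss)) = fvl tss"
  using vl_nested[of tss] by (simp add: vl_Tens)

lemma vl_padc: "concat (map vl (padc tss)) = fvl tss"
  using vl_padded[of tss] by (simp add: vl_Tens)

lemma vl_concat: "concat (map vl (concat tss)) = fvl tss"
  by (simp add: fvl_def)

lemma after_tild: "v \<in> set (fvl tss) \<Longrightarrow> after c (tild tss) v = after c tss v"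
  and before_tild: "v \<in> set (fvl tss) \<Longrightarrow> before c (tild tss) v = before c tss v"
  by (auto simp: tild_def fvl_def)

lemma after_hatt: "v \<in> set (fvl tss) \<Longrightarrow> after c (hatt tss) v = after c tss v"
  and before_hatt: "v \<in> set (fvl tss) \<Longrightarrow> before c (hatt tss) v = before c tss v"
  by (auto simp: hatt_def fvl_def)

lemma length_padc: "length (padc tss) = KZ (map length tss)"
  by (induction tss) (simp_all add: padc_def KZ_def Z_def)

text \<open>The function \<open>k \<mapsto> bar k - 1\<close>.\<close>
abbreviation db :: "nat \<Rightarrow> nat" where
  "db \<equiv> \<lambda>k. bar k - 1"

lemma length_padc_db: "length (padc tss) = wt db tss + length tss"
proof (induction tss)
  case (Cons ts tss)
  thus ?case by (cases ts) (simp_all add: padc_def bar_def Z_def)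
qed (simp add: padc_def)

lemma wt_tild: "wt db (tild tss) = wt db tss"
  by (simp add: tild_def bar_def Z_def)

lemma db_Z_pos: "n > 0 \<Longrightarrow> db n = n - 1" "n > 0 \<Longrightarrow> Z n = 0"
  by (simp_all add: bar_def Z_def)

text \<open>The contributions of one group to the exponents of variables in the other groups agree in each of the four
  associativity axioms.\<close>
lemma weight_Phi_Phi: "db (length tss) + wt db (tild tss) = db (length (padc tss))"
proof (cases "tss = []")
  case False
  hence l: "length tss > 0" by simp
  hence "db (length (padc tss)) = length (padc tss) - 1" by (intro db_Z_pos) (simp add: length_padc_db)
  thus ?thesis using l unfolding db_Z_pos(1)[OF l] wt_tild length_padc_db by linarith
qed (simp add: tild_def padc_def bar_def Z_def)

lemma weight_Phi_phi: "Z (length tss) + wt db (tild tss) = Z (length (padc tss)) + wt db tss"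
proof (cases "tss = []")
  case False
  hence l: "length tss > 0" by simp
  hence "Z (length (padc tss)) = 0" by (intro db_Z_pos) (simp add: length_padc_db)
  thus ?thesis unfolding db_Z_pos(2)[OF l] wt_tild by simp
qed (simp add: tild_def padc_def bar_def Z_def)

lemma wt_Z_hatt: "wt Z (hatt tss) = (if tss = [] then 0 else if concat tss = [] then length tss - 1 else wt Z tss)"
  by (auto simp: hatt_def Z_def sum_list_replicate)

lemma wt_Z_empty: "concat tss = [] \<Longrightarrow> wt Z tss = length tss"
  by (induction tss) (auto simp: Z_def)

lemma length_padc': "length (padc tss) = length (concat tss) + wt Z tss"
  by (simp add: length_padc KZ_def length_concat o_def)

lemma weight_phi_Phi: "db (length (padc tss)) = db (length (concat tss)) + wt Z (hatt tss)"
proof (cases "concat tss = []")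
  case True
  show ?thesis unfolding length_padc' wt_Z_hatt wt_Z_empty[OF True] True by (cases tss) (simp_all add: bar_def Z_def True)
next
  case False
  hence l: "length (concat tss) > 0" by simp
  hence p: "length (concat tss) + wt Z tss > 0" by simp
  have "wt Z (hatt tss) = wt Z tss" using False unfolding wt_Z_hatt by auto
  thus ?thesis using l unfolding length_padc' db_Z_pos(1)[OF l] db_Z_pos(1)[OF p] by linarith
qed

lemma weight_phi_phi: "Z (length (padc tss)) + wt Z tss = Z (length (concat tss)) + wt Z (hatt tss)"
proof (cases "concat tss = []")
  case True
  show ?thesis unfolding length_padc' wt_Z_hatt wt_Z_empty[OF True] True by (cases tss) (simp_all add: Z_def True)
next
  case False
  hence "length (concat tss) > 0" by simp
  thus ?thesis using False
    by (simp only: length_padc' wt_Z_hatt) (auto simp: Z_def)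
qed

lemmas group_simps = after_rows[OF vl_map_Tens] after_rows[OF vl_padc] after_rows[OF vl_concat]
  after_chunks[where g = tild, OF fvl_tild] after_chunks[where g = hatt, OF fvl_hatt]

lemmas after_concat = after_chunks[where g = "\<lambda>tss. tss", OF refl, simplified]

text \<open>The exponents in the four associativity axioms.\<close>
lemma exponents_Phi_Phi:
  "after db (map (map Tens) tsss) v + after db (concat (map tild tsss)) v
    = gaft (\<lambda>_. 0) (after db) tsss v + after db (map padc tsss) v"
  "before db (map (map Tens) tsss) v + before db (concat (map tild tsss)) v
    = gbef (\<lambda>_. 0) (before db) tsss v + before db (map padc tsss) v"
  by (simp_all only: group_simps, simp_all only: after_concat gaft_add gbef_add)
    (rule gaft_cong gbef_cong; simp only: weight_Phi_Phi[symmetric] length_map after_tild before_tild add_0 add_0_right)+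

lemma exponents_Phi_phi:
  "after Z (map (map Tens) tsss) v + after db (concat (map tild tsss)) v
    = after db (concat tsss) v + after Z (map padc tsss) v"
  "before Z (map (map Tens) tsss) v + before db (concat (map tild tsss)) v
    = before db (concat tsss) v + before Z (map padc tsss) v"
  by (simp_all only: group_simps, simp_all only: after_concat gaft_add gbef_add)
    (rule gaft_cong gbef_cong; simp only: weight_Phi_phi length_map after_tild before_tild add_0 add_0_right add.commute)+

lemma exponents_phi_Phi:
  "gaft (\<lambda>_. 0) (after Z) tsss v + after db (map padc tsss) v
    = after db (map concat tsss) v + after Z (concat (map hatt tsss)) v"
  "gbef (\<lambda>_. 0) (before Z) tsss v + before db (map padc tsss) v
    = before db (map concat tsss) v + before Z (concat (map hatt tsss)) v"
  by (simp_all only: group_simps, simp_all only: after_concat gaft_add gbef_add)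
    (rule gaft_cong gbef_cong; simp only: weight_phi_Phi after_hatt before_hatt add_0 add_0_right)+

lemma exponents_phi_phi:
  "after Z (concat tsss) v + after Z (map padc tsss) v
    = after Z (map concat tsss) v + after Z (concat (map hatt tsss)) v"
  "before Z (concat tsss) v + before Z (map padc tsss) v
    = before Z (map concat tsss) v + before Z (concat (map hatt tsss)) v"
  by (simp_all only: group_simps, simp_all only: after_concat gaft_add gbef_add)
    (rule gaft_cong gbef_cong; simp only: weight_phi_phi[symmetric] add.commute after_hatt before_hatt add_0 add_0_right)+

text \<open>The sources, targets and intermediate terms in the four associativity axioms.\<close>
lemma terms_tild: "map Tens (concat (map tild tsss)) = padc (map (map Tens) tsss)"
  by (induction tsss) (simp_all add: tild_def padc_def)

lemma padc_eq_Nil: "padc tss = [] \<longleftrightarrow> tss = []"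
  by (cases tss) (simp_all add: padc_def)

lemma padc_append: "padc (tss @ uss) = padc tss @ padc uss"
  by (simp add: padc_def)

lemma padc_concat: "padc (concat tsss) = concat (map padc tsss)"
  by (induction tsss) (simp_all add: padc_append, simp add: padc_def)

lemma padc_Cons: "padc (ts # tss) = (if ts = [] then [Unit] else ts) @ padc tss"
  by (simp add: padc_def)

lemma padc_tild: "padc (concat (map tild tsss)) = padc (map padc tsss)"
  by (induction tsss) (simp_all add: padc_append padc_Cons padc_eq_Nil tild_def)

lemma padc_empty: "concat tss = [] \<Longrightarrow> padc tss = replicate (length tss) Unit"
  by (induction tss) (simp_all add: padc_def)

lemma padc_replicate: "padc (replicate n []) = replicate n Unit"
  by (simp add: padc_empty)

lemma padc_hatt: "padc (hatt tss) = (if padc tss = [] then [Unit] else padc tss)"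
  by (cases tss) (auto simp: hatt_def padc_empty padc_Cons padc_replicate)

lemma padc_hatts: "padc (concat (map hatt tsss)) = padc (map padc tsss)"
  by (induction tsss) (simp_all add: padc_append padc_Cons padc_hatt)

lemma concat_hatts: "concat (concat (map hatt tsss)) = padc (map concat tsss)"
  by (induction tsss) (simp_all add: padc_Cons concat_hatt, simp add: padc_def)

lemma concat_Tens: "concat (map (map Tens) tsss) = map Tens (concat tsss)"
  by (simp add: map_concat)

lemma fvl_groups: "(\<And>tss. concat (map vl (f tss)) = fvl tss) \<Longrightarrow> fvl (map f tsss) = fvl (concat tsss)"
  "(\<And>tss. fvl (g tss) = fvl tss) \<Longrightarrow> fvl (concat (map g tsss)) = fvl (concat tsss)"
proof -
  have a: "fvl (x @ y) = fvl x @ fvl y" for x y :: "'a tterm list list" by (simp add: fvl_def)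
  show "(\<And>tss. concat (map vl (f tss)) = fvl tss) \<Longrightarrow> fvl (map f tsss) = fvl (concat tsss)"
    by (induction tsss) (simp_all add: fvl_Cons a)
  show "(\<And>tss. fvl (g tss) = fvl tss) \<Longrightarrow> fvl (concat (map g tsss)) = fvl (concat tsss)"
    by (induction tsss) (simp_all add: a)
qed

context symmetric_monoidal_category begin

section \<open>The two monoidal structures\<close>

text \<open>The extension of \<open>gen\<close> to lists of terms and arrows.\<close>
inductive gens :: "('v \<Rightarrow> ('o, 'a) darr) \<Rightarrow> 'v tterm list \<Rightarrow> 'v tterm list \<Rightarrow> ('o, 'a) darr list \<Rightarrow> bool"
  for h where
  gens_Nil: "gens h [] [] []"
| gens_Cons: "gen h s t f \<Longrightarrow> gens h ss ts fs \<Longrightarrow> gens h (s # ss) (t # ts) (f # fs)"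

lemma gens_append: "gens h ss ts fs \<Longrightarrow> gens h ss' ts' fs' \<Longrightarrow> gens h (ss @ ss') (ts @ ts') (fs @ fs')"
  by (induction rule: gens.induct) (auto intro: gens.intros)

lemma gens_map: "(\<And>i. i \<in> set is \<Longrightarrow> gen h (S i) (T i) (F i)) \<Longrightarrow> gens h (map S is) (map T is) (map F is)"
  by (induction "is") (auto intro: gens.intros)

lemma gens_concat: "(\<And>i. i \<in> set is \<Longrightarrow> gens h (S i) (T i) (F i))
    \<Longrightarrow> gens h (concat (map S is)) (concat (map T is)) (concat (map F is))"
  by (induction "is") (auto intro: gens.intros gens_append)

lemma gens_Tens:
  assumes h: "\<And>v. h v \<in> Ar D" and g: "gens h ss ts fs"
  shows "gen h (Tens ss) (Tens ts) (D_tars V fs)"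
proof -
  let ?z = "zip ss (zip ts fs)"
  from g have z: "ss = map fst ?z" "ts = map (\<lambda>i. fst (snd i)) ?z" "fs = map (\<lambda>i. snd (snd i)) ?z"
    "\<forall>i\<in>set ?z. gen h (fst i) (fst (snd i)) (snd (snd i))"
    by (induction rule: gens.induct) auto
  have "gen h (Tens (map fst ?z)) (Tens (map (\<lambda>i. fst (snd i)) ?z)) (D_tars V (map (\<lambda>i. snd (snd i)) ?z))"
    by (rule gen_Tens[OF h]) (use z(4) in blast)
  thus ?thesis by (simp only: z(1-3)[symmetric])
qed

lemma gens_Vars: "(\<And>v. h v \<in> Ar D) \<Longrightarrow> gens h (map Var vs) (map Var vs) (map h vs)"
  by (rule gens_map) (rule gen_Var)

lemma gens_id: "(\<And>v. X v \<in> Ob D) \<Longrightarrow> gens (\<lambda>v. Id D (X v)) ts ts (map (Id D) (map (Dval X) ts))"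
  using gens_map[of ts "\<lambda>v. Id D (X v)" "\<lambda>t. t" "\<lambda>t. t" "\<lambda>t. Id D (Dval X t)"] gen_id[of X]
  by (simp add: o_def)

lemma gens_Tens_map:
  assumes h: "\<And>v. h v \<in> Ar D" and "\<And>i. i \<in> set is \<Longrightarrow> gens h (S i) (T i) (F i)"
  shows "gens h (map (\<lambda>i. Tens (S i)) is) (map (\<lambda>i. Tens (T i)) is) (map (\<lambda>i. D_tars V (F i)) is)"
  by (rule gens_map) (rule gens_Tens[OF h assms(2)])

text \<open>The values of the functors in the definition of a monoidal structure, on families of arrows.\<close>

lemma far_prods: "far (prod_func (map (D_prd V) (map length fss))) fss = map (D_tars V) fss"
  using prods_map_far[of fss] by (simp add: prod_func_def)

lemma far_pads: "far (pads_func (D_prd V) (map length fss)) fss = concat (map (\<lambda>fs. if fs = [] then [D_tars V []] else fs) fss)"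
proof -
  have "map2 far (map (pad_func (D_prd V)) (map length fss)) fss = map (\<lambda>fs. if fs = [] then [D_tars V []] else fs) fss"
    by (induction fss) (auto simp: pad_func_def comp_func_def single_func_def id_func_def)
  thus ?thesis by (simp add: pads_func_def comp_func_def concat_func_def prod_func_def)
qed

lemma gens_pads:
  assumes h: "\<And>v. h v \<in> Ar D"
  shows "gens h (padc (map (map Var) vss)) (padc (map (map Var) vss))
    (concat (map (\<lambda>fs. if fs = [] then [D_tars V []] else fs) (map (map h) vss)))"
proof -
  have "gens h (if vs = [] then [Unit] else map Var vs) (if vs = [] then [Unit] else map Var vs)
      (if vs = [] then [D_tars V []] else map h vs)" for vs
    using gens_Cons[OF gens_Tens[where h = h, OF h gens_Nil] gens_Nil] gens_Vars[where h = h and vs = vs, OF h] by simp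
  from gens_concat[of vss h, OF this] show ?thesis by (simp add: padc_def o_def if_distrib cong: if_cong)
qed

lemma gen_nested:
  assumes h: "\<And>v. h v \<in> Ar D" and ks: "map length vss = ks"
  shows "gen h (Tens (map Tens (map (map Var) vss))) (Tens (map Tens (map (map Var) vss)))
    (far (nested_func (D_prd V) ks) (map (map h) vss))"
proof -
  have ks': "ks = map length (map (map h) vss)" using ks by (simp add: o_def)
  have "gens h (map (\<lambda>vs. Tens (map Var vs)) vss) (map (\<lambda>vs. Tens (map Var vs)) vss) (map (\<lambda>vs. D_tars V (map h vs)) vss)"
    by (rule gens_Tens_map[OF h gens_Vars[OF h]])
  from gens_Tens[OF h this] show ?thesis
    using far_prods[of "map (map h) vss"]
    unfolding nested_func_def comp_func_def ks' by (simp add: o_def)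
qed

lemma gen_padded:
  assumes h: "\<And>v. h v \<in> Ar D" and ks: "map length vss = ks"
  shows "gen h (Tens (padc (map (map Var) vss))) (Tens (padc (map (map Var) vss)))
    (far (padded_func (D_prd V) ks) (map (map h) vss))"
proof -
  have ks': "ks = map length (map (map h) vss)" using ks by (simp add: o_def)
  show ?thesis
    using gens_Tens[OF h gens_pads[OF h]] far_pads[of "map (map h) vss"]
    unfolding padded_func_def comp_func_def ks' by simp
qed

lemma gen_flat:
  assumes h: "\<And>v. h v \<in> Ar D"
  shows "gen h (Tens (concat (map (map Var) vss))) (Tens (concat (map (map Var) vss)))
    (far (flat_func (D_prd V) ks) (map (map h) vss))"
  using gens_Tens[OF h gens_Vars[where h = h and vs = "concat vss", OF h]]
  by (simp add: flat_func_def comp_func_def concat_func_def map_concat)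

lemma fvl_Vars [simp]: "fvl (map (map Var) vss) = concat vss"
  by (simp add: fvl_def map_concat o_def) (induction vss; simp add: o_def)

lemma Dval_Vars: "map (map (Dval X)) (map (map Var) vss) = map (map X) vss"
  by (simp add: o_def)

lemma fob_Vars:
  assumes "map length vss = ks"
  shows "fob (nested_func (D_prd V) ks) (map (map X) vss) = Dval X (Tens (map Tens (map (map Var) vss)))"
    "fob (padded_func (D_prd V) ks) (map (map X) vss) = Dval X (Tens (padc (map (map Var) vss)))"
    "fob (flat_func (D_prd V) ks) (map (map X) vss) = Dval X (Tens (concat (map (map Var) vss)))"
proof -
  have ks: "map length (map (map Var) vss) = ks" using assms by (simp add: o_def)
  show "fob (nested_func (D_prd V) ks) (map (map X) vss) = Dval X (Tens (map Tens (map (map Var) vss)))"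
    "fob (padded_func (D_prd V) ks) (map (map X) vss) = Dval X (Tens (padc (map (map Var) vss)))"
    "fob (flat_func (D_prd V) ks) (map (map X) vss) = Dval X (Tens (concat (map (map Var) vss)))"
    using fob_nested[of "map (map Var) vss" X] fob_padded[of "map (map Var) vss" X] fob_flat[of "map (map Var) vss" X]
    unfolding ks Dval_Vars by simp_all
qed

lemma apow_natural:
  assumes "m \<in> hom V a b" "f \<in> hom V a a" "g \<in> hom V b b" "m \<odot> f = g \<odot> m"
  shows "m \<odot> apow V f n = apow V g n \<odot> m"
proof (induction n)
  case (Suc n)
  note [simp] = homD[OF assms(1)] homD[OF assms(2)] homD[OF assms(3)] homD[OF apow_typ[OF assms(2)]] homD[OF apow_typ[OF assms(3)]]
  have "m \<odot> apow V f (Suc n) = (m \<odot> f) \<odot> apow V f n" by simp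
  also have "\<dots> = g \<odot> (m \<odot> apow V f n)" by (simp only: assms(4)) simp
  also have "\<dots> = apow V g (Suc n) \<odot> m" by (simp add: Suc)
  finally show ?case .
qed (use assms in \<open>auto simp: hom_def\<close>)

lemma endo_natural:
  assumes h: "h v \<in> Ar D" and s: "\<epsilon> \<in> sels" "\<eta> \<in> sels"
  shows "endo \<epsilon> \<eta> (\<lambda>v. tgt (h v)) i j v \<odot>\<^bsub>D\<^esub> h v = h v \<odot>\<^bsub>D\<^esub> endo \<epsilon> \<eta> (\<lambda>v. src (h v)) i j v"
proof -
  let ?x = "src (h v)" and ?y = "tgt (h v)"
  have xy: "?x \<in> Ob D" "?y \<in> Ob D" using D_arD[OF h] by auto
  have n: "mor (h v) \<odot> apow V (\<theta> ?x) n = apow V (\<theta> ?y) n \<odot> mor (h v)"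
    and t: "apow V (\<theta> ?x) n \<in> hom V (car ?x) (car ?x)" "apow V (\<theta> ?y) n \<in> hom V (car ?y) (car ?y)" if "\<theta> \<in> sels" for \<theta> n
    using apow_natural[OF mor_hom[OF h] sel_hom[OF xy(1) that] sel_hom[OF xy(2) that] D_arD(6)[OF h that]]
      apow_typ[OF sel_hom[OF xy(1) that]] apow_typ[OF sel_hom[OF xy(2) that]] by blast+
  note [simp] = homD[OF t(1)[OF s(1)]] homD[OF t(2)[OF s(1)]] homD[OF t(1)[OF s(2)]] homD[OF t(2)[OF s(2)]] homD[OF mor_hom[OF h]]
  have "(apow V (\<epsilon> ?y) (i v) \<odot> apow V (\<eta> ?y) (j v)) \<odot> mor (h v) = apow V (\<epsilon> ?y) (i v) \<odot> (mor (h v) \<odot> apow V (\<eta> ?x) (j v))"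
    by (simp add: n[OF s(2)])
  also have "\<dots> = (apow V (\<epsilon> ?y) (i v) \<odot> mor (h v)) \<odot> apow V (\<eta> ?x) (j v)"
    by simp
  also have "\<dots> = mor (h v) \<odot> apow V (\<epsilon> ?x) (i v) \<odot> apow V (\<eta> ?x) (j v)"
    by (simp flip: n[OF s(1)])
  finally show ?thesis by (simp add: endo_def)
qed

text \<open>Monomials commute with all arrows of \<open>D\<close>, so that arrows given by monomials are natural.\<close>
lemma dgen_nat_trans:
  assumes P: "shape P ob ar" and s: "distinct (vl s)" and t: "distinct (vl t)" and sels: "\<epsilon> \<in> sels" "\<eta> \<in> sels"
    and F: "\<And>X. (\<And>v. X v \<in> Ob D) \<Longrightarrow> fob F (ob X) = Dval X s" "\<And>h. (\<And>v. h v \<in> Ar D) \<Longrightarrow> gen h s s (far F (ar h))"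
    and G: "\<And>X. (\<And>v. X v \<in> Ob D) \<Longrightarrow> fob G (ob X) = Dval X t" "\<And>h. (\<And>v. h v \<in> Ar D) \<Longrightarrow> gen h t t (far G (ar h))"
    and \<tau>: "\<And>X. (\<And>v. X v \<in> Ob D) \<Longrightarrow> dgen b (endo \<epsilon> \<eta> X i j) s t (\<tau> (ob X))"
  shows "nat_trans P D (if b then F else G) (if b then G else F) \<tau>"
proof -
  have e: "endo \<epsilon> \<eta> X i j v \<in> Ar D \<and> src (endo \<epsilon> \<eta> X i j v) = X v \<and> tgt (endo \<epsilon> \<eta> X i j v) = X v" if "X v \<in> Ob D" for X v
    using endo_ar[of X v, OF that sels] by simp
  note en = endo_natural[OF _ sels]
  show ?thesis
  proof (cases b)
    case True
    have "nat_trans P D F G \<tau>"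
      by (rule shape_nat_trans[OF P s t F G, where e = "\<lambda>X. endo \<epsilon> \<eta> X i j", OF _ _ _ _ e en])
        (use \<tau> True in \<open>simp_all add: dgen_def\<close>)
    thus ?thesis using True by simp
  next
    case False
    have "nat_trans P D G F \<tau>"
      by (rule shape_nat_trans[OF P t s G F, where e = "\<lambda>X. endo \<epsilon> \<eta> X i j", OF _ _ _ _ e en])
        (use \<tau> False in \<open>simp_all add: dgen_def\<close>)
    thus ?thesis using False by simp
  qed
qed

lemma Phi_mon_nat:
  assumes s: "\<epsilon> \<in> sels" "\<eta> \<in> sels"
  shows "nat_trans (powers_cat D ks) D (if b then nested_func (D_prd V) ks else padded_func (D_prd V) ks)
    (if b then padded_func (D_prd V) ks else nested_func (D_prd V) ks) (Phi (mon_str V b \<epsilon> \<eta>) ks)"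
  and "nat_trans (powers_cat D ks) D (if b then flat_func (D_prd V) ks else padded_func (D_prd V) ks)
    (if b then padded_func (D_prd V) ks else flat_func (D_prd V) ks) (phi (mon_str V b \<epsilon> \<eta>) ks)"
proof -
  let ?tss = "map (map Var) (idx ks) :: (nat \<times> nat) tterm list list"
  have ks: "map length (idx ks) = ks" "map length ?tss = ks" using idx_length[of ks] by (simp_all only: map_map o_def length_map)
  have d: "distinct (fvl ?tss)" by (simp del: distinct_concat_iff)
  have dn: "distinct (vl (Tens (map Tens ?tss)))" and dp: "distinct (vl (Tens (padc ?tss)))" and df: "distinct (vl (Tens (concat ?tss)))"
    using d by (simp_all only: vl_nested vl_padded vl_flat)
  note P = shape_powers[OF idx_distinct ks(1)] and f = fob_Vars[OF ks(1)]
    and g = gen_nested[OF _ ks(1)] gen_padded[OF _ ks(1)] gen_flat[where vss = "idx ks"]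
  have t: "dgen b (endo \<epsilon> \<eta> X (after db ?tss) (before db ?tss)) (Tens (map Tens ?tss)) (Tens (padc ?tss)) (Phi (mon_str V b \<epsilon> \<eta>) ks (map (map X) (idx ks)))"
    "dgen b (endo \<epsilon> \<eta> X (after Z ?tss) (before Z ?tss)) (Tens (concat ?tss)) (Tens (padc ?tss)) (phi (mon_str V b \<epsilon> \<eta>) ks (map (map X) (idx ks)))"
    if "\<And>v. X v \<in> Ob D" for X
    using dgen_Phi[where X = X, OF that s d] dgen_phi[where X = X, OF that s d] unfolding Dval_Vars ks(2) by blast+
  show "nat_trans (powers_cat D ks) D (if b then nested_func (D_prd V) ks else padded_func (D_prd V) ks)
    (if b then padded_func (D_prd V) ks else nested_func (D_prd V) ks) (Phi (mon_str V b \<epsilon> \<eta>) ks)"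
    by (rule dgen_nat_trans[OF P dn dp s f(1) g(1) f(2) g(2) t(1)])
  show "nat_trans (powers_cat D ks) D (if b then flat_func (D_prd V) ks else padded_func (D_prd V) ks)
    (if b then padded_func (D_prd V) ks else flat_func (D_prd V) ks) (phi (mon_str V b \<epsilon> \<eta>) ks)"
    by (rule dgen_nat_trans[OF P df dp s f(3) g(3) f(2) g(2) t(2)])
qed

lemma D_prd_functor: "cat_functor (power_cat D n) D (D_prd V n)"
proof -
  have l: "length [0..<n] = n" by simp
  show ?thesis
    by (rule shape_functor[OF shape_power[of "[0..<n]", unfolded l], of "Tens (map Var [0..<n])"])
      (simp_all add: vl_Tens o_def Dval_Tens gens_Tens gens_Vars)
qed


text \<open>The category in which \<open>mon_str V b \<epsilon> \<eta>\<close> is a lax-plus oplax-zero monoidal structure.\<close>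
definition Cb :: "bool \<Rightarrow> (('o, 'a) dobj, ('o, 'a) darr) category" where
  "Cb b = (if b then D else op_cat D)"

text \<open>The arrows given by canonical arrows and by monomials \<open>\<epsilon>\<^sup>i \<eta>\<^sup>j\<close>.\<close>
definition mgen :: "bool \<Rightarrow> (('o, 'a) dobj \<Rightarrow> 'a) \<Rightarrow> (('o, 'a) dobj \<Rightarrow> 'a) \<Rightarrow> ('v \<Rightarrow> ('o, 'a) dobj)
    \<Rightarrow> ('v \<Rightarrow> nat) \<Rightarrow> ('v \<Rightarrow> nat) \<Rightarrow> 'v tterm \<Rightarrow> 'v tterm \<Rightarrow> ('o, 'a) darr \<Rightarrow> bool" where
  "mgen b \<epsilon> \<eta> X i j s t f \<longleftrightarrow> dgen b (endo \<epsilon> \<eta> X i j) s t f"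

lemma mgen_vars: "mgen b \<epsilon> \<eta> X i j s t f \<Longrightarrow> mset (vl s) = mset (vl t)"
  using gen_vars by (fastforce simp: mgen_def dgen_def split: if_splits)

lemma mgen_cong:
  assumes m: "mgen b \<epsilon> \<eta> X i j s t f" and e: "\<And>v. v \<in> set (vl s) \<Longrightarrow> i v = i' v \<and> j v = j' v"
  shows "mgen b \<epsilon> \<eta> X i' j' s t f"
proof -
  have "set (vl s) = set (vl t)" using mset_eq_setD[OF mgen_vars[OF m]] .
  hence "endo \<epsilon> \<eta> X i j v = endo \<epsilon> \<eta> X i' j' v" if "v \<in> set (vl s) \<or> v \<in> set (vl t)" for v
    using e that by (auto simp: endo_def)
  thus ?thesis using m gen_cong[of "endo \<epsilon> \<eta> X i j" _ _ f "endo \<epsilon> \<eta> X i' j'"]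
    by (cases b) (simp_all add: mgen_def dgen_def)
qed

context
  fixes X :: "'v \<Rightarrow> ('o, 'a) dobj" and \<epsilon> \<eta> :: "('o, 'a) dobj \<Rightarrow> 'a" and b :: bool
  assumes X: "\<And>v. X v \<in> Ob D" and sels: "\<epsilon> \<in> sels" "\<eta> \<in> sels"
begin

lemma endo_arX: "endo \<epsilon> \<eta> X i j v \<in> Ar D"
  by (rule endo_ar[where X = X, OF X sels])

text \<open>Arrows with the same terms and the same exponents are equal.\<close>
lemma mgen_unique:
  assumes m: "mgen b \<epsilon> \<eta> X i j s t f" "mgen b \<epsilon> \<eta> X i' j' s t f'" and d: "distinct (vl s)"
    and e: "\<And>v. v \<in> set (vl s) \<Longrightarrow> i v = i' v \<and> j v = j' v"
  shows "f = f'"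
proof -
  have "distinct (vl t)" using d mset_eq_imp_distinct_iff[OF mgen_vars[OF m(1)]] by simp
  moreover have "mgen b \<epsilon> \<eta> X i' j' s t f" by (rule mgen_cong[OF m(1) e])
  ultimately show ?thesis
    using m(2) d gen_unique[OF endo_arX] by (auto simp: mgen_def dgen_def split: if_splits)
qed

text \<open>Exponents add up under composition.\<close>
lemma mgen_comp:
  assumes m: "mgen b \<epsilon> \<eta> X i j s t f" "mgen b \<epsilon> \<eta> X i' j' t u g"
  shows "mgen b \<epsilon> \<eta> X (\<lambda>v. i v + i' v) (\<lambda>v. j v + j' v) s u (g \<odot>\<^bsub>Cb b\<^esub> f)"
proof (cases b)
  case True
  have "gen (\<lambda>v. endo \<epsilon> \<eta> X i' j' v \<odot>\<^bsub>D\<^esub> endo \<epsilon> \<eta> X i j v) s u (g \<odot>\<^bsub>D\<^esub> f)"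
    by (rule gen_comp[OF endo_arX endo_arX]) (use m True in \<open>simp_all add: mgen_def dgen_def\<close>)
  thus ?thesis using True by (simp only: endo_comp[where X = X, OF X sels] mgen_def dgen_def if_True Cb_def)
next
  case False
  have "gen (\<lambda>v. endo \<epsilon> \<eta> X i j v \<odot>\<^bsub>D\<^esub> endo \<epsilon> \<eta> X i' j' v) u s (f \<odot>\<^bsub>D\<^esub> g)"
    by (rule gen_comp[OF endo_arX endo_arX]) (use m False in \<open>simp_all add: mgen_def dgen_def\<close>)
  thus ?thesis using False by (simp only: endo_comp[where X = X, OF X sels] mgen_def dgen_def if_False Cb_def op_cat_simps add.commute)
qed

lemma mgen_Tens:
  assumes "\<And>k. k \<in> set ns \<Longrightarrow> mgen b \<epsilon> \<eta> X i j (S k) (T k) (F k)"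
  shows "mgen b \<epsilon> \<eta> X i j (Tens (map S ns)) (Tens (map T ns)) (D_tars V (map F ns))"
  using assms gen_Tens[of "endo \<epsilon> \<eta> X i j" ns _ _ F, OF endo_arX]
  by (cases b) (simp_all add: mgen_def dgen_def)

lemma endo_zero: "endo \<epsilon> \<eta> X (\<lambda>_. 0) (\<lambda>_. 0) = (\<lambda>v. Id D (X v))"
  using endo_0[where X = X, OF X sels] by (rule ext)

lemma mgen_id: "mgen b \<epsilon> \<eta> X (\<lambda>_. 0) (\<lambda>_. 0) t t (Id D (Dval X t))"
  using gen_id[OF X] by (simp only: mgen_def dgen_def endo_zero if_cancel)

lemma mgen_Phi:
  assumes "distinct (fvl tss)"
  shows "mgen b \<epsilon> \<eta> X (after db tss) (before db tss) (Tens (map Tens tss)) (Tens (padc tss))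
    (Phi (mon_str V b \<epsilon> \<eta>) (map length tss) (map (map (Dval X)) tss))"
  using dgen_Phi[OF X sels assms] by (simp only: mgen_def)

lemma mgen_phi:
  assumes "distinct (fvl tss)"
  shows "mgen b \<epsilon> \<eta> X (after Z tss) (before Z tss) (Tens (concat tss)) (Tens (padc tss))
    (phi (mon_str V b \<epsilon> \<eta>) (map length tss) (map (map (Dval X)) tss))"
  using dgen_phi[OF X sels assms] by (simp only: mgen_def)

text \<open>The groups have disjoint sets of variables, so that the exponents for the single groups combine.\<close>
lemma mgen_groups:
  assumes d: "distinct (fvl (concat tsss))"
    and F: "\<And>tss. tss \<in> set tsss \<Longrightarrow> distinct (fvl tss) \<Longrightarrow> mgen b \<epsilon> \<eta> X (i tss) (j tss) (S tss) (T tss) (F tss)"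
    and S: "\<And>tss. set (vl (S tss)) = set (fvl tss)"
  shows "mgen b \<epsilon> \<eta> X (gaft (\<lambda>_. 0) i tsss) (gbef (\<lambda>_. 0) j tsss) (Tens (map S tsss)) (Tens (map T tsss)) (D_tars V (map F tsss))"
proof (rule mgen_Tens)
  fix tss assume t: "tss \<in> set tsss"
  have "distinct (fvl tss)" using d t
    by (induction tsss) (auto simp: fvl_append)
  from mgen_cong[OF F[OF t this]] S show "mgen b \<epsilon> \<eta> X (gaft (\<lambda>_. 0) i tsss) (gbef (\<lambda>_. 0) j tsss) (S tss) (T tss) (F tss)"
    using gaft_gbef_group[OF d t] by metis
qed

end

lemma map_obs:
  fixes X :: "'v \<Rightarrow> ('o, 'a) dobj"
  shows "map2 (\<lambda>ks. fob (prod_func (map (D_prd V) ks))) (map (map length) tsss) (map (map (map (Dval X))) tsss)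
      = map (map (Dval X)) (map (map Tens) tsss)"
    "map2 (\<lambda>ks. fob (pads_func (D_prd V) ks)) (map (map length) tsss) (map (map (map (Dval X))) tsss)
      = map (map (Dval X)) (map padc tsss)"
  by (induction tsss) (simp_all only: list.map list.simps zip_Cons_Cons prod.case fob_prods fob_pads, simp_all)

lemma map2_lengths: "map2 F (map (map length) tsss) (map (map (map f)) tsss) = map (\<lambda>tss. F (map length tss) (map (map f) tss)) tsss"
  by (induction tsss) simp_all

lemma tilde_tild: "tilde_seq (map (map length) tsss) = map length (concat (map tild tsss))"
  "tilde_fam (map (map (map f)) tsss) = map (map f) (concat (map tild tsss))"
  by (induction tsss) (auto simp: tilde_seq_def tilde_fam_def tild_def)

lemma concat_Nil_sum: "sum_list (map length tss) = 0 \<longleftrightarrow> concat tss = []"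
  by (induction tss) auto

lemma map_concat': "concat (map (map f) tss) = map f (concat tss)"
  by (simp add: map_concat)

lemma hat_hatt: "hat_seq (map (map length) tsss) = map length (concat (map hatt tsss))"
  "hat_fam (D_tobs V []) (map (map (map (Dval X))) tsss) = map (map (Dval X)) (concat (map hatt tsss))"
proof -
  have u: "Dval X Unit = D_tobs V []" using Dval_Tens[of X "[]"] by simp
  have "(if map length tss = [] then [1] else if sum_list (map length tss) = 0 then 1 # replicate (length (map length tss) - 1) 0 else map length tss)
    = map length (hatt tss)" for tss :: "'b tterm list list"
    by (simp only: concat_Nil_sum hatt_def) (simp add: map_replicate_const)
  thus "hat_seq (map (map length) tsss) = map length (concat (map hatt tsss))"
    unfolding hat_seq_def by (simp only: map_map o_def map_concat)
  have "(if map (map (Dval X)) tss = [] then [[D_tobs V []]]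
     else if concat (map (map (Dval X)) tss) = [] then [D_tobs V []] # replicate (length (map (map (Dval X)) tss) - 1) [] else map (map (Dval X)) tss)
    = map (map (Dval X)) (hatt tss)" for tss :: "'b tterm list list"
    by (simp only: map_concat' hatt_def) (simp add: map_replicate_const u)
  thus "hat_fam (D_tobs V []) (map (map (map (Dval X))) tsss) = map (map (Dval X)) (concat (map hatt tsss))"
    unfolding hat_fam_def by (simp only: map_map o_def map_concat)
qed

lemma concat_concat: "concat (concat tsss) = concat (map concat tsss)"
  by (induction tsss) simp_all

lemma KZ_padc: "map KZ (map (map length) tsss) = map length (map padc tsss)"
  by (simp add: length_padc)

context
  fixes \<epsilon> \<eta> :: "('o, 'a) dobj \<Rightarrow> 'a" and b :: bool
  assumes sels: "\<epsilon> \<in> sels" "\<eta> \<in> sels"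
begin

abbreviation (input) "MS \<equiv> mon_str V b \<epsilon> \<eta>"

text \<open>The four associativity axioms. In each of them, both sides are given by the same terms, and their exponents
  agree.\<close>
lemma mon_assoc:
  fixes X :: "'v \<Rightarrow> ('o, 'a) dobj"
  assumes X: "\<And>v. X v \<in> Ob D" and d: "distinct (fvl (concat tsss))"
  defines "kss \<equiv> map (map length) tsss" and "xsss \<equiv> map (map (map (Dval X))) tsss"
  shows "Phi MS (tilde_seq kss) (tilde_fam xsss)
        \<odot>\<^bsub>Cb b\<^esub> Phi MS (map length kss) (map2 (\<lambda>ks. fob (prod_func (map (D_prd V) ks))) kss xsss)
      = Phi MS (map KZ kss) (map2 (\<lambda>ks. fob (pads_func (D_prd V) ks)) kss xsss)
        \<odot>\<^bsub>Cb b\<^esub> D_tars V (map2 (Phi MS) kss xsss)" (is ?E1)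
   and "Phi MS (tilde_seq kss) (tilde_fam xsss)
        \<odot>\<^bsub>Cb b\<^esub> phi MS (map length kss) (map2 (\<lambda>ks. fob (prod_func (map (D_prd V) ks))) kss xsss)
      = phi MS (map KZ kss) (map2 (\<lambda>ks. fob (pads_func (D_prd V) ks)) kss xsss)
        \<odot>\<^bsub>Cb b\<^esub> Phi MS (concat kss) (concat xsss)" (is ?E2)
   and "Phi MS (map KZ kss) (map2 (\<lambda>ks. fob (pads_func (D_prd V) ks)) kss xsss)
        \<odot>\<^bsub>Cb b\<^esub> D_tars V (map2 (phi MS) kss xsss)
      = phi MS (hat_seq kss) (hat_fam (D_tobs V []) xsss)
        \<odot>\<^bsub>Cb b\<^esub> Phi MS (map sum_list kss) (map concat xsss)" (is ?E3)
   and "phi MS (map KZ kss) (map2 (\<lambda>ks. fob (pads_func (D_prd V) ks)) kss xsss)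
        \<odot>\<^bsub>Cb b\<^esub> phi MS (concat kss) (concat xsss)
      = phi MS (hat_seq kss) (hat_fam (D_tobs V []) xsss)
        \<odot>\<^bsub>Cb b\<^esub> phi MS (map sum_list kss) (map concat xsss)" (is ?E4)
proof -
  let ?N = "map (map Tens) tsss" and ?P = "map padc tsss" and ?C = "map concat tsss"
    and ?T = "concat (map tild tsss)" and ?H = "concat (map hatt tsss)"
  have dN: "distinct (fvl ?N)" and dP: "distinct (fvl ?P)" and dC: "distinct (fvl ?C)"
    and dT: "distinct (fvl ?T)" and dH: "distinct (fvl ?H)"
    using d by (simp_all only: fvl_groups(1)[OF vl_map_Tens] fvl_groups(1)[OF vl_padc] fvl_groups(1)[OF vl_concat]
      fvl_groups(2)[OF fvl_tild] fvl_groups(2)[OF fvl_hatt])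
  note Phis = mgen_Phi[where X = X and b = b, OF X sels] and phis = mgen_phi[where X = X and b = b, OF X sels]
  note rew = tilde_tild hat_hatt KZ_padc map2_lengths
  have len: "map length (map (map length) tsss) = map length ?N" "map sum_list (map (map length) tsss) = map length ?C"
    "concat (map (map length) tsss) = map length (concat tsss)" "concat (map (map (map (Dval X))) tsss) = map (map (Dval X)) (concat tsss)"
    "map concat (map (map (map (Dval X))) tsss) = map (map (Dval X)) ?C"
    by (simp_all add: length_concat map_concat)
  have gPhi: "mgen b \<epsilon> \<eta> X (gaft (\<lambda>_. 0) (after db) tsss) (gbef (\<lambda>_. 0) (before db) tsss) (Tens (map Tens ?N)) (Tens (map Tens ?P))
      (D_tars V (map (\<lambda>tss. Phi MS (map length tss) (map (map (Dval X)) tss)) tsss))"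
    using mgen_groups[where X = X and b = b and S = "\<lambda>tss. Tens (map Tens tss)" and T = "\<lambda>tss. Tens (padc tss)", OF X sels d Phis]
    by (simp only: vl_nested map_map o_def)
  have gphi: "mgen b \<epsilon> \<eta> X (gaft (\<lambda>_. 0) (after Z) tsss) (gbef (\<lambda>_. 0) (before Z) tsss) (Tens (map Tens ?C)) (Tens (map Tens ?P))
      (D_tars V (map (\<lambda>tss. phi MS (map length tss) (map (map (Dval X)) tss)) tsss))"
    using mgen_groups[where X = X and b = b and S = "\<lambda>tss. Tens (concat tss)" and T = "\<lambda>tss. Tens (padc tss)", OF X sels d phis]
    by (simp only: vl_flat map_map o_def)
  note comp = mgen_comp[where X = X and b = b, OF X sels] and uniq = mgen_unique[where X = X and b = b, OF X sels]
  show ?E1 unfolding kss_def xsss_def map_obs unfolding rew unfolding len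
  proof (rule uniq)
    show "mgen b \<epsilon> \<eta> X (\<lambda>v. after db ?N v + after db ?T v) (\<lambda>v. before db ?N v + before db ?T v) (Tens (map Tens ?N)) (Tens (padc ?P))
      (Phi MS (map length ?T) (map (map (Dval X)) ?T) \<odot>\<^bsub>Cb b\<^esub> Phi MS (map length ?N) (map (map (Dval X)) ?N))"
      by (rule comp[OF Phis[OF dN] Phis[OF dT, unfolded terms_tild padc_tild]])
    show "mgen b \<epsilon> \<eta> X (\<lambda>v. gaft (\<lambda>_. 0) (after db) tsss v + after db ?P v) (\<lambda>v. gbef (\<lambda>_. 0) (before db) tsss v + before db ?P v)
      (Tens (map Tens ?N)) (Tens (padc ?P))
      (Phi MS (map length ?P) (map (map (Dval X)) ?P) \<odot>\<^bsub>Cb b\<^esub> D_tars V (map (\<lambda>tss. Phi MS (map length tss) (map (map (Dval X)) tss)) tsss))"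
      by (rule comp[OF gPhi Phis[OF dP]])
  qed (use dN in \<open>simp_all only: vl_nested exponents_Phi_Phi simp_thms\<close>)
  show ?E2 unfolding kss_def xsss_def map_obs unfolding rew unfolding len
  proof (rule uniq)
    show "mgen b \<epsilon> \<eta> X (\<lambda>v. after Z ?N v + after db ?T v) (\<lambda>v. before Z ?N v + before db ?T v) (Tens (concat ?N)) (Tens (padc ?P))
      (Phi MS (map length ?T) (map (map (Dval X)) ?T) \<odot>\<^bsub>Cb b\<^esub> phi MS (map length ?N) (map (map (Dval X)) ?N))"
      by (rule comp[OF phis[OF dN] Phis[OF dT, unfolded terms_tild padc_tild]])
    show "mgen b \<epsilon> \<eta> X (\<lambda>v. after db (concat tsss) v + after Z ?P v) (\<lambda>v. before db (concat tsss) v + before Z ?P v)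
      (Tens (concat ?N)) (Tens (padc ?P))
      (phi MS (map length ?P) (map (map (Dval X)) ?P) \<odot>\<^bsub>Cb b\<^esub> Phi MS (map length (concat tsss)) (map (map (Dval X)) (concat tsss)))"
      by (rule comp[OF Phis[OF d, unfolded padc_concat, folded concat_Tens] phis[OF dP]])
  qed (use dN in \<open>simp_all only: vl_flat exponents_Phi_phi simp_thms\<close>)
  show ?E3 unfolding kss_def xsss_def map_obs unfolding rew unfolding len
  proof (rule uniq)
    show "mgen b \<epsilon> \<eta> X (\<lambda>v. gaft (\<lambda>_. 0) (after Z) tsss v + after db ?P v) (\<lambda>v. gbef (\<lambda>_. 0) (before Z) tsss v + before db ?P v)
      (Tens (map Tens ?C)) (Tens (padc ?P))
      (Phi MS (map length ?P) (map (map (Dval X)) ?P) \<odot>\<^bsub>Cb b\<^esub> D_tars V (map (\<lambda>tss. phi MS (map length tss) (map (map (Dval X)) tss)) tsss))"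
      by (rule comp[OF gphi Phis[OF dP]])
    show "mgen b \<epsilon> \<eta> X (\<lambda>v. after db ?C v + after Z ?H v) (\<lambda>v. before db ?C v + before Z ?H v) (Tens (map Tens ?C)) (Tens (padc ?P))
      (phi MS (map length ?H) (map (map (Dval X)) ?H) \<odot>\<^bsub>Cb b\<^esub> Phi MS (map length ?C) (map (map (Dval X)) ?C))"
      by (rule comp[OF Phis[OF dC] phis[OF dH, unfolded concat_hatts padc_hatts]])
  qed (use dC in \<open>simp_all only: vl_nested exponents_phi_Phi simp_thms\<close>)
  show ?E4 unfolding kss_def xsss_def map_obs unfolding rew unfolding len
  proof (rule uniq)
    show "mgen b \<epsilon> \<eta> X (\<lambda>v. after Z (concat tsss) v + after Z ?P v) (\<lambda>v. before Z (concat tsss) v + before Z ?P v)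
      (Tens (concat ?C)) (Tens (padc ?P))
      (phi MS (map length ?P) (map (map (Dval X)) ?P) \<odot>\<^bsub>Cb b\<^esub> phi MS (map length (concat tsss)) (map (map (Dval X)) (concat tsss)))"
      by (rule comp[OF phis[OF d, unfolded padc_concat concat_concat] phis[OF dP]])
    show "mgen b \<epsilon> \<eta> X (\<lambda>v. after Z ?C v + after Z ?H v) (\<lambda>v. before Z ?C v + before Z ?H v) (Tens (concat ?C)) (Tens (padc ?P))
      (phi MS (map length ?H) (map (map (Dval X)) ?H) \<odot>\<^bsub>Cb b\<^esub> phi MS (map length ?C) (map (map (Dval X)) ?C))"
      by (rule comp[OF phis[OF dC] phis[OF dH, unfolded concat_hatts padc_hatts]])
  qed (use dC in \<open>simp_all only: vl_flat exponents_phi_phi simp_thms\<close>)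
qed

end

end

lemma wt_0: "wt c tss = 0 \<Longrightarrow> after c tss v = 0 \<and> before c tss v = 0"
  by (induction tss) auto

lemma padc_no_empty: "wt Z tss = 0 \<Longrightarrow> padc tss = concat tss"
  by (induction tss) (auto simp: padc_def Z_def split: if_splits)

lemma padc_all_empty: "concat tss = [] \<Longrightarrow> padc tss = map Tens tss"
  by (induction tss) (simp_all add: padc_def)

context symmetric_monoidal_category begin

lemma Cb_simps [simp]: "Ob (Cb b) = Ob D" "Id (Cb b) = Id D" "Ar (Cb b) = Ar D"
  by (simp_all add: Cb_def)

lemma Cb_power: "power_cat (Cb b) n = (if b then power_cat D n else op_cat (power_cat D n))"
  "powers_cat (Cb b) ks = (if b then powers_cat D ks else op_cat (powers_cat D ks))"
  by (simp_all add: Cb_def op_power_cat op_powers_cat)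

lemma Cb_nat_trans:
  assumes "nat_trans P D (if b then F else G) (if b then G else F) \<tau>"
  shows "nat_trans (if b then P else op_cat P) (Cb b) F G \<tau>"
  using assms op_nat_trans by (cases b) (auto simp: Cb_def)

text \<open>Objects of the powers of the category are given by families of terms with distinct variables.\<close>
lemma family_cases:
  assumes "xss \<in> Ob (powers_cat (Cb b) ks)"
  obtains X and tss :: "(nat \<times> nat) tterm list list" where "\<And>v. X v \<in> Ob D" "xss = map (map (Dval X)) tss"
    "ks = map length tss" "distinct (fvl tss)"
proof -
  have l: "map length xss = map length (idx ks)" and o: "\<And>xs. xs \<in> set xss \<Longrightarrow> set xs \<subseteq> Ob D"
    using assms by (simp_all add: powers_cat_simps)
  have ks: "ks = map length (map (map Var) (idx ks) :: (nat \<times> nat) tterm list list)"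
    using idx_length[of ks] by (simp only: map_map o_def length_map)
  have d: "distinct (fvl (map (map Var) (idx ks) :: (nat \<times> nat) tterm list list))"
    unfolding fvl_Vars by (rule idx_distinct)
  show ?thesis
  proof (rule label2[OF idx_distinct l o du_ob])
    fix X assume X: "xss = map (map X) (idx ks)" "\<And>v. X v \<in> Ob D"
    show ?thesis
      by (rule that[OF X(2) _ ks d]) (simp only: Dval_Vars X(1))
  qed simp
qed

lemma power_cases:
  assumes "xs \<in> Ob (power_cat (Cb b) n)"
  obtains X where "\<And>v. X v \<in> Ob D" "xs = map X [0..<n]"
proof -
  have "length xs = length [0..<n]" "set xs \<subseteq> Ob D"
    using assms by (simp_all add: power_cat_simps)
  from label[OF distinct_upt this du_ob] show ?thesis using that by metis
qed

theorem mon_str_lax_oplax_monoidal: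
  assumes sels: "\<epsilon> \<in> sels" "\<eta> \<in> sels"
  shows "lax_oplax_monoidal (Cb b) (mon_str V b \<epsilon> \<eta>)"
    (is "lax_oplax_monoidal ?C ?S")
proof (intro lax_oplax_monoidal.intro lax_oplax_monoidal_axioms.intro)
  show "category ?C"
    by (simp add: Cb_def D_category op_category)
  show "cat_functor (power_cat ?C n) ?C (prd ?S n)" for n
    using D_prd_functor[of n] op_functor[OF D_prd_functor[of n]] by (simp add: Cb_power) (simp add: Cb_def)
  show "nat_trans (powers_cat ?C ks) ?C (nested_func (prd ?S) ks) (padded_func (prd ?S) ks) (Phi ?S ks)" for ks
    unfolding Cb_power mon_str_simps by (rule Cb_nat_trans[OF Phi_mon_nat(1)[OF sels]])
  show "nat_trans (powers_cat ?C ks) ?C (flat_func (prd ?S) ks) (padded_func (prd ?S) ks) (phi ?S ks)" for ks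
    unfolding Cb_power mon_str_simps by (rule Cb_nat_trans[OF Phi_mon_nat(2)[OF sels]])
  show "nat_trans ?C ?C id_func (comp_func (prd ?S 1) single_func) (iota ?S)"
  proof -
    have far: "gen h (Var v) (Var v) (D_tars V [h v])" if "\<And>v. h v \<in> Ar D" for h and v :: nat
      using gens_Tens[where h = h, OF that gens_Vars[where h = h and vs = "[v]", OF that]] by simp
    have fob: "D_tobs V [X v] = Dval X (Var v)" for X and v :: nat
      using Dval_Tens[of X "[Var v]"] by simp
    have "nat_trans D D (if b then id_func else comp_func (D_prd V 1) single_func)
        (if b then comp_func (D_prd V 1) single_func else id_func) (Id D)"
      by (cases b; rule shape_nat_trans[OF shape_D[where v = "0::nat"], where s = "Var 0" and t = "Var 0" and e = "\<lambda>X v. Id D (X v)"])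
        (auto simp: id_func_def comp_func_def single_func_def far fob D_arD D_obD gen_Var gen_id[where t = "Var _", simplified])
    from Cb_nat_trans[OF this] show ?thesis by (simp add: Cb_def)
  qed
next
  fix ks xss assume ks: "sum_list ks = 0" and xss: "xss \<in> Ob (powers_cat (Cb b) ks)"
  obtain X and tss :: "(nat \<times> nat) tterm list list" where X: "\<And>v. X v \<in> Ob D" and f: "xss = map (map (Dval X)) tss"
    "ks = map length tss" "distinct (fvl tss)"
    using family_cases[OF xss] by metis
  have e: "concat tss = []" using ks unfolding f concat_Nil_sum .
  hence v: "fvl tss = []" by (simp add: fvl_def del: concat_eq_Nil_conv)
  show "Phi ?S ks xss = Id (Cb b) (fob (nested_func (prd ?S) ks) xss)"
    unfolding f Cb_simps mon_str_simps fob_nested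
    by (rule mgen_unique[where X = X and b = b, OF X sels mgen_Phi[where X = X and b = b, OF X sels f(3), unfolded padc_all_empty[OF e]]
          mgen_id[where X = X and b = b, OF X sels]]) (simp_all only: vl_nested v, simp_all)
next
  fix ks xss assume ks: "sum_list (map Z ks) = 0" and xss: "xss \<in> Ob (powers_cat (Cb b) ks)"
  obtain X and tss :: "(nat \<times> nat) tterm list list" where X: "\<And>v. X v \<in> Ob D" and f: "xss = map (map (Dval X)) tss"
    "ks = map length tss" "distinct (fvl tss)"
    using family_cases[OF xss] by metis
  have e: "wt Z tss = 0" using ks unfolding f by (simp add: o_def)
  show "phi ?S ks xss = Id (Cb b) (fob (flat_func (prd ?S) ks) xss)"
    unfolding f Cb_simps mon_str_simps fob_flat
    by (rule mgen_unique[where X = X and b = b, OF X sels mgen_phi[where X = X and b = b, OF X sels f(3), unfolded padc_no_empty[OF e]]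
          mgen_id[where X = X and b = b, OF X sels]]) (simp_all only: vl_flat f(3) wt_0[OF e] simp_thms)
next
  have du: "du \<in> Ob D" for v :: nat by simp
  note m = mgen_phi[where X = "\<lambda>_::nat. du" and b = b and tss = "[[]]", OF du sels]
  have u: "Dval (\<lambda>_::nat. du) Unit = D_tobs V []" using Dval_Tens[of "\<lambda>_::nat. du" "[]"] by simp
  have 1: "mgen b \<epsilon> \<eta> (\<lambda>_::nat. du) (after Z [[]]) (before Z [[]]) Unit Unit (phi ?S [0] [[]])"
    using m by (simp add: padc_def fvl_def)
  have "phi ?S [0] [[]] = Id D (D_tobs V [])"
    by (rule mgen_unique[where X = "\<lambda>_::nat. du" and b = b, OF du sels 1
      mgen_id[where X = "\<lambda>_::nat. du" and b = b and t = Unit, OF du sels, unfolded u]]) simp_all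
  thus "phi ?S [0] [[]] = iota ?S (fob (prd ?S 0) [])"
    by simp
next
  fix n :: nat and xs assume n: "n \<ge> 1" and xs: "xs \<in> Ob (power_cat (Cb b) n)"
  obtain X where X: "\<And>v. X v \<in> Ob D" and f: "xs = map X [0..<n]"
    using power_cases[OF xs] by metis
  let ?ts = "map Var [0..<n]"
  have ne: "?ts \<noteq> []" using n by simp
  have o: "D_tobs V xs = Dval X (Tens ?ts)" by (simp add: f Dval_Tens o_def)
  have d: "distinct (vl (Tens ?ts))" by (simp add: vl_Tens o_def)
  note comp = mgen_comp[where X = X and b = b, OF X sels] and uniq = mgen_unique[where X = X and b = b, OF X sels]
    and ident = mgen_id[where X = X and b = b, OF X sels] and Phis = mgen_Phi[where X = X and b = b, OF X sels]
  have 1: "mgen b \<epsilon> \<eta> X (after db [?ts]) (before db [?ts]) (Tens ?ts) (Tens ?ts) (Phi ?S [n] [xs])"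
    using Phis[of "[?ts]"] ne by (simp add: padc_def f fvl_def o_def)
  have "Phi ?S [n] [xs] \<odot>\<^bsub>?C\<^esub> Id D (Dval X (Tens ?ts)) = Id D (Dval X (Tens ?ts))"
    by (rule uniq[OF comp[OF ident 1] ident d]) (simp add: vl_Tens o_def)
  thus "Phi ?S [n] [xs] \<odot>\<^bsub>?C\<^esub> iota ?S (fob (prd ?S n) xs)
    = Id (Cb b) (fob (prd ?S n) xs)"
    by (simp only: Cb_simps mon_str_simps D_prd_simps o)
  let ?tss = "map (\<lambda>v. [Var v]) [0..<n]"
  have t: "map Tens ?tss = ?ts" "padc ?tss = ?ts" "map length ?tss = replicate n 1" "map (map (Dval X)) ?tss = map (\<lambda>x. [x]) xs"
    by (simp_all add: o_def f padc_def map_replicate_const)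
  have w: "wt db ?tss = 0" by (simp add: o_def bar_def Z_def)
  have 2: "mgen b \<epsilon> \<eta> X (after db ?tss) (before db ?tss) (Tens ?ts) (Tens ?ts) (Phi ?S (replicate n 1) (map (\<lambda>x. [x]) xs))"
    using Phis[of ?tss] unfolding t by (simp add: fvl_def o_def)
  have 3: "mgen b \<epsilon> \<eta> X (\<lambda>_. 0) (\<lambda>_. 0) (Tens ?ts) (Tens ?ts) (D_tars V (map (\<lambda>v. Id D (X v)) [0..<n]))"
    using ident[of "Var _"] by (intro mgen_Tens[where X = X and b = b, OF X sels]) (simp only: Dval_Var)
  have "Phi ?S (replicate n 1) (map (\<lambda>x. [x]) xs) \<odot>\<^bsub>?C\<^esub> D_tars V (map (\<lambda>v. Id D (X v)) [0..<n])
      = Id D (Dval X (Tens ?ts))"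
    by (rule uniq[OF comp[OF 3 2] ident d]) (use wt_0[OF w] in simp)
  thus "Phi ?S (replicate n 1) (map (\<lambda>x. [x]) xs) \<odot>\<^bsub>?C\<^esub> far (prd ?S n) (map (iota ?S) xs)
    = Id (Cb b) (fob (prd ?S n) xs)"
    by (simp only: Cb_simps mon_str_simps D_prd_simps o) (simp only: f map_map o_def)
next
  fix xsss kss assume x: "xsss \<in> Ob (prod_cat (map (powers_cat (Cb b)) kss))"
  have x': "\<forall>xss\<in>set xsss. \<forall>xs\<in>set xss. set xs \<subseteq> Ob D"
    using x by (auto simp: prod_powers_ob)
  obtain vsss and X :: "nat \<times> nat \<Rightarrow> ('o, 'a) dobj" where v: "xsss = map (map (map X)) vsss" "\<And>v. X v \<in> Ob D" "distinct (concat (concat vsss))"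
    using label3[OF x' du_ob] by blast
  let ?tsss = "map (map (map Var)) vsss :: (nat \<times> nat) tterm list list list"
  have e: "xsss = map (map (map (Dval X))) ?tsss" "kss = map (map length) ?tsss"
    using x by (simp_all add: v(1) o_def prod_powers_ob)
  have "fvl (concat ?tsss) = concat (concat vsss)"
    using fvl_Vars[of "concat vsss"] by (simp add: map_concat)
  hence d: "distinct (fvl (concat ?tsss))" using v(3) by simp
  note a = mon_assoc[where X = X and b = b, OF sels v(2) d, folded e]
  show "Phi ?S (tilde_seq kss) (tilde_fam xsss)
        \<odot>\<^bsub>?C\<^esub> Phi ?S (map length kss) (map2 (\<lambda>ks. fob (prod_func (map (prd ?S) ks))) kss xsss)
      = Phi ?S (map KZ kss) (map2 (\<lambda>ks. fob (pads_func (prd ?S) ks)) kss xsss)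
        \<odot>\<^bsub>?C\<^esub> far (prd ?S (length kss)) (map2 (Phi ?S) kss xsss)"
    unfolding mon_str_simps D_prd_simps by (rule a(1))
  show "Phi ?S (tilde_seq kss) (tilde_fam xsss)
        \<odot>\<^bsub>?C\<^esub> phi ?S (map length kss) (map2 (\<lambda>ks. fob (prod_func (map (prd ?S) ks))) kss xsss)
      = phi ?S (map KZ kss) (map2 (\<lambda>ks. fob (pads_func (prd ?S) ks)) kss xsss)
        \<odot>\<^bsub>?C\<^esub> Phi ?S (concat kss) (concat xsss)"
    unfolding mon_str_simps D_prd_simps by (rule a(2))
  show "Phi ?S (map KZ kss) (map2 (\<lambda>ks. fob (pads_func (prd ?S) ks)) kss xsss)
        \<odot>\<^bsub>?C\<^esub> far (prd ?S (length kss)) (map2 (phi ?S) kss xsss)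
      = phi ?S (hat_seq kss) (hat_fam (fob (prd ?S 0) []) xsss)
        \<odot>\<^bsub>?C\<^esub> Phi ?S (map sum_list kss) (map concat xsss)"
    unfolding mon_str_simps D_prd_simps by (rule a(3))
  show "phi ?S (map KZ kss) (map2 (\<lambda>ks. fob (pads_func (prd ?S) ks)) kss xsss)
        \<odot>\<^bsub>?C\<^esub> phi ?S (concat kss) (concat xsss)
      = phi ?S (hat_seq kss) (hat_fam (fob (prd ?S 0) []) xsss)
        \<odot>\<^bsub>?C\<^esub> phi ?S (map sum_list kss) (map concat xsss)"
    unfolding mon_str_simps D_prd_simps by (rule a(4))
qed

end

section \<open>Families of columns\<close>

lemma columns_columns:
  assumes "\<And>xs. xs \<in> set xss \<Longrightarrow> length xs = p"
  shows "columns (length xss) (columns p xss) = xss"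
  using assms by (intro nth_equalityI) (auto simp: columns_def intro!: nth_equalityI)

lemma length_columns [simp]: "length (columns p xss) = p"
  by (simp add: columns_def)

lemma columns_length: "xs \<in> set (columns p xss) \<Longrightarrow> length xs = length xss"
  by (auto simp: columns_def)

text \<open>In this part, \<open>A\<close> is a family of rows whose entries are lists of the same length \<open>n\<close>. It is viewed either as
  a family of objects of \<open>D\<^sup>n\<close>, or as \<open>n\<close> families of objects of \<open>D\<close>, the slices \<open>sl i A\<close>.\<close>
definition sl :: "nat \<Rightarrow> 'x list list list \<Rightarrow> 'x list list" where
  "sl i A = map (map (\<lambda>xs. xs ! i)) A"

text \<open>The analogue of \<open>padc\<close> for families of objects of \<open>D\<^sup>n\<close>.\<close>
definition padn :: "nat \<Rightarrow> 'v tterm list list list \<Rightarrow> 'v tterm list list" where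
  "padn n A = concat (map (\<lambda>row. if row = [] then [replicate n Unit] else row) A)"

text \<open>All entries of the family have length \<open>n\<close>.\<close>
definition depth :: "nat \<Rightarrow> 'x list list list \<Rightarrow> bool" where
  "depth n A \<longleftrightarrow> (\<forall>row\<in>set A. \<forall>xs\<in>set row. length xs = n)"

lemma sl_map: "depth n A \<Longrightarrow> i < n \<Longrightarrow> sl i (map (map (map f)) A) = map (map f) (sl i A)"
  by (simp add: sl_def depth_def)

lemma sl_lengths [simp]: "map length (sl i A) = map length A"
  by (simp add: sl_def)

lemma length_sl [simp]: "length (sl i A) = length A"
  by (simp add: sl_def)

lemma padc_sl: "i < n \<Longrightarrow> map (\<lambda>ts. ts ! i) (padn n A) = padc (sl i A)"
  by (induction A) (simp_all add: padn_def padc_def sl_def)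

lemma columns_padn: "columns n (padn n A) = map (\<lambda>i. padc (sl i A)) [0..<n]"
  by (simp add: columns_def padc_sl)

lemma columns_concat: "columns n (concat A) = map (\<lambda>i. concat (sl i A)) [0..<n]"
  by (simp add: columns_def sl_def map_concat)

lemma length_padn: "length (padn n A) = KZ (map length A)"
  by (induction A) (simp_all add: padn_def KZ_def Z_def)

lemma padn_lengths: "depth n A \<Longrightarrow> ts \<in> set (padn n A) \<Longrightarrow> length ts = n"
  by (auto simp: padn_def depth_def split: if_splits)

context symmetric_monoidal_category begin

text \<open>The transposition from a list of columns of length \<open>n\<close>: the structure of the functor \<open>\<circ>\<^sub>n\<close>.\<close>
lemma gen_str:
  assumes X: "\<And>v. X v \<in> Ob D" and l: "\<And>ts. ts \<in> set yss \<Longrightarrow> length ts = n" and m: "m = length yss"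
  shows "gen (\<lambda>v. Id D (X v)) (Tens (map Tens (columns n yss))) (Tens (map Tens yss))
    (D_xi V m n (columns n (map (map (Dval X)) yss)))"
proof -
  have "gen (\<lambda>v. Id D (X v)) (Tens (map Tens (columns n yss))) (Tens (map Tens (columns m (columns n yss))))
    (D_xi V m n (map (map (Dval X)) (columns n yss)))"
    by (rule gen_xi[OF X]) (use columns_length m in auto)
  thus ?thesis using l by (simp only: columns_map m columns_columns)
qed

lemma xi_natural: "nat_trans (powers_cat D (replicate n p)) D
        (comp_func (D_prd V n) (prod_func (replicate n (D_prd V p))))
        (comp_func (D_prd V p) (comp_func (prod_func (replicate p (D_prd V n))) \<lparr>fob = columns p, far = columns p\<rparr>))
        (D_xi V p n)"
proof -
  let ?ks = "replicate n p"
  let ?vss = "idx ?ks" and ?tss = "map (map Var) (idx ?ks) :: (nat \<times> nat) tterm list list"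
  have ks: "map length ?vss = ?ks" by simp
  have len: "length ?vss = n" by (simp add: idx_def)
  have rows: "length vs = p" if "vs \<in> set ?vss" for vs
    using that by (auto simp: idx_def)
  have F: "comp_func (D_prd V n) (prod_func (replicate n (D_prd V p))) = nested_func (D_prd V) ?ks"
    by (simp add: nested_func_def)
  have col: "columns p ?tss = map (map Var) (columns p ?vss)" "\<And>f. columns p (map (map f) ?vss) = map (map f) (columns p ?vss)"
    using rows by (simp_all add: columns_map)
  let ?G = "comp_func (D_prd V p) (comp_func (prod_func (replicate p (D_prd V n))) \<lparr>fob = columns p, far = columns p\<rparr>)"
  have m2: "map2 f (replicate p c) (map g (columns p ?vss)) = map (\<lambda>x. f c (g x)) (columns p ?vss)" for f c g
    by (simp add: map2_replicate o_def)
  have d: "distinct (vl (Tens (map Tens ?tss)))" unfolding vl_nested fvl_Vars by (rule idx_distinct)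
  have xi: "gen (\<lambda>v. Id D (X v)) (Tens (map Tens ?tss)) (Tens (map Tens (columns p ?tss))) (D_xi V p n (map (map X) ?vss))"
    if "\<And>v. X v \<in> Ob D" for X
  proof -
    have "gen (\<lambda>v. Id D (X v)) (Tens (map Tens ?tss)) (Tens (map Tens (columns p ?tss))) (D_xi V p n (map (map (Dval X)) ?tss))"
      by (rule gen_xi[OF that]) (use len rows in auto)
    thus ?thesis by (simp only: Dval_Vars)
  qed
  have "distinct (vl (Tens (map Tens (columns p ?tss))))"
    using d mset_eq_imp_distinct_iff[OF gen_vars[OF xi[of "\<lambda>_. du", OF du_ob]]] by simp
  moreover have "fob ?G (map (map X) ?vss) = Dval X (Tens (map Tens (columns p ?tss)))" for X
    unfolding col by (simp add: comp_func_def prod_func_def col m2 Dval_Tens o_def)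
  moreover have "gen h (Tens (map Tens (columns p ?tss))) (Tens (map Tens (columns p ?tss))) (far ?G (map (map h) ?vss))"
    if h: "\<And>v. h v \<in> Ar D" for h
  proof -
    have "gens h (map (\<lambda>vs. Tens (map Var vs)) (columns p ?vss)) (map (\<lambda>vs. Tens (map Var vs)) (columns p ?vss))
        (map (\<lambda>vs. D_tars V (map h vs)) (columns p ?vss))"
      by (rule gens_Tens_map[OF h gens_Vars[OF h]])
    from gens_Tens[OF h this] show ?thesis
      unfolding col by (simp add: comp_func_def prod_func_def col m2 o_def)
  qed
  ultimately show ?thesis
    unfolding F
    by (intro shape_nat_trans[OF shape_powers[OF idx_distinct ks], where e = "\<lambda>X v. Id D (X v)", OF d _ fob_Vars(1)[OF ks] gen_nested[OF _ ks] _ _ _ _ xi])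
      (simp_all add: D_arD D_obD)
qed

end

text \<open>The family of the products of the entries of a family.\<close>
abbreviation prow :: "'v tterm list list list \<Rightarrow> 'v tterm list list" where
  "prow A \<equiv> map (map Tens) A"

context symmetric_monoidal_category begin

text \<open>Slices and products of entries have the same variables, by transposition of \<open>concat A\<close>.\<close>
lemma mset_slices: "depth n A \<Longrightarrow> mset (fvl (prow A)) = mset (concat (map (\<lambda>i. fvl (sl i A)) [0..<n]))"
proof -
  assume d: "depth n A"
  have "mset (vl (Tens (map Tens (columns n (concat A))))) = mset (vl (Tens (map Tens (concat A))))"
    by (rule gen_vars[OF gen_str[where X = "\<lambda>_. du", OF du_ob _ refl]]) (use d in \<open>auto simp: depth_def\<close>)
  moreover have "vl (Tens (map Tens (columns n (concat A)))) = concat (map (\<lambda>i. fvl (sl i A)) [0..<n])"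
    by (simp add: columns_concat vl_Tens o_def fvl_def)
  moreover have "vl (Tens (map Tens (concat A))) = fvl (prow A)"
    by (simp add: vl_Tens fvl_def map_concat o_def)
  ultimately show ?thesis by simp
qed

lemma slice_distinct:
  assumes "depth n A" "distinct (fvl (prow A))" "i < n"
  shows "distinct (fvl (sl i A))"
proof -
  have "distinct (concat (map (\<lambda>i. fvl (sl i A)) [0..<n]))"
    using mset_eq_imp_distinct_iff[OF mset_slices[OF assms(1)]] assms(2) by simp
  thus ?thesis using assms(3) by (simp add: distinct_concat_iff)
qed

text \<open>The exponent of a variable depends only on its row, and hence is the same for the slices as for the
  products of the entries.\<close>
lemma slice_exponents:
  assumes d: "depth n A" and D: "distinct (fvl (prow A))" and i: "i < n" and v: "v \<in> set (fvl (sl i A))"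
  shows "after c (sl i A) v = after c (prow A) v \<and> before c (sl i A) v = before c (prow A) v"
proof -
  obtain row t where row: "row \<in> set (sl i A)" "t \<in> set row" "v \<in> set (vl t)"
    using v by (auto simp: fvl_def)
  then obtain r where r: "r < length A" "t \<in> set (sl i A ! r)"
    by (metis in_set_conv_nth length_sl)
  then obtain ts where ts: "ts \<in> set (A ! r)" "t = ts ! i"
    by (auto simp: sl_def)
  have "length ts = n" using d ts(1) r(1) by (auto simp: depth_def)
  hence "v \<in> set (vl (Tens ts))" using row(3) ts(2) i by (auto simp: vl_Tens)
  moreover have "Tens ts \<in> set (prow A ! r)" using ts(1) r(1) by simp
  moreover have "r < length (prow A)" "r < length (sl i A)" using r(1) by simp_all
  moreover have "map length (prow A) = map length A" by simp
  ultimately show ?thesis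
    using after_nth[OF slice_distinct[OF d D i], of r t v c] before_nth[OF slice_distinct[OF d D i], of r t v c]
      after_nth[OF D, of r "Tens ts" v c] before_nth[OF D, of r "Tens ts" v c] r(2) row(3)
    by (simp only: sl_lengths length_sl length_map simp_thms)
qed

lemma ps_simps:
  "fob (prd (power_struct (mon_str V b \<epsilon> \<eta>) n) m) xss = map (D_tobs V) (columns n xss)"
  "far (prd (power_struct (mon_str V b \<epsilon> \<eta>) n) m) fss = map (D_tars V) (columns n fss)"
  "Phi (power_struct (mon_str V b \<epsilon> \<eta>) n) ks xsss = map (\<lambda>i. Phi (mon_str V b \<epsilon> \<eta>) ks (sl i xsss)) [0..<n]"
  "phi (power_struct (mon_str V b \<epsilon> \<eta>) n) ks xsss = map (\<lambda>i. phi (mon_str V b \<epsilon> \<eta>) ks (sl i xsss)) [0..<n]"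
  "length xs = n \<Longrightarrow> iota (power_struct (mon_str V b \<epsilon> \<eta>) n) xs = map (Id D) xs"
  by (simp_all add: power_struct_def prod_struct_def columns_def sl_def o_def map2_replicate)

lemma circ_simps [simp]: "fob (circ_mfunc (mon_str V b \<epsilon> \<eta>) \<xi> n) = D_tobs V" "far (circ_mfunc (mon_str V b \<epsilon> \<eta>) \<xi> n) = D_tars V"
  "str (circ_mfunc (mon_str V b \<epsilon> \<eta>) \<xi> n) p yss = \<xi> p n (columns n yss)"
  by (simp_all add: circ_mfunc_def)

lemma map_columns_Dval: "(\<And>xs. xs \<in> set xss \<Longrightarrow> length xs = n) \<Longrightarrow>
    map (D_tobs V) (columns n (map (map (Dval X)) xss)) = map (Dval X) (map Tens (columns n xss))"
  by (simp only: columns_map) (simp add: o_def Dval_Tens)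

lemma map2_cong_rows: "(\<And>row. row \<in> set A \<Longrightarrow> f (length row) (g row) = h row) \<Longrightarrow>
    map2 f (map length A) (map g A) = map h A"
  by (induction A) auto

lemma ps_prods:
  assumes "depth n A"
  shows "fob (prod_func (map (prd (power_struct (mon_str V b \<epsilon> \<eta>) n)) (map length A))) (map (map (map (Dval X))) A)
    = map (map (Dval X)) (map (\<lambda>row. map Tens (columns n row)) A)"
proof -
  have "map2 (\<lambda>k. fob (prd (power_struct (mon_str V b \<epsilon> \<eta>) n) k)) (map length A) (map (map (map (Dval X))) A)
      = map (\<lambda>row. map (Dval X) (map Tens (columns n row))) A"
    using assms by (intro map2_cong_rows) (simp only: ps_simps, rule map_columns_Dval, auto simp: depth_def)
  thus ?thesis by (simp only: prod_func_def func.simps map2_map1 map_map o_def)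
qed

lemma columns_Nil: "columns n [] = replicate n []"
  by (simp add: columns_def map_replicate_const)

lemma ps_pads:
  assumes "depth n A"
  shows "fob (pads_func (prd (power_struct (mon_str V b \<epsilon> \<eta>) n)) (map length A)) (map (map (map (Dval X))) A)
    = map (map (Dval X)) (padn n A)"
proof -
  have u: "Dval X Unit = D_tobs V []" using Dval_Tens[of X "[]"] by simp
  have "map2 (\<lambda>k. fob (pad_func (prd (power_struct (mon_str V b \<epsilon> \<eta>) n)) k)) (map length A) (map (map (map (Dval X))) A)
    = map (\<lambda>row. map (map (Dval X)) (if row = [] then [replicate n Unit] else row)) A"
    by (rule map2_cong_rows)
      (auto simp: pad_func_def comp_func_def single_func_def id_func_def ps_simps columns_Nil u)
  hence "concat (map2 (\<lambda>k. fob (pad_func (prd (power_struct (mon_str V b \<epsilon> \<eta>) n)) k)) (map length A) (map (map (map (Dval X))) A))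
      = map (map (Dval X)) (padn n A)"
    by (simp add: padn_def map_concat o_def)
  thus ?thesis by (simp only: pads_func_def comp_func_def concat_func_def prod_func_def func.simps map2_map1)
qed

lemma mgen_of_gen:
  assumes "\<And>v. X v \<in> Ob D" "\<epsilon> \<in> sels" "\<eta> \<in> sels" "gen (\<lambda>v. Id D (X v)) s t f"
  shows "mgen True \<epsilon> \<eta> X (\<lambda>_. 0) (\<lambda>_. 0) s t f"
  using assms(4) by (simp only: mgen_def dgen_def if_True endo_zero[where X = X, OF assms(1-3)])

lemma mgen_True_False: "mgen False \<epsilon> \<eta> X i j s t f \<Longrightarrow> mgen True \<epsilon> \<eta> X i j t s f"
  by (simp add: mgen_def dgen_def)

lemma Cb_True: "Cb True = D"
  by (simp add: Cb_def)

context
  fixes X :: "'v \<Rightarrow> ('o, 'a) dobj" and \<epsilon> \<eta> :: "('o, 'a) dobj \<Rightarrow> 'a" and n :: nat and A :: "'v tterm list list list"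
  assumes X: "\<And>v. X v \<in> Ob D" and sels: "\<epsilon> \<in> sels" "\<eta> \<in> sels"
    and d: "depth n A" and dis: "distinct (fvl (prow A))"
begin

lemma IdX: "Id D (X v) \<in> Ar D"
  using X by simp

lemma slices_Phi:
  "mgen b \<epsilon> \<eta> X (after db (prow A)) (before db (prow A)) (Tens (map (\<lambda>i. Tens (map Tens (sl i A))) [0..<n]))
    (Tens (map (\<lambda>i. Tens (padc (sl i A))) [0..<n]))
    (D_tars V (map (\<lambda>i. Phi (mon_str V b \<epsilon> \<eta>) (map length A) (map (map (Dval X)) (sl i A))) [0..<n]))"
proof (rule mgen_Tens[where X = X, OF X sels])
  fix i assume "i \<in> set [0..<n]"
  hence i: "i < n" by simp
  show "mgen b \<epsilon> \<eta> X (after db (prow A)) (before db (prow A)) (Tens (map Tens (sl i A))) (Tens (padc (sl i A)))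
      (Phi (mon_str V b \<epsilon> \<eta>) (map length A) (map (map (Dval X)) (sl i A)))"
    by (rule mgen_cong[OF mgen_Phi[where X = X and b = b, OF X sels slice_distinct[OF d dis i], unfolded sl_lengths]])
      (simp only: vl_nested slice_exponents[OF d dis i])
qed

lemma slices_phi:
  "mgen b \<epsilon> \<eta> X (after Z (prow A)) (before Z (prow A)) (Tens (map (\<lambda>i. Tens (concat (sl i A))) [0..<n]))
    (Tens (map (\<lambda>i. Tens (padc (sl i A))) [0..<n]))
    (D_tars V (map (\<lambda>i. phi (mon_str V b \<epsilon> \<eta>) (map length A) (map (map (Dval X)) (sl i A))) [0..<n]))"
proof (rule mgen_Tens[where X = X, OF X sels])
  fix i assume "i \<in> set [0..<n]"
  hence i: "i < n" by simp
  show "mgen b \<epsilon> \<eta> X (after Z (prow A)) (before Z (prow A)) (Tens (concat (sl i A))) (Tens (padc (sl i A)))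
      (phi (mon_str V b \<epsilon> \<eta>) (map length A) (map (map (Dval X)) (sl i A)))"
    by (rule mgen_cong[OF mgen_phi[where X = X and b = b, OF X sels slice_distinct[OF d dis i], unfolded sl_lengths]])
      (simp only: vl_flat slice_exponents[OF d dis i])
qed

lemma whole_Phi:
  "mgen b \<epsilon> \<eta> X (after db (prow A)) (before db (prow A)) (Tens (map Tens (prow A))) (Tens (padc (prow A)))
    (Phi (mon_str V b \<epsilon> \<eta>) (map length A) (map (map (D_tobs V)) (map (map (map (Dval X))) A)))"
  using mgen_Phi[where X = X and b = b, OF X sels dis] by (simp add: o_def Dval_Tens)

lemma whole_phi:
  "mgen b \<epsilon> \<eta> X (after Z (prow A)) (before Z (prow A)) (Tens (concat (prow A))) (Tens (padc (prow A)))
    (phi (mon_str V b \<epsilon> \<eta>) (map length A) (map (map (D_tobs V)) (map (map (map (Dval X))) A)))"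
  using mgen_phi[where X = X and b = b, OF X sels dis] by (simp add: o_def Dval_Tens)

text \<open>The transposition of a list \<open>yss\<close> of columns of length \<open>n\<close>.\<close>
lemma mgen_str:
  assumes "\<And>ts. ts \<in> set yss \<Longrightarrow> length ts = p" "m = length yss"
  shows "mgen True \<epsilon> \<eta> X (\<lambda>_. 0) (\<lambda>_. 0) (Tens (map Tens (columns p yss))) (Tens (map Tens yss))
    (D_xi V m p (columns p (map (map (Dval X)) yss)))"
  by (rule mgen_of_gen[where X = X, OF X sels gen_str[OF X assms]])

lemma str_nested_slices:
  "mgen True \<epsilon> \<eta> X (\<lambda>_. 0) (\<lambda>_. 0) (Tens (map (\<lambda>i. Tens (map Tens (sl i A))) [0..<n]))
    (Tens (map (\<lambda>row. Tens (map Tens (columns n row))) A))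
    (D_xi V (length A) n (columns n (map (map (Dval X)) (map (\<lambda>row. map Tens (columns n row)) A))))"
proof -
  have "columns n (map (\<lambda>row. map Tens (columns n row)) A) = map (\<lambda>i. map Tens (sl i A)) [0..<n]"
    by (simp add: columns_def sl_def)
  moreover have "\<And>ts. ts \<in> set (map (\<lambda>row. map Tens (columns n row)) A) \<Longrightarrow> length ts = n" by auto
  ultimately show ?thesis
    using mgen_str[of "map (\<lambda>row. map Tens (columns n row)) A" n "length A"] by (simp only: length_map map_map o_def)
qed

lemma str_rows:
  "mgen True \<epsilon> \<eta> X (\<lambda>_. 0) (\<lambda>_. 0) (Tens (map (\<lambda>row. Tens (map Tens (columns n row))) A)) (Tens (map Tens (prow A)))
    (D_tars V (map (\<lambda>row. D_xi V (length row) n (columns n (map (map (Dval X)) row))) A))"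
proof -
  have "mgen True \<epsilon> \<eta> X (\<lambda>_. 0) (\<lambda>_. 0) (Tens (map (\<lambda>row. Tens (map Tens (columns n row))) A)) (Tens (map (\<lambda>row. Tens (map Tens row)) A))
    (D_tars V (map (\<lambda>row. D_xi V (length row) n (columns n (map (map (Dval X)) row))) A))"
    by (rule mgen_Tens[where X = X, OF X sels], rule mgen_str) (use d in \<open>auto simp: depth_def\<close>)
  thus ?thesis by (simp add: o_def)
qed

lemma str_padded_slices:
  "mgen True \<epsilon> \<eta> X (\<lambda>_. 0) (\<lambda>_. 0) (Tens (map (\<lambda>i. Tens (padc (sl i A))) [0..<n])) (Tens (map Tens (padn n A)))
    (D_xi V (KZ (map length A)) n (columns n (map (map (Dval X)) (padn n A))))"
  using mgen_str[of "padn n A" n "KZ (map length A)"] padn_lengths[OF d] length_padn[of n A]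
  by (simp add: columns_padn o_def)

lemma str_flat_slices:
  "mgen True \<epsilon> \<eta> X (\<lambda>_. 0) (\<lambda>_. 0) (Tens (map (\<lambda>i. Tens (concat (sl i A))) [0..<n])) (Tens (concat (prow A)))
    (D_xi V (sum_list (map length A)) n (columns n (map (map (Dval X)) (concat A))))"
proof -
  have "\<And>ts. ts \<in> set (concat A) \<Longrightarrow> length ts = n" using d by (auto simp: depth_def)
  from mgen_str[of "concat A" n "sum_list (map length A)", OF this] show ?thesis
    by (simp add: columns_concat o_def map_concat length_concat)
qed

text \<open>The product of the arrows \<open>\<langle>k\<rangle>\<close>.\<close>
lemma ang_pads:
  "mgen True \<epsilon> \<eta> X (\<lambda>_. 0) (\<lambda>_. 0) (Tens (map Tens (padn n A))) (Tens (padc (prow A)))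
    (D_tars V (concat (map2 (ang D (circ_mfunc (mon_str V b \<epsilon>' \<eta>') (D_xi V) n)) (map length A) (map (map (map (Dval X))) A))))"
proof -
  let ?F = "\<lambda>row. if row = [] then [D_xi V 0 n (columns n [])] else map (Id D) (map (Dval X) (map Tens row))"
  have m: "map2 (ang D (circ_mfunc (mon_str V b \<epsilon>' \<eta>') (D_xi V) n)) (map length A) (map (map (map (Dval X))) A) = map ?F A"
    by (rule map2_cong_rows) (simp add: ang_def Dval_Tens)
  have "gens (\<lambda>v. Id D (X v)) (map Tens (if row = [] then [replicate n Unit] else row)) (if row = [] then [Unit] else map Tens row) (?F row)" for row
  proof (cases "row = []")
    case True
    have "gen (\<lambda>v. Id D (X v)) (Tens (replicate n Unit)) Unit (D_xi V 0 n (columns n []))"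
      using gen_str[where X = X and yss = "[]" and n = n and m = 0, OF X] by (simp add: columns_Nil)
    thus ?thesis using True by (simp add: gens_Cons gens_Nil)
  next
    case False
    thus ?thesis using gens_id[where X = X and ts = "map Tens row", OF X] by (simp only: if_False)
  qed
  from gens_concat[of A "\<lambda>v. Id D (X v)", OF this]
  have "gens (\<lambda>v. Id D (X v)) (map Tens (padn n A)) (padc (prow A)) (concat (map ?F A))"
    by (simp add: padn_def padc_def map_concat o_def)
  thus ?thesis unfolding m by (rule mgen_of_gen[where X = X, OF X sels gens_Tens[OF IdX]])
qed

lemmas pcomp = mgen_comp[where X = X and b = True, OF X sels, unfolded Cb_True]
lemmas puniq = mgen_unique[where X = X and b = True, OF X sels]

text \<open>The compatibility of \<open>(\<circ>\<^sub>n, \<xi>)\<close> with the structure \<open>\<bullet>\<close>: on both sides, all exponents stem from one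
  application of the structure, to the slices on the left and to the products of the entries on the right.\<close>
lemma str_Phi_eq:
  "D_tars V (concat (map2 (ang D (circ_mfunc (mon_str V b \<epsilon>' \<eta>') (D_xi V) n)) (map length A) (map (map (map (Dval X))) A)))
    \<odot>\<^bsub>D\<^esub> D_xi V (KZ (map length A)) n (columns n (map (map (Dval X)) (padn n A)))
    \<odot>\<^bsub>D\<^esub> D_tars V (map (\<lambda>i. Phi (mon_str V True \<epsilon> \<eta>) (map length A) (map (map (Dval X)) (sl i A))) [0..<n])
  = Phi (mon_str V True \<epsilon> \<eta>) (map length A) (map (map (D_tobs V)) (map (map (map (Dval X))) A))
    \<odot>\<^bsub>D\<^esub> D_tars V (map (\<lambda>row. D_xi V (length row) n (columns n (map (map (Dval X)) row))) A)
    \<odot>\<^bsub>D\<^esub> D_xi V (length A) n (columns n (map (map (Dval X)) (map (\<lambda>row. map Tens (columns n row)) A)))"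
proof (rule puniq[OF pcomp[OF pcomp[OF slices_Phi str_padded_slices] ang_pads] pcomp[OF pcomp[OF str_nested_slices str_rows] whole_Phi]])
  show "distinct (vl (Tens (map (\<lambda>i. Tens (map Tens (sl i A))) [0..<n])))"
    using mset_eq_imp_distinct_iff[OF mgen_vars[OF pcomp[OF str_nested_slices str_rows]]] dis by (simp only: vl_nested)
qed simp

lemma str_phi_eq:
  "D_tars V (concat (map2 (ang D (circ_mfunc (mon_str V b \<epsilon>' \<eta>') (D_xi V) n)) (map length A) (map (map (map (Dval X))) A)))
    \<odot>\<^bsub>D\<^esub> D_xi V (KZ (map length A)) n (columns n (map (map (Dval X)) (padn n A)))
    \<odot>\<^bsub>D\<^esub> D_tars V (map (\<lambda>i. phi (mon_str V True \<epsilon> \<eta>) (map length A) (map (map (Dval X)) (sl i A))) [0..<n])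
  = phi (mon_str V True \<epsilon> \<eta>) (map length A) (map (map (D_tobs V)) (map (map (map (Dval X))) A))
    \<odot>\<^bsub>D\<^esub> D_xi V (sum_list (map length A)) n (columns n (map (map (Dval X)) (concat A)))"
proof (rule puniq[OF pcomp[OF pcomp[OF slices_phi str_padded_slices] ang_pads] pcomp[OF str_flat_slices whole_phi]])
  show "distinct (vl (Tens (map (\<lambda>i. Tens (concat (sl i A))) [0..<n])))"
    using mset_eq_imp_distinct_iff[OF mgen_vars[OF str_flat_slices]] dis by (simp only: vl_flat)
qed simp

end

end

lemma functor_cong: "cat_functor C D F \<Longrightarrow> fob G = fob F \<Longrightarrow> far G = far F \<Longrightarrow> cat_functor C D G"
  by (simp add: cat_functor_def cat_functor_axioms_def)

lemma nat_trans_cong: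
  assumes "nat_trans C D F G \<tau>" "fob F' = fob F" "far F' = far F" "fob G' = fob G" "far G' = far G"
  shows "nat_trans C D F' G' \<tau>"
  using assms functor_cong[of C D F F'] functor_cong[of C D G G'] by (simp add: nat_trans_def nat_trans_axioms_def)

lemma fvl_prow_Vars: "fvl (prow (map (map (map Var)) vsss)) = concat (concat vsss)"
proof -
  have "vl (Tens (map Var vs)) = vs" for vs :: "'a list" by (simp add: vl_Tens o_def)
  hence "map vl (concat (prow (map (map (map Var)) vsss))) = concat vsss" by (simp add: map_concat o_def)
  thus ?thesis by (simp only: fvl_def)
qed

context symmetric_monoidal_category begin

lemma triple_cases:
  assumes xsss: "\<forall>xss\<in>set xsss. \<forall>xs\<in>set xss. length xs = n \<and> set xs \<subseteq> Ob D"
  obtains X and A :: "(nat \<times> nat) tterm list list list" where "\<And>v. X v \<in> Ob D"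
    "xsss = map (map (map (Dval X))) A" "depth n A" "distinct (fvl (prow A))"
proof -
  have x: "\<forall>xss\<in>set xsss. \<forall>xs\<in>set xss. set xs \<subseteq> Ob D" using xsss by blast
  obtain X and vsss :: "(nat \<times> nat) list list list" where v: "xsss = map (map (map X)) vsss" "\<And>v. X v \<in> Ob D"
    "distinct (concat (concat vsss))"
    using label3[OF x du_ob] by blast
  have a: "xsss = map (map (map (Dval X))) (map (map (map Var)) vsss)" by (simp add: v(1) o_def)
  have d: "depth n (map (map (map Var)) vsss :: (nat \<times> nat) tterm list list list)"
    using xsss by (auto simp: v(1) depth_def)
  show ?thesis by (rule that[OF v(2) a d]) (simp only: fvl_prow_Vars v(3))
qed

section \<open>The functors of the structure \<open>\<circ>\<close>\<close>

theorem circ_lax_oplax_functor: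
  fixes b \<epsilon>' \<eta>' \<epsilon> \<eta> and n :: nat
  assumes sels: "\<epsilon> \<in> sels" "\<eta> \<in> sels"
  defines "B \<equiv> mon_str V True \<epsilon> \<eta>" and "G \<equiv> circ_mfunc (mon_str V b \<epsilon>' \<eta>') (D_xi V) n"
  shows "lax_oplax_functor (power_cat D n) (power_struct B n) D B G"
proof (intro lax_oplax_functor.intro lax_oplax_functor_axioms.intro)
  have G: "fob G = D_tobs V" "far G = D_tars V" "\<And>p yss. str G p yss = D_xi V p n (columns n yss)"
    by (simp_all add: G_def)
  have B: "\<And>k. prd B k = D_prd V k" "iota B = Id D" by (simp_all add: B_def)
  have ps: "fob (prd (power_struct B n) m) xss = map (D_tobs V) (columns n xss)"
    "far (prd (power_struct B n) m) fss = map (D_tars V) (columns n fss)" for m xss fss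
    by (simp_all add: B_def ps_simps)
  show "cat_functor (power_cat D n) D G"
    by (rule functor_cong[OF D_prd_functor]) (simp_all add: G)
  show "nat_trans (power_cat (power_cat D n) m) D (comp_func G (prd (power_struct B n) m))
    (comp_func (prd B m) (prod_func (replicate m G))) (str G m)" for m
  proof -
    let ?ks = "replicate m n"
    let ?vss = "idx ?ks" and ?tss = "map (map Var) (idx ?ks) :: (nat \<times> nat) tterm list list"
    have P: "power_cat (power_cat D n) m = powers_cat D ?ks" by (simp add: power_cat_def powers_cat_def)
    have ks: "map length ?vss = ?ks" by simp
    have len: "length ?vss = m" by (simp add: idx_def)
    have rows: "length vs = n" if "vs \<in> set ?vss" for vs
      using that by (auto simp: idx_def)
    have col: "columns n ?tss = map (map Var) (columns n ?vss)" "\<And>f. columns n (map (map f) ?vss) = map (map f) (columns n ?vss)"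
      using rows by (simp_all add: columns_map)
    have m2: "map2 f (replicate m c) (map g ?vss) = map (\<lambda>x. f c (g x)) ?vss" for f c g
      by (simp add: map2_replicate o_def len)
    have d: "distinct (vl (Tens (map Tens ?tss)))" unfolding vl_nested fvl_Vars by (rule idx_distinct)
    have xi: "gen (\<lambda>v. Id D (X v)) (Tens (map Tens (columns n ?tss))) (Tens (map Tens ?tss)) (str G m (map (map X) ?vss))"
      if "\<And>v. X v \<in> Ob D" for X
    proof -
      have "gen (\<lambda>v. Id D (X v)) (Tens (map Tens (columns n ?tss))) (Tens (map Tens ?tss)) (D_xi V m n (columns n (map (map (Dval X)) ?tss)))"
        by (rule gen_str[OF that]) (use len rows in auto)
      thus ?thesis by (simp only: Dval_Vars G)
    qed
    have d': "distinct (vl (Tens (map Tens (columns n ?tss))))"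
      using d mset_eq_imp_distinct_iff[OF gen_vars[OF xi[of "\<lambda>_. du", OF du_ob]]] by simp
    have gr: "gen h (Tens (map Tens (columns n ?tss))) (Tens (map Tens (columns n ?tss))) (far (comp_func G (prd (power_struct B n) m)) (map (map h) ?vss))"
      "gen h (Tens (map Tens ?tss)) (Tens (map Tens ?tss)) (far (comp_func (prd B m) (prod_func (replicate m G))) (map (map h) ?vss))"
      if h: "\<And>v. h v \<in> Ar D" for h
    proof -
      have "gens h (map (\<lambda>vs. Tens (map Var vs)) vss) (map (\<lambda>vs. Tens (map Var vs)) vss) (map (\<lambda>vs. D_tars V (map h vs)) vss)" for vss
        by (rule gens_Tens_map[OF h gens_Vars[OF h]])
      from gens_Tens[OF h this[of "columns n ?vss"]] gens_Tens[OF h this[of ?vss]]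
      show "gen h (Tens (map Tens (columns n ?tss))) (Tens (map Tens (columns n ?tss))) (far (comp_func G (prd (power_struct B n) m)) (map (map h) ?vss))"
        "gen h (Tens (map Tens ?tss)) (Tens (map Tens ?tss)) (far (comp_func (prd B m) (prod_func (replicate m G))) (map (map h) ?vss))"
        unfolding col by (simp_all add: comp_func_def prod_func_def ps col m2 o_def G B)
    qed
    have ob: "fob (comp_func G (prd (power_struct B n) m)) (map (map X) ?vss) = Dval X (Tens (map Tens (columns n ?tss)))"
      "fob (comp_func (prd B m) (prod_func (replicate m G))) (map (map X) ?vss) = Dval X (Tens (map Tens ?tss))" for X
      unfolding col by (simp_all add: comp_func_def prod_func_def ps col m2 o_def G B Dval_Tens)
    show ?thesis unfolding P
      by (rule shape_nat_trans[OF shape_powers[OF idx_distinct ks], where e = "\<lambda>X v. Id D (X v)", OF d' d ob(1) gr(1) ob(2) gr(2) _ _ xi])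
        (simp_all add: D_arD D_obD)
  qed
next
  fix x assume x: "x \<in> Ob (power_cat D n)"
  obtain X where X: "\<And>v. X v \<in> Ob D" and f: "x = map X [0..<n]"
    using power_cases[of x True n] x by (auto simp: Cb_True)
  let ?ts = "map Var [0..<n]"
  have o: "D_tobs V x = Dval X (Tens ?ts)" by (simp add: f Dval_Tens o_def)
  have c: "map Tens (columns n [?ts]) = ?ts" by (intro nth_equalityI) (simp_all add: columns_def)
  have 1: "gen (\<lambda>v. Id D (X v)) (Tens ?ts) (Tens ?ts) (D_xi V 1 n (columns n [x]))"
    using gen_str[where X = X and yss = "[?ts]" and n = n and m = 1, OF X] unfolding c by (simp add: f o_def)
  have 2: "gen (\<lambda>v. Id D (X v)) (Tens ?ts) (Tens ?ts) (D_tars V (map (Id D) x))"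
    using gens_Tens[OF _ gens_id[where X = X and ts = ?ts, OF X]] X by (simp add: f o_def)
  have "D_xi V 1 n (columns n [x]) \<odot>\<^bsub>D\<^esub> D_tars V (map (Id D) x) = Id D (Dval X (Tens ?ts))"
    by (rule mgen_unique[where X = X and b = True, OF X sels mgen_comp[where X = X and b = True, OF X sels
          mgen_of_gen[where X = X, OF X sels 2] mgen_of_gen[where X = X, OF X sels 1], unfolded Cb_True]
          mgen_id[where X = X and b = True, OF X sels]]) (simp_all add: vl_Tens o_def)
  moreover have "iota (power_struct B n) x = map (Id D) x" by (simp only: B_def) (rule ps_simps(5), simp add: f)
  ultimately show "str G 1 [x] \<odot>\<^bsub>D\<^esub> far G (iota (power_struct B n) x) = iota B (fob G x)"
    by (simp only: G_def circ_simps B_def mon_str_simps o)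
next
  fix xss ks assume x: "xss \<in> Ob (powers_cat (power_cat D n) ks)"
  have "\<forall>ys\<in>set xss. \<forall>xs\<in>set ys. length xs = n \<and> set xs \<subseteq> Ob D"
  proof (intro ballI)
    fix ys xs assume "ys \<in> set xss" "xs \<in> set ys"
    hence "xs \<in> Ob (power_cat D n)" using x by (auto simp: powers_cat_simps)
    thus "length xs = n \<and> set xs \<subseteq> Ob D" by (simp add: power_cat_simps)
  qed
  then obtain X and A :: "(nat \<times> nat) tterm list list list" where A: "\<And>v. X v \<in> Ob D"
    "xss = map (map (map (Dval X))) A" "depth n A" "distinct (fvl (prow A))"
    by (rule triple_cases) blast
  have ks: "ks = map length A" using x by (simp add: powers_cat_simps A(2) o_def)
  have sls: "map (\<lambda>i. F (sl i xss)) [0..<n] = map (\<lambda>i. F (map (map (Dval X)) (sl i A))) [0..<n]" for F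
    unfolding A(2) by (rule map_cong) (simp_all add: sl_map[OF A(3)])
  have rows: "map2 (str G) ks xss = map (\<lambda>row. D_xi V (length row) n (columns n (map (map (Dval X)) row))) A"
    unfolding A(2) ks by (rule map2_cong_rows) (simp add: G_def)
  note rew = ps_simps(3,4) mon_str_simps D_prd_simps circ_simps sls ps_pads[OF A(3)] ps_prods[OF A(3)] length_map
  show "far (prd B (KZ ks)) (concat (map2 (ang D G) ks xss)) \<odot>\<^bsub>D\<^esub> str G (KZ ks) (fob (pads_func (prd (power_struct B n)) ks) xss)
      \<odot>\<^bsub>D\<^esub> far G (Phi (power_struct B n) ks xss)
    = Phi B ks (map (map (fob G)) xss) \<odot>\<^bsub>D\<^esub> far (prd B (length ks)) (map2 (str G) ks xss)
      \<odot>\<^bsub>D\<^esub> str G (length ks) (fob (prod_func (map (prd (power_struct B n)) ks)) xss)"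
    unfolding rows unfolding B_def G_def rew unfolding ks A(2) rew
    by (rule str_Phi_eq[where X = X, OF A(1) sels A(3,4)])
  show "far (prd B (KZ ks)) (concat (map2 (ang D G) ks xss)) \<odot>\<^bsub>D\<^esub> str G (KZ ks) (fob (pads_func (prd (power_struct B n)) ks) xss)
      \<odot>\<^bsub>D\<^esub> far G (phi (power_struct B n) ks xss)
    = phi B ks (map (map (fob G)) xss) \<odot>\<^bsub>D\<^esub> str G (sum_list ks) (concat xss)"
    unfolding B_def G_def rew unfolding ks A(2) rew map_concat'
    by (rule str_phi_eq[where X = X, OF A(1) sels A(3,4)])
qed

end

section \<open>The transformations of the structure \<open>\<circ>\<close>\<close>

lemma columns_slices: "columns (length A) (map (\<lambda>i. map Tens (sl i A)) [0..<n]) = map (\<lambda>row. map Tens (columns n row)) A"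
  by (rule nth_equalityI) (auto simp: columns_def sl_def intro!: nth_equalityI)

context symmetric_monoidal_category begin

text \<open>The underlying functors of the composites in the definition of duoidal categories.\<close>
lemma pad_mfunc_simps:
  "fob (pad_mfunc D B (mon_str V b \<epsilon> \<eta>) \<xi> k) = fob (pad_func (D_prd V) k)"
  "far (pad_mfunc D B (mon_str V b \<epsilon> \<eta>) \<xi> k) = far (pad_func (D_prd V) k)"
  by (simp_all add: pad_mfunc_def pad_func_def comp_mfunc_def comp_func_def strict_mfunc_def single_func_def id_func_def)

lemma mfunc_funcs:
  "fob (padded_mfunc D B (mon_str V b \<epsilon> \<eta>) \<xi> ks) = fob (padded_func (D_prd V) ks)"
  "far (padded_mfunc D B (mon_str V b \<epsilon> \<eta>) \<xi> ks) = far (padded_func (D_prd V) ks)"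
  "fob (nested_mfunc D (mon_str V b \<epsilon> \<eta>) \<xi> ks) = fob (nested_func (D_prd V) ks)"
  "far (nested_mfunc D (mon_str V b \<epsilon> \<eta>) \<xi> ks) = far (nested_func (D_prd V) ks)"
  "fob (flat_mfunc D B (mon_str V b \<epsilon> \<eta>) \<xi> ks) = fob (flat_func (D_prd V) ks)"
  "far (flat_mfunc D B (mon_str V b \<epsilon> \<eta>) \<xi> ks) = far (flat_func (D_prd V) ks)"
  by (simp_all add: padded_mfunc_def padded_func_def pads_func_def nested_mfunc_def nested_func_def flat_mfunc_def flat_func_def
    comp_mfunc_def comp_func_def strict_mfunc_def prod_mfunc_def prod_func_def concat_func_def fun_eq_iff map2_map1 pad_mfunc_simps)

lemma gens_Id_comp:
  assumes "\<And>v. X v \<in> Ob D" "gens (\<lambda>v. Id D (X v)) ss ts fs" "N = length ts"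
  shows "Id (power_cat D N) (map (Dval X) ts) \<odot>\<^bsub>power_cat D N\<^esub> fs = fs"
proof -
  have I: "Id D (X v) \<in> Ar D" for v using assms(1) by simp
  have "length fs = length ts \<and> map2 (Comp D) (map (Id D) (map (Dval X) ts)) fs = fs"
    using assms(2)
  proof (induction rule: gens.induct)
    case (gens_Cons s t f ss ts fs)
    have "f \<in> Ar D" by (rule gen_ar[OF I gens_Cons.hyps(1)])
    moreover have "tgt f = Dval X t" using gen_tgt[OF gens_Cons.hyps(1)] by simp
    ultimately have "Id D (Dval X t) \<odot>\<^bsub>D\<^esub> f = f"
      by (intro category.id_comp[OF D_category, of f "src f"]) (simp add: hom_def)
    thus ?case using gens_Cons.IH by (simp del: D_simps)
  qed simp
  thus ?thesis using assms(3) by (simp add: power_cat_simps del: D_simps)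
qed

context
  fixes X :: "'v \<Rightarrow> ('o, 'a) dobj" and \<epsilon> \<eta> \<epsilon>' \<eta>' :: "('o, 'a) dobj \<Rightarrow> 'a" and n :: nat and A :: "'v tterm list list list"
    and B R xs ks
  assumes X: "\<And>v. X v \<in> Ob D" and sels: "\<epsilon> \<in> sels" "\<eta> \<in> sels"
    and d: "depth n A" and dis: "distinct (fvl (prow A))"
  defines "B \<equiv> mon_str V True \<epsilon>' \<eta>'" and "R \<equiv> mon_str V False \<epsilon> \<eta>" and "ks \<equiv> map length A"
    and "xs \<equiv> map (\<lambda>i. map (map (Dval X)) (sl i A)) [0..<n]"
begin

text \<open>A list \<open>xs\<close> of \<open>n\<close> families, whose transpose is a family of lists of length \<open>n\<close>, denoted by \<open>A\<close>.\<close>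
lemma row_depth: "r < length A \<Longrightarrow> ts \<in> set (A ! r) \<Longrightarrow> length ts = n"
  using d nth_mem by (fastforce simp: depth_def)

lemma row_xs:
  assumes "r < length A"
  shows "map (\<lambda>x. x ! r) xs = columns n (map (map (Dval X)) (A ! r))"
proof -
  have "Dval X (ts ! i) = map (Dval X) ts ! i" if "i < n" "ts \<in> set (A ! r)" for i ts
    using row_depth[OF assms that(2)] that(1) by simp
  thus ?thesis using assms by (simp add: xs_def sl_def columns_def)
qed

lemma columns_row_xs:
  assumes "r < length A"
  shows "columns (ks ! r) (map (\<lambda>x. x ! r) xs) = map (map (Dval X)) (A ! r)"
proof -
  have "columns (length (map (map (Dval X)) (A ! r))) (columns n (map (map (Dval X)) (A ! r))) = map (map (Dval X)) (A ! r)"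
    by (rule columns_columns) (use row_depth[OF assms] in auto)
  thus ?thesis unfolding row_xs[OF assms] using assms by (simp add: ks_def)
qed

lemma map_rows: "map (\<lambda>r. F (ks ! r) (A ! r)) [0..<length ks] = map (\<lambda>row. F (length row) row) A"
  by (rule nth_equalityI) (simp_all add: ks_def)

lemma powers_prd_xs: "fob (prd (powers_struct B ks) n) xs = map (map (Dval X)) (prow A)"
proof -
  have "fob (prd (powers_struct B ks) n) xs = map (\<lambda>r. map (D_tobs V) (columns (ks ! r) (map (\<lambda>x. x ! r) xs))) [0..<length ks]"
    by (simp add: powers_struct_def prod_struct_def B_def ps_simps)
  also have "\<dots> = map (\<lambda>r. map (D_tobs V) (map (map (Dval X)) (A ! r))) [0..<length ks]"
    by (rule map_cong[OF refl], subst columns_row_xs) (simp_all add: ks_def)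
  also have "\<dots> = map (map (Dval X)) (prow A)"
    using map_rows[of "\<lambda>_ row. map (D_tobs V) (map (map (Dval X)) row)"] by (simp add: o_def Dval_Tens)
  finally show ?thesis .
qed

abbreviation (input) "M0 \<equiv> mgen True \<epsilon> \<eta> X (\<lambda>_. 0) (\<lambda>_. 0)"

lemma M0_gens: "gens (\<lambda>v. Id D (X v)) ss ts fs \<Longrightarrow> M0 (Tens ss) (Tens ts) (D_tars V fs)"
  using X by (intro mgen_of_gen[where X = X, OF X sels gens_Tens]) simp_all

lemma M0_str:
  assumes "\<And>ts. ts \<in> set yss \<Longrightarrow> length ts = p" "m = length yss"
  shows "M0 (Tens (map Tens (columns p yss))) (Tens (map Tens yss)) (D_xi V m p (columns p (map (map (Dval X)) yss)))"
  by (rule mgen_of_gen[where X = X, OF X sels gen_str[OF X assms]])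

text \<open>The structure of the functor \<open>\<circ>\<^sub>n \<cdot> (\<circ> \<times> \<dots> \<times> \<circ>)\<close>.\<close>

lemma nested_str:
  obtains f g where "str (nested_mfunc D R (D_xi V) ks) n xs = g \<odot>\<^bsub>D\<^esub> f"
    "M0 (Tens (map Tens (prow A))) (Tens (map (\<lambda>row. Tens (map Tens (columns n row))) A)) f"
    "M0 (Tens (map (\<lambda>row. Tens (map Tens (columns n row))) A)) (Tens (map (\<lambda>i. Tens (map Tens (sl i A))) [0..<n])) g"
proof -
  let ?M = "prod_mfunc (map (circ_mfunc R (D_xi V)) ks)"
  let ?g = "D_xi V n (length ks) (columns (length ks) (map (fob ?M) xs))"
  have len: "length ks = length A" by (simp add: ks_def)
  have "fob ?M (map (map (Dval X)) (sl i A)) = map (Dval X) (map Tens (sl i A))" for i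
  proof -
    have "map2 (\<lambda>_. D_tobs V) ks (map (map (Dval X)) (sl i A)) = map (Dval X) (map Tens (sl i A))"
      unfolding ks_def by (rule nth_equalityI) (simp_all add: Dval_Tens)
    thus ?thesis by (simp add: prod_mfunc_def map2_map1 R_def)
  qed
  hence "map (fob ?M) xs = map (map (Dval X)) (map (\<lambda>i. map Tens (sl i A)) [0..<n])"
    by (simp add: xs_def)
  moreover have "M0 (Tens (map Tens (columns (length A) (map (\<lambda>i. map Tens (sl i A)) [0..<n])))) (Tens (map Tens (map (\<lambda>i. map Tens (sl i A)) [0..<n])))
      (D_xi V n (length A) (columns (length A) (map (map (Dval X)) (map (\<lambda>i. map Tens (sl i A)) [0..<n]))))"
    by (rule M0_str) auto
  ultimately have g: "M0 (Tens (map (\<lambda>row. Tens (map Tens (columns n row))) A)) (Tens (map (\<lambda>i. Tens (map Tens (sl i A))) [0..<n])) ?g"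
    by (simp add: len columns_slices o_def)
  have "str ?M n xs = map (\<lambda>r. D_xi V n (ks ! r) (columns (ks ! r) (map (\<lambda>x. x ! r) xs))) [0..<length ks]"
    by (simp add: prod_mfunc_def R_def)
  also have "\<dots> = map (\<lambda>r. D_xi V n (ks ! r) (map (map (Dval X)) (A ! r))) [0..<length ks]"
    by (rule map_cong[OF refl], subst columns_row_xs) (simp_all add: ks_def)
  also have "\<dots> = map (\<lambda>row. D_xi V n (length row) (map (map (Dval X)) row)) A"
    by (rule map_rows)
  finally have s: "str ?M n xs = map (\<lambda>row. D_xi V n (length row) (map (map (Dval X)) row)) A" .
  have "M0 (Tens (map (\<lambda>row. Tens (map Tens row)) A)) (Tens (map (\<lambda>row. Tens (map Tens (columns n row))) A)) (D_tars V (str ?M n xs))"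
    unfolding s
    by (rule mgen_Tens[where X = X, OF X sels], rule mgen_of_gen[where X = X, OF X sels], rule gen_xi[OF X]) (use d in \<open>auto simp: depth_def\<close>)
  hence f: "M0 (Tens (map Tens (prow A))) (Tens (map (\<lambda>row. Tens (map Tens (columns n row))) A)) (D_tars V (str ?M n xs))"
    by (simp add: o_def)
  show ?thesis
    by (rule that[OF _ f g]) (simp add: nested_mfunc_def comp_mfunc_def R_def)
qed

text \<open>The structure of the functor \<open>\<circ>\<^sub>K\<close>.\<close>
lemma flat_str:
  obtains f g where "str (flat_mfunc D B R (D_xi V) ks) n xs = g \<odot>\<^bsub>D\<^esub> f"
    "M0 (Tens (concat (prow A))) (Tens (concat (prow A))) f"
    "M0 (Tens (concat (prow A))) (Tens (map (\<lambda>i. Tens (concat (sl i A))) [0..<n])) g"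
proof -
  let ?K = "sum_list ks"
  let ?f = "D_tars V (map (Id D) (map (Dval X) (concat (prow A))))"
  let ?g = "D_xi V n ?K (columns ?K (map concat xs))"
  have K: "?K = length (concat A)" by (simp add: ks_def length_concat)
  have cA: "\<And>ts. ts \<in> set (concat A) \<Longrightarrow> length ts = n" using d by (auto simp: depth_def)
  have cc: "map (\<lambda>i. concat (sl i A)) [0..<n] = columns n (concat A)" by (simp add: columns_concat)
  have "map concat xs = map (map (Dval X)) (columns n (concat A))"
    by (simp add: xs_def map_concat' flip: cc)
  moreover have "M0 (Tens (map Tens (columns ?K (columns n (concat A))))) (Tens (map Tens (columns n (concat A))))
      (D_xi V n ?K (columns ?K (map (map (Dval X)) (columns n (concat A)))))"
    by (rule M0_str) (auto simp: K dest: columns_length)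
  moreover have "columns ?K (columns n (concat A)) = concat A" unfolding K by (rule columns_columns[OF cA])
  ultimately have g: "M0 (Tens (concat (prow A))) (Tens (map (\<lambda>i. Tens (concat (sl i A))) [0..<n])) ?g"
    by (simp add: map_concat' o_def flip: cc)
  have f: "M0 (Tens (concat (prow A))) (Tens (concat (prow A))) ?f"
    by (rule M0_gens[OF gens_id[where X = X, OF X]])
  have "Id (power_cat D ?K) (concat (fob (prd (powers_struct B ks) n) xs)) = map (Id D) (map (Dval X) (concat (prow A)))"
    unfolding powers_prd_xs map_concat' by (rule power_cat_simps(5)) (simp add: K map_concat')
  hence "str (flat_mfunc D B R (D_xi V) ks) n xs = ?g \<odot>\<^bsub>D\<^esub> ?f"
    by (simp only: flat_mfunc_def comp_mfunc_def strict_mfunc_def concat_func_def mfunc.simps func.simps R_def circ_simps)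
  thus ?thesis using f g by (rule that)
qed

text \<open>The structure of the padding functors \<open>[k]\<close>: an empty row contributes the canonical arrow from \<open>\<I>\<close> to the
  product of \<open>n\<close> units, any other row contributes identities.\<close>
lemma pad_str_row:
  assumes r: "r < length A"
  shows "str (pad_mfunc D B R (D_xi V) (ks ! r)) n (map (\<lambda>x. x ! r) xs)
    = (if A ! r = [] then [D_xi V n 0 []] else map (Id D) (map (Dval X) (map Tens (A ! r))))"
proof (cases "A ! r = []")
  case True
  have u: "Dval X Unit = D_tobs V []" using Dval_Tens[of X "[]"] by simp
  have k: "ks ! r = 0" using r True by (simp add: ks_def)
  have g: "gen (\<lambda>v. Id D (X v)) Unit (Tens (replicate n Unit)) (D_xi V n 0 [])"
    using gen_xi[where X = X and tss = "[]" and n = 0 and p = n, OF X] by (simp add: columns_Nil)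
  have "Id (power_cat D 1) (map (Dval X) [Tens (replicate n Unit)]) \<odot>\<^bsub>power_cat D 1\<^esub> [D_xi V n 0 []] = [D_xi V n 0 []]"
    by (rule gens_Id_comp[OF X gens_Cons[OF g gens_Nil]]) simp
  moreover have "map (Dval X) [Tens (replicate n Unit)] = [D_tobs V (map (D_tobs V) (replicate n []))]"
    by (simp add: Dval_Tens u)
  ultimately show ?thesis
    unfolding row_xs[OF r] k
    by (simp add: True pad_mfunc_def comp_mfunc_def strict_mfunc_def single_func_def R_def B_def columns_Nil del: D_simps)
      (simp add: columns_def)
next
  case False
  hence k: "ks ! r = length (A ! r)" "ks ! r \<noteq> 0" using r by (simp_all add: ks_def)
  have "fob (prd (power_struct B (ks ! r)) n) (map (\<lambda>x. x ! r) xs) = map (Dval X) (map Tens (A ! r))"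
    unfolding B_def ps_simps columns_row_xs[OF r] by (simp add: Dval_Tens o_def)
  thus ?thesis using False k
    by (simp add: pad_mfunc_def strict_mfunc_def id_func_def power_cat_simps del: D_simps)
qed

lemma bar_prd_xs:
  "concat (fob (prd (powers_struct B (map bar ks)) n) (map (fob (prod_mfunc (map (pad_mfunc D B R (D_xi V)) ks))) xs))
    = map (Dval X) (map Tens (padn n A))"
proof -
  let ?M = "prod_mfunc (map (pad_mfunc D B R (D_xi V)) ks)"
  let ?ys = "map (fob ?M) xs"
  have u: "Dval X Unit = D_tobs V []" using Dval_Tens[of X "[]"] by simp
  have row: "map (D_tobs V) (columns (bar (ks ! r)) (map (\<lambda>y. y ! r) ?ys)) = map (Dval X) (map Tens (if A ! r = [] then [replicate n Unit] else A ! r))"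
    if r: "r < length A" for r
  proof -
    have y: "map (\<lambda>y. y ! r) ?ys = map (fob (pad_func (D_prd V) (ks ! r))) (map (\<lambda>x. x ! r) xs)"
      using r by (simp add: prod_mfunc_def pad_mfunc_simps R_def xs_def ks_def)
    show ?thesis
    proof (cases "A ! r = []")
      case True
      hence k: "ks ! r = 0" using r by (simp add: ks_def)
      have "map (\<lambda>y. y ! r) ?ys = replicate n [D_tobs V []]"
        unfolding y row_xs[OF r] k by (simp add: True columns_Nil pad_func_def comp_func_def single_func_def)
      thus ?thesis using True k by (simp add: bar_def Z_def columns_def Dval_Tens u)
    next
      case False
      hence k: "ks ! r \<noteq> 0" using r by (simp add: ks_def)
      hence "map (\<lambda>y. y ! r) ?ys = map (\<lambda>x. x ! r) xs"
        unfolding y by (simp add: pad_func_def id_func_def)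
      moreover have "bar (ks ! r) = ks ! r" using k by (simp add: bar_def Z_def)
      ultimately show ?thesis
        by (simp only: columns_row_xs[OF r]) (simp add: False Dval_Tens o_def)
    qed
  qed
  have "fob (prd (powers_struct B (map bar ks)) n) ?ys = map (\<lambda>r. map (D_tobs V) (columns (map bar ks ! r) (map (\<lambda>y. y ! r) ?ys))) [0..<length ks]"
    by (simp add: powers_struct_def prod_struct_def B_def ps_simps)
  also have "\<dots> = map (\<lambda>r. map (Dval X) (map Tens (if A ! r = [] then [replicate n Unit] else A ! r))) [0..<length ks]"
  proof (rule map_cong[OF refl])
    fix r assume "r \<in> set [0..<length ks]"
    hence r: "r < length A" "map bar ks ! r = bar (ks ! r)" by (simp_all add: ks_def)
    show "map (D_tobs V) (columns (map bar ks ! r) (map (\<lambda>y. y ! r) ?ys))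
      = map (Dval X) (map Tens (if A ! r = [] then [replicate n Unit] else A ! r))"
      unfolding r(2) by (rule row[OF r(1)])
  qed
  also have "\<dots> = map (\<lambda>row. map (Dval X) (map Tens (if row = [] then [replicate n Unit] else row))) A"
    by (rule map_rows)
  finally show ?thesis by (simp add: padn_def map_concat o_def)
qed

text \<open>The structure of the functor \<open>\<circ> \<cdot> ([k\<^sub>1] \<times> \<dots> \<times> [k\<^sub>n])\<close>.\<close>
lemma padded_str:
  obtains f g where "str (padded_mfunc D B R (D_xi V) ks) n xs = g \<odot>\<^bsub>D\<^esub> f"
    "M0 (Tens (padc (prow A))) (Tens (map Tens (padn n A))) f"
    "M0 (Tens (map Tens (padn n A))) (Tens (map (\<lambda>i. Tens (padc (sl i A))) [0..<n])) g"
proof -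
  let ?K = "KZ ks" and ?M = "prod_mfunc (map (pad_mfunc D B R (D_xi V)) ks)"
  let ?I = "comp_mfunc (power_cat D ?K) (strict_mfunc (powers_struct B (map bar ks)) (power_cat D ?K) concat_func) ?M"
  have K: "?K = length (padn n A)" by (simp add: length_padn ks_def)
  have "fob ?I (map (map (Dval X)) (sl i A)) = map (Dval X) (padc (sl i A))" for i
    using fob_pads[of "sl i A" X]
    by (simp add: comp_mfunc_def strict_mfunc_def concat_func_def prod_mfunc_def pads_func_def comp_func_def prod_func_def
      map2_map1 pad_mfunc_simps R_def ks_def)
  hence "map (fob ?I) xs = map (map (Dval X)) (columns n (padn n A))"
    by (simp add: xs_def columns_padn)
  moreover have "M0 (Tens (map Tens (columns ?K (columns n (padn n A))))) (Tens (map Tens (columns n (padn n A))))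
      (D_xi V n ?K (columns ?K (map (map (Dval X)) (columns n (padn n A)))))"
    by (rule M0_str) (auto simp: K dest: columns_length)
  moreover have "columns ?K (columns n (padn n A)) = padn n A" unfolding K by (rule columns_columns[OF padn_lengths[OF d]])
  ultimately have g: "M0 (Tens (map Tens (padn n A))) (Tens (map (\<lambda>i. Tens (padc (sl i A))) [0..<n])) (D_xi V n ?K (columns ?K (map (fob ?I) xs)))"
    by (simp add: columns_padn o_def)
  let ?F = "\<lambda>row. if row = [] then [D_xi V n 0 []] else map (Id D) (map (Dval X) (map Tens row))"
  have "str ?M n xs = map (\<lambda>r. str (pad_mfunc D B R (D_xi V) (ks ! r)) n (map (\<lambda>x. x ! r) xs)) [0..<length ks]"
    by (simp add: prod_mfunc_def)
  also have "\<dots> = map (\<lambda>r. ?F (A ! r)) [0..<length ks]"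
    by (rule map_cong[OF refl], rule pad_str_row) (simp add: ks_def)
  also have "\<dots> = map ?F A"
    by (rule map_rows)
  finally have s: "str ?M n xs = map ?F A" .
  have "gens (\<lambda>v. Id D (X v)) (if row = [] then [Unit] else map Tens row) (map Tens (if row = [] then [replicate n Unit] else row)) (?F row)" for row
  proof (cases "row = []")
    case True
    have "gen (\<lambda>v. Id D (X v)) Unit (Tens (replicate n Unit)) (D_xi V n 0 [])"
      using gen_xi[where X = X and tss = "[]" and n = 0 and p = n, OF X] by (simp add: columns_Nil)
    thus ?thesis using True by (simp add: gens_Cons gens_Nil)
  next
    case False
    thus ?thesis using gens_id[where X = X and ts = "map Tens row", OF X] by (simp only: if_False)
  qed
  from gens_concat[of A "\<lambda>v. Id D (X v)", OF this]
  have gs: "gens (\<lambda>v. Id D (X v)) (padc (prow A)) (map Tens (padn n A)) (concat (str ?M n xs))"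
    unfolding s by (simp add: padn_def padc_def map_concat o_def)
  have "str ?I n xs = Id (power_cat D ?K) (concat (fob (prd (powers_struct B (map bar ks)) n) (map (fob ?M) xs)))
      \<odot>\<^bsub>power_cat D ?K\<^esub> concat (str ?M n xs)"
    by (simp only: comp_mfunc_def strict_mfunc_def concat_func_def mfunc.simps func.simps)
  also have "\<dots> = concat (str ?M n xs)"
    unfolding bar_prd_xs by (rule gens_Id_comp[OF X gs]) (simp add: K)
  finally have "str ?I n xs = concat (str ?M n xs)" .
  hence f: "M0 (Tens (padc (prow A))) (Tens (map Tens (padn n A))) (D_tars V (str ?I n xs))"
    using M0_gens[OF gs] by simp
  have "str (padded_mfunc D B R (D_xi V) ks) n xs = D_xi V n ?K (columns ?K (map (fob ?I) xs)) \<odot>\<^bsub>D\<^esub> D_tars V (str ?I n xs)"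
    unfolding padded_mfunc_def comp_mfunc_def[of D] by (simp only: mfunc.simps func.simps R_def circ_simps)
  thus ?thesis using f g by (rule that)
qed

lemmas pcomp' = mgen_comp[where X = X and b = True, OF X sels, unfolded Cb_True]
lemmas puniq' = mgen_unique[where X = X and b = True, OF X sels]

lemma distinct_padc: "distinct (vl (Tens (padc (prow A))))"
  using dis by (simp only: vl_padded)

text \<open>The compatibility of the transformations with the structures of the functors.\<close>
lemma Psi_str:
  "str (nested_mfunc D R (D_xi V) ks) n xs \<odot>\<^bsub>D\<^esub> Phi R ks (fob (prd (powers_struct B ks) n) xs)
    = D_tars V (map (Phi R ks) xs) \<odot>\<^bsub>D\<^esub> str (padded_mfunc D B R (D_xi V) ks) n xs"
proof -
  obtain f g where 1: "str (nested_mfunc D R (D_xi V) ks) n xs = g \<odot>\<^bsub>D\<^esub> f"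
    "M0 (Tens (map Tens (prow A))) (Tens (map (\<lambda>row. Tens (map Tens (columns n row))) A)) f"
    "M0 (Tens (map (\<lambda>row. Tens (map Tens (columns n row))) A)) (Tens (map (\<lambda>i. Tens (map Tens (sl i A))) [0..<n])) g"
    using nested_str by blast
  obtain f' g' where 2: "str (padded_mfunc D B R (D_xi V) ks) n xs = g' \<odot>\<^bsub>D\<^esub> f'"
    "M0 (Tens (padc (prow A))) (Tens (map Tens (padn n A))) f'"
    "M0 (Tens (map Tens (padn n A))) (Tens (map (\<lambda>i. Tens (padc (sl i A))) [0..<n])) g'"
    using padded_str by blast
  have w: "mgen True \<epsilon> \<eta> X (after db (prow A)) (before db (prow A)) (Tens (padc (prow A))) (Tens (map Tens (prow A)))
      (Phi R ks (fob (prd (powers_struct B ks) n) xs))"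
    unfolding powers_prd_xs unfolding R_def ks_def
    using mgen_True_False[OF mgen_Phi[where X = X and b = False, OF X sels dis]] by (simp add: o_def)
  have s: "mgen True \<epsilon> \<eta> X (after db (prow A)) (before db (prow A)) (Tens (map (\<lambda>i. Tens (padc (sl i A))) [0..<n]))
    (Tens (map (\<lambda>i. Tens (map Tens (sl i A))) [0..<n])) (D_tars V (map (Phi R ks) xs))"
    using mgen_True_False[OF slices_Phi[where X = X and b = False, OF X sels d dis]] by (simp add: xs_def R_def ks_def o_def)
  show ?thesis unfolding 1(1) 2(1)
    by (rule puniq'[OF pcomp'[OF w pcomp'[OF 1(2,3)]] pcomp'[OF pcomp'[OF 2(2,3)] s] distinct_padc]) simp
qed

lemma psi_str:
  "str (flat_mfunc D B R (D_xi V) ks) n xs \<odot>\<^bsub>D\<^esub> phi R ks (fob (prd (powers_struct B ks) n) xs)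
    = D_tars V (map (phi R ks) xs) \<odot>\<^bsub>D\<^esub> str (padded_mfunc D B R (D_xi V) ks) n xs"
proof -
  obtain f g where 1: "str (flat_mfunc D B R (D_xi V) ks) n xs = g \<odot>\<^bsub>D\<^esub> f"
    "M0 (Tens (concat (prow A))) (Tens (concat (prow A))) f"
    "M0 (Tens (concat (prow A))) (Tens (map (\<lambda>i. Tens (concat (sl i A))) [0..<n])) g"
    using flat_str by blast
  obtain f' g' where 2: "str (padded_mfunc D B R (D_xi V) ks) n xs = g' \<odot>\<^bsub>D\<^esub> f'"
    "M0 (Tens (padc (prow A))) (Tens (map Tens (padn n A))) f'"
    "M0 (Tens (map Tens (padn n A))) (Tens (map (\<lambda>i. Tens (padc (sl i A))) [0..<n])) g'"
    using padded_str by blast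
  have w: "mgen True \<epsilon> \<eta> X (after Z (prow A)) (before Z (prow A)) (Tens (padc (prow A))) (Tens (concat (prow A)))
      (phi R ks (fob (prd (powers_struct B ks) n) xs))"
    unfolding powers_prd_xs unfolding R_def ks_def
    using mgen_True_False[OF mgen_phi[where X = X and b = False, OF X sels dis]] by (simp add: o_def)
  have s: "mgen True \<epsilon> \<eta> X (after Z (prow A)) (before Z (prow A)) (Tens (map (\<lambda>i. Tens (padc (sl i A))) [0..<n]))
    (Tens (map (\<lambda>i. Tens (concat (sl i A))) [0..<n])) (D_tars V (map (phi R ks) xs))"
    using mgen_True_False[OF slices_phi[where X = X and b = False, OF X sels d dis]] by (simp add: xs_def R_def ks_def o_def)
  show ?thesis unfolding 1(1) 2(1)
    by (rule puniq'[OF pcomp'[OF w pcomp'[OF 1(2,3)]] pcomp'[OF pcomp'[OF 2(2,3)] s] distinct_padc]) simp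
qed

end


text \<open>Lists of families are the slices of a family of lists.\<close>
lemma columns_of_families:
  assumes "xs \<in> Ob (power_cat (powers_cat D ks) n)"
  obtains X and A :: "(nat \<times> nat) tterm list list list" where "\<And>v. X v \<in> Ob D" "depth n A" "distinct (fvl (prow A))"
    "ks = map length A" "xs = map (\<lambda>i. map (map (Dval X)) (sl i A)) [0..<n]"
proof -
  have len: "length xs = n" using assms by (simp add: power_cat_simps)
  have x: "map length x = ks \<and> (\<forall>row\<in>set x. set row \<subseteq> Ob D)" if "x \<in> set xs" for x
  proof -
    have "x \<in> Ob (powers_cat D ks)" using assms that by (auto simp: power_cat_simps)
    thus ?thesis by (simp add: powers_cat_simps)
  qed
  define Y where "Y = map (\<lambda>r. map (\<lambda>s. map (\<lambda>i. xs ! i ! r ! s) [0..<n]) [0..<ks ! r]) [0..<length ks]"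
  have entry: "xs ! i ! r ! s \<in> Ob D" if "i < n" "r < length ks" "s < ks ! r" for i r s
  proof -
    have xi: "map length (xs ! i) = ks" "\<forall>row\<in>set (xs ! i). set row \<subseteq> Ob D"
      using x[of "xs ! i"] len that(1) by simp_all
    have "r < length (xs ! i)" using xi(1) that(2) by auto
    moreover from this have "s < length (xs ! i ! r)" using xi(1) that(3) by auto
    ultimately show ?thesis using xi(2) by (meson nth_mem subsetD)
  qed
  have "\<forall>xss\<in>set Y. \<forall>xs\<in>set xss. length xs = n \<and> set xs \<subseteq> Ob D"
    using entry by (auto simp: Y_def)
  then obtain X and A :: "(nat \<times> nat) tterm list list list" where A: "\<And>v. X v \<in> Ob D"
    "Y = map (map (map (Dval X))) A" "depth n A" "distinct (fvl (prow A))"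
    by (rule triple_cases) blast
  have "map length Y = ks" by (intro nth_equalityI) (simp_all add: Y_def)
  hence ks: "ks = map length A" by (simp add: A(2) o_def)
  have sl: "sl i Y = xs ! i" if "i < n" for i
  proof -
    have xi: "map length (xs ! i) = ks" using x len that by auto
    have l: "length (xs ! i) = length ks" "\<And>r. r < length ks \<Longrightarrow> length (xs ! i ! r) = ks ! r" using xi by auto
    show ?thesis using that by (intro nth_equalityI) (simp_all add: sl_def Y_def l)
  qed
  have "xs = map (\<lambda>i. map (map (Dval X)) (sl i A)) [0..<n]"
    using len by (intro nth_equalityI) (simp_all add: sl_map[OF A(3)] A(2) flip: sl)
  from that[OF A(1,3,4) ks this] show ?thesis .
qed

theorem structure_transformations:
  fixes \<epsilon> \<eta> \<epsilon>' \<eta>' ks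
  assumes sels: "\<epsilon> \<in> sels" "\<eta> \<in> sels"
  defines "B \<equiv> mon_str V True \<epsilon>' \<eta>'" and "R \<equiv> mon_str V False \<epsilon> \<eta>"
  shows "lax_oplax_nat_trans (powers_cat D ks) (powers_struct B ks) D B
      (padded_mfunc D B R (D_xi V) ks) (nested_mfunc D R (D_xi V) ks) (Phi R ks)"
    and "lax_oplax_nat_trans (powers_cat D ks) (powers_struct B ks) D B
      (padded_mfunc D B R (D_xi V) ks) (flat_mfunc D B R (D_xi V) ks) (phi R ks)"
proof -
  have n: "nat_trans (powers_cat D ks) D (padded_mfunc D B R (D_xi V) ks) (nested_mfunc D R (D_xi V) ks) (Phi R ks)"
    unfolding R_def by (rule nat_trans_cong[OF Phi_mon_nat(1)[where b = False, OF sels, simplified]]) (simp_all add: mfunc_funcs)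
  have f: "nat_trans (powers_cat D ks) D (padded_mfunc D B R (D_xi V) ks) (flat_mfunc D B R (D_xi V) ks) (phi R ks)"
    unfolding R_def by (rule nat_trans_cong[OF Phi_mon_nat(2)[where b = False, OF sels, simplified]]) (simp_all add: mfunc_funcs)
  have s: "str (nested_mfunc D R (D_xi V) ks) n xs \<odot>\<^bsub>D\<^esub> Phi R ks (fob (prd (powers_struct B ks) n) xs)
      = D_tars V (map (Phi R ks) xs) \<odot>\<^bsub>D\<^esub> str (padded_mfunc D B R (D_xi V) ks) n xs"
    "str (flat_mfunc D B R (D_xi V) ks) n xs \<odot>\<^bsub>D\<^esub> phi R ks (fob (prd (powers_struct B ks) n) xs)
      = D_tars V (map (phi R ks) xs) \<odot>\<^bsub>D\<^esub> str (padded_mfunc D B R (D_xi V) ks) n xs"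
    if xs: "xs \<in> Ob (power_cat (powers_cat D ks) n)" for xs n
  proof -
    obtain X and A :: "(nat \<times> nat) tterm list list list" where A: "\<And>v. X v \<in> Ob D" "depth n A" "distinct (fvl (prow A))"
      and ks: "ks = map length A" and xs: "xs = map (\<lambda>i. map (map (Dval X)) (sl i A)) [0..<n]"
      using columns_of_families[OF xs] by blast
    show "str (nested_mfunc D R (D_xi V) ks) n xs \<odot>\<^bsub>D\<^esub> Phi R ks (fob (prd (powers_struct B ks) n) xs)
        = D_tars V (map (Phi R ks) xs) \<odot>\<^bsub>D\<^esub> str (padded_mfunc D B R (D_xi V) ks) n xs"
      unfolding B_def R_def ks xs by (rule Psi_str[where X = X, OF A(1) sels A(2,3)])
    show "str (flat_mfunc D B R (D_xi V) ks) n xs \<odot>\<^bsub>D\<^esub> phi R ks (fob (prd (powers_struct B ks) n) xs)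
        = D_tars V (map (phi R ks) xs) \<odot>\<^bsub>D\<^esub> str (padded_mfunc D B R (D_xi V) ks) n xs"
      unfolding B_def R_def ks xs by (rule psi_str[where X = X, OF A(1) sels A(2,3)])
  qed
  have B: "far (prd B n) = D_tars V" for n by (simp add: B_def)
  show "lax_oplax_nat_trans (powers_cat D ks) (powers_struct B ks) D B
      (padded_mfunc D B R (D_xi V) ks) (nested_mfunc D R (D_xi V) ks) (Phi R ks)"
    by (intro lax_oplax_nat_trans.intro n lax_oplax_nat_trans_axioms.intro) (simp only: s(1) B)
  show "lax_oplax_nat_trans (powers_cat D ks) (powers_struct B ks) D B
      (padded_mfunc D B R (D_xi V) ks) (flat_mfunc D B R (D_xi V) ks) (phi R ks)"
    by (intro lax_oplax_nat_trans.intro f lax_oplax_nat_trans_axioms.intro) (simp only: s(2) B)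
qed

theorem unit_transformation:
  fixes \<epsilon> \<eta> \<epsilon>' \<eta>'
  assumes sels: "\<epsilon> \<in> sels" "\<eta> \<in> sels"
  defines "B \<equiv> mon_str V True \<epsilon>' \<eta>'" and "R \<equiv> mon_str V False \<epsilon> \<eta>"
  shows "lax_oplax_nat_trans D B D B
        (comp_mfunc D (circ_mfunc R (D_xi V) 1) (strict_mfunc B (power_cat D 1) single_func))
        (strict_mfunc B D id_func) (iota R)" (is "lax_oplax_nat_trans D B D B ?G ?H _")
proof (intro lax_oplax_nat_trans.intro lax_oplax_nat_trans_axioms.intro)
  have far: "gen h (Var v) (Var v) (D_tars V [h v])" if "\<And>v. h v \<in> Ar D" for h and v :: nat
    using gens_Tens[where h = h, OF that gens_Vars[where h = h and vs = "[v]", OF that]] by simp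
  have fob: "D_tobs V [X v] = Dval X (Var v)" for X and v :: nat
    using Dval_Tens[of X "[Var v]"] by simp
  show "nat_trans D D ?G ?H (iota R)"
    unfolding R_def mon_str_simps
    by (rule shape_nat_trans[OF shape_D[where v = "0::nat"], where s = "Var 0" and t = "Var 0" and e = "\<lambda>X v. Id D (X v)"])
      (auto simp: strict_mfunc_def comp_mfunc_def id_func_def single_func_def far fob D_arD D_obD gen_Var gen_id[where t = "Var _", simplified])
next
  fix xs n assume xs: "xs \<in> Ob (power_cat D n)"
  obtain X where X: "\<And>v. X v \<in> Ob D" and f: "xs = map X [0..<n]"
    using power_cases[of xs True n] xs by (auto simp: Cb_True)
  let ?ts = "map Var [0..<n]"
  have o: "D_tobs V xs = Dval X (Tens ?ts)" by (simp add: f Dval_Tens o_def)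
  have c: "columns 1 (map (\<lambda>x. [x]) xs) = [xs]" by (simp add: columns_def o_def)
  have t: "map Tens (columns n [?ts]) = ?ts" by (intro nth_equalityI) (simp_all add: columns_def)
  have I: "Id D (X v) \<in> Ar D" for v using X by simp
  have o1: "D_tobs V [D_tobs V xs] = D_tobs V xs"
    using Dval_Tens[of X "[Tens ?ts]"] by (simp add: o)
  note M = mgen_of_gen[where X = X, OF X sels] and comp = mgen_comp[where X = X and b = True, OF X sels, unfolded Cb_True]
    and ident = mgen_id[where X = X and b = True, OF X sels]
  have 1: "gen (\<lambda>v. Id D (X v)) (Tens ?ts) (Tens ?ts) (D_xi V n 1 [xs])"
    using gen_xi[where X = X and tss = "[?ts]" and n = 1 and p = n, OF X] unfolding t by (simp add: f o_def)
  have 2: "gen (\<lambda>v. Id D (X v)) (Tens ?ts) (Tens ?ts) (D_tars V [Id D (D_tobs V xs)])"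
    using gens_Tens[OF I gens_id[where X = X and ts = "[Tens ?ts]", OF X]] unfolding o by simp
  have 3: "gen (\<lambda>v. Id D (X v)) (Tens ?ts) (Tens ?ts) (D_tars V (map (Id D) xs))"
    using gens_Tens[OF I gens_id[where X = X and ts = ?ts, OF X]] by (simp add: f o_def)
  have H: "str ?H n xs = Id D (D_tobs V xs)"
    by (simp add: strict_mfunc_def id_func_def B_def)
  have G: "str ?G n xs = D_xi V n 1 [xs] \<odot>\<^bsub>D\<^esub> D_tars V [Id D (D_tobs V xs)]"
    by (simp add: comp_mfunc_def strict_mfunc_def single_func_def R_def B_def c[unfolded One_nat_def] power_cat_simps del: D_simps)
  have "Id D (Dval X (Tens ?ts)) \<odot>\<^bsub>D\<^esub> Id D (Dval X (Tens ?ts)) = D_tars V (map (Id D) xs) \<odot>\<^bsub>D\<^esub> D_xi V n 1 [xs] \<odot>\<^bsub>D\<^esub> D_tars V [Id D (D_tobs V xs)]"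
    by (rule mgen_unique[where X = X and b = True, OF X sels comp[OF ident ident] comp[OF comp[OF M[OF 2] M[OF 1]] M[OF 3]]])
      (simp_all add: vl_Tens o_def)
  thus "str ?H n xs \<odot>\<^bsub>D\<^esub> iota R (fob (prd B n) xs) = far (prd B n) (map (iota R) xs) \<odot>\<^bsub>D\<^esub> str ?G n xs"
    unfolding H G unfolding B_def R_def mon_str_simps D_prd_simps o .
qed

end

theorem theorem7p11:
  fixes V :: "('o, 'a) sym_mon_cat"
  assumes "symmetric_monoidal_category V"
  shows "lax_oplax_duoidal (D_cat V) (D_bullet V) (D_circ V) (D_xi V)"
proof -
  interpret symmetric_monoidal_category V by (rule assms)
  have s: "al \<in> sels" "be \<in> sels" "ka \<in> sels" "nu \<in> sels" by (simp_all add: sels_def)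
  show ?thesis
    unfolding D_bullet_mon_str D_circ_mon_str
  proof (rule lax_oplax_duoidal.intro)
    show "lax_oplax_monoidal D (mon_str V True al be)"
      using mon_str_lax_oplax_monoidal[where b = True, OF s(1,2)] by (simp add: Cb_def)
    show "lax0_oplaxplus_monoidal D (mon_str V False ka nu)"
      using mon_str_lax_oplax_monoidal[where b = False, OF s(3,4)] by (simp add: Cb_def lax0_oplaxplus_monoidal_def)
    show "nat_trans (powers_cat D (replicate n p)) D
        (comp_func (prd (mon_str V False ka nu) n) (prod_func (replicate n (prd (mon_str V True al be) p))))
        (comp_func (prd (mon_str V True al be) p) (comp_func (prod_func (replicate p (prd (mon_str V False ka nu) n)))
          \<lparr>fob = columns p, far = columns p\<rparr>)) (D_xi V p n)" for n p
      unfolding mon_str_simps by (rule xi_natural)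
    show "lax_oplax_functor (power_cat D n) (power_struct (mon_str V True al be) n) D (mon_str V True al be)
        (circ_mfunc (mon_str V False ka nu) (D_xi V) n)" for n
      by (rule circ_lax_oplax_functor[OF s(1,2)])
  qed (rule structure_transformations[OF s(3,4)] unit_transformation[OF s(3,4)])+
qed

end
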